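(* Let $\rho^2-\rho^1>0$. Then there exist analytic initial data $s_0=s(\alpha,0)$, i.e. analytic curves in the strip $\mathbb R\times(-\pi/2,\pi/2)$, that can be parametrized as a graph (of a function of the horizontal variable), such that the solution $z(\alpha,t)=(z_1(\alpha,t),z_2(\alpha,t))$ with initial datum $s_0$ of $$\partial_t z(\alpha)= \frac{\rho^2-\rho^1}{4\pi}\,\mathrm{P.V.}\int_{\mathbb R}\left[\frac{(\partial_\alpha z(\alpha)-\partial_\alpha z(\eta))\sinh(z_1(\alpha)-z_1(\eta))}{\cosh(z_1(\alpha)-z_1(\eta))-\cos(z_2(\alpha)-z_2(\eta))}+\frac{(\partial_\alpha z_1(\alpha)-\partial_\alpha z_1(\eta),\ \partial_\alpha z_2(\alpha)+\partial_\alpha z_2(\eta))\sinh(z_1(\alpha)-z_1(\eta))}{\cosh(z_1(\alpha)-z_1(\eta))+\cos(z_2(\alpha)+z_2(\eta))}\right]d\eta$$ is, at some finite time, no longer a graph.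
   Context: The fluids occupy the strip $\mathbb R\times(-l,l)$ with the normalization $l=\pi/2$; $\rho^1,\rho^2$ are the constant densities of the two fluids and the interface is the curve $z(\alpha,t)=(z_1(\alpha,t),z_2(\alpha,t))$, $\alpha\in\mathbb R$. P.V. denotes principal value (at $\eta=\alpha$ and at infinity). *)

theory Defs
  imports "HOL-Complex_Analysis.Complex_Analysis"
begin

definition real_analytic :: "(real \<Rightarrow> 'a::banach) \<Rightarrow> bool" where
  "real_analytic f \<longleftrightarrow>
     (\<forall>x. \<exists>r>0. \<exists>a. \<forall>y. \<bar>y - x\<bar> < r \<longrightarrow> (\<lambda>n. (y - x) ^ n *\<^sub>R a n) sums f y)"

definition is_graph_of :: "(real \<Rightarrow> real \<times> real) \<Rightarrow> (real \<Rightarrow> real) \<Rightarrow> bool" where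
  "is_graph_of c f \<longleftrightarrow> range c = range (\<lambda>x. (x, f x))"

definition in_strip :: "(real \<Rightarrow> real \<times> real) \<Rightarrow> bool" where
  "in_strip c \<longleftrightarrow> (\<forall>\<alpha>. \<bar>snd (c \<alpha>)\<bar> < pi / 2)"

definition muskat_integrand :: "(real \<Rightarrow> real \<times> real) \<Rightarrow> real \<Rightarrow> real \<Rightarrow> real \<times> real" where
  "muskat_integrand c \<alpha> \<eta> =
     (let u = fst (c \<alpha>) - fst (c \<eta>);
          a = vector_derivative c (at \<alpha>);
          b = vector_derivative c (at \<eta>)
      in (sinh u / (cosh u - cos (snd (c \<alpha>) - snd (c \<eta>)))) *\<^sub>R (a - b)
       + (sinh u / (cosh u + cos (snd (c \<alpha>) + snd (c \<eta>)))) *\<^sub>R (fst a - fst b, snd a + snd b))"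

(* Principal value at \<alpha> and at infinity: the truncation is symmetric about \<alpha> at both ends.
   For non-graph parametrizations the value depends on where the truncation at infinity is
   centred, since the integrand need not decay. *)
definition has_pv_integral ::
  "(real \<Rightarrow> 'a::{banach, second_countable_topology}) \<Rightarrow> real \<Rightarrow> 'a \<Rightarrow> bool" where
  "has_pv_integral f \<alpha> I \<longleftrightarrow>
     (\<forall>\<epsilon> R. 0 < \<epsilon> \<longrightarrow> set_integrable lborel {\<eta>. \<epsilon> < \<bar>\<eta> - \<alpha>\<bar> \<and> \<bar>\<eta> - \<alpha>\<bar> < R} f) \<and>
     ((\<lambda>(\<epsilon>, R). set_lebesgue_integral lborel {\<eta>. \<epsilon> < \<bar>\<eta> - \<alpha>\<bar> \<and> \<bar>\<eta> - \<alpha>\<bar> < R} f) \<longlongrightarrow> I)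
       (at_right 0 \<times>\<^sub>F at_top)"

definition complex_strip :: "real \<Rightarrow> complex set" where
  "complex_strip r = {w. \<bar>Im w\<bar> < r}"

definition flat_extension :: "real \<Rightarrow> (real \<Rightarrow> real) \<Rightarrow> (complex \<Rightarrow> complex) \<Rightarrow> bool" where
  "flat_extension r g G \<longleftrightarrow>
     G holomorphic_on complex_strip r \<and>
     (\<forall>x. G (of_real x) = of_real (g x)) \<and>
     (G \<longlongrightarrow> 0) (inf at_infinity (principal (complex_strip r)))"

(* Analytic solutions on [0, T]: at each time a simple regular curve inside the fluid strip, whose
   difference from the flat curve (\<alpha>, 0) extends analytically to a complex strip (of width
   independent of time), vanishes at infinity there and depends continuously on time in the
   supremum norm. Flatness also fixes the orientation (z_1 is close to \<alpha> at infinity), which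
   matters because reversing \<alpha> changes the sign of the right-hand side. Time derivatives at
   0 and T are one-sided. *)
definition muskat_solution ::
  "real \<Rightarrow> real \<Rightarrow> real \<Rightarrow> (real \<Rightarrow> real \<Rightarrow> real \<times> real) \<Rightarrow> bool" where
  "muskat_solution \<rho>1 \<rho>2 T z \<longleftrightarrow>
     (\<forall>t\<in>{0..T}. in_strip (z t) \<and> inj (z t) \<and> (\<forall>\<alpha>. vector_derivative (z t) (at \<alpha>) \<noteq> 0)) \<and>
     (\<exists>r>0. \<exists>G H. \<forall>t\<in>{0..T}.
        flat_extension r (\<lambda>\<alpha>. fst (z t \<alpha>) - \<alpha>) (G t) \<and>
        flat_extension r (\<lambda>\<alpha>. snd (z t \<alpha>)) (H t) \<and>
        uniform_limit (complex_strip r) G (G t) (at t within {0..T}) \<and>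
        uniform_limit (complex_strip r) H (H t) (at t within {0..T})) \<and>
     (\<forall>t\<in>{0..T}. \<forall>\<alpha>. \<exists>I. has_pv_integral (muskat_integrand (z t) \<alpha>) \<alpha> I \<and>
        ((\<lambda>s. z s \<alpha>) has_vector_derivative ((\<rho>2 - \<rho>1) / (4 * pi)) *\<^sub>R I) (at t within {0..T}))"

end

theory Submission
 imports Defs "HOL-Real_Asymp.Real_Asymp"
begin

text \<open>
 Identify a curve in the plane with a holomorphic displacement: \<open>z(\<alpha>) = \<alpha> + v(\<alpha>)\<close>, where \<open>v\<close> is
 holomorphic in a strip around the real axis and tends to zero at infinity. After symmetric truncation
 the part of the Muskat integrand that does not decay is an exact derivative and drops out; the rest is an
 integral of hyperbolic tangents of differences of \<open>v\<close>, of its Schwarz reflection and of the parameter.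
 This integral makes sense for complex \<open>\<alpha>\<close>. The equation therefore becomes an ordinary differential
 equation \<open>\<partial>\<^sub>t v = F(v)\<close> in which \<open>F\<close> loses one derivative, and in which it loses it only at the point of
 evaluation: the line of integration may be moved away from \<open>\<alpha>\<close>, and there Cauchy's inequality
 controls \<open>v'\<close> by \<open>v\<close> (\<open>velocity_lipschitz\<close>, \<open>velocity_holomorphic\<close>). Such an equation is solved on a
 strip that shrinks linearly in time by a contraction argument in the style of Cauchy and Kovalevskaya
 (\<open>solution_exists\<close>, \<open>solution_unique\<close>). The argument needs only a
 chord-arc condition, so it can be run from a curve at which the graph property is about to be lost.

 Such a curve is \<open>z\<^sub>1(x) = x\<^sup>3 / (1 + x\<^sup>2)\<close>, with a suitable odd \<open>z\<^sub>2\<close>: it is a graph with one vertical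
 tangent, at the origin. At that point the horizontal velocity gradient is \<open>8 + 2 z\<^sub>2'(0) \<integral>J\<close> up to a
 factor that is positive because \<open>\<rho>2 > \<rho>1\<close> (\<open>turning_formula\<close>), where \<open>J\<close> has the sign of \<open>z\<^sub>1 z\<^sub>2\<close>. If \<open>z\<^sub>2\<close> rises steeply
 at the origin and then switches sign abruptly, the negative part of \<open>J\<close> wins and the gradient is negative
 (\<open>turning_velocity_negative\<close>): the tangent wants to turn over.

 Finally tilt the curve: add \<open>\<epsilon> x / (1 + x\<^sup>2)\<close> to \<open>z\<^sub>1\<close>. Now \<open>z\<^sub>1' > 0\<close> everywhere, with \<open>z\<^sub>1'(0) = \<epsilon>\<close>, so the
 initial curve is the graph of an analytic function (\<open>tilted_datum_is_graph\<close>). The tilted curves are all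
 close to the vertical one, so the time of existence \<open>T\<close> and the rate \<open>D\<close> at which \<open>z\<^sub>1'(0)\<close> decreases
 do not depend on \<open>\<epsilon>\<close>. For \<open>\<epsilon>\<close> small compared with \<open>D T\<close> the derivative \<open>z\<^sub>1'(0)\<close> is
 negative at time \<open>T\<close>, and an injective curve that runs from left to right cannot then be a graph
 (\<open>turning_dynamics\<close>, \<open>not_graph\<close>). The solution is unique in the whole class of analytic solutions because any
 two of them satisfy the same integral equation near a time at which they agree
 (\<open>muskat_solution_unique\<close>).
\<close>

section \<open>Holomorphic functions on horizontal strips\<close>

abbreviation strip :: "real \<Rightarrow> complex set" where "strip \<equiv> complex_strip"

lemma in_complex_strip [simp]: "w \<in> strip s \<longleftrightarrow> \<bar>Im w\<bar> < s"
 by (simp add: complex_strip_def)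

lemma open_complex_strip [simp]: "open (strip s)"
proof -
 have "strip s = {w. \<bar>Im w\<bar> < s}" by (simp add: complex_strip_def)
 then show ?thesis by (simp add: open_Collect_less continuous_intros)
qed

lemma convex_complex_strip [simp]: "convex (strip s)"
proof -
 have "strip s = {w. Im w < s} \<inter> {w. Im w > -s}"
  by (auto simp: complex_strip_def)
 then show ?thesis by (simp add: convex_Int convex_halfspace_Im_lt convex_halfspace_Im_gt)
qed

lemma connected_complex_strip [simp]: "connected (strip s)"
 by (simp add: convex_connected)

lemma ball_subset_complex_strip:
 assumes "\<bar>Im w\<bar> + r \<le> s" shows "ball w r \<subseteq> strip s"
proof
 fix x assume "x \<in> ball w r"
 then have "\<bar>Im (x - w)\<bar> < r" using abs_Im_le_cmod[of "x - w"] by (simp add: dist_norm norm_minus_commute)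
 then show "x \<in> strip s" using assms by simp
qed

lemma cball_subset_complex_strip:
 assumes "\<bar>Im w\<bar> + r < s" shows "cball w r \<subseteq> strip s"
proof
 fix x assume "x \<in> cball w r"
 then have "\<bar>Im (x - w)\<bar> \<le> r" using abs_Im_le_cmod[of "x - w"] by (simp add: dist_norm norm_minus_commute)
 then show "x \<in> strip s" using assms by simp
qed

lemma norm_deriv_le_cball:
 assumes "f holomorphic_on cball z r" "0 < r" "\<And>w. w \<in> cball z r \<Longrightarrow> norm (f w) \<le> B"
 shows "norm (deriv f z) \<le> B / r"
proof -
 have "norm ((deriv ^^ 1) f z) \<le> fact 1 * B / r ^ 1"
  by (rule Cauchy_inequality)
   (use assms in \<open>auto simp: dist_norm intro: holomorphic_on_imp_continuous_on holomorphic_on_subset\<close>)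
 then show ?thesis by simp
qed

lemma norm_deriv_le:
 assumes hol: "f holomorphic_on ball z r" and r: "0 < r" and B: "\<And>w. w \<in> ball z r \<Longrightarrow> norm (f w) \<le> B"
 shows "norm (deriv f z) \<le> B / r"
proof (rule ccontr)
 assume "\<not> ?thesis"
 then have d: "norm (deriv f z) > B / r" by simp
 have B0: "B \<ge> 0" using B[of z] r by (meson centre_in_ball norm_ge_zero order_trans)
 then have d0: "norm (deriv f z) > 0" using d r by (meson divide_nonneg_pos le_less_trans)
 have "B / norm (deriv f z) < r" using d d0 r by (simp add: field_simps)
 then obtain r' where r': "B / norm (deriv f z) < r'" "r' < r" using dense by blast
 have r'0: "0 < r'" using r' B0 d0 by (meson divide_nonneg_pos le_less_trans)
 have "norm (deriv f z) \<le> B / r'"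
  by (rule norm_deriv_le_cball)
   (use r' r'0 B hol in \<open>auto intro: holomorphic_on_subset\<close>)
 then show False using r' r'0 d0 by (simp add: field_simps)
qed

lemma norm_deriv_le_strip:
 assumes "f holomorphic_on strip s" "\<And>w. w \<in> strip s \<Longrightarrow> norm (f w) \<le> B"
  and "\<bar>Im z\<bar> + r \<le> s" "0 < r"
 shows "norm (deriv f z) \<le> B / r"
 using ball_subset_complex_strip[OF assms(3)] assms
 by (intro norm_deriv_le) (auto intro: holomorphic_on_subset)

text \<open>Cauchy's inequality turns the integrable bound on \<open>f\<close> into one on its
 difference quotients, so dominated convergence applies.\<close>

lemma has_field_derivative_integral:
 fixes f :: "complex \<Rightarrow> 'b \<Rightarrow> complex"
 assumes U: "open U" and z: "z \<in> U"
  and hol: "\<And>x. x \<in> space M \<Longrightarrow> (\<lambda>w. f w x) holomorphic_on U"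
  and meas: "\<And>w. w \<in> U \<Longrightarrow> f w \<in> borel_measurable M"
  and g: "integrable M g"
  and bd: "\<And>w x. w \<in> U \<Longrightarrow> x \<in> space M \<Longrightarrow> norm (f w x) \<le> g x"
 shows "((\<lambda>w. \<integral>x. f w x \<partial>M) has_field_derivative (\<integral>x. deriv (\<lambda>w. f w x) z \<partial>M)) (at z)"
  and "integrable M (\<lambda>x. deriv (\<lambda>w. f w x) z)"
proof -
 obtain r0 where r0: "0 < r0" "ball z r0 \<subseteq> U" using U z openE by blast
 define r where "r = r0 / 2"
 have r: "0 < r" using r0 by (simp add: r_def)
 have sub: "ball w r \<subseteq> U" if "w \<in> ball z r" for w
 proof
  fix y assume "y \<in> ball w r"
  then have "dist z y < r + r" using that dist_triangle_less_add[of z w r y r] by (simp add: dist_commute)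
  then show "y \<in> U" using r0 by (auto simp: r_def)
 qed
 have db: "norm (deriv (\<lambda>w. f w x) w) \<le> g x / r" if "w \<in> ball z r" "x \<in> space M" for w x
  by (rule norm_deriv_le) (use sub[OF that(1)] that r bd in \<open>auto intro: holomorphic_on_subset[OF hol]\<close>)
 have int: "integrable M (f w)" if "w \<in> U" for w
  by (rule Bochner_Integration.integrable_bound[OF g]) (use bd[OF that] meas[OF that] in \<open>auto intro!: AE_I2 intro: order_trans[OF _ abs_ge_self]\<close>)
 have zU: "z \<in> ball z r" using r by simp
 have bsub: "ball z r \<subseteq> U" using sub[OF zU] .
 have lip: "norm ((f w x - f z x) / (w - z)) \<le> g x / r" if w: "w \<in> ball z r - {z}" and x: "x \<in> space M" for w x
 proof -
  have "norm (f w x - f z x) \<le> g x / r * norm (w - z)"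
  proof (rule field_differentiable_bound[OF convex_ball _ _ _ zU, where f' = "\<lambda>w. deriv (\<lambda>w. f w x) w"])
   fix y assume y: "y \<in> ball z r"
   show "((\<lambda>w. f w x) has_field_derivative deriv (\<lambda>w. f w x) y) (at y within ball z r)"
    using hol[OF x] bsub U y
    by (meson holomorphic_derivI has_field_derivative_at_within subsetD)
   show "norm (deriv (\<lambda>w. f w x) y) \<le> g x / r" using db[OF y x] .
  qed (use w in auto)
  then show ?thesis using w by (simp add: norm_divide divide_le_eq)
 qed
 have main: "(\<lambda>i. \<integral>x. (f (X i) x - f z x) / (X i - z) \<partial>M) \<longlonglongrightarrow> (\<integral>x. deriv (\<lambda>w. f w x) z \<partial>M)
   \<and> integrable M (\<lambda>x. deriv (\<lambda>w. f w x) z)"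
  if X: "\<And>i. X i \<in> ball z r - {z}" "X \<longlonglongrightarrow> z" for X
 proof -
  have m: "(\<lambda>x. (f (X i) x - f z x) / (X i - z)) \<in> borel_measurable M" for i
   using meas bsub X(1)[of i] z by (intro borel_measurable_divide borel_measurable_diff) auto
  have l: "(\<lambda>i. (f (X i) x - f z x) / (X i - z)) \<longlonglongrightarrow> deriv (\<lambda>w. f w x) z" if x: "x \<in> space M" for x
  proof -
   have "((\<lambda>w. f w x) has_field_derivative deriv (\<lambda>w. f w x) z) (at z)"
    using hol[OF x] U z by (meson holomorphic_derivI)
   then have "((\<lambda>w. (f w x - f z x) / (w - z)) \<longlongrightarrow> deriv (\<lambda>w. f w x) z) (at z)"
    by (simp add: has_field_derivative_iff)
   then show ?thesis using X unfolding tendsto_at_iff_sequentially comp_def by auto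
  qed
  have m2: "(\<lambda>x. deriv (\<lambda>w. f w x) z) \<in> borel_measurable M"
   by (rule borel_measurable_LIMSEQ_metric[OF m l])
  have gi: "integrable M (\<lambda>x. g x / r)" using g by simp
  show ?thesis
  proof (intro conjI)
   have al: "AE x in M. (\<lambda>i. (f (X i) x - f z x) / (X i - z)) \<longlonglongrightarrow> deriv (\<lambda>w. f w x) z"
    using l by (auto intro!: AE_I2)
   have ab: "\<And>i. AE x in M. norm ((f (X i) x - f z x) / (X i - z)) \<le> g x / r"
    using lip X(1) by (intro AE_I2) blast
   show "(\<lambda>i. \<integral>x. (f (X i) x - f z x) / (X i - z) \<partial>M) \<longlonglongrightarrow> (\<integral>x. deriv (\<lambda>w. f w x) z \<partial>M)"
    by (rule integral_dominated_convergence[OF m2 m gi al ab])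
   show "integrable M (\<lambda>x. deriv (\<lambda>w. f w x) z)"
    by (rule integrable_dominated_convergence[OF m2 m gi al ab])
  qed
 qed
 have "((\<lambda>w. ((\<integral>x. f w x \<partial>M) - (\<integral>x. f z x \<partial>M)) / (w - z)) \<longlongrightarrow> (\<integral>x. deriv (\<lambda>w. f w x) z \<partial>M)) (at z within ball z r)"
  unfolding tendsto_at_iff_sequentially
 proof (intro allI impI)
  fix X assume X: "\<forall>i. X i \<in> ball z r - {z}" "X \<longlonglongrightarrow> z"
  have "(\<integral>x. (f (X i) x - f z x) / (X i - z) \<partial>M) = ((\<integral>x. f (X i) x \<partial>M) - (\<integral>x. f z x \<partial>M)) / (X i - z)" for i
   using int[OF subsetD[OF bsub], of "X i"] int[OF z] X(1)
   by (subst integral_divide_zero, subst Bochner_Integration.integral_diff) auto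
  then show "((\<lambda>w. ((\<integral>x. f w x \<partial>M) - (\<integral>x. f z x \<partial>M)) / (w - z)) \<circ> X) \<longlonglongrightarrow> (\<integral>x. deriv (\<lambda>w. f w x) z \<partial>M)"
   using main[of X] X by (simp add: comp_def)
 qed
 then show "((\<lambda>w. \<integral>x. f w x \<partial>M) has_field_derivative (\<integral>x. deriv (\<lambda>w. f w x) z \<partial>M)) (at z)"
  using zU by (simp add: has_field_derivative_iff at_within_open[OF zU open_ball])
 have "(\<lambda>i. z + of_real (r / (real i + 2))) \<longlonglongrightarrow> z + of_real 0"
  by (intro tendsto_intros) real_asymp
 moreover have "z + of_real (r / (real i + 2)) \<in> ball z r - {z}" for i
 proof -
  have "r / (real i + 2) < r" using r by (simp add: field_simps add_pos_nonneg)
  moreover have "norm (complex_of_real (r / (real i + 2))) = r / (real i + 2)"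
   using r by (simp only: norm_of_real) simp
  moreover have "complex_of_real (r / (real i + 2)) \<noteq> 0"
   using r by (simp only: of_real_eq_0_iff) simp
  ultimately show ?thesis using r by (simp only: Diff_iff mem_ball dist_norm) simp
 qed
 ultimately show "integrable M (\<lambda>x. deriv (\<lambda>w. f w x) z)"
  using main[of "\<lambda>i. z + of_real (r / (real i + 2))"] by simp
qed

lemma integrable_exp_neg_abs: "integrable lborel (\<lambda>x::real. exp (- \<bar>x\<bar>))"
proof -
 have 1: "set_integrable lborel {0..} (\<lambda>x::real. exp (- x))"
 proof -
  have "(\<lambda>x::real. exp (- 1 * x)) integrable_on {0..}" using integrable_on_exp_minus_to_infinity[of 1 0] by simp
  then have "(\<lambda>x::real. exp (- x)) absolutely_integrable_on {0..}"
   by (intro nonnegative_absolutely_integrable_1) auto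
  then show ?thesis unfolding set_integrable_def
   by (subst (asm) integrable_completion) auto
 qed
 have 2: "set_integrable lborel {..0} (\<lambda>x::real. exp x)"
 proof -
  have "integrable lborel (\<lambda>x::real. indicator {0..} (0 + (-1) * x) *\<^sub>R exp (- (0 + (-1)*x)))"
   using 1 unfolding set_integrable_def by (intro lborel_integrable_real_affine) auto
  moreover have "(\<lambda>x::real. indicator {0..} (0 + (-1) * x) *\<^sub>R exp (- (0 + (-1)*x))) = (\<lambda>x. indicator {..0} x *\<^sub>R exp x)"
   by (auto simp: fun_eq_iff indicator_def)
  ultimately show ?thesis unfolding set_integrable_def by simp
 qed
 have "integrable lborel (\<lambda>x::real. indicator {0..} x *\<^sub>R exp (- x) + indicator {..0} x *\<^sub>R exp x)"
  using 1 2 unfolding set_integrable_def by (rule Bochner_Integration.integrable_add)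
 then show ?thesis
  by (rule Bochner_Integration.integrable_bound) (auto simp: indicator_def)
qed

text \<open>Instead of a contour argument: the integral over the line through \<open>w\<close> is
 holomorphic in \<open>w\<close> and does not change under real translations of \<open>w\<close>. Its
 derivative is therefore zero.\<close>

lemma line_integral_shift:
 assumes hol: "h holomorphic_on {w. a < Im w \<and> Im w < b}"
  and bd: "\<And>w. a < Im w \<Longrightarrow> Im w < b \<Longrightarrow> norm (h w) \<le> C * exp (- \<bar>Re w\<bar>)"
  and y: "a < y1" "y1 < b" "a < y2" "y2 < b"
 shows "(LBINT x. h (of_real x + \<i> * of_real y1)) = (LBINT x. h (of_real x + \<i> * of_real y2))"
proof -
 define U where "U = {w. a < Im w} \<inter> {w. Im w < b} \<inter> {w. Re w < 1} \<inter> {w. Re w > -1}"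
 have oU: "open U" unfolding U_def
  by (intro open_Int open_halfspace_Im_gt open_halfspace_Im_lt open_halfspace_Re_gt open_halfspace_Re_lt)
 have cU: "convex U" unfolding U_def
  by (intro convex_Int convex_halfspace_Im_gt convex_halfspace_Im_lt convex_halfspace_Re_gt convex_halfspace_Re_lt)
 define g where "g w = (LBINT x. h (of_real x + w))" for w
 have C: "0 \<le> C" using bd[of "\<i> * of_real y1"] y by (simp add: order_trans[OF norm_ge_zero])
 have conth: "continuous_on {w. a < Im w \<and> Im w < b} h" using hol by (rule holomorphic_on_imp_continuous_on)
 have der: "(g has_field_derivative (LBINT x. deriv (\<lambda>w. h (of_real x + w)) z)) (at z)" if z: "z \<in> U" for z
  unfolding g_def
 proof (rule has_field_derivative_integral(1)[OF oU z, where g = "\<lambda>x. C * exp 1 * exp (- \<bar>x\<bar>)"])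
  show "(\<lambda>w. h (complex_of_real x + w)) holomorphic_on U" for x
  proof -
   have "(\<lambda>w. complex_of_real x + w) holomorphic_on U" by (intro holomorphic_intros)
   moreover have "(\<lambda>w. complex_of_real x + w) ` U \<subseteq> {w. a < Im w \<and> Im w < b}" by (auto simp: U_def)
   ultimately show ?thesis using holomorphic_on_compose_gen[OF _ hol] by (simp add: o_def)
  qed
  show "(\<lambda>x. h (complex_of_real x + w)) \<in> borel_measurable lborel" if "w \<in> U" for w
   using that unfolding measurable_lborel2
   by (intro borel_measurable_continuous_onI continuous_on_compose2[OF conth])
     (auto intro!: continuous_intros simp: U_def)
  show "integrable lborel (\<lambda>x. C * exp 1 * exp (- \<bar>x\<bar>))" using integrable_exp_neg_abs by simp
  show "norm (h (complex_of_real x + w)) \<le> C * exp 1 * exp (- \<bar>x\<bar>)" if "w \<in> U" for w x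
  proof -
   have "norm (h (complex_of_real x + w)) \<le> C * exp (- \<bar>x + Re w\<bar>)"
    using bd[of "of_real x + w"] that by (simp add: U_def)
   also have "exp (- \<bar>x + Re w\<bar>) \<le> exp (1 + - \<bar>x\<bar>)" using that by (auto simp: U_def)
   also have "\<dots> = exp 1 * exp (- \<bar>x\<bar>)" by (rule exp_add)
   finally show ?thesis using C by (simp add: mult_left_mono mult.assoc)
  qed
 qed
 have inv: "g (z + of_real s) = g z" for z s
 proof -
  have "(LBINT x. h (of_real (s + 1 * x) + z)) = g z"
   unfolding g_def using lborel_integral_real_affine[of 1 "\<lambda>x. h (of_real x + z)" s] by simp
  then show ?thesis by (simp add: g_def algebra_simps)
 qed
 have zero: "(g has_field_derivative 0) (at z)" if z: "z \<in> U" for z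
 proof -
  define D where "D = (LBINT x. deriv (\<lambda>w. h (of_real x + w)) z)"
  have "((\<lambda>w. (g (z + w) - g z) / w) \<longlongrightarrow> D) (at 0)"
   using der[OF z] unfolding D_def by (simp add: DERIV_def)
  moreover have "(\<lambda>n. complex_of_real (1 / Suc n)) \<longlonglongrightarrow> 0"
   using tendsto_of_real[OF lim_inverse_n'[THEN LIMSEQ_Suc], where 'a=complex] by simp
  moreover have "\<forall>n. complex_of_real (1 / Suc n) \<in> UNIV - {0}" by (simp del: of_nat_Suc)
  ultimately have "(\<lambda>n. (g (z + complex_of_real (1 / Suc n)) - g z) / complex_of_real (1 / Suc n)) \<longlonglongrightarrow> D"
   unfolding tendsto_at_iff_sequentially comp_def
   by - (drule spec[where x = "\<lambda>n. complex_of_real (1 / Suc n)"], simp only: simp_thms)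
  then have "D = 0" by (simp only: inv) (simp add: LIMSEQ_const_iff)
  then show ?thesis using der[OF z] D_def by simp
 qed
 have "\<exists>c. \<forall>w\<in>U. g w = c"
  using has_field_derivative_zero_constant[OF cU] zero by (meson has_field_derivative_at_within)
 then have "g (\<i> * of_real y1) = g (\<i> * of_real y2)" using y by (auto simp: U_def)
 then show ?thesis by (simp add: g_def)
qed

section \<open>Bounds for complex hyperbolic functions\<close>

lemma Re_cosh: "Re (cosh z) = cosh (Re z) * cos (Im z)"
 by (simp add: cosh_field_def Re_exp field_simps)
lemma Im_cosh: "Im (cosh z) = sinh (Re z) * sin (Im z)"
 by (simp add: cosh_field_def sinh_field_def Im_exp field_simps)
lemma Re_sinh: "Re (sinh z) = sinh (Re z) * cos (Im z)"
 by (simp add: sinh_field_def Re_exp field_simps)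
lemma Im_sinh: "Im (sinh z) = cosh (Re z) * sin (Im z)"
 by (simp add: cosh_field_def sinh_field_def Im_exp field_simps)

lemma norm_cosh_ge: "cosh (Re z) * \<bar>cos (Im z)\<bar> \<le> norm (cosh z)"
 using abs_Re_le_cmod[of "cosh z"] by (simp add: Re_cosh abs_mult)

lemma norm_sinh_squared: "(norm (sinh z))\<^sup>2 = (sinh (Re z))\<^sup>2 + (sin (Im z))\<^sup>2" for z :: complex
proof -
 have "(norm (sinh z))\<^sup>2 = (sinh (Re z))\<^sup>2 * (cos (Im z))\<^sup>2 + (cosh (Re z))\<^sup>2 * (sin (Im z))\<^sup>2"
  by (simp add: cmod_power2 Re_sinh Im_sinh power_mult_distrib)
 also have "\<dots> = (sinh (Re z))\<^sup>2 * ((cos (Im z))\<^sup>2 + (sin (Im z))\<^sup>2) + (sin (Im z))\<^sup>2"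
  by (simp add: cosh_square_eq algebra_simps del: sin_cos_squared_add sin_cos_squared_add2)
 finally show ?thesis by simp
qed

lemma le_sinh: "x \<le> sinh x" if "0 \<le> x" for x :: real
proof -
 have "sinh 0 - 0 \<le> sinh x - x"
 proof (rule DERIV_nonneg_imp_nondecreasing[OF that, of "\<lambda>x. sinh x - x"])
  fix y :: real
  have "((\<lambda>x. sinh x - x) has_real_derivative cosh y - 1) (at y)"
   by (auto intro!: derivative_eq_intros)
  then show "\<exists>D. ((\<lambda>x. sinh x - x) has_real_derivative D) (at y) \<and> 0 \<le> D"
   using cosh_real_ge_1[of y] by auto
 qed
 then show ?thesis by simp
qed

lemma half_le_sin:
 assumes "0 \<le> b" "b \<le> pi / 2" shows "b / 2 \<le> sin b"
proof -
 have mono: "sin 0 - 0 * cos 0 \<le> sin (b/2) - (b/2) * cos (b/2)"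
 proof (rule DERIV_nonneg_imp_nondecreasing[of 0 "b/2" "\<lambda>y. sin y - y * cos y"])
  fix x assume x: "0 \<le> x" "x \<le> b/2"
  have "((\<lambda>y. sin y - y * cos y) has_real_derivative x * sin x) (at x)"
   by (auto intro!: derivative_eq_intros)
  moreover have "0 \<le> x * sin x" using x assms by (intro mult_nonneg_nonneg sin_ge_zero) auto
  ultimately show "\<exists>y. ((\<lambda>y. sin y - y * cos y) has_real_derivative y) (at x) \<and> 0 \<le> y" by blast
 qed (use assms in auto)
 have c: "0 \<le> cos b" "0 \<le> cos (b/2)" using assms by (auto intro!: cos_ge_zero)
 have "b / 2 \<le> b * (cos (b/2))\<^sup>2"
 proof -
  have "cos b = 2 * (cos (b/2))\<^sup>2 - 1" using cos_double_cos[of "b/2"] by simp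
  then have "1/2 \<le> (cos (b/2))\<^sup>2" using c(1) by linarith
  then show ?thesis using mult_left_mono[of "1/2" "(cos (b/2))\<^sup>2" b] assms by simp
 qed
 also have "\<dots> = 2 * ((b/2) * cos (b/2)) * cos (b/2)" by (simp add: power2_eq_square)
 also have "\<dots> \<le> 2 * sin (b/2) * cos (b/2)"
  using mono c by (intro mult_right_mono) auto
 also have "\<dots> = sin b" using sin_double[of "b/2"] by simp
 finally show ?thesis .
qed

text \<open>Away from zero \<open>sinh\<close> is comparable to \<open>cosh (Re z)\<close>: if \<open>Re
 z\<close> is small then \<open>Im z\<close> is not, and \<open>half_le_sin\<close> applies.\<close>

lemma norm_sinh_ge:
 fixes z :: complex
 assumes "\<bar>Im z\<bar> \<le> pi / 2" "\<mu> \<le> norm z" "0 < \<mu>"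
 shows "cosh (Re z) * (\<mu> / (\<mu> + 2)) \<le> norm (sinh z)"
proof -
 define t where "t = \<mu> / 2"
 have t: "0 < t" using assms by (simp add: t_def)
 let ?a = "Re z" and ?b = "Im z" and ?N = "norm (sinh z)"
 have 1: "?a\<^sup>2 \<le> (sinh ?a)\<^sup>2"
 proof -
  have "\<bar>?a\<bar> \<le> \<bar>sinh ?a\<bar>" using le_sinh[of "\<bar>?a\<bar>"] by simp
  then show ?thesis by (simp add: abs_le_square_iff)
 qed
 have 2: "(?b / 2)\<^sup>2 \<le> (sin ?b)\<^sup>2"
 proof -
  have "\<bar>?b\<bar> / 2 \<le> \<bar>sin ?b\<bar>" using half_le_sin[of "\<bar>?b\<bar>"] assms(1) by (auto simp: abs_if split: if_splits)
  then show ?thesis unfolding abs_le_square_iff[symmetric] by simp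
 qed
 have "t\<^sup>2 \<le> (norm z)\<^sup>2 / 4"
  using power_mono[OF assms(2), of 2] assms(3) by (simp add: t_def power_divide)
 also have "\<dots> \<le> ?a\<^sup>2 + (?b/2)\<^sup>2" by (simp add: cmod_power2 power_divide)
 also have "\<dots> \<le> ?N\<^sup>2" using 1 2 by (simp add: norm_sinh_squared)
 finally have N1: "t\<^sup>2 \<le> ?N\<^sup>2" .
 have N2: "(sinh ?a)\<^sup>2 \<le> ?N\<^sup>2" by (simp add: norm_sinh_squared)
 have "(t * cosh ?a)\<^sup>2 = t\<^sup>2 + t\<^sup>2 * (sinh ?a)\<^sup>2"
  by (simp add: power_mult_distrib cosh_square_eq algebra_simps)
 also have "\<dots> \<le> ?N\<^sup>2 + t\<^sup>2 * ?N\<^sup>2" using N1 N2 by (intro add_mono mult_left_mono) auto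
 also have "\<dots> \<le> ((1 + t) * ?N)\<^sup>2"
  using t by (simp add: power_mult_distrib power2_eq_square algebra_simps)
 finally have "(t * cosh ?a)\<^sup>2 \<le> ((1 + t) * ?N)\<^sup>2" .
 then have "t * cosh ?a \<le> (1 + t) * ?N"
  by (rule power2_le_imp_le) (use t in simp)
 then show ?thesis using t assms(3) by (simp add: t_def field_simps)
qed

lemma norm_cosh_le: "norm (cosh z) \<le> exp (norm z)" for z :: complex
proof -
 have "norm (exp z + exp (- z)) \<le> exp (norm z) + exp (norm z)"
  using norm_exp[of z] norm_exp[of "-z"] by (intro order_trans[OF norm_triangle_ineq] add_mono) simp_all
 then show ?thesis by (simp add: cosh_field_def norm_divide)
qed

lemma norm_sinh_le: "norm (sinh z) \<le> norm z * exp (norm z)" for z :: complex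
proof -
 have "norm (sinh z - sinh 0) \<le> exp (norm z) * norm (z - 0)"
 proof (rule field_differentiable_bound[of "cball 0 (norm z)" sinh cosh])
  fix w :: complex assume w: "w \<in> cball 0 (norm z)"
  show "(sinh has_field_derivative cosh w) (at w within cball 0 (norm z))"
   by (auto intro!: derivative_eq_intros)
  show "norm (cosh w) \<le> exp (norm z)" using norm_cosh_le[of w] w order_trans[of "norm (cosh w)" "exp (norm w)" "exp (norm z)"] by simp
 qed auto
 then show ?thesis by (simp add: mult.commute)
qed

lemma tanh_diff_eq:
 fixes a b :: complex
 assumes "cosh a \<noteq> 0" "cosh b \<noteq> 0"
 shows "tanh a - tanh b = sinh (a - b) / (cosh a * cosh b)"
 using assms by (simp add: tanh_def sinh_diff field_simps)

text \<open>A difference of two \<open>tanh\<close> decays like the square of \<open>1 / cosh\<close> by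
  \<open>tanh_diff_eq\<close>. This is why the regularised kernel is integrable.\<close>

lemma norm_tanh_diff_le:
 fixes a b :: complex
 assumes "m * E \<le> norm (cosh a)" "m * E \<le> norm (cosh b)" "0 < m" "0 < E" "norm (a - b) \<le> d"
 shows "norm (tanh a - tanh b) \<le> d * exp d / (m * E)\<^sup>2"
proof -
 have p: "0 < m * E" using assms by simp
 have nz: "cosh a \<noteq> 0" "cosh b \<noteq> 0" using assms(1,2) p by (metis norm_zero not_le)+
 have "norm (tanh a - tanh b) = norm (sinh (a - b)) / (norm (cosh a) * norm (cosh b))"
  by (simp add: tanh_diff_eq[OF nz] norm_divide norm_mult)
 also have "\<dots> \<le> (d * exp d) / (m * E)\<^sup>2"
 proof (rule frac_le)
  show "norm (sinh (a - b)) \<le> d * exp d"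
   using order_trans[OF norm_sinh_le mult_mono[OF assms(5), of "exp (norm (a-b))" "exp d"]] assms(5)
   by (meson exp_ge_zero exp_le_cancel_iff norm_ge_zero order_trans)
  show "(m * E)\<^sup>2 \<le> norm (cosh a) * norm (cosh b)"
   unfolding power2_eq_square using assms p by (intro mult_mono) auto
  show "0 \<le> d * exp d" using order_trans[OF norm_ge_zero assms(5)] by simp
 qed (use assms(3,4) in simp)
 finally show ?thesis .
qed

text \<open>The kernel of the equation contains \<open>coth\<close> on the part with \<open>v(\<alpha>)
 - v(\<eta>)\<close> and \<open>tanh\<close> on its mirror image in the walls. A shift by \<open>\<i>
 \<pi>\<close> gives both the same form, so that one estimate serves both.\<close>

lemma tanh_plus_half_pi: "tanh ((X + \<i> * of_real pi) / 2) = cosh (X / 2) / sinh (X / 2)" for X :: complex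
proof -
 have s: "sinh (\<i> * of_real pi / 2) = \<i>"
  by (simp add: complex_eq_iff Re_sinh Im_sinh)
 have c: "cosh (\<i> * of_real pi / 2) = 0"
  by (simp add: complex_eq_iff Re_cosh Im_cosh)
 have "(X + \<i> * of_real pi) / 2 = X / 2 + \<i> * of_real pi / 2" by (simp add: field_simps)
 then show ?thesis by (simp only: tanh_def sinh_add cosh_add s c) simp
qed

lemma cosh_plus_half_pi: "cosh ((X + \<i> * of_real pi) / 2) = \<i> * sinh (X / 2)" for X :: complex
proof -
 have s: "sinh (\<i> * of_real pi / 2) = \<i>"
  by (simp add: complex_eq_iff Re_sinh Im_sinh)
 have c: "cosh (\<i> * of_real pi / 2) = 0"
  by (simp add: complex_eq_iff Re_cosh Im_cosh)
 have "(X + \<i> * of_real pi) / 2 = X / 2 + \<i> * of_real pi / 2" by (simp add: field_simps)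
 then show ?thesis by (simp only: cosh_add s c) simp
qed

section \<open>Schwarz reflection and the regularised kernel\<close>

text \<open>On the real axis this is the complex conjugate of \<open>v\<close>, but it is holomorphic.\<close>

definition conj_refl :: "(complex \<Rightarrow> complex) \<Rightarrow> complex \<Rightarrow> complex" where
 "conj_refl v w = cnj (v (cnj w))"

lemma conj_refl_has_deriv:
 assumes "(v has_field_derivative D) (at (cnj w))"
 shows "(conj_refl v has_field_derivative cnj D) (at w)"
 using has_field_derivative_cnj_cnj[OF assms]
 by (simp add: conj_refl_def[abs_def] o_def)

lemma conj_refl_holomorphic:
 assumes "v holomorphic_on strip s"
 shows "conj_refl v holomorphic_on strip s"
proof -
 have "(conj_refl v has_field_derivative cnj (deriv v (cnj w))) (at w)" if "w \<in> strip s" for w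
  using that assms by (intro conj_refl_has_deriv holomorphic_derivI) auto
 then show ?thesis unfolding holomorphic_on_open[OF open_complex_strip] by blast
qed

lemma deriv_conj_refl:
 assumes "v holomorphic_on strip s" "w \<in> strip s"
 shows "deriv (conj_refl v) w = cnj (deriv v (cnj w))"
 using assms by (intro DERIV_imp_deriv conj_refl_has_deriv holomorphic_derivI[where S = "strip s"]) auto

text \<open>The point of the curve with parameter \<open>w\<close>; curves are described by their
 displacement \<open>v\<close> from the flat one.\<close>

definition pt :: "(complex \<Rightarrow> complex) \<Rightarrow> complex \<Rightarrow> complex" where "pt v w = w + v w"

text \<open>Twice the complexified integrand of the equation, with the behaviour at infinity subtracted:
 each \<open>tanh\<close> is compared with that of the flat curve, and the last term compensates for
 the integration by parts in \<open>ref_ker\<close>. The imaginary shifts encode \<open>coth\<close>.\<close>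

definition reg_ker :: "(complex \<Rightarrow> complex) \<Rightarrow> complex \<Rightarrow> complex \<Rightarrow> complex" where
 "reg_ker v \<alpha> \<eta> =
   (deriv v \<alpha> - deriv v \<eta>) *
    ((tanh ((pt v \<alpha> - pt v \<eta> + \<i> * of_real pi) / 2) - tanh ((\<alpha> - \<eta>) / 2)) +
    (tanh ((pt (conj_refl v) \<alpha> - pt (conj_refl v) \<eta> + \<i> * of_real pi) / 2) - tanh ((\<alpha> - \<eta>) / 2)))
  + (deriv v \<alpha> - deriv (conj_refl v) \<eta>) *
    ((tanh ((pt v \<alpha> - pt (conj_refl v) \<eta>) / 2) - tanh ((\<alpha> - \<eta>) / 2)) +
    (tanh ((pt (conj_refl v) \<alpha> - pt v \<eta>) / 2) - tanh ((\<alpha> - \<eta>) / 2)))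
  - (v \<eta> + conj_refl v \<eta>) / (cosh ((\<alpha> - \<eta>) / 2))\<^sup>2"

text \<open>All denominators of \<open>reg_ker\<close> grow at the rate of those of the flat curve.\<close>

definition cosh_bds :: "real \<Rightarrow> (complex \<Rightarrow> complex) \<Rightarrow> complex \<Rightarrow> complex \<Rightarrow> bool" where
 "cosh_bds m v \<alpha> \<eta> \<longleftrightarrow>
   (\<forall>X\<in>{pt v \<alpha> - pt v \<eta> + \<i> * of_real pi, pt (conj_refl v) \<alpha> - pt (conj_refl v) \<eta> + \<i> * of_real pi,
     pt v \<alpha> - pt (conj_refl v) \<eta>, pt (conj_refl v) \<alpha> - pt v \<eta>, \<alpha> - \<eta>}.
    m * exp (\<bar>Re (\<alpha> - \<eta>)\<bar> / 2) \<le> norm (cosh (X / 2)))"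

text \<open>Displacements with uniform bounds: the curve stays away from the walls by
  \<open>\<theta>\<close> and satisfies a chord condition with constant \<open>\<mu>\<close>. In the
 wide strip it is required only at distance \<open>\<rho>\<close> or more, which is what the shifted
 contours see. In the narrow strip, where the contour runs through the diagonal, the full chord-arc
 bound is needed.\<close>

definition state :: "real \<Rightarrow> real \<Rightarrow> real \<Rightarrow> real \<Rightarrow> real \<Rightarrow> (complex \<Rightarrow> complex) \<Rightarrow> bool" where
 "state s \<rho> M \<theta> \<mu> v \<longleftrightarrow> 0 < \<rho> \<and> 4 * \<rho> \<le> s \<and> \<rho> \<le> 1/4 \<and> 0 \<le> M \<and> 0 < \<theta> \<and> 0 < \<mu> \<and>
   v holomorphic_on strip s \<and>
   (\<forall>w\<in>strip s. norm (v w) \<le> M \<and> \<bar>Im (pt v w)\<bar> \<le> pi/2 - \<theta>) \<and>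
   (\<forall>\<alpha>\<in>strip s. \<forall>\<eta>\<in>strip s. \<rho> \<le> norm (\<alpha> - \<eta>) \<longrightarrow> \<mu> \<le> norm (pt v \<alpha> - pt v \<eta>)) \<and>
   (\<forall>\<alpha>\<in>strip (2 * \<rho>). \<forall>\<eta>\<in>strip (2 * \<rho>). \<mu> * norm (\<alpha> - \<eta>) \<le> norm (pt v \<alpha> - pt v \<eta>))"

text \<open>The constant that \<open>state\<close> guarantees in \<open>cosh_bds\<close>.\<close>

definition cosh_low :: "real \<Rightarrow> real \<Rightarrow> real \<Rightarrow> real" where
 "cosh_low M \<theta> \<mu> = exp (- M) / 4 * min (sin \<theta>) (\<mu> / (\<mu> + 4))"

lemma pt_conj_refl: "pt (conj_refl v) w = cnj (pt v (cnj w))"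
 by (simp add: pt_def conj_refl_def)

lemma half_exp_le_cosh: "exp \<bar>a\<bar> / 2 \<le> cosh a" for a :: real
proof -
 have "exp \<bar>a\<bar> \<le> exp \<bar>a\<bar> + exp (-\<bar>a\<bar>)" by simp
 then have "exp \<bar>a\<bar> / 2 \<le> cosh \<bar>a\<bar>" by (simp add: cosh_field_def)
 then show ?thesis by simp
qed

lemma cosh_low_pos:
 assumes "0 < \<theta>" "\<theta> \<le> pi/2" "0 < \<mu>" shows "0 < cosh_low M \<theta> \<mu>"
proof -
 have "0 < sin \<theta>" using assms pi_gt_zero by (intro sin_gt_zero) linarith+
 then show ?thesis using assms by (simp add: cosh_low_def)
qed

lemma state_theta: assumes "state s \<rho> M \<theta> \<mu> v" shows "\<theta> \<le> pi / 2"
proof -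
 have "0 < s" using assms by (auto simp: state_def)
 then have "(0::complex) \<in> strip s" by simp
 then have "\<bar>Im (pt v 0)\<bar> \<le> pi/2 - \<theta>" using assms unfolding state_def by blast
 then show ?thesis by linarith
qed

text \<open>The factors with an imaginary shift are bounded below by the chord condition via
  \<open>norm_sinh_ge\<close>; the others by the distance to the walls, which keeps the cosine positive.\<close>

lemma state_cosh_bds:
 assumes st: "state s \<rho> M \<theta> \<mu> v" and a: "\<alpha> \<in> strip s" and e: "\<eta> \<in> strip s"
  and far: "\<mu> \<le> norm (pt v \<alpha> - pt v \<eta>)" "\<mu> \<le> norm (pt v (cnj \<alpha>) - pt v (cnj \<eta>))"
  and im: "\<bar>Im (\<alpha> - \<eta>)\<bar> \<le> 1"
 shows "cosh_bds (cosh_low M \<theta> \<mu>) v \<alpha> \<eta>"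
proof -
 note st' = st[unfolded state_def]
 have th: "0 < \<theta>" "\<theta> \<le> pi/2" and mu: "0 < \<mu>" and M: "0 \<le> M" using st' state_theta[OF st] by auto
 have sth: "0 < sin \<theta>" using th pi_gt_zero by (intro sin_gt_zero) linarith+
 let ?b = "\<bar>Re (\<alpha> - \<eta>)\<bar>"
 have ca: "cnj \<alpha> \<in> strip s" and ce: "cnj \<eta> \<in> strip s" using a e by auto
 have bd: "norm (v w) \<le> M" "\<bar>Im (pt v w)\<bar> \<le> pi/2 - \<theta>" if "w \<in> strip s" for w
  using st' that by auto
 have bdr: "norm (conj_refl v w) \<le> M" "\<bar>Im (pt (conj_refl v) w)\<bar> \<le> pi/2 - \<theta>" if "w \<in> strip s" for w
  using bd[of "cnj w"] that by (auto simp: conj_refl_def pt_conj_refl)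
 have low: "cosh_low M \<theta> \<mu> * exp (?b / 2) \<le> norm (cosh (X/2))"
  if re: "?b - 2 * M \<le> \<bar>Re X\<bar>" and X: "cosh (Re (X/2)) * (2 * t) \<le> norm (cosh (X/2))"
   and t: "min (sin \<theta>) (\<mu>/(\<mu>+4)) \<le> 4 * t" for X t
 proof -
  have t0: "0 \<le> t" using t sth mu by (smt (verit) divide_nonneg_nonneg min_def)
  have "exp (?b/2 - M) = exp (-M) * exp (?b/2)" by (simp flip: exp_add)
  then have "cosh_low M \<theta> \<mu> * exp (?b / 2) = exp (?b/2 - M) / 4 * min (sin \<theta>) (\<mu>/(\<mu>+4))"
   by (simp only: cosh_low_def) simp
  also have "\<dots> \<le> exp (\<bar>Re X\<bar> / 2) / 4 * (4 * t)"
   using re t t0 sth mu by (intro mult_mono divide_right_mono) auto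
  also have "\<dots> = exp \<bar>Re (X/2)\<bar> / 2 * (2 * t)" by simp
  also have "\<dots> \<le> cosh (Re (X/2)) * (2 * t)"
   using t0 half_exp_le_cosh[of "Re (X/2)"] by (intro mult_right_mono) auto
  finally show ?thesis using X by linarith
 qed
 have tanhX: "cosh_low M \<theta> \<mu> * exp (?b / 2) \<le> norm (cosh ((P - Q)/2))"
  if P: "\<bar>Re P - Re \<alpha>\<bar> \<le> M" "\<bar>Im P\<bar> \<le> pi/2 - \<theta>" and Q: "\<bar>Re Q - Re \<eta>\<bar> \<le> M" "\<bar>Im Q\<bar> \<le> pi/2 - \<theta>" for P Q
 proof (rule low[where t = "sin \<theta> / 2"])
  show "?b - 2 * M \<le> \<bar>Re (P - Q)\<bar>" using P Q by simp
  have "cos (pi/2 - \<theta>) \<le> cos \<bar>Im ((P - Q)/2)\<bar>"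
   using P Q th by (subst cos_mono_le_eq) auto
  then have "cos (pi/2 - \<theta>) \<le> cos (Im ((P-Q)/2))" by (simp only: cos_abs_real)
  moreover have "cos (pi/2 - \<theta>) = sin \<theta>" by (simp add: cos_diff)
  ultimately have "sin \<theta> \<le> \<bar>cos (Im ((P-Q)/2))\<bar>" by linarith
  then show "cosh (Re ((P-Q)/2)) * (2 * (sin \<theta> / 2)) \<le> norm (cosh ((P-Q)/2))"
   using norm_cosh_ge[of "(P-Q)/2"] by (smt (verit, best) cosh_real_pos field_sum_of_halves mult_left_mono)
  show "min (sin \<theta>) (\<mu> / (\<mu> + 4)) \<le> 4 * (sin \<theta> / 2)" using sth by (auto simp: min_def)
 qed
 have cothX: "cosh_low M \<theta> \<mu> * exp (?b / 2) \<le> norm (cosh ((P - Q + \<i> * of_real pi)/2))"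
  if P: "\<bar>Re P - Re \<alpha>\<bar> \<le> M" "\<bar>Im P\<bar> \<le> pi/2 - \<theta>" and Q: "\<bar>Re Q - Re \<eta>\<bar> \<le> M" "\<bar>Im Q\<bar> \<le> pi/2 - \<theta>"
   and far: "\<mu> \<le> norm (P - Q)" for P Q
 proof (rule low[where t = "\<mu> / (\<mu> + 4) / 2"])
  show "?b - 2 * M \<le> \<bar>Re (P - Q + \<i> * of_real pi)\<bar>" using P Q by simp
  have "cosh (Re ((P-Q)/2)) * ((\<mu>/2) / (\<mu>/2 + 2)) \<le> norm (sinh ((P-Q)/2))"
   using P Q th far mu by (intro norm_sinh_ge) (auto simp: norm_divide)
  moreover have "(\<mu>/2) / (\<mu>/2 + 2) = 2 * (\<mu> / (\<mu> + 4) / 2)" using mu by (simp add: field_simps)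
  moreover have "Re ((P-Q + \<i> * of_real pi)/2) = Re ((P-Q)/2)" by simp
  moreover have "norm (cosh ((P-Q + \<i> * of_real pi)/2)) = norm (sinh ((P-Q)/2))"
   by (simp only: cosh_plus_half_pi norm_mult norm_ii mult_1)
  ultimately show "cosh (Re ((P-Q + \<i> * of_real pi)/2)) * (2 * (\<mu> / (\<mu> + 4) / 2)) \<le> norm (cosh ((P-Q + \<i> * of_real pi)/2))"
   by (simp only:)
  have "0 < \<mu> / (\<mu> + 4)" using mu by simp
  moreover have "min (sin \<theta>) (\<mu> / (\<mu> + 4)) \<le> \<mu> / (\<mu> + 4)" by simp
  moreover have "y \<le> 4 * (x / 2)" if "0 < x" "y \<le> x" for x y :: real using that by linarith
  ultimately show "min (sin \<theta>) (\<mu> / (\<mu> + 4)) \<le> 4 * (\<mu> / (\<mu> + 4) / 2)" by blast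
 qed
 have re: "\<bar>Re (pt f w) - Re w\<bar> \<le> M" if "norm (f w) \<le> M" for f w
  using abs_Re_le_cmod[of "f w"] that by (simp add: pt_def)
 have Y: "cosh_low M \<theta> \<mu> * exp (?b / 2) \<le> norm (cosh ((\<alpha> - \<eta>)/2))"
 proof (rule low[where t = "1/4"])
  show "?b - 2 * M \<le> \<bar>Re (\<alpha> - \<eta>)\<bar>" using M by simp
  have "cos (pi/3) \<le> cos \<bar>Im ((\<alpha> - \<eta>)/2)\<bar>"
   using im pi_gt3 by (subst cos_mono_le_eq) auto
  then have "cos (pi/3) \<le> cos (Im ((\<alpha> - \<eta>)/2))" by (simp only: cos_abs_real)
  then have "1/2 \<le> \<bar>cos (Im ((\<alpha> - \<eta>)/2))\<bar>" unfolding cos_60 by linarith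
  then have "cosh (Re ((\<alpha> - \<eta>)/2)) * (1/2) \<le> cosh (Re ((\<alpha> - \<eta>)/2)) * \<bar>cos (Im ((\<alpha> - \<eta>)/2))\<bar>"
   by (rule mult_left_mono) simp
  then show "cosh (Re ((\<alpha> - \<eta>)/2)) * (2 * (1/4)) \<le> norm (cosh ((\<alpha> - \<eta>)/2))"
   using norm_cosh_ge[of "(\<alpha> - \<eta>)/2"] by linarith
  have "min (sin \<theta>) (\<mu> / (\<mu> + 4)) \<le> sin \<theta>" by simp
  then show "min (sin \<theta>) (\<mu> / (\<mu> + 4)) \<le> 4 * (1/4)" using sin_le_one[of \<theta>] by linarith
 qed
 have far2: "\<mu> \<le> norm (pt (conj_refl v) \<alpha> - pt (conj_refl v) \<eta>)"
  using far(2) by (simp add: pt_conj_refl flip: complex_cnj_diff)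
 show ?thesis unfolding cosh_bds_def ball_simps
 proof (intro conjI TrueI)
  show "cosh_low M \<theta> \<mu> * exp (?b / 2) \<le> norm (cosh ((pt v \<alpha> - pt v \<eta> + \<i> * of_real pi) / 2))"
   by (intro cothX re bd bdr a e far(1) far2)
  show "cosh_low M \<theta> \<mu> * exp (?b / 2) \<le> norm (cosh ((pt (conj_refl v) \<alpha> - pt (conj_refl v) \<eta> + \<i> * of_real pi) / 2))"
   by (intro cothX re bd bdr a e far(1) far2)
  show "cosh_low M \<theta> \<mu> * exp (?b / 2) \<le> norm (cosh ((pt v \<alpha> - pt (conj_refl v) \<eta>) / 2))"
   by (intro tanhX re bd bdr a e)
  show "cosh_low M \<theta> \<mu> * exp (?b / 2) \<le> norm (cosh ((pt (conj_refl v) \<alpha> - pt v \<eta>) / 2))"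
   by (intro tanhX re bd bdr a e)
  show "cosh_low M \<theta> \<mu> * exp (?b / 2) \<le> norm (cosh ((\<alpha> - \<eta>) / 2))" by (rule Y)
 qed
qed

section \<open>Size and Lipschitz bounds for the kernel\<close>

text \<open>The bookkeeping for a difference of two kernels, with the factors of \<open>reg_ker\<close>
 abstracted.\<close>

lemma norm_bilinear_diff_le:
 fixes A1 :: complex
 assumes "norm (A1 - A2) \<le> a" "norm (B1 - B2) \<le> a" "norm S1 \<le> \<sigma>" "norm T1 \<le> \<sigma>"
  "norm A2 \<le> b" "norm B2 \<le> b" "norm (S1 - S2) \<le> \<delta>" "norm (T1 - T2) \<le> \<delta>"
  "norm (G1 - G2) \<le> g" "norm (inverse c) \<le> \<gamma>"
 shows "norm (A1 * S1 + B1 * T1 - G1 / c - (A2 * S2 + B2 * T2 - G2 / c)) \<le> 2 * a * \<sigma> + 2 * b * \<delta> + g * \<gamma>"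
proof -
 have eq: "A1 * S1 + B1 * T1 - G1 / c - (A2 * S2 + B2 * T2 - G2 / c)
   = (A1 - A2) * S1 + A2 * (S1 - S2) + ((B1 - B2) * T1 + B2 * (T1 - T2)) - (G1 - G2) * inverse c"
  by (simp add: divide_inverse algebra_simps)
 have m: "norm (x * y) \<le> p * q" if "norm x \<le> p" "norm y \<le> q" for x y :: complex and p q
  using that by (simp add: norm_mult mult_mono')
 have t1: "norm (x + y) \<le> p + q" if "norm x \<le> p" "norm y \<le> q" for x y :: complex and p q
  using that norm_triangle_ineq[of x y] by linarith
 have t2: "norm (x - y) \<le> p + q" if "norm x \<le> p" "norm y \<le> q" for x y :: complex and p q
  using that norm_triangle_ineq4[of x y] by linarith
 have "norm ((A1 - A2) * S1 + A2 * (S1 - S2) + ((B1 - B2) * T1 + B2 * (T1 - T2)) - (G1 - G2) * inverse c)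
   \<le> (a * \<sigma> + b * \<delta>) + (a * \<sigma> + b * \<delta>) + g * \<gamma>"
  by (intro t1 t2 m assms)
 moreover have "(a * \<sigma> + b * \<delta>) + (a * \<sigma> + b * \<delta>) + g * \<gamma> = 2 * a * \<sigma> + 2 * b * \<delta> + g * \<gamma>"
  by (simp add: algebra_simps)
 ultimately show ?thesis unfolding eq by (simp only:)
qed

lemma norm_diff_plus_i_pi_le:
 fixes x y :: complex
 assumes "norm x \<le> M" "norm y \<le> M"
 shows "norm (x - y + \<i> * of_real pi) \<le> 2 * (M + pi)"
proof -
 have "norm (x - y + \<i> * of_real pi) \<le> norm (x - y) + norm (\<i> * complex_of_real pi)"
  by (rule norm_triangle_ineq)
 also have "norm (\<i> * complex_of_real pi) = pi" by (simp add: norm_mult)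
 also have "norm (x - y) + pi \<le> (M + M) + (pi + pi)"
  using assms norm_triangle_ineq4[of x y] by (intro add_mono) auto
 finally show ?thesis by simp
qed

lemma norm_conj_refl_diff_le:
 assumes "\<And>w. w \<in> strip s \<Longrightarrow> norm (v1 w - v2 w) \<le> N" "w \<in> strip s"
 shows "norm (conj_refl v1 w - conj_refl v2 w) \<le> N"
proof -
 have "conj_refl v1 w - conj_refl v2 w = cnj (v1 (cnj w) - v2 (cnj w))" by (simp add: conj_refl_def)
 then show ?thesis using assms(1)[of "cnj w"] assms(2) by (simp del: complex_cnj_diff)
qed

lemma exp_half_sq: "(m * exp (b / 2))\<^sup>2 = m\<^sup>2 * exp b" for b :: real
 by (simp add: power_mult_distrib power2_eq_square flip: exp_add)

lemma norm_tanh_ker_diff_le: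
 fixes X Y :: complex
 assumes "m * exp (b/2) \<le> norm (cosh (X/2))" "m * exp (b/2) \<le> norm (cosh (Y/2))" "0 < m" "norm (X - Y) \<le> 2 * d"
 shows "norm (tanh (X/2) - tanh (Y/2)) \<le> d * exp d / m\<^sup>2 * exp (- b)"
proof -
 have "norm (X/2 - Y/2) \<le> d" using assms(4) by (simp add: norm_divide flip: diff_divide_distrib)
 then have "norm (tanh (X/2) - tanh (Y/2)) \<le> d * exp d / (m * exp (b/2))\<^sup>2"
  using assms by (intro norm_tanh_diff_le) auto
 then show ?thesis unfolding exp_half_sq by (simp add: exp_minus field_simps)
qed

lemma norm_inverse_cosh_sq_le:
 fixes Y :: complex
 assumes "m * exp (b/2) \<le> norm (cosh (Y/2))" "0 < m"
 shows "norm (inverse ((cosh (Y/2))\<^sup>2)) \<le> exp (- b) / m\<^sup>2"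
proof -
 have p: "0 < m * exp (b/2)" using assms by simp
 then have "(m * exp (b/2))\<^sup>2 \<le> (norm (cosh (Y/2)))\<^sup>2" using assms by (intro power_mono) auto
 then have "inverse ((norm (cosh (Y/2)))\<^sup>2) \<le> inverse ((m * exp (b/2))\<^sup>2)"
  using p assms(2) by (intro le_imp_inverse_le) auto
 then show ?thesis
  unfolding norm_inverse norm_power exp_half_sq by (simp add: exp_minus field_simps)
qed

definition reg_ker_const :: "real \<Rightarrow> real \<Rightarrow> real" where
 "reg_ker_const M m = (4 * ((M + pi) * exp (M + pi)) + 1) / m\<^sup>2"

lemma norm_reg_ker_le:
 assumes c: "cosh_bds m v \<alpha> \<eta>" and m: "0 < m"
  and v: "norm (v \<alpha>) \<le> M" "norm (v \<eta>) \<le> M" "norm (conj_refl v \<alpha>) \<le> M" "norm (conj_refl v \<eta>) \<le> M"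
 shows "norm (reg_ker v \<alpha> \<eta>) \<le> reg_ker_const M m * exp (- \<bar>Re (\<alpha> - \<eta>)\<bar>) *
   (norm (deriv v \<alpha>) + norm (deriv v \<eta>) + norm (deriv (conj_refl v) \<eta>) + norm (v \<eta>) + norm (conj_refl v \<eta>))"
proof -
 define b where "b = \<bar>Re (\<alpha> - \<eta>)\<bar>"
 define k where "k = (M + pi) * exp (M + pi) / m\<^sup>2 * exp (- b)"
 note cb = c[unfolded cosh_bds_def ball_simps, folded b_def]
 have M: "0 \<le> M" using v(1) norm_ge_zero order_trans by blast
 have k0: "0 \<le> k" using M by (simp add: k_def)
 have tri: "norm (x - y) \<le> 2 * (M + pi)" if "norm x \<le> M" "norm y \<le> M" for x y :: complex
  using that norm_triangle_ineq4[of x y] pi_gt_zero by (smt (verit))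
 note trii = norm_diff_plus_i_pi_le
 have K1: "norm (tanh ((pt v \<alpha> - pt v \<eta> + \<i> * of_real pi) / 2) - tanh ((\<alpha> - \<eta>) / 2)) \<le> k"
  unfolding k_def using cb m trii[OF v(1) v(2)]
  by (intro norm_tanh_ker_diff_le) (auto simp: pt_def algebra_simps)
 have K2: "norm (tanh ((pt (conj_refl v) \<alpha> - pt (conj_refl v) \<eta> + \<i> * of_real pi) / 2) - tanh ((\<alpha> - \<eta>) / 2)) \<le> k"
  unfolding k_def using cb m trii[OF v(3) v(4)]
  by (intro norm_tanh_ker_diff_le) (auto simp: pt_def algebra_simps)
 have K3: "norm (tanh ((pt v \<alpha> - pt (conj_refl v) \<eta>) / 2) - tanh ((\<alpha> - \<eta>) / 2)) \<le> k"
  unfolding k_def using cb m tri[OF v(1) v(4)]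
  by (intro norm_tanh_ker_diff_le) (auto simp: pt_def algebra_simps)
 have K4: "norm (tanh ((pt (conj_refl v) \<alpha> - pt v \<eta>) / 2) - tanh ((\<alpha> - \<eta>) / 2)) \<le> k"
  unfolding k_def using cb m tri[OF v(3) v(2)]
  by (intro norm_tanh_ker_diff_le) (auto simp: pt_def algebra_simps)
 have C: "norm (inverse ((cosh ((\<alpha> - \<eta>)/2))\<^sup>2)) \<le> exp (- b) / m\<^sup>2"
  using cb m by (intro norm_inverse_cosh_sq_le) auto
 define a where "a = norm (deriv v \<alpha>) + norm (deriv v \<eta>) + norm (deriv (conj_refl v) \<eta>)"
 define g where "g = norm (v \<eta>) + norm (conj_refl v \<eta>)"
 have a0: "0 \<le> a" and g0: "0 \<le> g" by (simp_all add: a_def g_def)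
 have "norm (reg_ker v \<alpha> \<eta>) \<le> 2 * a * (2 * k) + 2 * 0 * 0 + g * (exp (- b) / m\<^sup>2)"
 proof -
  have "norm (reg_ker v \<alpha> \<eta> - (0 * 0 + 0 * 0 - 0 / (cosh ((\<alpha> - \<eta>) / 2))\<^sup>2)) \<le> 2 * a * (2 * k) + 2 * 0 * (2 * k) + g * (exp (- b) / m\<^sup>2)"
   unfolding reg_ker_def
  proof (rule norm_bilinear_diff_le)
   show "norm (deriv v \<alpha> - deriv v \<eta> - 0) \<le> a"
    using norm_triangle_ineq4[of "deriv v \<alpha>" "deriv v \<eta>"] by (simp add: a_def add_increasing2)
   show "norm (deriv v \<alpha> - deriv (conj_refl v) \<eta> - 0) \<le> a"
    using norm_triangle_ineq4[of "deriv v \<alpha>" "deriv (conj_refl v) \<eta>"] norm_ge_zero[of "deriv v \<eta>"]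
    unfolding a_def diff_0_right by linarith
   show "norm (v \<eta> + conj_refl v \<eta> - 0) \<le> g" using norm_triangle_ineq[of "v \<eta>"] by (simp add: g_def)
   show "norm (inverse ((cosh ((\<alpha> - \<eta>)/2))\<^sup>2)) \<le> exp (- b) / m\<^sup>2" by (rule C)
  qed (use norm_triangle_mono[OF K1 K2] norm_triangle_mono[OF K3 K4] in \<open>simp_all only: diff_0_right mult_2 norm_zero order_refl\<close>)
  then show ?thesis by simp
 qed
 also have "\<dots> = exp (-b) * (a * (4 * ((M + pi) * exp (M + pi)) / m\<^sup>2) + g * (1 / m\<^sup>2))"
  by (simp add: k_def algebra_simps)
 also have "\<dots> \<le> exp (-b) * (a * reg_ker_const M m + g * reg_ker_const M m)"
 proof (intro mult_left_mono add_mono)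
  show "4 * ((M + pi) * exp (M + pi)) / m\<^sup>2 \<le> reg_ker_const M m"
   unfolding reg_ker_const_def by (intro divide_right_mono) auto
  show "1 / m\<^sup>2 \<le> reg_ker_const M m"
   unfolding reg_ker_const_def using M by (intro divide_right_mono) auto
 qed (use a0 g0 in auto)
 finally show ?thesis by (simp add: a_def g_def b_def algebra_simps)
qed

definition reg_ker_lip :: "real \<Rightarrow> real \<Rightarrow> real \<Rightarrow> real" where
 "reg_ker_lip M m e = (1 + e) * (4 * ((M + pi) * exp (M + pi)) * (1 + e) + 4 * exp (2 * M) * (1 + M * e) + 2) / m\<^sup>2"

text \<open>The derivative at the evaluation point, \<open>v'(\<alpha>)\<close>, enters the bound
 linearly and is kept separate. The derivatives at \<open>\<eta>\<close> are controlled by the size of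
  \<open>v\<close> over the distance \<open>1 / e\<close> to the boundary.\<close>

lemma norm_reg_ker_diff_le:
 assumes c1: "cosh_bds m v1 \<alpha> \<eta>" and c2: "cosh_bds m v2 \<alpha> \<eta>" and m: "0 < m" and e: "0 \<le> e"
  and v1: "norm (v1 \<alpha>) \<le> M" "norm (v1 \<eta>) \<le> M" "norm (conj_refl v1 \<alpha>) \<le> M" "norm (conj_refl v1 \<eta>) \<le> M"
  and N: "norm (v1 \<alpha> - v2 \<alpha>) \<le> N" "norm (v1 \<eta> - v2 \<eta>) \<le> N"
    "norm (conj_refl v1 \<alpha> - conj_refl v2 \<alpha>) \<le> N" "norm (conj_refl v1 \<eta> - conj_refl v2 \<eta>) \<le> N" "N \<le> 2 * M"
  and d: "norm (deriv v1 \<eta> - deriv v2 \<eta>) \<le> N * e" "norm (deriv (conj_refl v1) \<eta> - deriv (conj_refl v2) \<eta>) \<le> N * e"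
  and d2: "norm (deriv v2 \<eta>) \<le> M * e" "norm (deriv (conj_refl v2) \<eta>) \<le> M * e"
 shows "norm (reg_ker v1 \<alpha> \<eta> - reg_ker v2 \<alpha> \<eta>) \<le> reg_ker_lip M m e * exp (- \<bar>Re (\<alpha> - \<eta>)\<bar>) *
   (norm (deriv v1 \<alpha> - deriv v2 \<alpha>) + (1 + norm (deriv v2 \<alpha>)) * N)"
proof -
 define b where "b = \<bar>Re (\<alpha> - \<eta>)\<bar>"
 define k where "k = (M + pi) * exp (M + pi) / m\<^sup>2 * exp (- b)"
 define l where "l = N * exp N / m\<^sup>2 * exp (- b)"
 note cb = c1[unfolded cosh_bds_def ball_simps, folded b_def]
 note cb2 = c2[unfolded cosh_bds_def ball_simps, folded b_def]
 have M: "0 \<le> M" using v1(1) norm_ge_zero order_trans by blast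
 have N0: "0 \<le> N" using N(1) norm_ge_zero order_trans by blast
 have tri: "norm (x - y) \<le> 2 * (M + pi)" if "norm x \<le> M" "norm y \<le> M" for x y :: complex
  using that norm_triangle_ineq4[of x y] pi_gt_zero by (smt (verit))
 note trii = norm_diff_plus_i_pi_le
 have K1: "norm (tanh ((pt v1 \<alpha> - pt v1 \<eta> + \<i> * of_real pi) / 2) - tanh ((\<alpha> - \<eta>) / 2)) \<le> k"
  unfolding k_def using cb m trii[OF v1(1) v1(2)]
  by (intro norm_tanh_ker_diff_le) (auto simp: pt_def algebra_simps)
 have K2: "norm (tanh ((pt (conj_refl v1) \<alpha> - pt (conj_refl v1) \<eta> + \<i> * of_real pi) / 2) - tanh ((\<alpha> - \<eta>) / 2)) \<le> k"
  unfolding k_def using cb m trii[OF v1(3) v1(4)]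
  by (intro norm_tanh_ker_diff_le) (auto simp: pt_def algebra_simps)
 have K3: "norm (tanh ((pt v1 \<alpha> - pt (conj_refl v1) \<eta>) / 2) - tanh ((\<alpha> - \<eta>) / 2)) \<le> k"
  unfolding k_def using cb m tri[OF v1(1) v1(4)]
  by (intro norm_tanh_ker_diff_le) (auto simp: pt_def algebra_simps)
 have K4: "norm (tanh ((pt (conj_refl v1) \<alpha> - pt v1 \<eta>) / 2) - tanh ((\<alpha> - \<eta>) / 2)) \<le> k"
  unfolding k_def using cb m tri[OF v1(3) v1(2)]
  by (intro norm_tanh_ker_diff_le) (auto simp: pt_def algebra_simps)
 have C: "norm (inverse ((cosh ((\<alpha> - \<eta>)/2))\<^sup>2)) \<le> exp (- b) / m\<^sup>2"
  using cb m by (intro norm_inverse_cosh_sq_le) auto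
 have dd: "norm ((x1 - y1) - (x2 - y2)) \<le> 2 * N" if "norm (x1 - x2) \<le> N" "norm (y1 - y2) \<le> N" for x1 x2 y1 y2 :: complex
 proof -
  have "(x1 - y1) - (x2 - y2) = (x1 - x2) - (y1 - y2)" by simp
  then show ?thesis using that norm_triangle_ineq4[of "x1 - x2" "y1 - y2"] by (smt (verit))
 qed
 have L: "norm (tanh (X1/2) - tanh (X2/2)) \<le> l"
  if "m * exp (b/2) \<le> norm (cosh (X1/2))" "m * exp (b/2) \<le> norm (cosh (X2/2))" "norm (X1 - X2) \<le> 2 * N" for X1 X2 :: complex
  unfolding l_def using that m by (intro norm_tanh_ker_diff_le) auto
 have L1: "norm (tanh ((pt v1 \<alpha> - pt v1 \<eta> + \<i> * of_real pi) / 2) - tanh ((pt v2 \<alpha> - pt v2 \<eta> + \<i> * of_real pi) / 2)) \<le> l"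
  using cb cb2 dd[OF N(1,2)] by (intro L) (auto simp: pt_def algebra_simps)
 have L2: "norm (tanh ((pt (conj_refl v1) \<alpha> - pt (conj_refl v1) \<eta> + \<i> * of_real pi) / 2) - tanh ((pt (conj_refl v2) \<alpha> - pt (conj_refl v2) \<eta> + \<i> * of_real pi) / 2)) \<le> l"
  using cb cb2 dd[OF N(3,4)] by (intro L) (auto simp: pt_def algebra_simps)
 have L3: "norm (tanh ((pt v1 \<alpha> - pt (conj_refl v1) \<eta>) / 2) - tanh ((pt v2 \<alpha> - pt (conj_refl v2) \<eta>) / 2)) \<le> l"
  using cb cb2 dd[OF N(1,4)] by (intro L) (auto simp: pt_def algebra_simps)
 have L4: "norm (tanh ((pt (conj_refl v1) \<alpha> - pt v1 \<eta>) / 2) - tanh ((pt (conj_refl v2) \<alpha> - pt v2 \<eta>) / 2)) \<le> l"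
  using cb cb2 dd[OF N(3,2)] by (intro L) (auto simp: pt_def algebra_simps)
 have sum2: "norm ((x1 - y) + (x2 - y) - ((x1' - y) + (x2' - y))) \<le> 2 * l" if "norm (x1 - x1') \<le> l" "norm (x2 - x2') \<le> l" for x1 x2 x1' x2' y :: complex
 proof -
  have "(x1 - y) + (x2 - y) - ((x1' - y) + (x2' - y)) = (x1 - x1') + (x2 - x2')" by simp
  then show ?thesis using that norm_triangle_ineq[of "x1 - x1'" "x2 - x2'"] by (smt (verit))
 qed
 define D where "D = norm (deriv v1 \<alpha> - deriv v2 \<alpha>)"
 define B where "B = norm (deriv v2 \<alpha>)"
 have D0: "0 \<le> D" and B0: "0 \<le> B" by (simp_all add: D_def B_def)
 have dd2: "norm ((x1 - y1) - (x2 - y2)) \<le> D + N * e" if "norm (x1 - x2) \<le> D" "norm (y1 - y2) \<le> N * e" for x1 x2 y1 y2 :: complex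
 proof -
  have "(x1 - y1) - (x2 - y2) = (x1 - x2) - (y1 - y2)" by simp
  then show ?thesis using that norm_triangle_ineq4[of "x1 - x2" "y1 - y2"] by (smt (verit))
 qed
 have "norm (reg_ker v1 \<alpha> \<eta> - reg_ker v2 \<alpha> \<eta>) \<le> 2 * (D + N * e) * (2 * k) + 2 * (B + M * e) * (2 * l) + 2 * N * (exp (- b) / m\<^sup>2)"
  unfolding reg_ker_def
 proof (rule norm_bilinear_diff_le)
  show "norm (deriv v1 \<alpha> - deriv v1 \<eta> - (deriv v2 \<alpha> - deriv v2 \<eta>)) \<le> D + N * e"
   by (rule dd2) (use d in \<open>simp_all add: D_def\<close>)
  show "norm (deriv v1 \<alpha> - deriv (conj_refl v1) \<eta> - (deriv v2 \<alpha> - deriv (conj_refl v2) \<eta>)) \<le> D + N * e"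
   by (rule dd2) (use d in \<open>simp_all add: D_def\<close>)
  show "norm (deriv v2 \<alpha> - deriv v2 \<eta>) \<le> B + M * e"
   using norm_triangle_ineq4[of "deriv v2 \<alpha>" "deriv v2 \<eta>"] d2 unfolding B_def by linarith
  show "norm (deriv v2 \<alpha> - deriv (conj_refl v2) \<eta>) \<le> B + M * e"
   using norm_triangle_ineq4[of "deriv v2 \<alpha>" "deriv (conj_refl v2) \<eta>"] d2 unfolding B_def by linarith
  show "norm (v1 \<eta> + conj_refl v1 \<eta> - (v2 \<eta> + conj_refl v2 \<eta>)) \<le> 2 * N"
  proof -
   have "v1 \<eta> + conj_refl v1 \<eta> - (v2 \<eta> + conj_refl v2 \<eta>) = (v1 \<eta> - v2 \<eta>) + (conj_refl v1 \<eta> - conj_refl v2 \<eta>)" by simp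
   then show ?thesis using N norm_triangle_ineq[of "v1 \<eta> - v2 \<eta>" "conj_refl v1 \<eta> - conj_refl v2 \<eta>"] by (smt (verit))
  qed
  show "norm (inverse ((cosh ((\<alpha> - \<eta>)/2))\<^sup>2)) \<le> exp (- b) / m\<^sup>2" by (rule C)
 qed (use norm_triangle_mono[OF K1 K2] norm_triangle_mono[OF K3 K4] in \<open>simp_all only: mult_2\<close>,
    (simp only: flip: mult_2; rule sum2[OF L1 L2] sum2[OF L3 L4])+)
 also have "\<dots> = exp (-b) / m\<^sup>2 * ((D + N * e) * (4 * ((M + pi) * exp (M + pi))) + (B + M * e) * N * (4 * exp N) + 2 * N)"
  by (simp add: k_def l_def algebra_simps add_divide_distrib)
 also have "\<dots> \<le> exp (-b) / m\<^sup>2 * (((1 + e) * (4 * ((M + pi) * exp (M + pi)) * (1 + e) + 4 * exp (2 * M) * (1 + M * e) + 2)) * (D + (1 + B) * N))"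
 proof (intro mult_left_mono)
  define P where "P = 4 * ((M + pi) * exp (M + pi))"
  define Q where "Q = 4 * exp (2 * M)"
  have P0: "0 \<le> P" and Q0: "0 \<le> Q" using M by (auto simp: P_def Q_def)
  have EN: "4 * exp N \<le> Q" using N by (simp add: Q_def)
  let ?R = "D + (1 + B) * N"
  have R0: "0 \<le> ?R" using D0 B0 N0 by simp
  have a1: "D + N * e \<le> (1 + e) * ?R"
   using mult_nonneg_nonneg[OF D0 e] mult_nonneg_nonneg[OF B0 N0] mult_nonneg_nonneg[OF e mult_nonneg_nonneg[OF B0 N0]] N0
   by (simp add: algebra_simps)
  have 1: "(D + N * e) * P \<le> ((1 + e) * P) * ?R"
   using mult_right_mono[OF a1 P0] by (simp add: algebra_simps)
  have a2: "(B + M * e) * N \<le> (1 + M * e) * ?R"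
   using mult_nonneg_nonneg[OF mult_nonneg_nonneg[OF M e] D0] mult_nonneg_nonneg[OF B0 N0]
    mult_nonneg_nonneg[OF mult_nonneg_nonneg[OF M e] mult_nonneg_nonneg[OF B0 N0]] N0 D0
   by (simp add: algebra_simps)
  have 2: "(B + M * e) * N * (4 * exp N) \<le> ((1 + M * e) * ?R) * Q"
   by (rule mult_mono[OF a2 EN]) (use N0 M e B0 R0 in auto)
  have 3: "2 * N \<le> 2 * ?R" using D0 mult_nonneg_nonneg[OF B0 N0] by (simp add: algebra_simps)
  have "(D + N * e) * P + (B + M * e) * N * (4 * exp N) + 2 * N \<le> ((1 + e) * P + Q * (1 + M * e) + 2) * ?R"
   using 1 2 3 by (simp add: algebra_simps)
  also have "\<dots> \<le> ((1 + e) * (P * (1 + e) + Q * (1 + M * e) + 2)) * ?R"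
  proof (rule mult_right_mono[OF _ R0])
   have "0 \<le> Q * (1 + M * e) * e" "0 \<le> 2 * e" "0 \<le> (1 + e) * P * e" using P0 Q0 M e by auto
   then show "(1 + e) * P + Q * (1 + M * e) + 2 \<le> (1 + e) * (P * (1 + e) + Q * (1 + M * e) + 2)"
    by (simp add: algebra_simps)
  qed
  finally show "(D + N * e) * (4 * ((M + pi) * exp (M + pi))) + (B + M * e) * N * (4 * exp N) + 2 * N
   \<le> ((1 + e) * (4 * ((M + pi) * exp (M + pi)) * (1 + e) + 4 * exp (2 * M) * (1 + M * e) + 2)) * ?R"
   by (simp add: P_def Q_def)
 qed simp
 finally show ?thesis by (simp add: reg_ker_lip_def D_def B_def b_def mult_ac)
qed

section \<open>The velocity operator\<close>

text \<open>The qualitative form of \<open>cosh_bds\<close>, enough for holomorphy.\<close>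

definition cosh_nz :: "(complex \<Rightarrow> complex) \<Rightarrow> complex \<Rightarrow> complex \<Rightarrow> bool" where
 "cosh_nz v \<alpha> \<eta> \<longleftrightarrow>
   (\<forall>X\<in>{pt v \<alpha> - pt v \<eta> + \<i> * of_real pi, pt (conj_refl v) \<alpha> - pt (conj_refl v) \<eta> + \<i> * of_real pi,
     pt v \<alpha> - pt (conj_refl v) \<eta>, pt (conj_refl v) \<alpha> - pt v \<eta>, \<alpha> - \<eta>}. cosh (X / 2) \<noteq> 0)"

lemma cosh_bds_imp_nz:
 assumes "cosh_bds m v \<alpha> \<eta>" "0 < m" shows "cosh_nz v \<alpha> \<eta>"
 unfolding cosh_nz_def
proof
 fix X assume "X \<in> {pt v \<alpha> - pt v \<eta> + \<i> * of_real pi, pt (conj_refl v) \<alpha> - pt (conj_refl v) \<eta> + \<i> * of_real pi,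
     pt v \<alpha> - pt (conj_refl v) \<eta>, pt (conj_refl v) \<alpha> - pt v \<eta>, \<alpha> - \<eta>}"
 then have "m * exp (\<bar>Re (\<alpha> - \<eta>)\<bar> / 2) \<le> norm (cosh (X / 2))"
  using assms(1) unfolding cosh_bds_def by blast
 moreover have "0 < m * exp (\<bar>Re (\<alpha> - \<eta>)\<bar> / 2)" using assms(2) by simp
 ultimately show "cosh (X / 2) \<noteq> 0" by (metis norm_zero not_le)
qed

lemma holomorphic_on_cosh: "f holomorphic_on W \<Longrightarrow> (\<lambda>w. cosh (f w)) holomorphic_on W"
 unfolding cosh_field_def by (intro holomorphic_intros) auto

lemma holomorphic_on_sinh: "f holomorphic_on W \<Longrightarrow> (\<lambda>w. sinh (f w)) holomorphic_on W"
 unfolding sinh_field_def by (intro holomorphic_intros) auto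

lemma holomorphic_on_tanh:
 "f holomorphic_on W \<Longrightarrow> (\<And>w. w \<in> W \<Longrightarrow> cosh (f w) \<noteq> 0) \<Longrightarrow> (\<lambda>w. tanh (f w)) holomorphic_on W"
 unfolding tanh_def by (intro holomorphic_on_divide holomorphic_on_cosh holomorphic_on_sinh)

lemma reg_ker_holomorphic:
 assumes v: "v holomorphic_on strip s"
  and f: "f holomorphic_on W" "f ` W \<subseteq> strip s" and g: "g holomorphic_on W" "g ` W \<subseteq> strip s"
  and nz: "\<And>w. w \<in> W \<Longrightarrow> cosh_nz v (f w) (g w)"
 shows "(\<lambda>w. reg_ker v (f w) (g w)) holomorphic_on W"
proof -
 note r = conj_refl_holomorphic[OF v]
 note dv = holomorphic_deriv[OF v open_complex_strip]
 note dr = holomorphic_deriv[OF r open_complex_strip]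
 note c = holomorphic_on_compose_gen[unfolded o_def]
 note nz' = nz[unfolded cosh_nz_def ball_simps]
 show ?thesis unfolding reg_ker_def pt_def
  by (intro holomorphic_intros holomorphic_on_tanh holomorphic_on_cosh
    c[OF f(1) v f(2)] c[OF f(1) r f(2)] c[OF g(1) v g(2)] c[OF g(1) r g(2)]
    c[OF f(1) dv f(2)] c[OF f(1) dr f(2)] c[OF g(1) dv g(2)] c[OF g(1) dr g(2)] f(1) g(1))
   (use nz' in \<open>auto simp: pt_def\<close>)
qed

lemma stateD:
 assumes "state s \<rho> M \<theta> \<mu> v"
 shows "0 < \<rho>" "4 * \<rho> \<le> s" "\<rho> \<le> 1/4" "0 \<le> M" "0 < \<theta>" "0 < \<mu>" "v holomorphic_on strip s"
  "\<And>w. w \<in> strip s \<Longrightarrow> norm (v w) \<le> M"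
  "\<And>w. w \<in> strip s \<Longrightarrow> norm (conj_refl v w) \<le> M"
  "\<And>\<alpha> \<eta>. \<alpha> \<in> strip s \<Longrightarrow> \<eta> \<in> strip s \<Longrightarrow> \<rho> \<le> norm (\<alpha> - \<eta>) \<Longrightarrow> \<mu> \<le> norm (pt v \<alpha> - pt v \<eta>)"
  "\<And>\<alpha> \<eta>. \<alpha> \<in> strip (2 * \<rho>) \<Longrightarrow> \<eta> \<in> strip (2 * \<rho>) \<Longrightarrow> \<mu> * norm (\<alpha> - \<eta>) \<le> norm (pt v \<alpha> - pt v \<eta>)"
  "0 < cosh_low M \<theta> \<mu>"
 using assms cosh_low_pos[OF _ state_theta[OF assms]] by (auto simp: state_def conj_refl_def)

text \<open>The contour through \<open>\<alpha> - \<i> \<sigma>\<close> stays in the strip, at distance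
  \<open>\<rho>\<close> from its boundary and from \<open>\<alpha>\<close>.\<close>

definition shift_ok :: "real \<Rightarrow> real \<Rightarrow> real \<Rightarrow> complex \<Rightarrow> bool" where
 "shift_ok s \<rho> \<sigma> \<alpha> \<longleftrightarrow> \<alpha> \<in> strip s \<and> (\<sigma> = \<rho> \<and> - \<rho> < Im \<alpha> \<or> \<sigma> = - \<rho> \<and> Im \<alpha> < \<rho>)"

lemma state_far_cosh_bds:
 assumes st: "state s \<rho> M \<theta> \<mu> v" and a: "\<alpha> \<in> strip s" and e: "\<eta> \<in> strip s"
  and far: "\<rho> \<le> norm (\<alpha> - \<eta>)" and im: "\<bar>Im (\<alpha> - \<eta>)\<bar> \<le> 1"
 shows "cosh_bds (cosh_low M \<theta> \<mu>) v \<alpha> \<eta>"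
proof (rule state_cosh_bds[OF st a e _ _ im])
 show "\<mu> \<le> norm (pt v \<alpha> - pt v \<eta>)" using stateD(10)[OF st a e far] .
 have "norm (cnj \<alpha> - cnj \<eta>) = norm (\<alpha> - \<eta>)" by (metis complex_cnj_diff complex_mod_cnj)
 then show "\<mu> \<le> norm (pt v (cnj \<alpha>) - pt v (cnj \<eta>))" using far a e by (intro stateD(10)[OF st]) auto
qed

lemma shift_ok_strip: "shift_ok s \<rho> \<sigma> \<alpha> \<Longrightarrow> \<alpha> \<in> strip s"
 by (simp add: shift_ok_def)

lemma shift_props:
 assumes st: "state s \<rho> M \<theta> \<mu> v" and ok: "shift_ok s \<rho> \<sigma> \<alpha>"
 defines "\<eta> \<equiv> (\<lambda>\<beta>. \<alpha> - complex_of_real \<beta> - \<i> * complex_of_real \<sigma>)"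
 shows "\<eta> \<beta> \<in> strip s" "\<bar>Im (\<eta> \<beta>)\<bar> + \<rho> \<le> s" "cosh_bds (cosh_low M \<theta> \<mu>) v \<alpha> (\<eta> \<beta>)" "Re (\<alpha> - \<eta> \<beta>) = \<beta>"
proof -
 note r = stateD(1-3)[OF st]
 have a: "\<alpha> \<in> strip s" using ok by (simp add: shift_ok_def)
 show 2: "\<bar>Im (\<eta> \<beta>)\<bar> + \<rho> \<le> s" using ok r by (auto simp: shift_ok_def \<eta>_def)
 then show 1: "\<eta> \<beta> \<in> strip s" using r by simp
 have im: "\<bar>Im (\<alpha> - \<eta> \<beta>)\<bar> = \<rho>" using ok r by (auto simp: shift_ok_def \<eta>_def)
 then have "\<rho> \<le> norm (\<alpha> - \<eta> \<beta>)" using abs_Im_le_cmod[of "\<alpha> - \<eta> \<beta>"] by simp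
 then show "cosh_bds (cosh_low M \<theta> \<mu>) v \<alpha> (\<eta> \<beta>)" using state_far_cosh_bds[OF st a 1] im r by simp
 show "Re (\<alpha> - \<eta> \<beta>) = \<beta>" by (simp add: \<eta>_def)
qed

lemma norm_deriv_conj_refl_le:
 assumes "v holomorphic_on strip s" "\<And>w. w \<in> strip s \<Longrightarrow> norm (v w) \<le> M" "\<bar>Im z\<bar> + r \<le> s" "0 < r"
 shows "norm (deriv (conj_refl v) z) \<le> M / r"
 by (rule norm_deriv_le_strip[OF conj_refl_holomorphic[OF assms(1)] _ assms(3,4)])
   (use assms(2) in \<open>auto simp: conj_refl_def\<close>)

lemma shift_bound:
 assumes st: "state s \<rho> M \<theta> \<mu> v" and ok: "shift_ok s \<rho> \<sigma> \<alpha>"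
 shows "norm (reg_ker v \<alpha> (\<alpha> - of_real \<beta> - \<i> * of_real \<sigma>)) \<le>
   reg_ker_const M (cosh_low M \<theta> \<mu>) * (norm (deriv v \<alpha>) + 2 * M / \<rho> + 2 * M) * exp (- \<bar>\<beta>\<bar>)"
proof -
 note sp = shift_props[OF st ok, of \<beta>]
 note sd = stateD[OF st]
 let ?\<eta> = "\<alpha> - complex_of_real \<beta> - \<i> * complex_of_real \<sigma>"
 have d: "norm (deriv v ?\<eta>) \<le> M / \<rho>" "norm (deriv (conj_refl v) ?\<eta>) \<le> M / \<rho>"
  using norm_deriv_le_strip[OF sd(7,8) sp(2) sd(1)] norm_deriv_conj_refl_le[OF sd(7,8) sp(2) sd(1)] by auto
 have "norm (reg_ker v \<alpha> ?\<eta>) \<le> reg_ker_const M (cosh_low M \<theta> \<mu>) * exp (- \<bar>Re (\<alpha> - ?\<eta>)\<bar>) *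
   (norm (deriv v \<alpha>) + norm (deriv v ?\<eta>) + norm (deriv (conj_refl v) ?\<eta>) + norm (v ?\<eta>) + norm (conj_refl v ?\<eta>))"
  by (rule norm_reg_ker_le[OF sp(3) sd(12) sd(8)[OF shift_ok_strip[OF ok]] sd(8)[OF sp(1)] sd(9)[OF shift_ok_strip[OF ok]] sd(9)[OF sp(1)]])
 also have "\<dots> \<le> reg_ker_const M (cosh_low M \<theta> \<mu>) * exp (- \<bar>Re (\<alpha> - ?\<eta>)\<bar>) * (norm (deriv v \<alpha>) + M/\<rho> + M/\<rho> + M + M)"
  by (intro mult_left_mono add_mono d order_refl sd(8)[OF sp(1)] sd(9)[OF sp(1)] mult_nonneg_nonneg)
    (use sd(4) in \<open>auto simp: reg_ker_const_def\<close>)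
 finally show ?thesis unfolding sp(4) by (simp add: algebra_simps)
qed

lemma shift_measurable:
 assumes st: "state s \<rho> M \<theta> \<mu> v" and ok: "shift_ok s \<rho> \<sigma> \<alpha>"
 shows "(\<lambda>\<beta>. reg_ker v \<alpha> (\<alpha> - of_real \<beta> - \<i> * of_real \<sigma>)) \<in> borel_measurable lborel"
proof -
 define W where "W = range (\<lambda>\<beta>. \<alpha> - complex_of_real \<beta> - \<i> * complex_of_real \<sigma>)"
 have "(\<lambda>w. reg_ker v \<alpha> w) holomorphic_on W"
 proof (rule reg_ker_holomorphic[OF stateD(7)[OF st]])
  show "(\<lambda>w. w) ` W \<subseteq> strip s" using shift_props(1)[OF st ok] by (auto simp: W_def)
  show "(\<lambda>w. \<alpha>) ` W \<subseteq> strip s" using shift_ok_strip[OF ok] by auto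
  show "cosh_nz v \<alpha> w" if "w \<in> W" for w
   using that cosh_bds_imp_nz[OF shift_props(3)[OF st ok] stateD(12)[OF st]] unfolding W_def by blast
 qed (intro holomorphic_intros)+
 then have "continuous_on W (reg_ker v \<alpha>)" by (rule holomorphic_on_imp_continuous_on)
 then have "continuous_on UNIV (\<lambda>\<beta>. reg_ker v \<alpha> (\<alpha> - complex_of_real \<beta> - \<i> * complex_of_real \<sigma>))"
 proof (rule continuous_on_compose2)
  show "continuous_on UNIV (\<lambda>\<beta>. \<alpha> - complex_of_real \<beta> - \<i> * complex_of_real \<sigma>)"
   by (intro continuous_intros)
 qed (simp add: W_def)
 then show ?thesis unfolding measurable_lborel2 by (rule borel_measurable_continuous_onI)
qed

lemma shift_integrable:
 assumes st: "state s \<rho> M \<theta> \<mu> v" and ok: "shift_ok s \<rho> \<sigma> \<alpha>"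
 shows "integrable lborel (\<lambda>\<beta>. reg_ker v \<alpha> (\<alpha> - of_real \<beta> - \<i> * of_real \<sigma>))"
proof (rule Bochner_Integration.integrable_bound)
 show "integrable lborel (\<lambda>\<beta>. reg_ker_const M (cosh_low M \<theta> \<mu>) * (norm (deriv v \<alpha>) + 2 * M / \<rho> + 2 * M) * exp (- \<bar>\<beta>\<bar>))"
  using integrable_exp_neg_abs by simp
 show "AE \<beta> in lborel. norm (reg_ker v \<alpha> (\<alpha> - of_real \<beta> - \<i> * of_real \<sigma>)) \<le> norm (reg_ker_const M (cosh_low M \<theta> \<mu>) * (norm (deriv v \<alpha>) + 2 * M / \<rho> + 2 * M) * exp (- \<bar>\<beta>\<bar>))"
  using shift_bound[OF st ok] by (intro AE_I2) (metis abs_ge_self order_trans real_norm_def)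
qed (rule shift_measurable[OF st ok])

definition shifted :: "(complex \<Rightarrow> complex) \<Rightarrow> real \<Rightarrow> complex \<Rightarrow> complex" where
 "shifted v \<sigma> \<alpha> = (LBINT \<beta>. reg_ker v \<alpha> (\<alpha> - of_real \<beta> - \<i> * of_real \<sigma>))"

text \<open>Up to a constant, the right-hand side of the equation as a function of complex
  \<open>\<alpha>\<close>. The contour is moved towards the far side of the strip, so that it never
 meets \<open>\<alpha>\<close> and Cauchy's inequality is available along it. The two choices agree
 near the real axis (\<open>shifted_eq_unshifted\<close>), so the jump at \<open>Im \<alpha> =
 0\<close> is only apparent.\<close>

definition velocity :: "real \<Rightarrow> (complex \<Rightarrow> complex) \<Rightarrow> complex \<Rightarrow> complex" where
 "velocity \<rho> v \<alpha> = shifted v (if 0 \<le> Im \<alpha> then \<rho> else - \<rho>) \<alpha>"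

lemma velocity_shift_ok: "\<alpha> \<in> strip s \<Longrightarrow> 0 < \<rho> \<Longrightarrow> shift_ok s \<rho> (if 0 \<le> Im \<alpha> then \<rho> else - \<rho>) \<alpha>"
 by (auto simp: shift_ok_def)

definition velocity_lip :: "real \<Rightarrow> real \<Rightarrow> real \<Rightarrow> real \<Rightarrow> real" where
 "velocity_lip \<rho> M \<theta> \<mu> = reg_ker_lip M (cosh_low M \<theta> \<mu>) (1/\<rho>) * (LBINT \<beta>. exp (- \<bar>\<beta>\<bar>))"

lemma velocity_lip_nonneg: "0 \<le> M \<Longrightarrow> 0 < \<rho> \<Longrightarrow> 0 \<le> velocity_lip \<rho> M \<theta> \<mu>"
 unfolding velocity_lip_def reg_ker_lip_def by (intro mult_nonneg_nonneg divide_nonneg_nonneg add_nonneg_nonneg integral_nonneg_AE) auto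

text \<open>The velocity loses a derivative only through \<open>v'(\<alpha>)\<close>: this pointwise
 form of the loss is the hypothesis of the abstract existence theorem below.\<close>

lemma velocity_lipschitz:
 assumes s1: "state s \<rho> M \<theta> \<mu> v1" and s2: "state s \<rho> M \<theta> \<mu> v2"
  and N: "\<And>w. w \<in> strip s \<Longrightarrow> norm (v1 w - v2 w) \<le> N" and a: "\<alpha> \<in> strip s"
 shows "norm (velocity \<rho> v1 \<alpha> - velocity \<rho> v2 \<alpha>) \<le> velocity_lip \<rho> M \<theta> \<mu> * (norm (deriv v1 \<alpha> - deriv v2 \<alpha>) + (1 + norm (deriv v2 \<alpha>)) * N)"
proof -
 note d1 = stateD[OF s1] and d2 = stateD[OF s2]
 define N' where "N' = min N (2 * M)"
 have N': "norm (v1 w - v2 w) \<le> N'" if "w \<in> strip s" for w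
  using N[OF that] norm_triangle_ineq4[of "v1 w" "v2 w"] d1(8)[OF that] d2(8)[OF that] by (simp add: N'_def)
 define \<sigma> where "\<sigma> = (if 0 \<le> Im \<alpha> then \<rho> else - \<rho>)"
 have ok: "shift_ok s \<rho> \<sigma> \<alpha>" using velocity_shift_ok[OF a d1(1)] by (simp add: \<sigma>_def)
 define m where "m = cosh_low M \<theta> \<mu>"
 let ?R = "norm (deriv v1 \<alpha> - deriv v2 \<alpha>) + (1 + norm (deriv v2 \<alpha>)) * N'"
 have bd: "norm (reg_ker v1 \<alpha> (\<alpha> - of_real \<beta> - \<i> * of_real \<sigma>) - reg_ker v2 \<alpha> (\<alpha> - of_real \<beta> - \<i> * of_real \<sigma>)) \<le> reg_ker_lip M m (1/\<rho>) * ?R * exp (- \<bar>\<beta>\<bar>)" for \<beta>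
 proof -
  note p1 = shift_props[OF s1 ok, of \<beta>] and p2 = shift_props[OF s2 ok, of \<beta>]
  let ?\<eta> = "\<alpha> - complex_of_real \<beta> - \<i> * complex_of_real \<sigma>"
  have hd: "(\<lambda>w. v1 w - v2 w) holomorphic_on strip s" using d1(7) d2(7) by (rule holomorphic_on_diff)
  have hr: "(\<lambda>w. conj_refl v1 w - conj_refl v2 w) holomorphic_on strip s"
   using conj_refl_holomorphic d1(7) d2(7) by (intro holomorphic_on_diff) auto
  have D: "norm (deriv v1 ?\<eta> - deriv v2 ?\<eta>) \<le> N' * (1/\<rho>)"
  proof -
   have "deriv (\<lambda>w. v1 w - v2 w) ?\<eta> = deriv v1 ?\<eta> - deriv v2 ?\<eta>"
    using d1(7) d2(7) p1(1) by (intro deriv_diff) (auto intro: holomorphic_on_imp_differentiable_at)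
   then show ?thesis using norm_deriv_le_strip[OF hd N' p1(2) d1(1)] by simp
  qed
  have DR: "norm (deriv (conj_refl v1) ?\<eta> - deriv (conj_refl v2) ?\<eta>) \<le> N' * (1/\<rho>)"
  proof -
   have "deriv (\<lambda>w. conj_refl v1 w - conj_refl v2 w) ?\<eta> = deriv (conj_refl v1) ?\<eta> - deriv (conj_refl v2) ?\<eta>"
    using conj_refl_holomorphic[OF d1(7)] conj_refl_holomorphic[OF d2(7)] p1(1)
    by (intro deriv_diff) (auto intro: holomorphic_on_imp_differentiable_at)
   then show ?thesis using norm_deriv_le_strip[OF hr norm_conj_refl_diff_le[of s v1 v2 N', OF N'] p1(2) d1(1)] by simp
  qed
  have "norm (reg_ker v1 \<alpha> ?\<eta> - reg_ker v2 \<alpha> ?\<eta>) \<le> reg_ker_lip M m (1/\<rho>) * exp (- \<bar>Re (\<alpha> - ?\<eta>)\<bar>) * ?R"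
  proof (rule norm_reg_ker_diff_le)
   show "cosh_bds m v1 \<alpha> ?\<eta>" "cosh_bds m v2 \<alpha> ?\<eta>" using p1(3) p2(3) by (simp_all add: m_def)
   show "norm (deriv v2 ?\<eta>) \<le> M * (1/\<rho>)" "norm (deriv (conj_refl v2) ?\<eta>) \<le> M * (1/\<rho>)"
    using norm_deriv_le_strip[OF d2(7,8) p1(2) d1(1)] norm_deriv_conj_refl_le[OF d2(7,8) p1(2) d1(1)] by auto
   show "norm (conj_refl v1 \<alpha> - conj_refl v2 \<alpha>) \<le> N'" "norm (conj_refl v1 ?\<eta> - conj_refl v2 ?\<eta>) \<le> N'"
    by (rule norm_conj_refl_diff_le[of s v1 v2 N'], erule N', rule a p1(1))+
  qed (use d1 d2 p1(1) a N' D DR in \<open>auto simp: m_def N'_def\<close>)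
  then show ?thesis unfolding p1(4) by (simp add: algebra_simps)
 qed
 have "norm (velocity \<rho> v1 \<alpha> - velocity \<rho> v2 \<alpha>) = norm (LBINT \<beta>. reg_ker v1 \<alpha> (\<alpha> - of_real \<beta> - \<i> * of_real \<sigma>) - reg_ker v2 \<alpha> (\<alpha> - of_real \<beta> - \<i> * of_real \<sigma>))"
  unfolding velocity_def shifted_def \<sigma>_def[symmetric]
  by (subst Bochner_Integration.integral_diff[OF shift_integrable[OF s1 ok] shift_integrable[OF s2 ok]]) simp
 also have "\<dots> \<le> (LBINT \<beta>. reg_ker_lip M m (1/\<rho>) * ?R * exp (- \<bar>\<beta>\<bar>))"
  by (rule Bochner_Integration.integral_norm_bound_integral)
    (use bd integrable_exp_neg_abs shift_integrable[OF s1 ok] shift_integrable[OF s2 ok] in auto)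
 also have "\<dots> = velocity_lip \<rho> M \<theta> \<mu> * ?R" by (simp add: velocity_lip_def m_def)
 also have "\<dots> \<le> velocity_lip \<rho> M \<theta> \<mu> * (norm (deriv v1 \<alpha> - deriv v2 \<alpha>) + (1 + norm (deriv v2 \<alpha>)) * N)"
  using velocity_lip_nonneg[OF d1(4,1)] by (intro mult_left_mono add_left_mono) (auto simp: N'_def)
 finally show ?thesis .
qed

lemma shifted_holomorphic:
 assumes st: "state s \<rho> M \<theta> \<mu> v"
 shows "shifted v \<sigma> holomorphic_on {\<alpha>. shift_ok s \<rho> \<sigma> \<alpha>}"
proof -
 note sd = stateD[OF st]
 define W where "W = {\<alpha>. shift_ok s \<rho> \<sigma> \<alpha>}"
 have W: "W = strip s \<inter> {\<alpha>. (\<sigma> = \<rho> \<and> - \<rho> < Im \<alpha>) \<or> (\<sigma> = - \<rho> \<and> Im \<alpha> < \<rho>)}"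
  by (auto simp: W_def shift_ok_def)
 have "open {\<alpha>. (\<sigma> = \<rho> \<and> - \<rho> < Im \<alpha>) \<or> (\<sigma> = - \<rho> \<and> Im \<alpha> < \<rho>)}"
  by (intro open_Collect_disj open_Collect_conj open_Collect_const open_halfspace_Im_gt open_halfspace_Im_lt)
 then have oW: "open W" unfolding W by (intro open_Int) auto
 have "\<exists>D. (shifted v \<sigma> has_field_derivative D) (at z)" if z: "z \<in> W" for z
 proof -
  obtain e where e: "0 < e" "cball z e \<subseteq> W" using oW z open_contains_cball by blast
  define U where "U = ball z e"
  have UW: "U \<subseteq> W" using e by (auto simp: U_def)
  have "\<exists>B. \<forall>w\<in>cball z e. norm (deriv v w) \<le> B"
  proof -
   have "continuous_on (cball z e) (deriv v)"
    using holomorphic_on_imp_continuous_on[OF holomorphic_deriv[OF sd(7) open_complex_strip]] e W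
    by (auto intro: continuous_on_subset)
   then show ?thesis using compact_continuous_image[of "cball z e" "deriv v"] compact_imp_bounded
    by (force simp: bounded_iff)
  qed
  then obtain B where B: "\<And>w. w \<in> cball z e \<Longrightarrow> norm (deriv v w) \<le> B" by blast
  show ?thesis unfolding shifted_def
  proof (rule exI, rule has_field_derivative_integral(1))
   show "open U" "z \<in> U" using e by (auto simp: U_def)
   show "(\<lambda>w. reg_ker v w (w - complex_of_real x - \<i> * complex_of_real \<sigma>)) holomorphic_on U" for x
   proof (rule reg_ker_holomorphic[OF sd(7)])
    show "(\<lambda>w. w - complex_of_real x - \<i> * complex_of_real \<sigma>) holomorphic_on U" "(\<lambda>w. w) holomorphic_on U"
     by (intro holomorphic_intros)+
    show "(\<lambda>w. w) ` U \<subseteq> strip s" using UW W by auto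
    show "(\<lambda>w. w - complex_of_real x - \<i> * complex_of_real \<sigma>) ` U \<subseteq> strip s"
    proof
     fix y assume "y \<in> (\<lambda>w. w - complex_of_real x - \<i> * complex_of_real \<sigma>) ` U"
     then obtain w where w: "w \<in> U" "y = w - complex_of_real x - \<i> * complex_of_real \<sigma>" by blast
     then have "shift_ok s \<rho> \<sigma> w" using UW by (auto simp: W_def)
     then show "y \<in> strip s" using shift_props(1)[OF st] w by blast
    qed
    show "cosh_nz v w (w - complex_of_real x - \<i> * complex_of_real \<sigma>)" if "w \<in> U" for w
     using that UW by (intro cosh_bds_imp_nz[OF shift_props(3)[OF st] sd(12)]) (auto simp: W_def)
   qed
   show "(\<lambda>\<beta>. reg_ker v w (w - complex_of_real \<beta> - \<i> * complex_of_real \<sigma>)) \<in> borel_measurable lborel" if "w \<in> U" for w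
    using that UW by (intro shift_measurable[OF st]) (auto simp: W_def)
   show "integrable lborel (\<lambda>\<beta>. reg_ker_const M (cosh_low M \<theta> \<mu>) * (B + 2 * M / \<rho> + 2 * M) * exp (- \<bar>\<beta>\<bar>))"
    using integrable_exp_neg_abs by simp
   show "norm (reg_ker v w (w - complex_of_real \<beta> - \<i> * complex_of_real \<sigma>)) \<le> reg_ker_const M (cosh_low M \<theta> \<mu>) * (B + 2 * M / \<rho> + 2 * M) * exp (- \<bar>\<beta>\<bar>)"
    if "w \<in> U" for w \<beta>
   proof (rule order_trans[OF shift_bound[OF st]])
    show "shift_ok s \<rho> \<sigma> w" using that UW by (auto simp: W_def)
    show "reg_ker_const M (cosh_low M \<theta> \<mu>) * (norm (deriv v w) + 2 * M / \<rho> + 2 * M) * exp (- \<bar>\<beta>\<bar>)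
      \<le> reg_ker_const M (cosh_low M \<theta> \<mu>) * (B + 2 * M / \<rho> + 2 * M) * exp (- \<bar>\<beta>\<bar>)"
     using B[of w] that sd(4) by (intro mult_right_mono mult_left_mono add_mono) (auto simp: U_def reg_ker_const_def)
   qed
  qed
 qed
 then show ?thesis unfolding W_def[symmetric] using holomorphic_on_open[OF oW] by blast
qed

section \<open>The diagonal singularity and contour independence\<close>

lemma borel_measurable_line:
 fixes h :: "complex \<Rightarrow> complex"
 assumes "continuous_on S h" "\<And>x. complex_of_real x + c \<in> S"
 shows "(\<lambda>x. h (of_real x + c)) \<in> borel_measurable borel"
proof -
 have "continuous_on UNIV (\<lambda>x. h (of_real x + c))"
 proof (rule continuous_on_compose2[OF assms(1)])
  show "continuous_on UNIV (\<lambda>x. complex_of_real x + c)" by (intro continuous_intros)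
 qed (use assms(2) in auto)
 then show ?thesis by (rule borel_measurable_continuous_onI)
qed

lemma state_mono_mu:
 assumes "state s \<rho> M \<theta> \<mu> v" "0 < \<mu>'" "\<mu>' \<le> \<mu>" shows "state s \<rho> M \<theta> \<mu>' v"
proof -
 have "\<mu>' * norm (\<alpha> - \<eta>) \<le> norm (pt v \<alpha> - pt v \<eta>)" if "\<alpha> \<in> strip (2 * \<rho>)" "\<eta> \<in> strip (2 * \<rho>)" for \<alpha> \<eta>
  using stateD(11)[OF assms(1) that] mult_right_mono[OF assms(3), of "norm (\<alpha> - \<eta>)"] by simp
 moreover have "\<mu>' \<le> norm (pt v \<alpha> - pt v \<eta>)" if "\<alpha> \<in> strip s" "\<eta> \<in> strip s" "\<rho> \<le> norm (\<alpha> - \<eta>)" for \<alpha> \<eta>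
  using stateD(10)[OF assms(1) that] assms(3) by simp
 ultimately show ?thesis using assms unfolding state_def by blast
qed

lemma inner_subset: "state s \<rho> M \<theta> \<mu> v \<Longrightarrow> strip (2 * \<rho>) \<subseteq> strip s"
 using stateD(1,2)[of s \<rho> M \<theta> \<mu> v] by auto

lemma inner_cosh_nz:
 assumes st: "state s \<rho> M \<theta> \<mu> v" and a: "\<alpha> \<in> strip (2 * \<rho>)" and e: "\<eta> \<in> strip (2 * \<rho>)"
  and ne: "\<alpha> \<noteq> \<eta>"
 shows "cosh_nz v \<alpha> \<eta>"
proof -
 note sd = stateD[OF st]
 define \<mu>' where "\<mu>' = min \<mu> (\<mu> * norm (\<alpha> - \<eta>))"
 have mu': "0 < \<mu>'" "\<mu>' \<le> \<mu>" "\<mu>' \<le> \<mu> * norm (\<alpha> - \<eta>)" using sd(6) ne by (auto simp: \<mu>'_def)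
 have st': "state s \<rho> M \<theta> \<mu>' v" by (rule state_mono_mu[OF st mu'(1,2)])
 have n: "norm (cnj \<alpha> - cnj \<eta>) = norm (\<alpha> - \<eta>)" by (metis complex_cnj_diff complex_mod_cnj)
 have "cosh_bds (cosh_low M \<theta> \<mu>') v \<alpha> \<eta>"
 proof (rule state_cosh_bds[OF st'])
  show "\<mu>' \<le> norm (pt v \<alpha> - pt v \<eta>)" using sd(11)[OF a e] mu' by simp
  show "\<mu>' \<le> norm (pt v (cnj \<alpha>) - pt v (cnj \<eta>))" using sd(11)[of "cnj \<alpha>" "cnj \<eta>"] a e mu' n by simp
  show "\<alpha> \<in> strip s" "\<eta> \<in> strip s" using inner_subset[OF st] a e by auto
  show "\<bar>Im (\<alpha> - \<eta>)\<bar> \<le> 1" using a e sd(3) by (simp only: in_complex_strip minus_complex.sel)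
 qed
 then show ?thesis using stateD(12)[OF st'] by (rule cosh_bds_imp_nz)
qed

lemma state_conj_refl:
 assumes st: "state s \<rho> M \<theta> \<mu> v" shows "state s \<rho> M \<theta> \<mu> (conj_refl v)"
proof -
 note sd = stateD[OF st]
 have n: "norm (cnj \<alpha> - cnj \<eta>) = norm (\<alpha> - \<eta>)" for \<alpha> \<eta> by (metis complex_cnj_diff complex_mod_cnj)
 have im: "\<bar>Im (pt v w)\<bar> \<le> pi/2 - \<theta>" if "w \<in> strip s" for w using st that by (auto simp: state_def)
 have pp: "norm (pt (conj_refl v) \<alpha> - pt (conj_refl v) \<eta>) = norm (pt v (cnj \<alpha>) - pt v (cnj \<eta>))" for \<alpha> \<eta>
  by (simp add: pt_conj_refl n)
 show ?thesis unfolding state_def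
  using sd conj_refl_holomorphic[OF sd(7)] im sd(10)[of "cnj _" "cnj _"] sd(11)[of "cnj _" "cnj _"]
  by (auto simp: pp n pt_conj_refl)
qed

lemma pt_deriv:
 assumes "v holomorphic_on strip s" "\<alpha> \<in> strip s"
 shows "(pt v has_field_derivative (1 + deriv v \<alpha>)) (at \<alpha>)"
 unfolding pt_def[abs_def] using holomorphic_derivI[OF assms(1) open_complex_strip assms(2)]
 by (auto intro!: derivative_eq_intros)

lemma inner_deriv_nz:
 assumes st: "state s \<rho> M \<theta> \<mu> v" and a: "\<alpha> \<in> strip (2 * \<rho>)"
 shows "\<mu> \<le> norm (1 + deriv v \<alpha>)"
proof -
 note sd = stateD[OF st]
 have "((\<lambda>w. (pt v w - pt v \<alpha>) / (w - \<alpha>)) \<longlongrightarrow> 1 + deriv v \<alpha>) (at \<alpha>)"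
  using pt_deriv[OF sd(7)] inner_subset[OF st] a by (auto simp: has_field_derivative_iff)
 then have "((\<lambda>w. norm ((pt v w - pt v \<alpha>) / (w - \<alpha>))) \<longlongrightarrow> norm (1 + deriv v \<alpha>)) (at \<alpha>)"
  by (rule tendsto_norm)
 moreover have "\<forall>\<^sub>F w in at \<alpha>. \<mu> \<le> norm ((pt v w - pt v \<alpha>) / (w - \<alpha>))"
 proof -
  have "\<forall>\<^sub>F w in at \<alpha>. w \<in> strip (2 * \<rho>) - {\<alpha>}"
   using a open_complex_strip by (metis eventually_at_in_open)
  then show ?thesis
  proof eventually_elim
   case (elim w)
   then show ?case using sd(11)[of w \<alpha>] a by (simp add: norm_divide le_divide_eq)
  qed
 qed
 ultimately show ?thesis by (rule tendsto_lowerbound) simp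
qed

text \<open>The simple pole of \<open>coth\<close> on the diagonal; its residue involves the tangent of
 the curve.\<close>

lemma lim_coth:
 assumes u: "(pt u has_field_derivative D) (at a)" and D: "D \<noteq> 0"
 shows "((\<lambda>w. (w - a) * tanh ((pt u a - pt u w + \<i> * of_real pi) / 2)) \<longlongrightarrow> - 2 / D) (at a)"
  and "((\<lambda>w. (w - a) * tanh ((pt u w - pt u a + \<i> * of_real pi) / 2)) \<longlongrightarrow> 2 / D) (at a)"
proof -
 have c: "(pt u \<longlongrightarrow> pt u a) (at a)" using DERIV_isCont[OF u] by (simp add: isCont_def)
 have 1: "((\<lambda>w. sinh ((pt u a - pt u w) / 2)) has_field_derivative cosh ((pt u a - pt u a)/2) * (- D / 2)) (at a)"
  using u by (auto intro!: derivative_eq_intros)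
 have q1: "((\<lambda>w. sinh ((pt u a - pt u w) / 2) / (w - a)) \<longlongrightarrow> - D / 2) (at a)"
  using 1 by (simp add: has_field_derivative_iff)
 have r1: "((\<lambda>w. cosh ((pt u a - pt u w) / 2)) \<longlongrightarrow> cosh ((pt u a - pt u a) / 2)) (at a)"
  unfolding cosh_field_def by (intro tendsto_intros c) auto
 have "((\<lambda>w. cosh ((pt u a - pt u w) / 2) / (sinh ((pt u a - pt u w) / 2) / (w - a))) \<longlongrightarrow> cosh ((pt u a - pt u a) / 2) / (- D / 2)) (at a)"
  using D by (intro tendsto_divide[OF r1 q1]) simp
 then show "((\<lambda>w. (w - a) * tanh ((pt u a - pt u w + \<i> * of_real pi) / 2)) \<longlongrightarrow> - 2 / D) (at a)"
  by (simp add: tanh_plus_half_pi divide_simps mult_ac)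
 have 2: "((\<lambda>w. sinh ((pt u w - pt u a) / 2)) has_field_derivative cosh ((pt u a - pt u a)/2) * (D / 2)) (at a)"
  using u by (auto intro!: derivative_eq_intros)
 have q2: "((\<lambda>w. sinh ((pt u w - pt u a) / 2) / (w - a)) \<longlongrightarrow> D / 2) (at a)"
  using 2 by (simp add: has_field_derivative_iff)
 have r2: "((\<lambda>w. cosh ((pt u w - pt u a) / 2)) \<longlongrightarrow> cosh ((pt u a - pt u a) / 2)) (at a)"
  unfolding cosh_field_def by (intro tendsto_intros c) auto
 have "((\<lambda>w. cosh ((pt u w - pt u a) / 2) / (sinh ((pt u w - pt u a) / 2) / (w - a))) \<longlongrightarrow> cosh ((pt u a - pt u a) / 2) / (D / 2)) (at a)"
  using D by (intro tendsto_divide[OF r2 q2]) simp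
 then show "((\<lambda>w. (w - a) * tanh ((pt u w - pt u a + \<i> * of_real pi) / 2)) \<longlongrightarrow> 2 / D) (at a)"
  by (simp add: tanh_plus_half_pi divide_simps mult_ac)
qed

lemma tanh_half_nz: "(f \<longlongrightarrow> l) F \<Longrightarrow> cosh (l/2) \<noteq> 0 \<Longrightarrow> ((\<lambda>x. tanh (f x / 2)) \<longlongrightarrow> tanh (l/2)) F" for l :: complex
 by (intro tendsto_intros) auto

lemma diag_cosh_nz:
 assumes st: "state s \<rho> M \<theta> \<mu> v" and a: "\<alpha> \<in> strip s"
 shows "cosh ((pt v \<alpha> - pt (conj_refl v) \<alpha>) / 2) \<noteq> 0" "cosh ((pt (conj_refl v) \<alpha> - pt v \<alpha>) / 2) \<noteq> 0"
proof -
 note sd = stateD[OF st]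
 have im: "\<bar>Im (pt v w)\<bar> \<le> pi/2 - \<theta>" if "w \<in> strip s" for w using st that by (auto simp: state_def)
 have imr: "\<bar>Im (pt (conj_refl v) w)\<bar> \<le> pi/2 - \<theta>" if "w \<in> strip s" for w
  using im[of "cnj w"] that by (simp add: pt_conj_refl)
 have "cosh ((P - Q) / 2) \<noteq> 0" if "\<bar>Im P\<bar> \<le> pi/2 - \<theta>" "\<bar>Im Q\<bar> \<le> pi/2 - \<theta>" for P Q
 proof -
  have "0 < cos (Im ((P-Q)/2))" using that sd(5) by (intro cos_gt_zero_pi) auto
  then have "0 < cosh (Re ((P-Q)/2)) * \<bar>cos (Im ((P-Q)/2))\<bar>" by (intro mult_pos_pos) auto
  then show ?thesis using norm_cosh_ge[of "(P-Q)/2"] by (metis norm_zero not_le)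
 qed
 then show "cosh ((pt v \<alpha> - pt (conj_refl v) \<alpha>) / 2) \<noteq> 0" "cosh ((pt (conj_refl v) \<alpha> - pt v \<alpha>) / 2) \<noteq> 0"
  using im[OF a] imr[OF a] by blast+
qed

lemma reg_ker_lim_aux:
 fixes w :: "complex \<Rightarrow> complex"
 assumes z: "(z \<longlongrightarrow> 0) F" and A: "(A \<longlongrightarrow> 0) F" and B: "(B \<longlongrightarrow> lB) F"
  and c: "((\<lambda>x. z x * c1 x) \<longlongrightarrow> l1) F" "((\<lambda>x. z x * c2 x) \<longlongrightarrow> l2) F"
  and t: "(t1 \<longlongrightarrow> m1) F" "(t2 \<longlongrightarrow> m2) F" "(t0 \<longlongrightarrow> m0) F" and G: "(G \<longlongrightarrow> (g::complex)) F" "(C \<longlongrightarrow> k) F" "k \<noteq> 0"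
 shows "((\<lambda>x. z x * (A x * ((c1 x - t0 x) + (c2 x - t0 x)) + B x * ((t1 x - t0 x) + (t2 x - t0 x)) - G x / C x)) \<longlongrightarrow> 0) F"
proof -
 have "((\<lambda>x. A x * ((z x * c1 x - z x * t0 x) + (z x * c2 x - z x * t0 x)) + B x * (z x * ((t1 x - t0 x) + (t2 x - t0 x))) - z x * (G x / C x))
   \<longlongrightarrow> 0 * ((l1 - 0 * m0) + (l2 - 0 * m0)) + lB * (0 * ((m1 - m0) + (m2 - m0))) - 0 * (g / k)) F"
  by (intro tendsto_intros assms)
 then show ?thesis by (simp add: algebra_simps)
qed

text \<open>On the diagonal the factor \<open>v'(\<alpha>) - v'(\<eta>)\<close> cancels the pole, hence
 the singularity is removable.\<close>

lemma reg_ker_lim: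
 assumes st: "state s \<rho> M \<theta> \<mu> v" and a: "a \<in> strip (2 * \<rho>)"
 shows "((\<lambda>w. (w - a) * reg_ker v a w) \<longlongrightarrow> 0) (at a)" "((\<lambda>w. (w - a) * reg_ker v w a) \<longlongrightarrow> 0) (at a)"
proof -
 note sd = stateD[OF st]
 let ?r = "conj_refl v"
 have as: "a \<in> strip s" using inner_subset[OF st] a by auto
 note hr = conj_refl_holomorphic[OF sd(7)]
 have cv: "(v \<longlongrightarrow> v a) (at a)" using sd(7) as by (metis holomorphic_on_imp_continuous_on continuous_on_eq_continuous_at open_complex_strip isCont_def)
 have cr: "(?r \<longlongrightarrow> ?r a) (at a)" using hr as by (metis holomorphic_on_imp_continuous_on continuous_on_eq_continuous_at open_complex_strip isCont_def)
 have cdv: "(deriv v \<longlongrightarrow> deriv v a) (at a)" using holomorphic_deriv[OF sd(7) open_complex_strip] as by (metis holomorphic_on_imp_continuous_on continuous_on_eq_continuous_at open_complex_strip isCont_def)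
 have cdr: "(deriv ?r \<longlongrightarrow> deriv ?r a) (at a)" using holomorphic_deriv[OF hr open_complex_strip] as by (metis holomorphic_on_imp_continuous_on continuous_on_eq_continuous_at open_complex_strip isCont_def)
 have cp: "(pt v \<longlongrightarrow> pt v a) (at a)" "(pt ?r \<longlongrightarrow> pt ?r a) (at a)"
  unfolding pt_def[abs_def] by (intro tendsto_intros cv cr)+
 have d1: "1 + deriv v a \<noteq> 0" using inner_deriv_nz[OF st a] sd(6) by auto
 have d2: "1 + deriv ?r a \<noteq> 0" using inner_deriv_nz[OF state_conj_refl[OF st] a] sd(6) by auto
 note L1 = lim_coth[OF pt_deriv[OF sd(7) as] d1] and L2 = lim_coth[OF pt_deriv[OF hr as] d2]
 note nz = diag_cosh_nz[OF st as]
 have z: "((\<lambda>w. w - a) \<longlongrightarrow> 0) (at a)" by (rule LIM_zero) simp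
 have k: "((cosh ((a - a)/2))\<^sup>2 :: complex) \<noteq> 0" by simp
 have cc: "((\<lambda>w. (cosh ((a - w) / 2))\<^sup>2) \<longlongrightarrow> (cosh ((a - a)/2))\<^sup>2) (at a)" "((\<lambda>w. (cosh ((w - a) / 2))\<^sup>2) \<longlongrightarrow> (cosh ((a - a)/2))\<^sup>2) (at a)"
  unfolding cosh_field_def by (intro tendsto_intros; simp)+
 have t0: "((\<lambda>w. tanh ((a - w) / 2)) \<longlongrightarrow> tanh ((a - a)/2)) (at a)" "((\<lambda>w. tanh ((w - a) / 2)) \<longlongrightarrow> tanh ((a - a)/2)) (at a)"
  by (intro tanh_half_nz tendsto_intros; simp)+
 have A: "((\<lambda>w. deriv v a - deriv v w) \<longlongrightarrow> 0) (at a)" "((\<lambda>w. deriv v w - deriv v a) \<longlongrightarrow> 0) (at a)"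
  using tendsto_diff[OF tendsto_const[of "deriv v a"] cdv] tendsto_diff[OF cdv tendsto_const[of "deriv v a"]] by auto
 show "((\<lambda>w. (w - a) * reg_ker v a w) \<longlongrightarrow> 0) (at a)"
  unfolding reg_ker_def
  by (rule reg_ker_lim_aux[OF z A(1) _ L1(1) L2(1) _ _ t0(1) _ cc(1) k])
    (rule tendsto_intros tanh_half_nz cdr cdv cp cv cr nz)+
 show "((\<lambda>w. (w - a) * reg_ker v w a) \<longlongrightarrow> 0) (at a)"
  unfolding reg_ker_def
  by (rule reg_ker_lim_aux[OF z A(2) _ L1(2) L2(2) _ _ t0(2) _ cc(2) k])
    (rule tendsto_intros tanh_half_nz cdr cdv cp cv cr nz)+
qed

lemma inner_bound:
 assumes st: "state s \<rho> M \<theta> \<mu> v" and a: "\<alpha> \<in> strip (2 * \<rho>)" and e: "\<eta> \<in> strip (2 * \<rho>)"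
  and far: "\<rho> \<le> norm (\<alpha> - \<eta>)"
 shows "norm (reg_ker v \<alpha> \<eta>) \<le> reg_ker_const M (cosh_low M \<theta> \<mu>) * (3 * M / \<rho> + 2 * M) * exp (- \<bar>Re (\<alpha> - \<eta>)\<bar>)"
proof -
 note sd = stateD[OF st]
 have as: "\<alpha> \<in> strip s" "\<eta> \<in> strip s" using inner_subset[OF st] a e by auto
 have ma: "\<bar>Im \<alpha>\<bar> + \<rho> \<le> s" "\<bar>Im \<eta>\<bar> + \<rho> \<le> s" using a e sd(1,2) by auto
 have d: "norm (deriv v \<alpha>) \<le> M / \<rho>" "norm (deriv v \<eta>) \<le> M / \<rho>" "norm (deriv (conj_refl v) \<eta>) \<le> M / \<rho>"
  using norm_deriv_le_strip[OF sd(7,8) ma(1) sd(1)] norm_deriv_le_strip[OF sd(7,8) ma(2) sd(1)] norm_deriv_conj_refl_le[OF sd(7,8) ma(2) sd(1)] by auto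
 have im: "\<bar>Im (\<alpha> - \<eta>)\<bar> \<le> 1" using a e sd(3) by (simp only: in_complex_strip minus_complex.sel)
 have "norm (reg_ker v \<alpha> \<eta>) \<le> reg_ker_const M (cosh_low M \<theta> \<mu>) * exp (- \<bar>Re (\<alpha> - \<eta>)\<bar>) *
   (norm (deriv v \<alpha>) + norm (deriv v \<eta>) + norm (deriv (conj_refl v) \<eta>) + norm (v \<eta>) + norm (conj_refl v \<eta>))"
  by (rule norm_reg_ker_le[OF state_far_cosh_bds[OF st as far im] sd(12) sd(8)[OF as(1)] sd(8)[OF as(2)] sd(9)[OF as(1)] sd(9)[OF as(2)]])
 also have "\<dots> \<le> reg_ker_const M (cosh_low M \<theta> \<mu>) * exp (- \<bar>Re (\<alpha> - \<eta>)\<bar>) * (M/\<rho> + M/\<rho> + M/\<rho> + M + M)"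
  by (intro mult_left_mono add_mono d order_refl sd(8)[OF as(2)] sd(9)[OF as(2)] mult_nonneg_nonneg)
    (use sd(4) in \<open>auto simp: reg_ker_const_def\<close>)
 finally show ?thesis by (simp add: algebra_simps)
qed

text \<open>At distance \<open>\<rho>\<close> from the diagonal \<open>inner_bound\<close> applies;
 closer to it the maximum principle on a disc does.\<close>

lemma reg_ker_extend:
 assumes st: "state s \<rho> M \<theta> \<mu> v" and a: "\<alpha> \<in> strip \<rho>"
 obtains g C where "g holomorphic_on strip (2 * \<rho>)" "\<And>\<eta>. \<eta> \<in> strip (2 * \<rho>) \<Longrightarrow> \<eta> \<noteq> \<alpha> \<Longrightarrow> g \<eta> = reg_ker v \<alpha> \<eta>"
  "\<And>\<eta>. \<eta> \<in> strip (2 * \<rho>) \<Longrightarrow> norm (g \<eta>) \<le> C * exp (- \<bar>Re (\<alpha> - \<eta>)\<bar>)"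
proof -
 note sd = stateD[OF st]
 have a2: "\<alpha> \<in> strip (2 * \<rho>)" using a sd(1) by simp
 have hol: "reg_ker v \<alpha> holomorphic_on strip (2 * \<rho>) - {\<alpha>}"
  by (rule reg_ker_holomorphic[OF sd(7), where f = "\<lambda>_. \<alpha>" and g = "\<lambda>w. w"])
    (use inner_cosh_nz[OF st a2] inner_subset[OF st] a2 in auto)
 have "\<exists>g. g holomorphic_on strip (2 * \<rho>) \<and> (\<forall>z\<in>strip (2 * \<rho>) - {\<alpha>}. g z = reg_ker v \<alpha> z)"
  using holomorphic_on_extend_lim[OF hol] reg_ker_lim(1)[OF st a2] a2 by (simp add: interior_open)
 then obtain g where g: "g holomorphic_on strip (2 * \<rho>)" "\<And>z. z \<in> strip (2 * \<rho>) - {\<alpha>} \<Longrightarrow> g z = reg_ker v \<alpha> z" by blast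
 have sub: "cball \<alpha> \<rho> \<subseteq> strip (2 * \<rho>)" using a sd(1) by (intro cball_subset_complex_strip) simp
 have "\<exists>B. \<forall>w\<in>cball \<alpha> \<rho>. norm (g w) \<le> B"
  using compact_continuous_image[of "cball \<alpha> \<rho>" g] compact_imp_bounded
   continuous_on_subset[OF holomorphic_on_imp_continuous_on[OF g(1)] sub]
  by (force simp: bounded_iff)
 then obtain B where B: "\<And>w. w \<in> cball \<alpha> \<rho> \<Longrightarrow> norm (g w) \<le> B" by blast
 have B0: "0 \<le> B" using B[of \<alpha>] sd(1) by (auto intro: order_trans[OF norm_ge_zero])
 define C where "C = max (B * exp \<rho>) (reg_ker_const M (cosh_low M \<theta> \<mu>) * (3 * M / \<rho> + 2 * M))"
 have "norm (g \<eta>) \<le> C * exp (- \<bar>Re (\<alpha> - \<eta>)\<bar>)" if e: "\<eta> \<in> strip (2 * \<rho>)" for \<eta>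
 proof (cases "\<rho> \<le> norm (\<alpha> - \<eta>)")
  case True
  then have "\<eta> \<noteq> \<alpha>" using sd(1) by auto
  then have "norm (g \<eta>) \<le> reg_ker_const M (cosh_low M \<theta> \<mu>) * (3 * M / \<rho> + 2 * M) * exp (- \<bar>Re (\<alpha> - \<eta>)\<bar>)"
   using inner_bound[OF st a2 e True] g(2)[of \<eta>] e by simp
  also have "\<dots> \<le> C * exp (- \<bar>Re (\<alpha> - \<eta>)\<bar>)" by (intro mult_right_mono) (auto simp: C_def)
  finally show ?thesis .
 next
  case False
  have "norm (g \<eta>) \<le> B" using False by (intro B) (simp add: dist_norm)
  also have "\<dots> \<le> B * exp (\<rho> - \<bar>Re (\<alpha> - \<eta>)\<bar>)"
   using False abs_Re_le_cmod[of "\<alpha> - \<eta>"] B0 mult_left_mono[of 1 "exp (\<rho> - \<bar>Re (\<alpha> - \<eta>)\<bar>)" B] by simp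
  also have "\<dots> = B * exp \<rho> * exp (- \<bar>Re (\<alpha> - \<eta>)\<bar>)" by (simp add: mult.assoc flip: exp_add)
  also have "\<dots> \<le> C * exp (- \<bar>Re (\<alpha> - \<eta>)\<bar>)" by (intro mult_right_mono) (auto simp: C_def)
  finally show ?thesis .
 qed
 then show ?thesis using that g by blast
qed

text \<open>\<open>line_integral_shift\<close> for the holomorphic extension across the diagonal.\<close>

lemma shifted_eq_unshifted:
 assumes st: "state s \<rho> M \<theta> \<mu> v" and a: "\<alpha> \<in> strip \<rho>" and y: "\<bar>y\<bar> \<le> \<rho>"
 shows "shifted v y \<alpha> = shifted v 0 \<alpha>" "integrable lborel (\<lambda>\<beta>. reg_ker v \<alpha> (\<alpha> - of_real \<beta>))"
proof -
 note sd = stateD[OF st]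
 obtain g C where g: "g holomorphic_on strip (2 * \<rho>)" "\<And>\<eta>. \<eta> \<in> strip (2 * \<rho>) \<Longrightarrow> \<eta> \<noteq> \<alpha> \<Longrightarrow> g \<eta> = reg_ker v \<alpha> \<eta>"
  "\<And>\<eta>. \<eta> \<in> strip (2 * \<rho>) \<Longrightarrow> norm (g \<eta>) \<le> C * exp (- \<bar>Re (\<alpha> - \<eta>)\<bar>)"
  using reg_ker_extend[OF st a] by blast
 define h where "h w = g (\<alpha> - w)" for w
 define S where "S = {w. Im \<alpha> - 2 * \<rho> < Im w \<and> Im w < Im \<alpha> + 2 * \<rho>}"
 have in_S: "\<alpha> - w \<in> strip (2 * \<rho>)" if "Im \<alpha> - 2 * \<rho> < Im w" "Im w < Im \<alpha> + 2 * \<rho>" for w using that by auto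
 have hh: "h holomorphic_on S" unfolding h_def[abs_def]
 proof (rule holomorphic_on_compose_gen[unfolded o_def, OF _ g(1)])
  show "(\<lambda>w. \<alpha> - w) holomorphic_on S" by (intro holomorphic_intros)
  show "(\<lambda>w. \<alpha> - w) ` S \<subseteq> strip (2 * \<rho>)" using in_S by (auto simp: S_def)
 qed
 have hb: "norm (h w) \<le> C * exp (- \<bar>Re w\<bar>)" if "Im \<alpha> - 2 * \<rho> < Im w" "Im w < Im \<alpha> + 2 * \<rho>" for w
  using g(3)[OF in_S[OF that]] by (simp add: h_def)
 have eq: "(LBINT x. h (of_real x + \<i> * of_real y')) = shifted v y' \<alpha>" if "\<bar>y'\<bar> \<le> \<rho>" for y'
  unfolding shifted_def
 proof (rule integral_cong_AE)
  show "AE x in lborel. h (of_real x + \<i> * of_real y') = reg_ker v \<alpha> (\<alpha> - of_real x - \<i> * of_real y')"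
   using AE_lborel_singleton[of 0]
  proof eventually_elim
   case (elim x)
   have "\<alpha> - (complex_of_real x + \<i> * of_real y') \<in> strip (2 * \<rho>)" using that a by (intro in_S) auto
   moreover have "\<alpha> - (complex_of_real x + \<i> * of_real y') \<noteq> \<alpha>" using elim by (auto simp: complex_eq_iff)
   ultimately show ?case unfolding h_def using g(2) by (simp add: diff_diff_eq)
  qed
  have m: "(\<lambda>x. h (of_real x + \<i> * of_real y')) \<in> borel_measurable borel"
   by (rule borel_measurable_line[OF holomorphic_on_imp_continuous_on[OF hh]]) (use that a in \<open>auto simp: S_def\<close>)
  then show "(\<lambda>x. h (of_real x + \<i> * of_real y')) \<in> borel_measurable lborel" by simp
  have "(\<lambda>x. if x = 0 then reg_ker v \<alpha> (\<alpha> - of_real 0 - \<i> * of_real y') else h (of_real x + \<i> * of_real y')) \<in> borel_measurable borel"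
   using m by (intro measurable_If) auto
  also have "(\<lambda>x. if x = 0 then reg_ker v \<alpha> (\<alpha> - of_real 0 - \<i> * of_real y') else h (of_real x + \<i> * of_real y')) = (\<lambda>x. reg_ker v \<alpha> (\<alpha> - of_real x - \<i> * of_real y'))"
  proof
   fix x :: real
   have "\<alpha> - (complex_of_real x + \<i> * of_real y') \<in> strip (2 * \<rho>)" using that a by (intro in_S) auto
   moreover have "\<alpha> - (complex_of_real x + \<i> * of_real y') \<noteq> \<alpha>" if "x \<noteq> 0" using that by (auto simp: complex_eq_iff)
   ultimately show "(if x = 0 then reg_ker v \<alpha> (\<alpha> - of_real 0 - \<i> * of_real y') else h (of_real x + \<i> * of_real y')) = reg_ker v \<alpha> (\<alpha> - of_real x - \<i> * of_real y')"
    unfolding h_def using g(2) by (simp add: diff_diff_eq)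
  qed
  finally show "(\<lambda>x. reg_ker v \<alpha> (\<alpha> - of_real x - \<i> * of_real y')) \<in> borel_measurable lborel" by simp
 qed
 show "shifted v y \<alpha> = shifted v 0 \<alpha>"
 proof -
  have "(LBINT x. h (of_real x + \<i> * of_real y)) = (LBINT x. h (of_real x + \<i> * of_real 0))"
   using hh hb y a by (intro line_integral_shift[where a = "Im \<alpha> - 2 * \<rho>" and b = "Im \<alpha> + 2 * \<rho>" and C = C]) (auto simp: S_def)
  then show ?thesis using eq[OF y] eq[of 0] sd(1) by simp
 qed
 have i: "integrable lborel (\<lambda>x. h (of_real x))"
 proof (rule Bochner_Integration.integrable_bound)
  show "integrable lborel (\<lambda>x. C * exp (- \<bar>x\<bar>))" using integrable_exp_neg_abs by simp
  show "AE x in lborel. norm (h (of_real x)) \<le> norm (C * exp (- \<bar>x\<bar>))"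
  proof (rule AE_I2)
   fix x :: real
   have "norm (h (of_real x)) \<le> C * exp (- \<bar>Re (complex_of_real x)\<bar>)" using a by (intro hb) auto
   then show "norm (h (of_real x)) \<le> norm (C * exp (- \<bar>x\<bar>))" by simp
  qed
  have "(\<lambda>x. h (of_real x)) \<in> borel_measurable borel"
  proof -
   have "complex_of_real x + 0 \<in> S" for x
    using a sd(1) by (simp add: S_def abs_less_iff)
   then show ?thesis using borel_measurable_line[OF holomorphic_on_imp_continuous_on[OF hh], of 0] by simp
  qed
  then show "(\<lambda>x. h (of_real x)) \<in> borel_measurable lborel" by simp
 qed
 have hm: "h (of_real x) = reg_ker v \<alpha> (\<alpha> - of_real x)" if "x \<noteq> 0" for x
 proof -
  have "\<alpha> - complex_of_real x \<in> strip (2 * \<rho>)" using a by (intro in_S) auto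
  then show ?thesis unfolding h_def using g(2) that by simp
 qed
 have "(\<lambda>x. if x = 0 then reg_ker v \<alpha> \<alpha> else h (of_real x)) = (\<lambda>x. reg_ker v \<alpha> (\<alpha> - of_real x))"
  using hm by auto
 moreover have "(\<lambda>x. if x = 0 then reg_ker v \<alpha> \<alpha> else h (of_real x)) \<in> borel_measurable lborel"
  using borel_measurable_integrable[OF i] by (intro measurable_If) auto
 ultimately have "(\<lambda>x. reg_ker v \<alpha> (\<alpha> - of_real x)) \<in> borel_measurable lborel" by simp
 then show "integrable lborel (\<lambda>\<beta>. reg_ker v \<alpha> (\<alpha> - of_real \<beta>))"
  using i AE_lborel_singleton[of 0] by (subst integrable_cong_AE[where g = "\<lambda>x. h (of_real x)"]) (auto simp: hm elim: eventually_mono)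
qed

lemma velocity_eq_unshifted:
 assumes "state s \<rho> M \<theta> \<mu> v" "\<alpha> \<in> strip \<rho>"
 shows "velocity \<rho> v \<alpha> = (LBINT \<beta>. reg_ker v \<alpha> (\<alpha> - of_real \<beta>))"
proof -
 have "velocity \<rho> v \<alpha> = shifted v 0 \<alpha>"
  unfolding velocity_def using stateD(1)[OF assms(1)] by (intro shifted_eq_unshifted(1)[OF assms]) auto
 then show ?thesis by (simp add: shifted_def)
qed

text \<open>The two halves of the strip overlap in the strip of width \<open>\<rho>\<close>, where both
 contours may be replaced by the unshifted one.\<close>

lemma velocity_holomorphic:
 assumes st: "state s \<rho> M \<theta> \<mu> v"
 shows "velocity \<rho> v holomorphic_on strip s"
proof -
 note sd = stateD[OF st]
 let ?A = "strip s \<inter> {\<alpha>. - \<rho> < Im \<alpha>}" and ?B = "strip s \<inter> {\<alpha>. Im \<alpha> < \<rho>}"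
 have eq: "shifted v \<rho> \<alpha> = shifted v (- \<rho>) \<alpha>" if "\<alpha> \<in> strip \<rho>" for \<alpha>
  using shifted_eq_unshifted(1)[OF st that, of \<rho>] shifted_eq_unshifted(1)[OF st that, of "- \<rho>"] sd(1) by simp
 have "velocity \<rho> v holomorphic_on ?A"
 proof (rule holomorphic_transform[of "shifted v \<rho>"])
  show "shifted v \<rho> holomorphic_on ?A"
   by (rule holomorphic_on_subset[OF shifted_holomorphic[OF st]]) (auto simp: shift_ok_def)
  show "shifted v \<rho> \<alpha> = velocity \<rho> v \<alpha>" if "\<alpha> \<in> ?A" for \<alpha> using that eq[of \<alpha>] by (auto simp: velocity_def)
 qed
 moreover have "velocity \<rho> v holomorphic_on ?B"
 proof (rule holomorphic_transform[of "shifted v (-\<rho>)"])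
  show "shifted v (-\<rho>) holomorphic_on ?B"
   by (rule holomorphic_on_subset[OF shifted_holomorphic[OF st]]) (auto simp: shift_ok_def)
  show "shifted v (-\<rho>) \<alpha> = velocity \<rho> v \<alpha>" if "\<alpha> \<in> ?B" for \<alpha> using that eq[of \<alpha>] by (auto simp: velocity_def)
 qed
 ultimately have "velocity \<rho> v holomorphic_on (?A \<union> ?B)"
  by (rule holomorphic_on_Un) (auto intro!: open_Int open_halfspace_Im_gt open_halfspace_Im_lt)
 moreover have "?A \<union> ?B = strip s" using sd(1) by auto
 ultimately show ?thesis by simp
qed

section \<open>Decay at infinity\<close>

text \<open>Uniform decay in each smaller strip; the smaller strips leave room for Cauchy's inequality.\<close>

definition decays :: "real \<Rightarrow> (complex \<Rightarrow> complex) \<Rightarrow> bool" where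
 "decays s v \<longleftrightarrow> (\<forall>s'<s. (v \<longlongrightarrow> 0) (inf at_infinity (principal (strip s'))))"

lemma decays_iff_eps:
 "decays s v \<longleftrightarrow> (\<forall>s'<s. \<forall>e>0. \<exists>b. \<forall>w\<in>strip s'. b \<le> norm w \<longrightarrow> norm (v w) < e)"
 unfolding decays_def tendsto_iff dist_0_norm
 by (simp add: eventually_inf_principal eventually_at_infinity) (metis in_complex_strip)

lemma decays_seqD:
 assumes "decays s v" "s' < s" "\<And>n. X n \<in> strip s'" "filterlim (\<lambda>n. norm (X n)) at_top sequentially"
 shows "(\<lambda>n. v (X n)) \<longlonglongrightarrow> 0"
proof (rule LIMSEQ_I, simp)
 fix e :: real assume "0 < e"
 then obtain b where b: "\<And>w. w \<in> strip s' \<Longrightarrow> b \<le> norm w \<Longrightarrow> norm (v w) < e"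
  using assms(1,2) unfolding decays_iff_eps by blast
 have "eventually (\<lambda>n. b \<le> norm (X n)) sequentially" using assms(4) by (simp add: filterlim_at_top)
 then obtain N where "\<And>n. n \<ge> N \<Longrightarrow> b \<le> norm (X n)" unfolding eventually_sequentially by blast
 then show "\<exists>no. \<forall>n\<ge>no. norm (v (X n)) < e" using b assms(3) by blast
qed

text \<open>Sequences make dominated convergence applicable to parameter integrals.\<close>

lemma decays_seqI:
 assumes "\<And>s' X. s' < s \<Longrightarrow> (\<And>n. X n \<in> strip s') \<Longrightarrow> filterlim (\<lambda>n. norm (X n)) at_top sequentially
  \<Longrightarrow> (\<lambda>n. v (X n)) \<longlonglongrightarrow> 0"
 shows "decays s v"
proof (rule ccontr)
 assume "\<not> decays s v"
 then obtain s' e where s': "s' < s" and e: "0 < e" and n: "\<And>b. \<exists>w\<in>strip s'. b \<le> norm w \<and> \<not> norm (v w) < e"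
  unfolding decays_iff_eps by blast
 have "\<exists>X. \<forall>n::nat. X n \<in> strip s' \<and> real n \<le> norm (X n) \<and> \<not> norm (v (X n)) < e"
  by (rule choice) (use n in blast)
 then obtain X where X: "\<And>n::nat. X n \<in> strip s'" "\<And>n. real n \<le> norm (X n)" "\<And>n. \<not> norm (v (X n)) < e"
  by blast
 have "filterlim (\<lambda>n. norm (X n)) at_top sequentially"
  by (rule filterlim_at_top_mono[OF filterlim_real_sequentially]) (use X(2) in auto)
 then have "(\<lambda>n. v (X n)) \<longlonglongrightarrow> 0" using assms[of s' X] s' X(1) by blast
 then have "eventually (\<lambda>n. norm (v (X n)) < e) sequentially" using e by (simp add: tendsto_iff)
 then show False using X(3) by simp
qed

lemma decays_conj_refl: assumes "decays s v" shows "decays s (conj_refl v)"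
 unfolding decays_iff_eps
proof (intro allI impI)
 fix s' e :: real assume "s' < s" "0 < e"
 then obtain b where b: "\<And>w. w \<in> strip s' \<Longrightarrow> b \<le> norm w \<Longrightarrow> norm (v w) < e"
  using assms unfolding decays_iff_eps by blast
 then have "\<And>w. w \<in> strip s' \<Longrightarrow> b \<le> norm w \<Longrightarrow> norm (conj_refl v w) < e"
  by (simp add: conj_refl_def)
 then show "\<exists>b. \<forall>w\<in>strip s'. b \<le> norm w \<longrightarrow> norm (conj_refl v w) < e" by blast
qed

lemma decays_deriv:
 assumes hol: "v holomorphic_on strip s" and d: "decays s v" shows "decays s (deriv v)"
 unfolding decays_iff_eps
proof (intro allI impI)
 fix s' e :: real assume s': "s' < s" and e: "0 < e"
 define r where "r = (s - s') / 2"
 have r: "0 < r" "s' + r < s" using s' by (auto simp: r_def field_simps)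
 have "0 < e * r / 2" using e r by simp
 then obtain b where b: "\<And>w. w \<in> strip (s' + r) \<Longrightarrow> b \<le> norm w \<Longrightarrow> norm (v w) < e * r / 2"
  using d r unfolding decays_iff_eps by blast
 have "norm (deriv v w) < e" if w: "w \<in> strip s'" "b + r \<le> norm w" for w
 proof -
  have sub: "ball w r \<subseteq> strip (s' + r)" using w by (intro ball_subset_complex_strip) simp
  then have hb: "v holomorphic_on ball w r" using r by (intro holomorphic_on_subset[OF hol]) fastforce
  have "norm (deriv v w) \<le> (e * r / 2) / r"
  proof (rule norm_deriv_le[OF hb r(1)])
   fix x assume x: "x \<in> ball w r"
   then have "norm w \<le> norm x + r" using norm_triangle_sub[of w x] by (simp add: dist_norm)
   then show "norm (v x) \<le> e * r / 2" using b[of x] sub x w by fastforce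
  qed
  also have "\<dots> < e" using e r by simp
  finally show ?thesis .
 qed
 then show "\<exists>b. \<forall>w\<in>strip s'. b \<le> norm w \<longrightarrow> norm (deriv v w) < e" by blast
qed

text \<open>Along a sequence going to infinity the integrand tends to zero pointwise, since the
 displacement vanishes at both \<open>\<alpha>\<close> and \<open>\<eta>\<close>.\<close>

lemma velocity_decays:
 assumes st: "state s \<rho> M \<theta> \<mu> v" and d: "decays s v"
 shows "decays s (velocity \<rho> v)"
proof (rule decays_seqI)
 fix s' and X :: "nat \<Rightarrow> complex"
 assume s': "s' < s" and X: "\<And>n. X n \<in> strip s'" and lim: "filterlim (\<lambda>n. norm (X n)) at_top sequentially"
 note sd = stateD[OF st]
 have Xs: "X n \<in> strip s" for n using X[of n] s' by simp
 define \<sigma> where "\<sigma> n = (if 0 \<le> Im (X n) then \<rho> else - \<rho>)" for n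
 have ok: "shift_ok s \<rho> (\<sigma> n) (X n)" for n using velocity_shift_ok[OF Xs sd(1)] by (simp add: \<sigma>_def)
 define B where "B = M / (s - s')"
 have B: "norm (deriv v (X n)) \<le> B" for n
  unfolding B_def using X[of n] s' by (intro norm_deriv_le_strip[OF sd(7,8)]) auto
 define \<eta> where "\<eta> \<beta> n = X n - complex_of_real \<beta> - \<i> * complex_of_real (\<sigma> n)" for \<beta> n
 define s'' where "s'' = max s' (2 * \<rho>)"
 have s'': "s'' < s" using s' sd(1,2) by (auto simp: s''_def)
 have eta: "\<eta> \<beta> n \<in> strip s''" for \<beta> n
  using X[of n] sd(1) by (auto simp: \<eta>_def \<sigma>_def s''_def)
 have eta_lim: "filterlim (\<lambda>n. norm (\<eta> \<beta> n)) at_top sequentially" for \<beta>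
 proof (rule filterlim_at_top_mono)
  show "filterlim (\<lambda>n. - (\<bar>\<beta>\<bar> + \<rho>) + norm (X n)) at_top sequentially"
   by (rule filterlim_tendsto_add_at_top[OF tendsto_const lim])
  have "norm (X n) - norm (complex_of_real \<beta> + \<i> * complex_of_real (\<sigma> n)) \<le> norm (\<eta> \<beta> n)" for n
   using norm_triangle_ineq2[of "X n" "complex_of_real \<beta> + \<i> * complex_of_real (\<sigma> n)"] by (simp add: \<eta>_def diff_diff_eq)
  moreover have "norm (complex_of_real \<beta> + \<i> * complex_of_real (\<sigma> n)) \<le> \<bar>\<beta>\<bar> + \<rho>" for n
   using norm_triangle_ineq[of "complex_of_real \<beta>" "\<i> * complex_of_real (\<sigma> n)"] sd(1) by (simp add: norm_mult \<sigma>_def split: if_splits)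
  ultimately show "\<forall>\<^sub>F n in sequentially. - (\<bar>\<beta>\<bar> + \<rho>) + norm (X n) \<le> norm (\<eta> \<beta> n)"
   by (intro always_eventually allI) (smt (verit))
 qed
 have dr: "decays s (conj_refl v)" "decays s (deriv v)" "decays s (deriv (conj_refl v))"
  using decays_conj_refl[OF d] decays_deriv[OF sd(7) d] decays_deriv[OF conj_refl_holomorphic[OF sd(7)] decays_conj_refl[OF d]] by auto
 have "(\<lambda>n. LBINT \<beta>. reg_ker v (X n) (\<eta> \<beta> n)) \<longlonglongrightarrow> (LBINT \<beta>::real. 0)"
 proof (rule integral_dominated_convergence)
  show "(\<lambda>\<beta>. reg_ker v (X n) (\<eta> \<beta> n)) \<in> borel_measurable lborel" for n
   unfolding \<eta>_def by (rule shift_measurable[OF st ok])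
  show "integrable lborel (\<lambda>\<beta>. reg_ker_const M (cosh_low M \<theta> \<mu>) * (B + 2 * M / \<rho> + 2 * M) * exp (- \<bar>\<beta>\<bar>))"
   using integrable_exp_neg_abs by simp
  show "AE \<beta> in lborel. norm (reg_ker v (X n) (\<eta> \<beta> n)) \<le> reg_ker_const M (cosh_low M \<theta> \<mu>) * (B + 2 * M / \<rho> + 2 * M) * exp (- \<bar>\<beta>\<bar>)" for n
  proof (rule AE_I2)
   fix \<beta> :: real
   show "norm (reg_ker v (X n) (\<eta> \<beta> n)) \<le> reg_ker_const M (cosh_low M \<theta> \<mu>) * (B + 2 * M / \<rho> + 2 * M) * exp (- \<bar>\<beta>\<bar>)"
    unfolding \<eta>_def
   proof (rule order_trans[OF shift_bound[OF st ok]])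
    show "reg_ker_const M (cosh_low M \<theta> \<mu>) * (norm (deriv v (X n)) + 2 * M / \<rho> + 2 * M) * exp (- \<bar>\<beta>\<bar>)
     \<le> reg_ker_const M (cosh_low M \<theta> \<mu>) * (B + 2 * M / \<rho> + 2 * M) * exp (- \<bar>\<beta>\<bar>)"
     using B[of n] sd(4) by (intro mult_right_mono mult_left_mono add_mono) (auto simp: reg_ker_const_def)
   qed
  qed
  show "AE \<beta> in lborel. (\<lambda>n. reg_ker v (X n) (\<eta> \<beta> n)) \<longlonglongrightarrow> 0"
  proof (rule AE_I2)
   fix \<beta> :: real
   let ?b = "\<lambda>n. reg_ker_const M (cosh_low M \<theta> \<mu>) * exp (- \<bar>\<beta>\<bar>) * (norm (deriv v (X n)) + norm (deriv v (\<eta> \<beta> n)) + norm (deriv (conj_refl v) (\<eta> \<beta> n)) + norm (v (\<eta> \<beta> n)) + norm (conj_refl v (\<eta> \<beta> n)))"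
   have "?b \<longlonglongrightarrow> reg_ker_const M (cosh_low M \<theta> \<mu>) * exp (- \<bar>\<beta>\<bar>) * (0 + 0 + 0 + 0 + 0)"
    by (intro tendsto_intros tendsto_norm_zero decays_seqD[OF _ s'' eta eta_lim] decays_seqD[OF _ s' X lim] dr d)
   then have b0: "?b \<longlonglongrightarrow> 0" by simp
   show "(\<lambda>n. reg_ker v (X n) (\<eta> \<beta> n)) \<longlonglongrightarrow> 0"
   proof (rule tendsto_norm_zero_cancel, rule tendsto_sandwich[OF _ _ tendsto_const b0])
    have "norm (reg_ker v (X n) (\<eta> \<beta> n)) \<le> ?b n" for n
    proof -
     note sp = shift_props[OF st ok, of n \<beta>, folded \<eta>_def]
     show ?thesis using norm_reg_ker_le[OF sp(3) sd(12) sd(8)[OF Xs] sd(8)[OF sp(1)] sd(9)[OF Xs] sd(9)[OF sp(1)]] unfolding sp(4) .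
    qed
    then show "\<forall>\<^sub>F n in sequentially. norm (reg_ker v (X n) (\<eta> \<beta> n)) \<le> ?b n" by simp
   qed simp
  qed
 qed simp
 then show "(\<lambda>n. velocity \<rho> v (X n)) \<longlonglongrightarrow> 0"
  by (simp add: velocity_def shifted_def \<eta>_def \<sigma>_def)
qed

section \<open>Time integrals over a shrinking cone\<close>

text \<open>The distance from \<open>\<alpha>\<close> to the boundary of the strip at time
  \<open>t\<close>; it shrinks with speed \<open>K\<close>.\<close>

definition cdist :: "real \<Rightarrow> real \<Rightarrow> real \<Rightarrow> complex \<Rightarrow> real" where
 "cdist s K t \<alpha> = s - K * t - \<bar>Im \<alpha>\<bar>"

lemma cdist_pos_iff: "0 < cdist s K t \<alpha> \<longleftrightarrow> \<alpha> \<in> strip (s - K * t)"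
 by (auto simp: cdist_def)

text \<open>The two weights that occur: an integrand of size
  \<open>d\<^sup>-\<^sup>1\<^sup>/\<^sup>2\<close> has a bounded time integral, and its derivative, of
 size \<open>d\<^sup>-\<^sup>3\<^sup>/\<^sup>2\<close>, integrates to
  \<open>d\<^sup>-\<^sup>1\<^sup>/\<^sup>2\<close> again. Both gain a factor \<open>1 / K\<close>.\<close>

lemma has_integral_cdist:
 assumes K: "0 < K" and t: "0 \<le> t" and a: "0 < cdist s K t \<alpha>"
 shows "((\<lambda>\<tau>. 1 / sqrt (cdist s K \<tau> \<alpha>)) has_integral 2 / K * (sqrt (cdist s K 0 \<alpha>) - sqrt (cdist s K t \<alpha>))) {0..t}"
  "((\<lambda>\<tau>. 1 / (cdist s K \<tau> \<alpha> * sqrt (cdist s K \<tau> \<alpha>))) has_integral 2 / K * (1 / sqrt (cdist s K t \<alpha>) - 1 / sqrt (cdist s K 0 \<alpha>))) {0..t}"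
proof -
 have pos: "0 < cdist s K \<tau> \<alpha>" if "\<tau> \<in> {0..t}" for \<tau>
 proof -
  have "K * \<tau> \<le> K * t" using K that by simp
  then show ?thesis using a by (simp add: cdist_def)
 qed
 have d: "((\<lambda>\<tau>. cdist s K \<tau> \<alpha>) has_real_derivative - K) (at \<tau> within {0..t})" for \<tau>
  unfolding cdist_def by (auto intro!: derivative_eq_intros)
 have "((\<lambda>\<tau>. 1 / sqrt (cdist s K \<tau> \<alpha>)) has_integral (- (2 / K) * sqrt (cdist s K t \<alpha>)) - (- (2 / K) * sqrt (cdist s K 0 \<alpha>))) {0..t}"
 proof (rule fundamental_theorem_of_calculus[OF t])
  fix \<tau> assume "\<tau> \<in> {0..t}"
  note p = pos[OF this]
  show "((\<lambda>\<tau>. - (2 / K) * sqrt (cdist s K \<tau> \<alpha>)) has_vector_derivative 1 / sqrt (cdist s K \<tau> \<alpha>)) (at \<tau> within {0..t})"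
   unfolding has_real_derivative_iff_has_vector_derivative[symmetric]
   using p K by (auto intro!: derivative_eq_intros d simp: field_simps)
 qed
 then show "((\<lambda>\<tau>. 1 / sqrt (cdist s K \<tau> \<alpha>)) has_integral 2 / K * (sqrt (cdist s K 0 \<alpha>) - sqrt (cdist s K t \<alpha>))) {0..t}"
  by (simp add: algebra_simps)
 have "((\<lambda>\<tau>. 1 / (cdist s K \<tau> \<alpha> * sqrt (cdist s K \<tau> \<alpha>))) has_integral (2 / K * (1 / sqrt (cdist s K t \<alpha>))) - 2 / K * (1 / sqrt (cdist s K 0 \<alpha>))) {0..t}"
 proof (rule fundamental_theorem_of_calculus[OF t])
  fix \<tau> assume "\<tau> \<in> {0..t}"
  note p = pos[OF this]
  show "((\<lambda>\<tau>. 2 / K * (1 / sqrt (cdist s K \<tau> \<alpha>))) has_vector_derivative 1 / (cdist s K \<tau> \<alpha> * sqrt (cdist s K \<tau> \<alpha>))) (at \<tau> within {0..t})"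
   unfolding has_real_derivative_iff_has_vector_derivative[symmetric]
   using p K by (auto intro!: derivative_eq_intros d simp: field_simps)
 qed
 then show "((\<lambda>\<tau>. 1 / (cdist s K \<tau> \<alpha> * sqrt (cdist s K \<tau> \<alpha>))) has_integral 2 / K * (1 / sqrt (cdist s K t \<alpha>) - 1 / sqrt (cdist s K 0 \<alpha>))) {0..t}"
  by (simp add: algebra_simps)
qed

definition time_int :: "(real \<Rightarrow> complex \<Rightarrow> complex) \<Rightarrow> real \<Rightarrow> complex \<Rightarrow> complex" where
 "time_int f t \<alpha> = integral {0..t} (\<lambda>\<tau>. f \<tau> \<alpha>)"

text \<open>Functions on the shrinking cone that grow at most like the inverse square root of the
 distance to its boundary, the growth of \<open>F(v)\<close> when \<open>v'\<close> is allowed that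
 growth.\<close>

locale cone_integrand =
 fixes s K T B :: real and f :: "real \<Rightarrow> complex \<Rightarrow> complex"
 assumes s: "s \<le> 1" and K: "0 < K" and B: "0 \<le> B"
  and hol: "\<And>\<tau>. \<tau> \<in> {0..T} \<Longrightarrow> f \<tau> holomorphic_on strip (s - K * \<tau>)"
  and bound: "\<And>\<tau> \<alpha>. \<tau> \<in> {0..T} \<Longrightarrow> \<alpha> \<in> strip (s - K * \<tau>) \<Longrightarrow> norm (f \<tau> \<alpha>) \<le> B / sqrt (cdist s K \<tau> \<alpha>)"
  and cont: "\<And>t \<alpha>. t \<in> {0..T} \<Longrightarrow> \<alpha> \<in> strip (s - K * t) \<Longrightarrow> continuous_on {0..t} (\<lambda>\<tau>. f \<tau> \<alpha>)"
begin

lemma cdist_mono: "\<tau> \<le> t \<Longrightarrow> cdist s K t \<alpha> \<le> cdist s K \<tau> \<alpha>"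
 using K by (simp add: cdist_def)

lemma cdist_ball: "w \<in> ball \<alpha> (cdist s K \<tau> \<alpha> / 2) \<Longrightarrow> cdist s K \<tau> \<alpha> / 2 \<le> cdist s K \<tau> w"
proof -
 assume "w \<in> ball \<alpha> (cdist s K \<tau> \<alpha> / 2)"
 then have "\<bar>Im (w - \<alpha>)\<bar> \<le> cdist s K \<tau> \<alpha> / 2" using abs_Im_le_cmod[of "w - \<alpha>"] by (simp add: dist_norm norm_minus_commute)
 then have "\<bar>Im w\<bar> \<le> \<bar>Im \<alpha>\<bar> + cdist s K \<tau> \<alpha> / 2" unfolding minus_complex.sel by linarith
 then show ?thesis by (simp add: cdist_def field_simps)
qed

lemma sqrt_cdist_le_1: "0 \<le> t \<Longrightarrow> sqrt (cdist s K t \<alpha>) \<le> 1"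
proof -
 assume "0 \<le> t"
 then have "0 \<le> K * t" using K by simp
 then have "cdist s K t \<alpha> \<le> 1" using s unfolding cdist_def by linarith
 then show ?thesis by simp
qed

context
 fixes t \<alpha> assumes t: "t \<in> {0..T}" and a: "\<alpha> \<in> strip (s - K * t)"
begin

lemma d_pos: "0 < cdist s K t \<alpha>" using a by (simp only: cdist_pos_iff)

lemma integrable_f: "(\<lambda>\<tau>. f \<tau> \<alpha>) integrable_on {0..t}"
 using cont[OF t a] by (rule integrable_continuous_interval)

lemma f_in_strip: "\<tau> \<in> {0..t} \<Longrightarrow> 0 < r \<Longrightarrow> r \<le> cdist s K t w \<Longrightarrow> \<tau> \<in> {0..T} \<and> w \<in> strip (s - K * \<tau>) \<and> r \<le> cdist s K \<tau> w"
 using t cdist_mono[of \<tau> t w] cdist_pos_iff[of s K \<tau> w] by auto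

text \<open>Differentiation under the time integral, on a disc whose radius is half the distance to the
 boundary.\<close>

lemma time_int_deriv:
 "(time_int f t has_field_derivative integral {0..t} (\<lambda>\<tau>. deriv (f \<tau>) \<alpha>)) (at \<alpha>)"
 "(\<lambda>\<tau>. deriv (f \<tau>) \<alpha>) integrable_on {0..t}"
proof -
 define r where "r = cdist s K t \<alpha> / 2"
 have r: "0 < r" using d_pos by (simp add: r_def)
 define U where "U = ball \<alpha> r"
 let ?M = "lebesgue_on {0..t}"
 have strip: "\<tau> \<in> {0..T}" "w \<in> strip (s - K * \<tau>)" "r \<le> cdist s K \<tau> w" if "w \<in> U" "\<tau> \<in> {0..t}" for w \<tau>
  using f_in_strip[OF that(2) r] cdist_ball[of w \<alpha> t] that(1) by (auto simp: U_def r_def)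
 have strip': "w \<in> strip (s - K * t)" if "w \<in> U" for w
  using strip(2)[OF that, of t] t by auto
 have fin: "finite_measure ?M" by (rule finite_measure_lebesgue_on) (metis lmeasurable_cbox cbox_interval)
 have meas: "(\<lambda>\<tau>. f \<tau> w) \<in> borel_measurable ?M" if "w \<in> U" for w
  using cont[OF t strip'[OF that]] by (rule continuous_imp_measurable_on_sets_lebesgue) simp
 have bd: "norm (f \<tau> w) \<le> B / sqrt r" if "w \<in> U" "\<tau> \<in> space ?M" for w \<tau>
 proof -
  have \<tau>: "\<tau> \<in> {0..t}" using that(2) by simp
  note st = strip[OF that(1) \<tau>]
  have "norm (f \<tau> w) \<le> B / sqrt (cdist s K \<tau> w)" by (rule bound[OF st(1,2)])
  also have "\<dots> \<le> B / sqrt r" using st(3) r B by (intro divide_left_mono) auto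
  finally show ?thesis .
 qed
 have intg: "integrable ?M (\<lambda>\<tau>. B / sqrt r)" using fin by (rule finite_measure.integrable_const)
 have hU: "(\<lambda>w. f \<tau> w) holomorphic_on U" if "\<tau> \<in> space ?M" for \<tau>
 proof -
  have \<tau>: "\<tau> \<in> {0..t}" using that by simp
  have "\<alpha> \<in> U" using r by (simp add: U_def)
  then have "\<tau> \<in> {0..T}" using strip(1) \<tau> by blast
  then show ?thesis by (rule holomorphic_on_subset[OF hol]) (use strip(2) \<tau> in blast)
 qed
 have oU: "open U" and aU: "\<alpha> \<in> U" using r by (auto simp: U_def)
 note D = has_field_derivative_integral[OF oU aU hU meas intg bd]
 have int: "integrable ?M (\<lambda>\<tau>. f \<tau> w)" if "w \<in> U" for w
  by (rule Bochner_Integration.integrable_bound[OF intg meas[OF that]])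
    (intro AE_I2, unfold real_norm_def, rule order_trans[OF bd[OF that] abs_ge_self])
 have eq: "(\<integral>\<tau>. f \<tau> w \<partial>?M) = time_int f t w" if "w \<in> U" for w
  unfolding time_int_def using int[OF that] by (intro lebesgue_integral_eq_integral) auto
 have eqd: "(\<integral>\<tau>. deriv (f \<tau>) \<alpha> \<partial>?M) = integral {0..t} (\<lambda>\<tau>. deriv (f \<tau>) \<alpha>)"
  using D(2) by (intro lebesgue_integral_eq_integral) auto
 show "(time_int f t has_field_derivative integral {0..t} (\<lambda>\<tau>. deriv (f \<tau>) \<alpha>)) (at \<alpha>)"
  using has_field_derivative_transform_within_open[OF D(1) oU aU eq] by (simp add: eqd)
 show "(\<lambda>\<tau>. deriv (f \<tau>) \<alpha>) integrable_on {0..t}"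
  using D(2) by (simp add: integrable_on_lebesgue_on)
qed

lemma time_int_bound: "norm (time_int f t \<alpha>) \<le> 2 * B / K"
proof -
 note I = has_integral_mult_right[OF has_integral_cdist(1)[OF K _ d_pos], of B]
 have t0: "0 \<le> t" using t by simp
 have "norm (time_int f t \<alpha>) \<le> integral {0..t} (\<lambda>\<tau>. B * (1 / sqrt (cdist s K \<tau> \<alpha>)))"
  unfolding time_int_def
 proof (rule integral_norm_bound_integral[OF integrable_f])
  show "(\<lambda>\<tau>. B * (1 / sqrt (cdist s K \<tau> \<alpha>))) integrable_on {0..t}" using I[OF t0] by blast
  show "norm (f \<tau> \<alpha>) \<le> B * (1 / sqrt (cdist s K \<tau> \<alpha>))" if "\<tau> \<in> {0..t}" for \<tau>
   using bound[of \<tau> \<alpha>] f_in_strip[OF that d_pos order_refl] by simp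
 qed
 also have "\<dots> = B * (2 / K * (sqrt (cdist s K 0 \<alpha>) - sqrt (cdist s K t \<alpha>)))"
  using I[OF t0] by (rule integral_unique)
 also have "\<dots> \<le> B * (2 / K * 1)"
 proof (intro mult_left_mono)
  show "sqrt (cdist s K 0 \<alpha>) - sqrt (cdist s K t \<alpha>) \<le> 1"
   using sqrt_cdist_le_1[of 0 \<alpha>] real_sqrt_ge_zero[OF less_imp_le[OF d_pos]] by linarith
 qed (use B K in auto)
 finally show ?thesis by (simp add: field_simps)
qed

text \<open>Cauchy's inequality on that disc gives \<open>2 \<surd>2 B
 d\<^sup>-\<^sup>3\<^sup>/\<^sup>2\<close> for the derivative of the integrand; integrating costs
  \<open>2 / K\<close>, and \<open>4 \<surd>2 \<le> 6\<close>.\<close>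

lemma deriv_time_int_bound: "norm (deriv (time_int f t) \<alpha>) \<le> 6 * B / K / sqrt (cdist s K t \<alpha>)"
proof -
 note I = has_integral_mult_right[OF has_integral_cdist(2)[OF K _ d_pos], of "3 * B"]
 have t0: "0 \<le> t" using t by simp
 have "norm (integral {0..t} (\<lambda>\<tau>. deriv (f \<tau>) \<alpha>)) \<le> integral {0..t} (\<lambda>\<tau>. 3 * B * (1 / (cdist s K \<tau> \<alpha> * sqrt (cdist s K \<tau> \<alpha>))))"
 proof (rule integral_norm_bound_integral[OF time_int_deriv(2)])
  show "(\<lambda>\<tau>. 3 * B * (1 / (cdist s K \<tau> \<alpha> * sqrt (cdist s K \<tau> \<alpha>)))) integrable_on {0..t}" using I[OF t0] by blast
  fix \<tau> assume \<tau>: "\<tau> \<in> {0..t}"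
  define d where "d = cdist s K \<tau> \<alpha>"
  have d: "0 < d" "\<tau> \<in> {0..T}" using f_in_strip[OF \<tau> d_pos order_refl] d_pos by (auto simp: d_def)
  have w: "w \<in> strip (s - K * \<tau>)" "d / 2 \<le> cdist s K \<tau> w" if "w \<in> ball \<alpha> (d / 2)" for w
  proof -
   show "d / 2 \<le> cdist s K \<tau> w" using cdist_ball[of w \<alpha> \<tau>] that by (simp add: d_def)
   then have "0 < cdist s K \<tau> w" using d by simp
   then show "w \<in> strip (s - K * \<tau>)" by (simp only: cdist_pos_iff)
  qed
  have "norm (deriv (f \<tau>) \<alpha>) \<le> (B / sqrt (d / 2)) / (d / 2)"
  proof (rule norm_deriv_le)
   show "f \<tau> holomorphic_on ball \<alpha> (d / 2)" using hol[OF d(2)] w(1) by (meson holomorphic_on_subset subsetI)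
   show "norm (f \<tau> w) \<le> B / sqrt (d / 2)" if "w \<in> ball \<alpha> (d/2)" for w
    using bound[OF d(2) w(1)[OF that]] w(2)[OF that] d B by (elim order_trans) (intro divide_left_mono; simp)
  qed (use d in simp)
  also have "\<dots> = (2 * sqrt 2) * B * (1 / (d * sqrt d))" using d by (simp add: real_sqrt_divide field_simps)
  also have "\<dots> \<le> 3 * B * (1 / (d * sqrt d))"
  proof -
   have "sqrt 2 \<le> 3 / 2" by (rule real_le_lsqrt) (auto simp: power2_eq_square)
   then show ?thesis using d B by (intro mult_right_mono) auto
  qed
  finally show "norm (deriv (f \<tau>) \<alpha>) \<le> 3 * B * (1 / (cdist s K \<tau> \<alpha> * sqrt (cdist s K \<tau> \<alpha>)))" by (simp add: d_def)
 qed
 also have "\<dots> = 3 * B * (2 / K * (1 / sqrt (cdist s K t \<alpha>) - 1 / sqrt (cdist s K 0 \<alpha>)))"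
  using I[OF t0] by (rule integral_unique)
 also have "\<dots> \<le> 3 * B * (2 / K * (1 / sqrt (cdist s K t \<alpha>)))"
  using d_pos cdist_mono[OF t0, of \<alpha>] B K by (intro mult_left_mono) auto
 finally show ?thesis using DERIV_imp_deriv[OF time_int_deriv(1)] by (simp add: field_simps)
qed

lemma time_int_diff:
 assumes t': "0 \<le> t'" "t' \<le> t"
 shows "norm (time_int f t \<alpha> - time_int f t' \<alpha>) \<le> B / sqrt (cdist s K t \<alpha>) * (t - t')"
proof -
 have "time_int f t \<alpha> - time_int f t' \<alpha> = integral {t'..t} (\<lambda>\<tau>. f \<tau> \<alpha>)"
  unfolding time_int_def using Henstock_Kurzweil_Integration.integral_combine[OF t' integrable_f] by (simp add: algebra_simps)
 also have "norm \<dots> \<le> integral {t'..t} (\<lambda>\<tau>. B / sqrt (cdist s K t \<alpha>))"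
 proof (rule integral_norm_bound_integral)
  show "(\<lambda>\<tau>. f \<tau> \<alpha>) integrable_on {t'..t}" using integrable_f t' by (rule_tac integrable_subinterval_real) auto
  show "norm (f \<tau> \<alpha>) \<le> B / sqrt (cdist s K t \<alpha>)" if "\<tau> \<in> {t'..t}" for \<tau>
  proof -
   have \<tau>: "\<tau> \<in> {0..t}" using that t' by simp
   have "norm (f \<tau> \<alpha>) \<le> B / sqrt (cdist s K \<tau> \<alpha>)" using bound f_in_strip[OF \<tau> d_pos order_refl] by blast
   also have "\<dots> \<le> B / sqrt (cdist s K t \<alpha>)" using f_in_strip[OF \<tau> d_pos order_refl] d_pos B by (intro divide_left_mono) auto
   finally show ?thesis .
  qed
 qed auto
 also have "\<dots> = B / sqrt (cdist s K t \<alpha>) * (t - t')" using t' by simp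
 finally show ?thesis .
qed

end

lemma time_int_uniform_limit:
 assumes t: "t \<in> {0..T}" and s': "s' < s - K * t"
 shows "uniform_limit (strip s') (time_int f) (time_int f t) (at t within {0..T})"
proof (rule uniform_limitI)
 fix e :: real assume e: "0 < e"
 define q where "q = (s - K * t - s') / 2"
 have q: "0 < q" using s' by (simp add: q_def)
 define L where "L = B / sqrt q + 1"
 have L: "0 < L" using B q by (simp add: L_def add_nonneg_pos)
 define \<delta> where "\<delta> = min (e / L) (q / K)"
 have \<delta>: "0 < \<delta>" using e L q K by (simp add: \<delta>_def)
 have "dist (time_int f \<tau> w) (time_int f t w) < e" if \<tau>: "\<tau> \<in> {0..T}" "dist \<tau> t < \<delta>" and w: "w \<in> strip s'" for \<tau> w
 proof -
  define hi where "hi = max \<tau> t" define lo where "lo = min \<tau> t"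
  have hl: "0 \<le> lo" "lo \<le> hi" "hi \<in> {0..T}" "hi - lo = \<bar>\<tau> - t\<bar>" using \<tau> t by (auto simp: hi_def lo_def)
  have "hi - t \<le> q / K" using \<tau>(2) q K by (auto simp: hi_def \<delta>_def dist_real_def)
  then have "K * (hi - t) \<le> q" using K by (simp add: field_simps)
  then have cd: "q \<le> cdist s K hi w" using w by (simp add: cdist_def q_def field_simps)
  have ws: "w \<in> strip (s - K * hi)" using cd q by (simp only: cdist_pos_iff[symmetric])
  have "dist (time_int f \<tau> w) (time_int f t w) = norm (time_int f hi w - time_int f lo w)"
   by (auto simp: hi_def lo_def max_def min_def dist_norm norm_minus_commute)
  also have "\<dots> \<le> B / sqrt (cdist s K hi w) * (hi - lo)" by (rule time_int_diff[OF hl(3) ws hl(1,2)])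
  also have "\<dots> \<le> L * (hi - lo)"
  proof (rule mult_right_mono)
   have "B / sqrt (cdist s K hi w) \<le> B / sqrt q" using cd q B by (intro divide_left_mono) auto
   then show "B / sqrt (cdist s K hi w) \<le> L" by (simp add: L_def)
  qed (use hl in simp)
  also have "\<dots> < L * \<delta>" using hl(4) \<tau>(2) L by (simp add: dist_real_def)
  also have "\<dots> \<le> e" using L by (simp add: \<delta>_def min_def field_simps)
  finally show ?thesis .
 qed
 then show "\<forall>\<^sub>F \<tau> in at t within {0..T}. \<forall>w\<in>strip s'. dist (time_int f \<tau> w) (time_int f t w) < e"
  unfolding eventually_at using \<delta> by blast
qed

text \<open>Dominated convergence in time along a sequence of points going to infinity.\<close>

lemma time_int_decays:
 assumes t: "t \<in> {0..T}" and d: "\<And>\<tau>. \<tau> \<in> {0..T} \<Longrightarrow> decays (s - K * \<tau>) (f \<tau>)"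
 shows "decays (s - K * t) (time_int f t)"
proof (rule decays_seqI)
 fix s' and X :: "nat \<Rightarrow> complex"
 assume s': "s' < s - K * t" and X: "\<And>n. X n \<in> strip s'" and lim: "filterlim (\<lambda>n. norm (X n)) at_top sequentially"
 let ?M = "lebesgue_on {0..t}"
 define q where "q = s - K * t - s'"
 have q: "0 < q" using s' by (simp add: q_def)
 have cd: "q \<le> cdist s K t (X n)" for n using X[of n] by (simp add: q_def cdist_def)
 have Xt: "X n \<in> strip (s - K * t)" for n using X[of n] s' by simp
 have fin: "finite_measure ?M" by (rule finite_measure_lebesgue_on) (metis lmeasurable_cbox cbox_interval)
 have meas: "(\<lambda>\<tau>. f \<tau> (X n)) \<in> borel_measurable ?M" for n
  using cont[OF t Xt] by (rule continuous_imp_measurable_on_sets_lebesgue) simp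
 have intg: "integrable ?M (\<lambda>\<tau>. B / sqrt q)" using fin by (rule finite_measure.integrable_const)
 have bd: "norm (f \<tau> (X n)) \<le> B / sqrt q" if "\<tau> \<in> {0..t}" for \<tau> n
 proof -
  have fs: "q \<le> cdist s K \<tau> (X n)" using f_in_strip[OF t Xt that q cd] by blast
  have "norm (f \<tau> (X n)) \<le> B / sqrt (cdist s K \<tau> (X n))" using bound f_in_strip[OF t Xt that q cd] by blast
  also have "\<dots> \<le> B / sqrt q"
  proof (rule divide_left_mono)
   show "0 < sqrt (cdist s K \<tau> (X n)) * sqrt q" using fs q by simp
  qed (use fs B in auto)
  finally show ?thesis .
 qed
 have "(\<lambda>n. \<integral>\<tau>. f \<tau> (X n) \<partial>?M) \<longlonglongrightarrow> (\<integral>\<tau>. 0 \<partial>?M)"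
 proof (rule integral_dominated_convergence[OF _ meas intg])
  show "AE \<tau> in ?M. (\<lambda>n. f \<tau> (X n)) \<longlonglongrightarrow> 0"
  proof (rule AE_I2)
   fix \<tau> assume "\<tau> \<in> space ?M"
   then have \<tau>: "\<tau> \<in> {0..t}" by simp
   have "K * \<tau> \<le> K * t" using \<tau> K by simp
   then have "s' < s - K * \<tau>" using s' by simp
   then show "(\<lambda>n. f \<tau> (X n)) \<longlonglongrightarrow> 0" using decays_seqD[OF d _ X lim] \<tau> t by simp
  qed
  show "AE \<tau> in ?M. norm (f \<tau> (X n)) \<le> B / sqrt q" for n by (rule AE_I2) (use bd in simp)
 qed simp
 moreover have "(\<integral>\<tau>. f \<tau> (X n) \<partial>?M) = time_int f t (X n)" for n
  unfolding time_int_def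
 proof (rule lebesgue_integral_eq_integral)
  show "integrable ?M (\<lambda>\<tau>. f \<tau> (X n))"
  proof (rule Bochner_Integration.integrable_bound[OF intg meas], rule AE_I2)
   fix \<tau> assume "\<tau> \<in> space ?M"
   then show "norm (f \<tau> (X n)) \<le> norm (B / sqrt q)"
    unfolding real_norm_def by (intro order_trans[OF bd abs_ge_self]) simp
  qed
 qed simp
 ultimately show "(\<lambda>n. time_int f t (X n)) \<longlonglongrightarrow> 0" by simp
qed

lemma time_int_holomorphic: "t \<in> {0..T} \<Longrightarrow> time_int f t holomorphic_on strip (s - K * t)"
 unfolding holomorphic_on_open[OF open_complex_strip] using time_int_deriv(1) by blast

end

section \<open>An abstract Cauchy--Kovalevskaya theorem\<close>

text \<open>The ball of radius \<open>R\<close> around the reference displacement \<open>vs\<close>.\<close>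

definition near :: "(complex \<Rightarrow> complex) \<Rightarrow> real \<Rightarrow> real \<Rightarrow> (complex \<Rightarrow> complex) \<Rightarrow> bool" where
 "near vs R s v \<longleftrightarrow> v holomorphic_on strip s \<and> (\<forall>w\<in>strip s. norm (v w - vs w) \<le> R)"

lemma near_subset: "near vs R s v \<Longrightarrow> s' \<le> s \<Longrightarrow> near vs R s' v"
 unfolding near_def by (auto elim!: holomorphic_on_subset)

lemma deriv_diff_strip:
 assumes "u holomorphic_on strip s" "v holomorphic_on strip s" "w \<in> strip s"
 shows "deriv (\<lambda>w. u w - v w) w = deriv u w - deriv v w"
 using assms by (intro deriv_diff) (auto intro: holomorphic_on_imp_differentiable_at)

lemma deriv_cong_strip:
 assumes "\<And>w. w \<in> strip s \<Longrightarrow> u w = v w" "w \<in> strip s"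
 shows "deriv u w = deriv v w"
proof (rule deriv_cong_ev)
 show "\<forall>\<^sub>F x in nhds w. u x = v x"
  using assms open_complex_strip eventually_nhds by blast
qed simp

text \<open>An operator that loses one derivative, pointwise and in Lipschitz form, on every strip
 between half and full width.\<close>

locale ck_operator =
 fixes F :: "(complex \<Rightarrow> complex) \<Rightarrow> complex \<Rightarrow> complex" and vs :: "complex \<Rightarrow> complex" and s R C :: real
 assumes s: "0 < s" "s \<le> 1" and R: "0 < R" and C: "1 \<le> C"
  and vs_hol: "vs holomorphic_on strip s"
  and vs_deriv: "\<And>w. w \<in> strip s \<Longrightarrow> norm (deriv vs w) \<le> C"
  and F_hol: "\<And>s' v. s/2 \<le> s' \<Longrightarrow> s' \<le> s \<Longrightarrow> near vs R s' v \<Longrightarrow> F v holomorphic_on strip s'"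
  and F_lip: "\<And>s' v1 v2 N \<alpha>. s/2 \<le> s' \<Longrightarrow> s' \<le> s \<Longrightarrow> near vs R s' v1 \<Longrightarrow> near vs R s' v2 \<Longrightarrow>
   (\<And>w. w \<in> strip s' \<Longrightarrow> norm (v1 w - v2 w) \<le> N) \<Longrightarrow> \<alpha> \<in> strip s' \<Longrightarrow>
   norm (F v1 \<alpha> - F v2 \<alpha>) \<le> C * (norm (deriv v1 \<alpha> - deriv v2 \<alpha>) + (1 + norm (deriv v2 \<alpha>)) * N)"
  and F_bd: "\<And>\<alpha>. \<alpha> \<in> strip s \<Longrightarrow> norm (F vs \<alpha>) \<le> C"
begin

definition A :: real where "A = C * (1 + R) * (2 + C + R)"

lemma A_pos: "0 < A" using C R by (simp add: A_def)

text \<open>The space of the contraction argument: the displacement stays in the ball while its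
 derivative may blow up like the inverse square root of the distance to the boundary of the cone.\<close>

definition in_cone :: "real \<Rightarrow> real \<Rightarrow> (real \<Rightarrow> complex \<Rightarrow> complex) \<Rightarrow> bool" where
 "in_cone K T v \<longleftrightarrow>
   (\<forall>t\<in>{0..T}. near vs R (s - K * t) (v t) \<and>
    (\<forall>\<alpha>\<in>strip (s - K * t). norm (deriv (v t) \<alpha> - deriv vs \<alpha>) \<le> R / sqrt (cdist s K t \<alpha>)) \<and>
    (\<forall>s'<s - K * t. uniform_limit (strip s') v (v t) (at t within {0..T})))"

context
 fixes K T :: real assumes K: "0 < K" and T: "0 \<le> T" and KT: "K * T \<le> s / 4"
begin

lemma width: "t \<in> {0..T} \<Longrightarrow> 3/4 * s \<le> s - K * t \<and> s - K * t \<le> s"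
proof -
 assume t: "t \<in> {0..T}"
 then have "0 \<le> K * t" "K * t \<le> K * T" using K by auto
 then show ?thesis using KT by simp
qed

lemma width2: "t \<in> {0..T} \<Longrightarrow> s / 2 \<le> s - K * t" using width[of t] s by simp

lemma in_coneD:
 assumes "in_cone K T v" "t \<in> {0..T}"
 shows "near vs R (s - K * t) (v t)" "v t holomorphic_on strip (s - K * t)"
  "\<And>\<alpha>. \<alpha> \<in> strip (s - K * t) \<Longrightarrow> norm (v t \<alpha> - vs \<alpha>) \<le> R"
  "\<And>\<alpha>. \<alpha> \<in> strip (s - K * t) \<Longrightarrow> norm (deriv (v t) \<alpha> - deriv vs \<alpha>) \<le> R / sqrt (cdist s K t \<alpha>)"
  "\<And>s'. s' < s - K * t \<Longrightarrow> uniform_limit (strip s') v (v t) (at t within {0..T})"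
 using assms unfolding in_cone_def near_def by blast+

lemma near_vs: "s' \<le> s \<Longrightarrow> near vs R s' vs"
proof -
 assume "s' \<le> s"
 then have "strip s' \<subseteq> strip s" by auto
 then show ?thesis unfolding near_def using holomorphic_on_subset[OF vs_hol] R by auto
qed

lemma sqrt_cdist:
 assumes "t \<in> {0..T}" "\<alpha> \<in> strip (s - K * t)"
 shows "0 < sqrt (cdist s K t \<alpha>)" "sqrt (cdist s K t \<alpha>) \<le> 1" "0 < cdist s K t \<alpha>" "\<alpha> \<in> strip s"
proof -
 show p: "0 < cdist s K t \<alpha>" using assms(2) by (simp only: cdist_pos_iff)
 then show "0 < sqrt (cdist s K t \<alpha>)" by simp
 show "sqrt (cdist s K t \<alpha>) \<le> 1"
 proof -
  have "cdist s K t \<alpha> \<le> 1" using width[OF assms(1)] s unfolding cdist_def by linarith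
  then show ?thesis by simp
 qed
 show "\<alpha> \<in> strip s" using assms(2) width[OF assms(1)] by simp
qed

lemma le_div_sqrt: "t \<in> {0..T} \<Longrightarrow> \<alpha> \<in> strip (s - K * t) \<Longrightarrow> 0 \<le> x \<Longrightarrow> x \<le> x / sqrt (cdist s K t \<alpha>)"
 using sqrt_cdist[of t \<alpha>] by (simp add: le_divide_eq mult_left_le)

text \<open>Compare \<open>F(v)\<close> with \<open>F(vs)\<close> by the Lipschitz hypothesis;
  \<open>A\<close> collects the constants.\<close>

lemma F_bound:
 assumes v: "in_cone K T v" and t: "t \<in> {0..T}" and a: "\<alpha> \<in> strip (s - K * t)"
 shows "norm (F (v t) \<alpha>) \<le> A / sqrt (cdist s K t \<alpha>)"
proof -
 let ?d = "sqrt (cdist s K t \<alpha>)"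
 note d = sqrt_cdist[OF t a] and w = width[OF t] and w2 = width2[OF t]
 have "norm (F (v t) \<alpha> - F vs \<alpha>) \<le> C * (norm (deriv (v t) \<alpha> - deriv vs \<alpha>) + (1 + norm (deriv vs \<alpha>)) * R)"
  by (rule F_lip[OF w2 _ in_coneD(1)[OF v t] near_vs]) (use w a in_coneD(3)[OF v t] in auto)
 also have "\<dots> \<le> C * (R / ?d + (1 + C) * R)"
  using in_coneD(4)[OF v t a] vs_deriv[OF d(4)] C R by (intro mult_left_mono add_mono mult_right_mono) auto
 finally have "norm (F (v t) \<alpha>) \<le> C + C * (R / ?d + (1 + C) * R)"
  using F_bd[OF d(4)] norm_triangle_sub[of "F (v t) \<alpha>" "F vs \<alpha>"] by linarith
 also have "\<dots> \<le> C / ?d + C * (R / ?d + (1 + C) * R / ?d)"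
  using C R by (intro add_mono mult_left_mono le_div_sqrt[OF t a]) auto
 also have "\<dots> = C * (1 + 2 * R + C * R) / ?d" by (simp add: field_simps add_divide_distrib)
 also have "\<dots> \<le> A / ?d"
 proof (rule divide_right_mono)
  have "1 + 2 * R + C * R \<le> (1 + R) * (2 + C + R)" using C R by (simp add: algebra_simps)
  then show "C * (1 + 2 * R + C * R) \<le> A" using C by (simp add: A_def mult.assoc)
 qed (use d in simp)
 finally show ?thesis .
qed

lemma F_diff:
 assumes v1: "in_cone K T v1" and v2: "in_cone K T v2" and t: "t \<in> {0..T}" and a: "\<alpha> \<in> strip (s - K * t)"
  and N: "\<And>w. w \<in> strip (s - K * t) \<Longrightarrow> norm (v1 t w - v2 t w) \<le> N"
  and N': "norm (deriv (v1 t) \<alpha> - deriv (v2 t) \<alpha>) \<le> N / sqrt (cdist s K t \<alpha>)"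
 shows "norm (F (v1 t) \<alpha> - F (v2 t) \<alpha>) \<le> A * N / sqrt (cdist s K t \<alpha>)"
proof -
 let ?d = "sqrt (cdist s K t \<alpha>)"
 note d = sqrt_cdist[OF t a] and w = width[OF t] and w2 = width2[OF t]
 have N0: "0 \<le> N" using N[OF a] norm_ge_zero order_trans by blast
 have dv2: "norm (deriv (v2 t) \<alpha>) \<le> C + R / ?d"
  using in_coneD(4)[OF v2 t a] vs_deriv[OF d(4)] norm_triangle_sub[of "deriv (v2 t) \<alpha>" "deriv vs \<alpha>"] by linarith
 have "norm (F (v1 t) \<alpha> - F (v2 t) \<alpha>) \<le> C * (norm (deriv (v1 t) \<alpha> - deriv (v2 t) \<alpha>) + (1 + norm (deriv (v2 t) \<alpha>)) * N)"
  by (rule F_lip[OF w2 _ in_coneD(1)[OF v1 t] in_coneD(1)[OF v2 t]]) (use w a N in auto)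
 also have "\<dots> \<le> C * (N / ?d + (1 + (C + R / ?d)) * N)"
  using N' dv2 C N0 by (intro mult_left_mono add_mono mult_right_mono) auto
 also have "\<dots> \<le> C * (N / ?d + ((1 + C) / ?d + R / ?d) * N)"
 proof -
  have "1 + C \<le> (1 + C) / ?d" using C by (intro le_div_sqrt[OF t a]) simp
  then show ?thesis using C N0 by (intro mult_left_mono add_left_mono mult_right_mono) auto
 qed
 also have "\<dots> = C * (2 + C + R) * N / ?d" by (simp add: field_simps add_divide_distrib)
 also have "\<dots> \<le> A * N / ?d"
 proof (intro divide_right_mono mult_right_mono)
  have "C * (2 + C + R) * 1 \<le> C * (2 + C + R) * (1 + R)" using C R by (intro mult_left_mono) auto
  then show "C * (2 + C + R) \<le> A" by (simp add: A_def algebra_simps)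
 qed (use d N0 in auto)
 finally show ?thesis .
qed

text \<open>Uniform convergence of \<open>v\<close> on a smaller strip gives convergence of the
 derivative at \<open>\<alpha>\<close>, hence of \<open>F(v)\<close> there.\<close>

lemma F_cont:
 assumes v: "in_cone K T v" and t: "t \<in> {0..T}" and a: "\<alpha> \<in> strip (s - K * t)"
 shows "continuous_on {0..t} (\<lambda>\<tau>. F (v \<tau>) \<alpha>)"
 unfolding continuous_on_def
proof
 fix \<tau>0 assume \<tau>0: "\<tau>0 \<in> {0..t}"
 then have \<tau>0T: "\<tau>0 \<in> {0..T}" using t by auto
 define s' where "s' = max ((\<bar>Im \<alpha>\<bar> + (s - K * t)) / 2) (s / 2)"
 have "\<bar>Im \<alpha>\<bar> < (\<bar>Im \<alpha>\<bar> + (s - K * t)) / 2" using a by simp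
 then have s': "\<bar>Im \<alpha>\<bar> < s'" "s' < s - K * t" "s / 2 \<le> s'" "s' \<le> s"
  using a width[OF t] s by (auto simp: s'_def less_max_iff_disj)
 have mono: "s - K * t \<le> s - K * \<tau>" if "\<tau> \<in> {0..t}" for \<tau> using that K by auto
 define q where "q = s' - \<bar>Im \<alpha>\<bar>"
 have q: "0 < q" using s' by (simp add: q_def)
 have as': "\<alpha> \<in> strip s'" using s' by simp
 have nr: "near vs R s' (v \<tau>)" if "\<tau> \<in> {0..t}" for \<tau>
 proof (rule near_subset[OF in_coneD(1)[OF v]])
  show "\<tau> \<in> {0..T}" using that t by simp
  show "s' \<le> s - K * \<tau>" using mono[OF that] s' by linarith
 qed
 have ul: "uniform_limit (strip s') v (v \<tau>0) (at \<tau>0 within {0..t})"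
 proof -
  have "uniform_limit (strip s') v (v \<tau>0) (at \<tau>0 within {0..T})"
   using mono[OF \<tau>0] s' by (intro in_coneD(5)[OF v \<tau>0T]) simp
  moreover have "at \<tau>0 within {0..t} \<le> at \<tau>0 within {0..T}" using t by (intro at_le) auto
  ultimately show ?thesis using filterlim_mono[OF _ order_refl] by blast
 qed
 define D where "D = C * (1 / q + (1 + norm (deriv (v \<tau>0) \<alpha>)))"
 have D: "0 < D" using C q by (auto simp: D_def intro!: mult_pos_pos add_pos_nonneg)
 show "((\<lambda>\<tau>. F (v \<tau>) \<alpha>) \<longlongrightarrow> F (v \<tau>0) \<alpha>) (at \<tau>0 within {0..t})"
 proof (rule tendstoI)
  fix e :: real assume e: "0 < e"
  define e' where "e' = e / (2 * D)"
  have e': "0 < e'" using e D by (simp add: e'_def)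
  have "\<forall>\<^sub>F \<tau> in at \<tau>0 within {0..t}. \<tau> \<in> {0..t} \<and> (\<forall>w\<in>strip s'. dist (v \<tau> w) (v \<tau>0 w) < e')"
   using uniform_limitD[OF ul e'] by (simp add: eventually_conj_iff eventually_at_filter)
  then show "\<forall>\<^sub>F \<tau> in at \<tau>0 within {0..t}. dist (F (v \<tau>) \<alpha>) (F (v \<tau>0) \<alpha>) < e"
  proof eventually_elim
   case (elim \<tau>)
   have nd: "norm (v \<tau> w - v \<tau>0 w) \<le> e'" if "w \<in> strip s'" for w
    using elim that by (auto simp: dist_norm less_imp_le)
   note n1 = nr[of \<tau>] and n0 = nr[OF \<tau>0]
   have h: "v \<tau> holomorphic_on strip s'" "v \<tau>0 holomorphic_on strip s'" using n1 n0 elim by (auto simp: near_def)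
   have "norm (deriv (\<lambda>w. v \<tau> w - v \<tau>0 w) \<alpha>) \<le> e' / q"
    using h nd q by (intro norm_deriv_le_strip[of _ s']) (auto intro: holomorphic_on_diff simp: q_def)
   then have "norm (deriv (v \<tau>) \<alpha> - deriv (v \<tau>0) \<alpha>) \<le> e' / q" by (simp add: deriv_diff_strip[OF h as'])
   moreover have "norm (F (v \<tau>) \<alpha> - F (v \<tau>0) \<alpha>) \<le> C * (norm (deriv (v \<tau>) \<alpha> - deriv (v \<tau>0) \<alpha>) + (1 + norm (deriv (v \<tau>0) \<alpha>)) * e')"
    using elim by (intro F_lip[OF s'(3,4) n1 n0 nd as']) auto
   ultimately have "norm (F (v \<tau>) \<alpha> - F (v \<tau>0) \<alpha>) \<le> C * (e' / q + (1 + norm (deriv (v \<tau>0) \<alpha>)) * e')"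
    using C by (meson add_right_mono mult_left_mono order_trans zero_le_one)
   also have "\<dots> = D * e'" by (simp add: D_def algebra_simps)
   also have "\<dots> < e" using e D by (simp add: e'_def)
   finally show ?case by (simp add: dist_norm)
  qed
 qed
qed

lemma F_cone:
 assumes "in_cone K T v" shows "cone_integrand s K T A (\<lambda>\<tau>. F (v \<tau>))"
proof
 show "F (v \<tau>) holomorphic_on strip (s - K * \<tau>)" if "\<tau> \<in> {0..T}" for \<tau>
  using F_hol[OF width2[OF that] _ in_coneD(1)[OF assms that]] width[OF that] by simp
qed (use s K A_pos F_bound[OF assms] F_cont[OF assms] in auto)

lemma F_diff_cone:
 assumes v1: "in_cone K T v1" and v2: "in_cone K T v2" and N0: "0 \<le> N"
  and N: "\<And>t w. t \<in> {0..T} \<Longrightarrow> w \<in> strip (s - K * t) \<Longrightarrow> norm (v1 t w - v2 t w) \<le> N"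
  and N': "\<And>t w. t \<in> {0..T} \<Longrightarrow> w \<in> strip (s - K * t) \<Longrightarrow> norm (deriv (v1 t) w - deriv (v2 t) w) \<le> N / sqrt (cdist s K t w)"
 shows "cone_integrand s K T (A * N) (\<lambda>\<tau> \<alpha>. F (v1 \<tau>) \<alpha> - F (v2 \<tau>) \<alpha>)"
proof -
 interpret c1: cone_integrand s K T A "\<lambda>\<tau>. F (v1 \<tau>)" by (rule F_cone[OF v1])
 interpret c2: cone_integrand s K T A "\<lambda>\<tau>. F (v2 \<tau>)" by (rule F_cone[OF v2])
 show ?thesis
 proof
  show "(\<lambda>\<alpha>. F (v1 \<tau>) \<alpha> - F (v2 \<tau>) \<alpha>) holomorphic_on strip (s - K * \<tau>)" if "\<tau> \<in> {0..T}" for \<tau>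
   using c1.hol[OF that] c2.hol[OF that] by (rule holomorphic_on_diff)
  show "norm (F (v1 \<tau>) \<alpha> - F (v2 \<tau>) \<alpha>) \<le> A * N / sqrt (cdist s K \<tau> \<alpha>)" if "\<tau> \<in> {0..T}" "\<alpha> \<in> strip (s - K * \<tau>)" for \<tau> \<alpha>
   by (rule F_diff[OF v1 v2 that N[OF that(1)] N'[OF that]])
  show "continuous_on {0..t} (\<lambda>\<tau>. F (v1 \<tau>) \<alpha> - F (v2 \<tau>) \<alpha>)" if "t \<in> {0..T}" "\<alpha> \<in> strip (s - K * t)" for t \<alpha>
   using c1.cont[OF that] c2.cont[OF that] by (rule continuous_on_diff)
 qed (use s K A_pos N0 in auto)
qed

text \<open>Half of the norm is gained from the factor \<open>1 / K\<close> in
  \<open>time_int_bound\<close> and \<open>deriv_time_int_bound\<close> when the cone is steep.\<close>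

lemma contraction:
 assumes v1: "in_cone K T v1" and v2: "in_cone K T v2" and N0: "0 \<le> N" and KA: "12 * A \<le> K"
  and N: "\<And>t w. t \<in> {0..T} \<Longrightarrow> w \<in> strip (s - K * t) \<Longrightarrow> norm (v1 t w - v2 t w) \<le> N"
  and N': "\<And>t w. t \<in> {0..T} \<Longrightarrow> w \<in> strip (s - K * t) \<Longrightarrow> norm (deriv (v1 t) w - deriv (v2 t) w) \<le> N / sqrt (cdist s K t w)"
  and w1: "\<And>t w. t \<in> {0..T} \<Longrightarrow> w \<in> strip (s - K * t) \<Longrightarrow> w1 t w = vi w + time_int (\<lambda>\<tau>. F (v1 \<tau>)) t w"
  and w2: "\<And>t w. t \<in> {0..T} \<Longrightarrow> w \<in> strip (s - K * t) \<Longrightarrow> w2 t w = vi w + time_int (\<lambda>\<tau>. F (v2 \<tau>)) t w"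
  and vi: "vi holomorphic_on strip s"
  and t: "t \<in> {0..T}" and a: "\<alpha> \<in> strip (s - K * t)"
 shows "norm (w1 t \<alpha> - w2 t \<alpha>) \<le> N / 2" "norm (deriv (w1 t) \<alpha> - deriv (w2 t) \<alpha>) \<le> N / 2 / sqrt (cdist s K t \<alpha>)"
proof -
 let ?f = "\<lambda>\<tau> \<alpha>. F (v1 \<tau>) \<alpha> - F (v2 \<tau>) \<alpha>"
 interpret c1: cone_integrand s K T A "\<lambda>\<tau>. F (v1 \<tau>)" by (rule F_cone[OF v1])
 interpret c2: cone_integrand s K T A "\<lambda>\<tau>. F (v2 \<tau>)" by (rule F_cone[OF v2])
 interpret c: cone_integrand s K T "A * N" ?f by (rule F_diff_cone[OF v1 v2 N0 N N'])
 have eq: "w1 t w - w2 t w = time_int ?f t w" if "w \<in> strip (s - K * t)" for w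
  using integral_diff[OF c1.integrable_f[OF t that] c2.integrable_f[OF t that]] w1[OF t that] w2[OF t that] by (simp add: time_int_def)
 have 2: "2 * (A * N) / K \<le> N / 2" and 6: "6 * (A * N) / K \<le> N / 2"
 proof -
  have "0 \<le> A * N" using A_pos N0 by simp
  moreover have "12 * (A * N) \<le> N * K" using mult_right_mono[OF KA N0] by (simp add: mult_ac)
  ultimately have "2 * (A * N) \<le> N / 2 * K" "6 * (A * N) \<le> N / 2 * K" by linarith+
  then show "2 * (A * N) / K \<le> N / 2" "6 * (A * N) / K \<le> N / 2" using K by (simp_all add: pos_divide_le_eq)
 qed
 show "norm (w1 t \<alpha> - w2 t \<alpha>) \<le> N / 2" using c.time_int_bound[OF t a] 2 eq[OF a] by simp
 have sub: "strip (s - K * t) \<subseteq> strip s" using width[OF t] by auto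
 have h: "w1 t holomorphic_on strip (s - K * t)"
  by (rule holomorphic_transform[OF holomorphic_on_add[OF holomorphic_on_subset[OF vi sub] c1.time_int_holomorphic[OF t]]]) (use w1[OF t] in auto)
 have h2: "w2 t holomorphic_on strip (s - K * t)"
  by (rule holomorphic_transform[OF holomorphic_on_add[OF holomorphic_on_subset[OF vi sub] c2.time_int_holomorphic[OF t]]]) (use w2[OF t] in auto)
 have "deriv (w1 t) \<alpha> - deriv (w2 t) \<alpha> = deriv (time_int ?f t) \<alpha>"
  unfolding deriv_diff_strip[OF h h2 a, symmetric] by (rule deriv_cong_strip[OF eq a])
 then have "norm (deriv (w1 t) \<alpha> - deriv (w2 t) \<alpha>) \<le> 6 * (A * N) / K / sqrt (cdist s K t \<alpha>)"
  using c.deriv_time_int_bound[OF t a] by simp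
 also have "\<dots> \<le> N / 2 / sqrt (cdist s K t \<alpha>)" using 6 sqrt_cdist[OF t a] by (intro divide_right_mono) auto
 finally show "norm (deriv (w1 t) \<alpha> - deriv (w2 t) \<alpha>) \<le> N / 2 / sqrt (cdist s K t \<alpha>)" .
qed

lemma in_cone_dist:
 assumes v1: "in_cone K T v1" and v2: "in_cone K T v2" and t: "t \<in> {0..T}" and w: "w \<in> strip (s - K * t)"
 shows "norm (v1 t w - v2 t w) \<le> 2 * R" "norm (deriv (v1 t) w - deriv (v2 t) w) \<le> 2 * R / sqrt (cdist s K t w)"
proof -
 have tr: "norm (x - y) \<le> p + p" if "norm (x - z) \<le> p" "norm (y - z) \<le> p" for x y z :: complex and p
  using that norm_triangle_ineq4[of "x - z" "y - z"] by simp
 show "norm (v1 t w - v2 t w) \<le> 2 * R"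
  using tr[OF in_coneD(3)[OF v1 t w] in_coneD(3)[OF v2 t w]] by simp
 show "norm (deriv (v1 t) w - deriv (v2 t) w) \<le> 2 * R / sqrt (cdist s K t w)"
  using tr[OF in_coneD(4)[OF v1 t w] in_coneD(4)[OF v2 t w]] by simp
qed

text \<open>Iterate the contraction, starting from the trivial bound \<open>in_cone_dist\<close>.\<close>

lemma solution_unique:
 assumes v1: "in_cone K T v1" and v2: "in_cone K T v2" and KA: "12 * A \<le> K"
  and e1: "\<And>t w. t \<in> {0..T} \<Longrightarrow> w \<in> strip (s - K * t) \<Longrightarrow> v1 t w = vi w + time_int (\<lambda>\<tau>. F (v1 \<tau>)) t w"
  and e2: "\<And>t w. t \<in> {0..T} \<Longrightarrow> w \<in> strip (s - K * t) \<Longrightarrow> v2 t w = vi w + time_int (\<lambda>\<tau>. F (v2 \<tau>)) t w"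
  and vi: "vi holomorphic_on strip s"
  and t: "t \<in> {0..T}" and a: "\<alpha> \<in> strip (s - K * t)"
 shows "v1 t \<alpha> = v2 t \<alpha>"
proof -
 have "\<forall>t\<in>{0..T}. \<forall>w\<in>strip (s - K * t). norm (v1 t w - v2 t w) \<le> 2 * R / 2 ^ n
   \<and> norm (deriv (v1 t) w - deriv (v2 t) w) \<le> 2 * R / 2 ^ n / sqrt (cdist s K t w)" for n :: nat
 proof (induction n)
  case 0
  then show ?case using in_cone_dist[OF v1 v2] by auto
 next
  case (Suc n)
  have "norm (v1 t w - v2 t w) \<le> 2 * R / 2 ^ n / 2" "norm (deriv (v1 t) w - deriv (v2 t) w) \<le> 2 * R / 2 ^ n / 2 / sqrt (cdist s K t w)"
   if "t \<in> {0..T}" "w \<in> strip (s - K * t)" for t w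
   using contraction[OF v1 v2 _ KA _ _ e1 e2 vi that, of "2 * R / 2 ^ n"] Suc R by auto
  then show ?case by (simp add: field_simps)
 qed
 then have "norm (v1 t \<alpha> - v2 t \<alpha>) \<le> 2 * R / 2 ^ n" for n :: nat using t a by blast
 moreover have "(\<lambda>n. 2 * R / 2 ^ n) \<longlonglongrightarrow> 0" by real_asymp
 ultimately have "norm (v1 t \<alpha> - v2 t \<alpha>) \<le> 0" by (intro LIMSEQ_le_const[of _ 0]) auto
 then show ?thesis by simp
qed

lemma picard_step_in_cone:
 assumes v: "in_cone K T v" and KA: "12 * A \<le> K * R"
  and vi: "vi holomorphic_on strip s" "\<And>w. w \<in> strip s \<Longrightarrow> norm (vi w - vs w) \<le> R / 2"
   "\<And>w. w \<in> strip s \<Longrightarrow> norm (deriv vi w - deriv vs w) \<le> R / 2"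
 shows "in_cone K T (\<lambda>t w. vi w + time_int (\<lambda>\<tau>. F (v \<tau>)) t w)"
 unfolding in_cone_def
proof (intro ballI conjI allI impI)
 interpret c: cone_integrand s K T A "\<lambda>\<tau>. F (v \<tau>)" by (rule F_cone[OF v])
 let ?I = "time_int (\<lambda>\<tau>. F (v \<tau>))"
 fix t assume t: "t \<in> {0..T}"
 have sub: "strip (s - K * t) \<subseteq> strip s" using width[OF t] by auto
 have vih: "vi holomorphic_on strip (s - K * t)" by (rule holomorphic_on_subset[OF vi(1) sub])
 have q: "6 * A / K \<le> R / 2" "2 * A / K \<le> R / 2" using KA K A_pos by (auto simp: field_simps)
 have hI: "?I t holomorphic_on strip (s - K * t)" by (rule c.time_int_holomorphic[OF t])
 show "near vs R (s - K * t) (\<lambda>w. vi w + ?I t w)" unfolding near_def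
 proof (intro conjI ballI)
  show "(\<lambda>w. vi w + ?I t w) holomorphic_on strip (s - K * t)" using vih hI by (rule holomorphic_on_add)
  fix w assume w: "w \<in> strip (s - K * t)"
  have "norm (vi w + ?I t w - vs w) \<le> norm (vi w - vs w) + norm (?I t w)"
   using norm_triangle_ineq[of "vi w - vs w" "?I t w"] by (simp add: algebra_simps)
  also have "\<dots> \<le> R / 2 + R / 2" using vi(2)[of w] sub w c.time_int_bound[OF t w] q by (intro add_mono) auto
  finally show "norm (vi w + ?I t w - vs w) \<le> R" by simp
 qed
 fix \<alpha> assume a: "\<alpha> \<in> strip (s - K * t)"
 let ?d = "sqrt (cdist s K t \<alpha>)"
 have "deriv (\<lambda>w. vi w + ?I t w) \<alpha> = deriv vi \<alpha> + deriv (?I t) \<alpha>"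
  using vih hI a by (intro deriv_add) (auto intro: holomorphic_on_imp_differentiable_at)
 then have "norm (deriv (\<lambda>w. vi w + ?I t w) \<alpha> - deriv vs \<alpha>) \<le> norm (deriv vi \<alpha> - deriv vs \<alpha>) + norm (deriv (?I t) \<alpha>)"
  using norm_triangle_ineq[of "deriv vi \<alpha> - deriv vs \<alpha>" "deriv (?I t) \<alpha>"] by (simp add: algebra_simps)
 also have "\<dots> \<le> R / 2 / ?d + R / 2 / ?d"
 proof (rule add_mono)
  show "norm (deriv vi \<alpha> - deriv vs \<alpha>) \<le> R / 2 / ?d"
   using vi(3)[of \<alpha>] sub a le_div_sqrt[OF t a, of "R/2"] R by fastforce
  have "norm (deriv (?I t) \<alpha>) \<le> 6 * A / K / ?d" by (rule c.deriv_time_int_bound[OF t a])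
  also have "\<dots> \<le> R / 2 / ?d" using q sqrt_cdist[OF t a] by (intro divide_right_mono) auto
  finally show "norm (deriv (?I t) \<alpha>) \<le> R / 2 / ?d" .
 qed
 finally show "norm (deriv (\<lambda>w. vi w + ?I t w) \<alpha> - deriv vs \<alpha>) \<le> R / ?d" by simp
next
 interpret c: cone_integrand s K T A "\<lambda>\<tau>. F (v \<tau>)" by (rule F_cone[OF v])
 fix t s' assume t: "t \<in> {0..T}" and s': "s' < s - K * t"
 show "uniform_limit (strip s') (\<lambda>t w. vi w + time_int (\<lambda>\<tau>. F (v \<tau>)) t w) (\<lambda>w. vi w + time_int (\<lambda>\<tau>. F (v \<tau>)) t w) (at t within {0..T})"
  by (intro uniform_limit_intros c.time_int_uniform_limit[OF t s'])
qed

lemma in_cone_const: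
 assumes vi: "vi holomorphic_on strip s" "\<And>w. w \<in> strip s \<Longrightarrow> norm (vi w - vs w) \<le> R / 2"
   "\<And>w. w \<in> strip s \<Longrightarrow> norm (deriv vi w - deriv vs w) \<le> R / 2"
 shows "in_cone K T (\<lambda>t. vi)"
 unfolding in_cone_def
proof (intro ballI conjI allI impI)
 fix t assume t: "t \<in> {0..T}"
 have sub: "strip (s - K * t) \<subseteq> strip s" using width[OF t] by auto
 show "near vs R (s - K * t) vi" unfolding near_def using holomorphic_on_subset[OF vi(1) sub] vi(2) sub R by fastforce
 fix \<alpha> assume a: "\<alpha> \<in> strip (s - K * t)"
 have "norm (deriv vi \<alpha> - deriv vs \<alpha>) \<le> R" using vi(3)[of \<alpha>] sub a R by fastforce
 also have "\<dots> \<le> R / sqrt (cdist s K t \<alpha>)" using R by (intro le_div_sqrt[OF t a]) simp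
 finally show "norm (deriv vi \<alpha> - deriv vs \<alpha>) \<le> R / sqrt (cdist s K t \<alpha>)" .
next
 fix t s' assume "t \<in> {0..T}" "s' < s - K * t"
 show "uniform_limit (strip s') (\<lambda>t. vi) vi (at t within {0..T})" by (rule uniform_limit_const)
qed

text \<open>Completeness of the space: the limit is uniform on each strip, so it is holomorphic and
 derivatives converge as well.\<close>

lemma in_cone_limit:
 fixes V :: "nat \<Rightarrow> real \<Rightarrow> complex \<Rightarrow> complex" and \<epsilon> :: "nat \<Rightarrow> real"
 assumes V: "\<And>n. in_cone K T (V n)"
  and \<epsilon>: "\<epsilon> \<longlonglongrightarrow> 0" "\<And>n. 0 \<le> \<epsilon> n"
  and cl: "\<And>m n t w. n \<le> m \<Longrightarrow> t \<in> {0..T} \<Longrightarrow> w \<in> strip (s - K * t) \<Longrightarrow> norm (V m t w - V n t w) \<le> \<epsilon> n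
    \<and> norm (deriv (V m t) w - deriv (V n t) w) \<le> \<epsilon> n / sqrt (cdist s K t w)"
 obtains v where "in_cone K T v"
  "\<And>n t w. t \<in> {0..T} \<Longrightarrow> w \<in> strip (s - K * t) \<Longrightarrow> norm (V n t w - v t w) \<le> \<epsilon> n"
  "\<And>n t w. t \<in> {0..T} \<Longrightarrow> w \<in> strip (s - K * t) \<Longrightarrow> norm (deriv (V n t) w - deriv (v t) w) \<le> \<epsilon> n / sqrt (cdist s K t w)"
proof -
 define v where "v t w = lim (\<lambda>n. V n t w)" for t w
 have conv: "(\<lambda>n. V n t w) \<longlonglongrightarrow> v t w" if "t \<in> {0..T}" "w \<in> strip (s - K * t)" for t w
 proof -
  have "Cauchy (\<lambda>n. V n t w)"
  proof (rule CauchyI)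
   fix e :: real assume e: "0 < e"
   then have "eventually (\<lambda>n. \<epsilon> n < e / 2) sequentially" using order_tendstoD(2)[OF \<epsilon>(1), of "e/2"] by simp
   then obtain M where M: "\<epsilon> M < e / 2" by (auto simp: eventually_sequentially)
   have "norm (V m t w - V n t w) < e" if mn: "m \<ge> M" "n \<ge> M" for m n
   proof -
    have "norm (V m t w - V M t w) \<le> \<epsilon> M" "norm (V n t w - V M t w) \<le> \<epsilon> M" using cl mn that \<open>t \<in> {0..T}\<close> \<open>w \<in> _\<close> by blast+
    then show ?thesis using M norm_triangle_ineq4[of "V m t w - V M t w" "V n t w - V M t w"] by simp
   qed
   then show "\<exists>M. \<forall>m\<ge>M. \<forall>n\<ge>M. norm (V m t w - V n t w) < e" by blast
  qed
  then show ?thesis unfolding v_def by (simp add: Cauchy_convergent_iff convergent_LIMSEQ_iff)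
 qed
 have vd: "norm (V n t w - v t w) \<le> \<epsilon> n" if "t \<in> {0..T}" "w \<in> strip (s - K * t)" for n t w
 proof -
  have "(\<lambda>m. norm (V m t w - V n t w)) \<longlonglongrightarrow> norm (v t w - V n t w)" by (intro tendsto_intros conv that)
  moreover have "\<forall>\<^sub>F m in sequentially. norm (V m t w - V n t w) \<le> \<epsilon> n"
   using cl that unfolding eventually_sequentially by blast
  ultimately have "norm (v t w - V n t w) \<le> \<epsilon> n" by (intro tendsto_upperbound) auto
  then show ?thesis by (simp add: norm_minus_commute)
 qed
 have hol: "v t holomorphic_on strip (s - K * t)" if t: "t \<in> {0..T}" for t
 proof (rule holomorphic_uniform_sequence[OF open_complex_strip in_coneD(2)[OF V t]])
  fix x assume x: "x \<in> strip (s - K * t)"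
  then obtain d where d: "0 < d" "cball x d \<subseteq> strip (s - K * t)" using open_complex_strip open_contains_cball by blast
  have "uniform_limit (cball x d) (\<lambda>n. V n t) (v t) sequentially"
  proof (rule uniform_limitI)
   fix e :: real assume "0 < e"
   then have "eventually (\<lambda>n. \<epsilon> n < e) sequentially" using order_tendstoD(2)[OF \<epsilon>(1)] by simp
   then show "\<forall>\<^sub>F n in sequentially. \<forall>w\<in>cball x d. dist (V n t w) (v t w) < e"
   proof eventually_elim
    case (elim n)
    show ?case
    proof
     fix w assume "w \<in> cball x d"
     then have "w \<in> strip (s - K * t)" using d(2) by blast
     then show "dist (V n t w) (v t w) < e" unfolding dist_norm using le_less_trans[OF vd[OF t] elim] by blast
    qed
   qed
  qed
  then show "\<exists>d>0. cball x d \<subseteq> strip (s - K * t) \<and> uniform_limit (cball x d) (\<lambda>n. V n t) (v t) sequentially"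
   using d by blast
 qed
 have convd: "(\<lambda>n. deriv (V n t) w) \<longlonglongrightarrow> deriv (v t) w" if t: "t \<in> {0..T}" and w: "w \<in> strip (s - K * t)" for t w
 proof -
  have d: "0 < cdist s K t w" using sqrt_cdist[OF t w] by simp
  have e1: "norm (deriv (V n t) w - deriv (v t) w) \<le> \<epsilon> n / cdist s K t w" for n
   unfolding deriv_diff_strip[OF in_coneD(2)[OF V t] hol[OF t] w, symmetric]
   using vd[OF t] in_coneD(2)[OF V t] hol[OF t] d
   by (intro norm_deriv_le_strip[of _ "s - K * t"]) (auto intro: holomorphic_on_diff simp: cdist_def)
  have "(\<lambda>n. \<epsilon> n / cdist s K t w) \<longlonglongrightarrow> 0 / cdist s K t w" using d by (intro tendsto_intros \<epsilon>) auto
  then have e2: "(\<lambda>n. \<epsilon> n / cdist s K t w) \<longlonglongrightarrow> 0" by simp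
  have "(\<lambda>n. deriv (V n t) w - deriv (v t) w) \<longlonglongrightarrow> 0"
   by (rule Lim_null_comparison[OF _ e2]) (intro always_eventually allI e1)
  then show ?thesis by (rule LIM_zero_cancel)
 qed
 have vdd: "norm (deriv (V n t) w - deriv (v t) w) \<le> \<epsilon> n / sqrt (cdist s K t w)" if "t \<in> {0..T}" "w \<in> strip (s - K * t)" for n t w
 proof -
  have "(\<lambda>m. norm (deriv (V m t) w - deriv (V n t) w)) \<longlonglongrightarrow> norm (deriv (v t) w - deriv (V n t) w)" by (intro tendsto_intros convd that)
  moreover have "\<forall>\<^sub>F m in sequentially. norm (deriv (V m t) w - deriv (V n t) w) \<le> \<epsilon> n / sqrt (cdist s K t w)"
   using cl that unfolding eventually_sequentially by blast
  ultimately have "norm (deriv (v t) w - deriv (V n t) w) \<le> \<epsilon> n / sqrt (cdist s K t w)" by (intro tendsto_upperbound) auto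
  then show ?thesis by (simp add: norm_minus_commute)
 qed
 have "in_cone K T v" unfolding in_cone_def near_def
 proof (intro ballI conjI allI impI)
  fix t assume t: "t \<in> {0..T}"
  show "v t holomorphic_on strip (s - K * t)" by (rule hol[OF t])
  fix w assume w: "w \<in> strip (s - K * t)"
  have "(\<lambda>n. norm (V n t w - vs w)) \<longlonglongrightarrow> norm (v t w - vs w)" by (intro tendsto_intros conv t w)
  then show "norm (v t w - vs w) \<le> R" by (rule tendsto_upperbound) (use in_coneD(3)[OF V t w] in auto)
  have "(\<lambda>n. norm (deriv (V n t) w - deriv vs w)) \<longlonglongrightarrow> norm (deriv (v t) w - deriv vs w)" by (intro tendsto_intros convd t w)
  then show "norm (deriv (v t) w - deriv vs w) \<le> R / sqrt (cdist s K t w)" by (rule tendsto_upperbound) (use in_coneD(4)[OF V t w] in auto)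
 next
  fix t s' assume t: "t \<in> {0..T}" and s': "s' < s - K * t"
  show "uniform_limit (strip s') v (v t) (at t within {0..T})"
  proof (rule uniform_limitI)
   fix e :: real assume e: "0 < e"
   have "eventually (\<lambda>n. \<epsilon> n < e / 3) sequentially" using order_tendstoD(2)[OF \<epsilon>(1), of "e/3"] e by simp
   then obtain n where n: "\<epsilon> n < e / 3" by (auto simp: eventually_sequentially)
   have 1: "\<forall>\<^sub>F \<tau> in at t within {0..T}. \<forall>w\<in>strip s'. dist (V n \<tau> w) (V n t w) < e / 3"
    using uniform_limitD[OF in_coneD(5)[OF V t s'], of "e/3"] e by simp
   have 2: "\<forall>\<^sub>F \<tau> in at t within {0..T}. \<tau> \<in> {0..T} \<and> s' < s - K * \<tau>"
   proof -
    have "((\<lambda>\<tau>. s - K * \<tau>) \<longlongrightarrow> s - K * t) (at t within {0..T})" by (intro tendsto_intros)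
    then have "\<forall>\<^sub>F \<tau> in at t within {0..T}. s' < s - K * \<tau>" using order_tendstoD(1) s' by blast
    then show ?thesis by (simp add: eventually_conj_iff eventually_at_filter)
   qed
   show "\<forall>\<^sub>F \<tau> in at t within {0..T}. \<forall>w\<in>strip s'. dist (v \<tau> w) (v t w) < e"
    using 1 2
   proof eventually_elim
    case (elim \<tau>)
    show ?case
    proof
     fix w assume w: "w \<in> strip s'"
     have "norm (V n \<tau> w - v \<tau> w) \<le> \<epsilon> n" "norm (V n t w - v t w) \<le> \<epsilon> n"
      using vd[of \<tau> w n] vd[of t w n] elim t s' w by auto
     moreover have "norm (V n \<tau> w - V n t w) < e / 3" using elim w by (simp add: dist_norm)
     moreover have "v \<tau> w - v t w = (V n \<tau> w - V n t w) - (V n \<tau> w - v \<tau> w) + (V n t w - v t w)" by simp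
     ultimately show "dist (v \<tau> w) (v t w) < e"
      unfolding dist_norm using n norm_triangle_ineq4[of "V n \<tau> w - V n t w" "V n \<tau> w - v \<tau> w"]
       norm_triangle_ineq[of "(V n \<tau> w - V n t w) - (V n \<tau> w - v \<tau> w)" "V n t w - v t w"] by (simp only:)
    qed
   qed
  qed
 qed
 then show ?thesis using that vd vdd by blast
qed

text \<open>Picard iteration starting from the constant path \<open>vi\<close>. Decay at infinity passes
 to each iterate and then to the uniform limit.\<close>

lemma solution_exists:
 assumes KA: "12 * A \<le> K * R" "12 * A \<le> K"
  and vi: "vi holomorphic_on strip s" "\<And>w. w \<in> strip s \<Longrightarrow> norm (vi w - vs w) \<le> R / 2"
   "\<And>w. w \<in> strip s \<Longrightarrow> norm (deriv vi w - deriv vs w) \<le> R / 2"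
  and dec: "decays s vi" "\<And>s' v. s/2 \<le> s' \<Longrightarrow> s' \<le> s \<Longrightarrow> near vs R s' v \<Longrightarrow> decays s' v \<Longrightarrow> decays s' (F v)"
 obtains v where "in_cone K T v" "\<And>t w. t \<in> {0..T} \<Longrightarrow> w \<in> strip (s - K * t) \<Longrightarrow> v t w = vi w + time_int (\<lambda>\<tau>. F (v \<tau>)) t w"
  "\<And>t. t \<in> {0..T} \<Longrightarrow> decays (s - K * t) (v t)"
proof -
 define step where "step v = (\<lambda>t w. vi w + time_int (\<lambda>\<tau>. F (v \<tau>)) t w)" for v
 define V where "V n = (step ^^ n) (\<lambda>t. vi)" for n
 have V0: "V 0 = (\<lambda>t. vi)" and VS: "V (Suc n) = step (V n)" for n by (simp_all add: V_def)
 have cone: "in_cone K T (V n)" for n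
 proof (induction n)
  case 0 show ?case unfolding V0 by (rule in_cone_const[OF vi])
 next
  case (Suc n) show ?case unfolding VS step_def by (rule picard_step_in_cone[OF Suc KA(1) vi])
 qed
 have dV: "\<forall>t\<in>{0..T}. decays (s - K * t) (V n t)" for n
 proof (induction n)
  case 0
  have "decays (s - K * t) vi" if "t \<in> {0..T}" for t using dec(1) width[OF that] unfolding decays_def by auto
  then show ?case by (simp add: V0)
 next
  case (Suc n)
  interpret c: cone_integrand s K T A "\<lambda>\<tau>. F (V n \<tau>)" by (rule F_cone[OF cone])
  show ?case
  proof
   fix t assume t: "t \<in> {0..T}"
   have 1: "decays (s - K * t) vi" using dec(1) width[OF t] unfolding decays_def by auto
   have 2: "decays (s - K * t) (time_int (\<lambda>\<tau>. F (V n \<tau>)) t)"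
    by (rule c.time_int_decays[OF t]) (use dec(2) width2 width in_coneD(1)[OF cone] Suc in blast)
   show "decays (s - K * t) (V (Suc n) t)" unfolding VS step_def decays_def
    using tendsto_add[OF 1[unfolded decays_def, rule_format] 2[unfolded decays_def, rule_format]] by simp
  qed
 qed
 have step_le: "\<forall>t\<in>{0..T}. \<forall>w\<in>strip (s - K * t). norm (V (Suc n) t w - V n t w) \<le> 2 * R / 2 ^ n
   \<and> norm (deriv (V (Suc n) t) w - deriv (V n t) w) \<le> 2 * R / 2 ^ n / sqrt (cdist s K t w)" for n :: nat
 proof (induction n)
  case 0
  then show ?case using in_cone_dist[OF cone[of "Suc 0"] cone[of 0]] by auto
 next
  case (Suc n)
  have N0: "0 \<le> 2 * R / 2 ^ n" using R by simp
  have "norm (V (Suc (Suc n)) t w - V (Suc n) t w) \<le> 2 * R / 2 ^ n / 2 \<and>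
     norm (deriv (V (Suc (Suc n)) t) w - deriv (V (Suc n) t) w) \<le> 2 * R / 2 ^ n / 2 / sqrt (cdist s K t w)"
   if tw: "t \<in> {0..T}" "w \<in> strip (s - K * t)" for t w
  proof -
   have a: "norm (V (Suc n) t w - V n t w) \<le> 2 * R / 2 ^ n" if "t \<in> {0..T}" "w \<in> strip (s - K * t)" for t w
    using Suc that by blast
   have b: "norm (deriv (V (Suc n) t) w - deriv (V n t) w) \<le> 2 * R / 2 ^ n / sqrt (cdist s K t w)" if "t \<in> {0..T}" "w \<in> strip (s - K * t)" for t w
    using Suc that by blast
   have c: "V (Suc m) t w = vi w + time_int (\<lambda>\<tau>. F (V m \<tau>)) t w" for m t w
    unfolding VS step_def ..
   show ?thesis using contraction[OF cone cone N0 KA(2) a b c c vi(1) tw] by blast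
  qed
  then show ?case by (simp add: field_simps)
 qed
 define \<epsilon> where "\<epsilon> n = 4 * R / 2 ^ n" for n :: nat
 have eps: "\<epsilon> \<longlonglongrightarrow> 0" unfolding \<epsilon>_def by real_asymp
 have eps0: "0 \<le> \<epsilon> n" for n using R by (simp add: \<epsilon>_def)
 have cl: "norm (V m t w - V n t w) \<le> \<epsilon> n - \<epsilon> m \<and> norm (deriv (V m t) w - deriv (V n t) w) \<le> (\<epsilon> n - \<epsilon> m) / sqrt (cdist s K t w)"
  if "n \<le> m" "t \<in> {0..T}" "w \<in> strip (s - K * t)" for m n t w
  using that(1)
 proof (induction m rule: dec_induct)
  case base then show ?case by simp
 next
  case (step m)
  have e: "2 * R / 2 ^ m = \<epsilon> m - \<epsilon> (Suc m)" by (simp add: \<epsilon>_def field_simps)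
  note sl = step_le[of m, rule_format, OF that(2,3), unfolded e]
  have "norm (V (Suc m) t w - V n t w) \<le> \<epsilon> n - \<epsilon> (Suc m)"
   using sl step.IH norm_triangle_ineq[of "V (Suc m) t w - V m t w" "V m t w - V n t w"] by simp
  moreover have "norm (deriv (V (Suc m) t) w - deriv (V n t) w) \<le> (\<epsilon> n - \<epsilon> (Suc m)) / sqrt (cdist s K t w)"
   using sl step.IH norm_triangle_ineq[of "deriv (V (Suc m) t) w - deriv (V m t) w" "deriv (V m t) w - deriv (V n t) w"]
   by (simp add: diff_divide_distrib)
  ultimately show ?case ..
 qed
 have cl': "norm (V m t w - V n t w) \<le> \<epsilon> n \<and> norm (deriv (V m t) w - deriv (V n t) w) \<le> \<epsilon> n / sqrt (cdist s K t w)"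
  if "n \<le> m" "t \<in> {0..T}" "w \<in> strip (s - K * t)" for m n t w
 proof -
  have "(\<epsilon> n - \<epsilon> m) / sqrt (cdist s K t w) \<le> \<epsilon> n / sqrt (cdist s K t w)"
   using sqrt_cdist[OF that(2,3)] eps0[of m] by (intro divide_right_mono) auto
  then show ?thesis using cl[OF that] eps0[of m] by auto
 qed
 obtain v where v: "in_cone K T v"
  "\<And>n t w. t \<in> {0..T} \<Longrightarrow> w \<in> strip (s - K * t) \<Longrightarrow> norm (V n t w - v t w) \<le> \<epsilon> n"
  "\<And>n t w. t \<in> {0..T} \<Longrightarrow> w \<in> strip (s - K * t) \<Longrightarrow> norm (deriv (V n t) w - deriv (v t) w) \<le> \<epsilon> n / sqrt (cdist s K t w)"
  using in_cone_limit[OF cone eps eps0 cl'] by blast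
 have fp: "v t w = vi w + time_int (\<lambda>\<tau>. F (v \<tau>)) t w" if t: "t \<in> {0..T}" and w: "w \<in> strip (s - K * t)" for t w
 proof -
  have e1: "norm (V (Suc n) t w - step v t w) \<le> \<epsilon> n / 2" for n
   by (rule contraction(1)[OF cone[of n] v(1) eps0 KA(2) v(2) v(3) _ _ vi(1) t w]) (auto simp: VS step_def)
  have e2: "(\<lambda>n. \<epsilon> n / 2) \<longlonglongrightarrow> 0" using tendsto_divide[OF eps tendsto_const[of 2]] by simp
  have "(\<lambda>n. V (Suc n) t w - step v t w) \<longlonglongrightarrow> 0"
   by (rule Lim_null_comparison[OF _ e2]) (intro always_eventually allI e1)
  then have 1: "(\<lambda>n. V (Suc n) t w) \<longlonglongrightarrow> step v t w" by (rule LIM_zero_cancel)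
  have "(\<lambda>n. V (Suc n) t w - v t w) \<longlonglongrightarrow> 0"
   by (rule Lim_null_comparison[OF _ LIMSEQ_Suc[OF eps]]) (intro always_eventually allI v(2)[OF t w])
  then have "(\<lambda>n. V (Suc n) t w) \<longlonglongrightarrow> v t w" by (rule LIM_zero_cancel)
  then show ?thesis using LIMSEQ_unique[OF 1] by (simp add: step_def)
 qed
 have "decays (s - K * t) (v t)" if t: "t \<in> {0..T}" for t
  unfolding decays_iff_eps
 proof (intro allI impI)
  fix s' e :: real assume s': "s' < s - K * t" and e: "0 < e"
  have "eventually (\<lambda>n. \<epsilon> n < e / 2) sequentially" using order_tendstoD(2)[OF eps, of "e/2"] e by simp
  then obtain n where n: "\<epsilon> n < e / 2" by (auto simp: eventually_sequentially)
  obtain b where b: "\<And>w. w \<in> strip s' \<Longrightarrow> b \<le> norm w \<Longrightarrow> norm (V n t w) < e / 2"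
   using dV[of n] t s' e unfolding decays_iff_eps by (meson half_gt_zero)
  have "norm (v t w) < e" if "w \<in> strip s'" "b \<le> norm w" for w
   using b[OF that] n v(2)[of t w n] t that s' norm_triangle_ineq4[of "V n t w" "V n t w - v t w"] by simp
  then show "\<exists>b. \<forall>w\<in>strip s'. b \<le> norm w \<longrightarrow> norm (v t w) < e" by blast
 qed
 then show ?thesis using that v(1) fp by blast
qed

end

end

section \<open>Uniform bounds near a fixed curve\<close>

text \<open>A displacement with quantitative bounds twice as good as those of \<open>state\<close>, so
 that a whole neighbourhood of it consists of states. The strip of double width provides the bound on
 the derivative.\<close>

definition center :: "real \<Rightarrow> real \<Rightarrow> real \<Rightarrow> real \<Rightarrow> (complex \<Rightarrow> complex) \<Rightarrow> bool" where
 "center s M \<theta> \<mu> vs \<longleftrightarrow> 0 < s \<and> s \<le> 1 \<and> 0 \<le> M \<and> 0 < \<theta> \<and> 0 < \<mu> \<and> vs holomorphic_on strip (2 * s) \<and>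
   (\<forall>w\<in>strip (2 * s). norm (vs w) \<le> M) \<and>
   (\<forall>w\<in>strip s. \<bar>Im (pt vs w)\<bar> \<le> pi/2 - 2 * \<theta>) \<and>
   (\<forall>\<alpha>\<in>strip s. \<forall>\<eta>\<in>strip s. 2 * \<mu> * norm (\<alpha> - \<eta>) \<le> norm (pt vs \<alpha> - pt vs \<eta>))"

lemma norm_diff_le_strip:
 assumes h: "h holomorphic_on strip s" and d: "\<And>w. w \<in> strip s' \<Longrightarrow> norm (deriv h w) \<le> B"
  and ss: "s' \<le> s" and x: "x \<in> strip s'" and y: "y \<in> strip s'"
 shows "norm (h x - h y) \<le> B * norm (x - y)"
proof (rule field_differentiable_bound[OF convex_complex_strip[of s'] _ d x y])
 fix z assume "z \<in> strip s'"
 then have "z \<in> strip s" using ss by simp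
 then show "(h has_field_derivative deriv h z) (at z within strip s')"
  using h holomorphic_derivI has_field_derivative_at_within open_complex_strip by blast
qed

text \<open>For points at distance \<open>\<rho>\<close> the perturbation \<open>R\<close> is absorbed
 by the chord bound. In the narrow strip Cauchy's inequality makes the perturbation Lipschitz with a
 small constant.\<close>

lemma near_state:
 assumes c: "center s M \<theta> \<mu> vs" and R: "0 \<le> R" "R \<le> \<theta>" "R \<le> \<mu> * (s / 16) / 2"
  and s': "s / 2 \<le> s'" "s' \<le> s" and n: "near vs R s' v"
 shows "state s' (s / 16) (M + R) \<theta> (\<mu> * (s / 16)) v"
proof -
 define \<rho> where "\<rho> = s / 16"
 note c' = c[unfolded center_def]
 have r: "0 < \<rho>" "8 * \<rho> \<le> s'" "\<rho> \<le> 1" "s' \<le> s" using c' s' by (auto simp: \<rho>_def)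
 have v: "v holomorphic_on strip s'" "\<And>w. w \<in> strip s' \<Longrightarrow> norm (v w - vs w) \<le> R"
  using n by (auto simp: near_def)
 have vsh: "vs holomorphic_on strip s'"
  by (rule holomorphic_on_subset[of _ "strip (2 * s)"]) (use c' s' in auto)
 have diff: "norm ((v a - vs a) - (v e - vs e)) \<le> R / \<rho> * norm (a - e)" if "a \<in> strip (2 * \<rho>)" "e \<in> strip (2 * \<rho>)" for a e
 proof (rule norm_diff_le_strip[where h = "\<lambda>w. v w - vs w" and s = s' and s' = "2 * \<rho>"])
  show hd: "(\<lambda>w. v w - vs w) holomorphic_on strip s'" using v(1) vsh by (rule holomorphic_on_diff)
  show "norm (deriv (\<lambda>w. v w - vs w) w) \<le> R / \<rho>" if "w \<in> strip (2 * \<rho>)" for w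
   by (rule norm_deriv_le_strip[OF hd v(2)]) (use that r in auto)
 qed (use that r in auto)
 have pteq: "pt v a - pt v e = (pt vs a - pt vs e) + ((v a - vs a) - (v e - vs e))" for a e by (simp add: pt_def)
 have lowb: "norm (pt vs a - pt vs e) - norm ((v a - vs a) - (v e - vs e)) \<le> norm (pt v a - pt v e)" for a e
  unfolding pteq by (rule norm_diff_ineq)
 have cs: "2 * \<mu> * norm (a - e) \<le> norm (pt vs a - pt vs e)" if "a \<in> strip s'" "e \<in> strip s'" for a e
  using c' that s' by simp
 have mu: "0 < \<mu>" using c' by simp
 show ?thesis unfolding state_def \<rho>_def[symmetric]
 proof (intro conjI ballI impI)
  show "v holomorphic_on strip s'" by (rule v(1))
  fix w assume w: "w \<in> strip s'"
  have "norm (vs w) \<le> M" using c' w s' by auto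
  then show "norm (v w) \<le> M + R" using v(2)[OF w] norm_triangle_sub[of "v w" "vs w"] by linarith
  have "\<bar>Im (pt vs w)\<bar> \<le> pi/2 - 2 * \<theta>" using c' w s' by auto
  moreover have "Im (pt v w) = Im (pt vs w) + Im (v w - vs w)" by (simp add: pt_def)
  moreover have "\<bar>Im (v w - vs w)\<bar> \<le> R" using v(2)[OF w] abs_Im_le_cmod order_trans by blast
  ultimately show "\<bar>Im (pt v w)\<bar> \<le> pi/2 - \<theta>" using R by linarith
 next
  fix a e assume ae: "a \<in> strip s'" "e \<in> strip s'" and far: "\<rho> \<le> norm (a - e)"
  have "norm ((v a - vs a) - (v e - vs e)) \<le> 2 * R"
   using v(2)[OF ae(1)] v(2)[OF ae(2)] norm_triangle_ineq4[of "v a - vs a" "v e - vs e"] by linarith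
  moreover have "2 * \<mu> * \<rho> \<le> 2 * \<mu> * norm (a - e)" using far mu by (intro mult_left_mono) auto
  moreover have "2 * R \<le> \<mu> * \<rho>" using R by (simp add: \<rho>_def)
  ultimately show "\<mu> * \<rho> \<le> norm (pt v a - pt v e)" using lowb[of a e] cs[OF ae] by linarith
 next
  fix a e assume ae: "a \<in> strip (2 * \<rho>)" "e \<in> strip (2 * \<rho>)"
  then have ae': "a \<in> strip s'" "e \<in> strip s'" using r by auto
  have "R / \<rho> \<le> \<mu> / 2" using R r by (simp add: \<rho>_def field_simps)
  then have "R / \<rho> * norm (a - e) \<le> \<mu> / 2 * norm (a - e)" by (rule mult_right_mono) simp
  then have d2: "norm ((v a - vs a) - (v e - vs e)) \<le> \<mu> / 2 * norm (a - e)" by (rule order_trans[OF diff[OF ae]])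
  have "\<mu> * \<rho> * norm (a - e) \<le> \<mu> * norm (a - e)" using mu r by (intro mult_right_mono) auto
  also have "\<dots> \<le> 2 * \<mu> * norm (a - e) - \<mu> / 2 * norm (a - e)"
   using mu mult_nonneg_nonneg[of \<mu> "norm (a - e)"] by (simp add: algebra_simps)
  also have "\<dots> \<le> norm (pt vs a - pt vs e) - norm ((v a - vs a) - (v e - vs e))" by (rule diff_mono[OF cs[OF ae'] d2])
  also have "\<dots> \<le> norm (pt v a - pt v e)" by (rule lowb)
  finally show "\<mu> * \<rho> * norm (a - e) \<le> norm (pt v a - pt v e)" .
 qed (use c' r R in auto)
qed

lemma velocity_bound:
 assumes st: "state s \<rho> M \<theta> \<mu> v" and a: "\<alpha> \<in> strip s"
 shows "norm (velocity \<rho> v \<alpha>) \<le> reg_ker_const M (cosh_low M \<theta> \<mu>) * (norm (deriv v \<alpha>) + 2 * M / \<rho> + 2 * M) * (LBINT \<beta>. exp (- \<bar>\<beta>\<bar>))"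
proof -
 define \<sigma> where "\<sigma> = (if 0 \<le> Im \<alpha> then \<rho> else - \<rho>)"
 have ok: "shift_ok s \<rho> \<sigma> \<alpha>" using velocity_shift_ok[OF a stateD(1)[OF st]] by (simp add: \<sigma>_def)
 have "norm (LBINT \<beta>. reg_ker v \<alpha> (\<alpha> - of_real \<beta> - \<i> * of_real \<sigma>)) \<le>
   (LBINT \<beta>. reg_ker_const M (cosh_low M \<theta> \<mu>) * (norm (deriv v \<alpha>) + 2 * M / \<rho> + 2 * M) * exp (- \<bar>\<beta>\<bar>))"
  by (rule Bochner_Integration.integral_norm_bound_integral[OF shift_integrable[OF st ok]])
    (use shift_bound[OF st ok] integrable_exp_neg_abs in auto)
 then show ?thesis by (simp add: velocity_def shifted_def \<sigma>_def)
qed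

lemma center_vs_hol: "center s M \<theta> \<mu> vs \<Longrightarrow> s' \<le> 2 * s \<Longrightarrow> vs holomorphic_on strip s'"
 unfolding center_def by (elim conjE, erule holomorphic_on_subset) auto

lemma center_near_self: "center s M \<theta> \<mu> vs \<Longrightarrow> 0 \<le> R \<Longrightarrow> s' \<le> 2 * s \<Longrightarrow> near vs R s' vs"
 using center_vs_hol by (simp add: near_def)

lemma center_deriv:
 assumes "center s M \<theta> \<mu> vs" "w \<in> strip s" shows "norm (deriv vs w) \<le> M / s"
 by (rule norm_deriv_le_strip[of _ "2 * s"]) (use assms in \<open>auto simp: center_def\<close>)

text \<open>The velocity near a center satisfies the hypotheses of the abstract theorem, with constants
 that depend only on the data of the center.\<close>

lemma center_ck_operator:
 assumes c: "center s M \<theta> \<mu> vs" and R: "0 < R" "R \<le> \<theta>" "R \<le> \<mu> * (s / 16) / 2"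
 shows "\<exists>C. ck_operator (\<lambda>v \<alpha>. of_real \<kappa> * velocity (s / 16) v \<alpha>) vs s R C"
proof -
 note c' = c[unfolded center_def]
 have R0: "0 \<le> R" using R by simp
 let ?\<rho> = "s / 16" let ?M = "M + R" let ?\<mu> = "\<mu> * (s / 16)"
 note st = near_state[OF c R0 R(2,3)]
 define L where "L = velocity_lip ?\<rho> ?M \<theta> ?\<mu>"
 define B where "B = reg_ker_const ?M (cosh_low ?M \<theta> ?\<mu>) * (M / s + 2 * ?M / ?\<rho> + 2 * ?M) * (LBINT \<beta>. exp (- \<bar>\<beta>\<bar>))"
 define C where "C = Max {1, M / s, \<bar>\<kappa>\<bar> * L, \<bar>\<kappa>\<bar> * B}"
 have CC: "1 \<le> C" "M / s \<le> C" "\<bar>\<kappa>\<bar> * L \<le> C" "\<bar>\<kappa>\<bar> * B \<le> C" unfolding C_def by (rule Max_ge; simp)+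
 have "ck_operator (\<lambda>v \<alpha>. of_real \<kappa> * velocity ?\<rho> v \<alpha>) vs s R C"
 proof
  show "0 < s" "s \<le> 1" "0 < R" "1 \<le> C" using c' R CC by auto
  show "vs holomorphic_on strip s" using c' by (intro center_vs_hol[OF c]) auto
  show "norm (deriv vs w) \<le> C" if "w \<in> strip s" for w using center_deriv[OF c that] CC by simp
  show "(\<lambda>\<alpha>. of_real \<kappa> * velocity ?\<rho> v \<alpha>) holomorphic_on strip s'" if "s / 2 \<le> s'" "s' \<le> s" "near vs R s' v" for s' v
   by (intro holomorphic_intros velocity_holomorphic[OF st[OF that]])
  show "norm (of_real \<kappa> * velocity ?\<rho> v1 \<alpha> - of_real \<kappa> * velocity ?\<rho> v2 \<alpha>) \<le> C * (norm (deriv v1 \<alpha> - deriv v2 \<alpha>) + (1 + norm (deriv v2 \<alpha>)) * N)"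
   if a: "s / 2 \<le> s'" "s' \<le> s" "near vs R s' v1" "near vs R s' v2" "\<And>w. w \<in> strip s' \<Longrightarrow> norm (v1 w - v2 w) \<le> N" "\<alpha> \<in> strip s'" for s' v1 v2 N \<alpha>
  proof -
   have N0: "0 \<le> N" using a(5)[OF a(6)] norm_ge_zero order_trans by blast
   have "norm (of_real \<kappa> * velocity ?\<rho> v1 \<alpha> - of_real \<kappa> * velocity ?\<rho> v2 \<alpha>) = \<bar>\<kappa>\<bar> * norm (velocity ?\<rho> v1 \<alpha> - velocity ?\<rho> v2 \<alpha>)"
    by (simp add: norm_mult flip: right_diff_distrib)
   also have "\<dots> \<le> \<bar>\<kappa>\<bar> * (L * (norm (deriv v1 \<alpha> - deriv v2 \<alpha>) + (1 + norm (deriv v2 \<alpha>)) * N))"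
    unfolding L_def by (intro mult_left_mono velocity_lipschitz[OF st[OF a(1,2,3)] st[OF a(1,2,4)] a(5,6)]) auto
   also have "\<dots> \<le> C * (norm (deriv v1 \<alpha> - deriv v2 \<alpha>) + (1 + norm (deriv v2 \<alpha>)) * N)"
    using CC(3) N0 by (simp only: mult.assoc[symmetric]) (intro mult_right_mono add_nonneg_nonneg mult_nonneg_nonneg; simp)
   finally show ?thesis .
  qed
  show "norm (of_real \<kappa> * velocity ?\<rho> vs \<alpha>) \<le> C" if a: "\<alpha> \<in> strip s" for \<alpha>
  proof -
   have nn: "near vs R s vs" using c' by (intro center_near_self[OF c R0]) auto
   have "norm (velocity ?\<rho> vs \<alpha>) \<le> reg_ker_const ?M (cosh_low ?M \<theta> ?\<mu>) * (norm (deriv vs \<alpha>) + 2 * ?M / ?\<rho> + 2 * ?M) * (LBINT \<beta>. exp (- \<bar>\<beta>\<bar>))"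
    using c' by (intro velocity_bound[OF st[OF _ order_refl nn] a]) auto
   also have "\<dots> \<le> B" unfolding B_def
    using center_deriv[OF c a] c' R0
    by (intro mult_right_mono mult_left_mono add_mono integral_nonneg_AE) (auto simp: reg_ker_const_def)
   finally have "norm (velocity ?\<rho> vs \<alpha>) \<le> B" .
   then have "\<bar>\<kappa>\<bar> * norm (velocity ?\<rho> vs \<alpha>) \<le> \<bar>\<kappa>\<bar> * B" by (intro mult_left_mono) auto
   then show ?thesis using CC(4) by (simp add: norm_mult)
  qed
 qed
 then show ?thesis by blast
qed

section \<open>Principal values\<close>

lemma has_pv_integral_bounded_linear:
 assumes L: "bounded_linear L" and f: "has_pv_integral f \<alpha> I"
 shows "has_pv_integral (\<lambda>\<eta>. L (f \<eta>)) \<alpha> (L I)"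
proof -
 have ind: "indicator A x *\<^sub>R L y = L (indicator A x *\<^sub>R y)" for A x y
  by (simp add: linear_scale[OF bounded_linear.linear[OF L]])
 have si: "set_integrable lborel A (\<lambda>\<eta>. L (f \<eta>))" if "set_integrable lborel A f" for A
  using integrable_bounded_linear[OF L that[unfolded set_integrable_def]] by (simp add: set_integrable_def ind)
 have sl: "set_lebesgue_integral lborel A (\<lambda>\<eta>. L (f \<eta>)) = L (set_lebesgue_integral lborel A f)" if "set_integrable lborel A f" for A
  using integral_bounded_linear[OF L that[unfolded set_integrable_def]] by (simp add: set_lebesgue_integral_def ind)
 let ?A = "\<lambda>\<epsilon> R. {\<eta>. \<epsilon> < \<bar>\<eta> - \<alpha>\<bar> \<and> \<bar>\<eta> - \<alpha>\<bar> < R}"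
 have fi: "set_integrable lborel (?A \<epsilon> R) f" if "0 < \<epsilon>" for \<epsilon> R using f that by (simp add: has_pv_integral_def)
 have "((\<lambda>x. L ((\<lambda>(\<epsilon>, R). set_lebesgue_integral lborel (?A \<epsilon> R) f) x)) \<longlongrightarrow> L I) (at_right 0 \<times>\<^sub>F at_top)"
  using f by (intro bounded_linear.tendsto[OF L]) (simp add: has_pv_integral_def)
 moreover have "\<forall>\<^sub>F x in at_right 0 \<times>\<^sub>F at_top. L ((\<lambda>(\<epsilon>, R). set_lebesgue_integral lborel (?A \<epsilon> R) f) x) = (\<lambda>(\<epsilon>, R). set_lebesgue_integral lborel (?A \<epsilon> R) (\<lambda>\<eta>. L (f \<eta>))) x"
 proof -
  have "\<forall>\<^sub>F x in at_right (0::real) \<times>\<^sub>F (at_top::real filter). 0 < fst x"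
   by (rule eventually_compose_filterlim[OF eventually_at_right_less filterlim_fst])
  then show ?thesis
  proof eventually_elim
   case (elim x)
   then show ?case using sl[OF fi[of "fst x" "snd x"]] by (simp add: case_prod_beta)
  qed
 qed
 ultimately have "((\<lambda>(\<epsilon>, R). set_lebesgue_integral lborel (?A \<epsilon> R) (\<lambda>\<eta>. L (f \<eta>))) \<longlongrightarrow> L I) (at_right 0 \<times>\<^sub>F at_top)"
  by (rule Lim_transform_eventually)
 then show ?thesis unfolding has_pv_integral_def using si fi by blast
qed

lemma has_pv_integral_unique: "has_pv_integral f \<alpha> I \<Longrightarrow> has_pv_integral f \<alpha> J \<Longrightarrow> I = J"
 unfolding has_pv_integral_def
 by (elim conjE, erule tendsto_unique[rotated], assumption) (simp add: prod_filter_eq_bot)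

lemma has_pv_integral_cong:
 assumes "\<And>\<eta>. \<eta> \<noteq> \<alpha> \<Longrightarrow> f \<eta> = g \<eta>" "has_pv_integral f \<alpha> I" shows "has_pv_integral g \<alpha> I"
proof -
 let ?A = "\<lambda>\<epsilon> R. {\<eta>. \<epsilon> < \<bar>\<eta> - \<alpha>\<bar> \<and> \<bar>\<eta> - \<alpha>\<bar> < R}"
 have i: "indicator (?A \<epsilon> R) x *\<^sub>R f x = indicator (?A \<epsilon> R) x *\<^sub>R g x" if "0 < \<epsilon>" for \<epsilon> R x
  using assms(1)[of x] that by (auto simp: indicator_def)
 have si: "set_integrable lborel (?A \<epsilon> R) g" if "0 < \<epsilon>" for \<epsilon> R
  using assms(2) that i[OF that] unfolding has_pv_integral_def set_integrable_def by (metis (no_types, lifting) Bochner_Integration.integrable_cong)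
 have sl: "set_lebesgue_integral lborel (?A \<epsilon> R) f = set_lebesgue_integral lborel (?A \<epsilon> R) g" if "0 < \<epsilon>" for \<epsilon> R
  unfolding set_lebesgue_integral_def i[OF that] ..
 have "\<forall>\<^sub>F x in at_right 0 \<times>\<^sub>F at_top. (\<lambda>(\<epsilon>, R). set_lebesgue_integral lborel (?A \<epsilon> R) f) x = (\<lambda>(\<epsilon>, R). set_lebesgue_integral lborel (?A \<epsilon> R) g) x"
 proof -
  have "\<forall>\<^sub>F x in at_right (0::real) \<times>\<^sub>F (at_top::real filter). 0 < fst x"
   by (rule eventually_compose_filterlim[OF eventually_at_right_less filterlim_fst])
  then show ?thesis
  proof eventually_elim
   case (elim x)
   then show ?case using sl[of "fst x" "snd x"] by (simp add: case_prod_beta)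
  qed
 qed
 moreover have "((\<lambda>(\<epsilon>, R). set_lebesgue_integral lborel (?A \<epsilon> R) f) \<longlongrightarrow> I) (at_right 0 \<times>\<^sub>F at_top)"
  using assms(2) unfolding has_pv_integral_def by blast
 ultimately have "((\<lambda>(\<epsilon>, R). set_lebesgue_integral lborel (?A \<epsilon> R) g) \<longlongrightarrow> I) (at_right 0 \<times>\<^sub>F at_top)"
  by (rule Lim_transform_eventually[rotated])
 then show ?thesis using si unfolding has_pv_integral_def by blast
qed

text \<open>An absolutely convergent part contributes its integral, an exact derivative \<open>h =
 \<Gamma>'\<close> the limit of its symmetric boundary terms.\<close>

lemma has_pv_integral_split:
 fixes g h \<Gamma> :: "real \<Rightarrow> complex" and L :: complex
 assumes g: "integrable lborel g" and h: "continuous_on UNIV h"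
  and \<Gamma>: "\<And>\<eta>. (\<Gamma> has_vector_derivative h \<eta>) (at \<eta>)" and lim: "((\<lambda>R. \<Gamma> (\<alpha> + R) - \<Gamma> (\<alpha> - R)) \<longlongrightarrow> L) at_top"
 shows "has_pv_integral (\<lambda>\<eta>. g \<eta> + h \<eta>) \<alpha> (integral\<^sup>L lborel g + L)"
proof -
 define A where "A \<epsilon> R = {\<eta>. \<epsilon> < \<bar>\<eta> - \<alpha>\<bar> \<and> \<bar>\<eta> - \<alpha>\<bar> < R}" for \<epsilon> R
 have Am: "A \<epsilon> R \<in> sets lborel" for \<epsilon> R
 proof -
  have "open (A \<epsilon> R)" unfolding A_def by (intro open_Collect_conj open_Collect_less continuous_intros)
  then show ?thesis by simp
 qed
 have gi: "set_integrable lborel (A \<epsilon> R) g" for \<epsilon> R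
  unfolding set_integrable_def by (rule integrable_mult_indicator[OF Am g])
 have hc: "set_integrable lborel {a..b} h" for a b
  by (rule borel_integrable_compact[unfolded set_integrable_def[symmetric]]) (use h continuous_on_subset in auto)
 have hi: "set_integrable lborel (A \<epsilon> R) h" for \<epsilon> R
  by (rule set_integrable_subset[OF hc[of "\<alpha> - R" "\<alpha> + R"] Am]) (auto simp: A_def)
 have FTC: "(LBINT \<eta>:{a<..<b}. h \<eta>) = \<Gamma> b - \<Gamma> a" if "a \<le> b" for a b
 proof -
  have "(LBINT \<eta>:{a..b}. h \<eta>) = \<Gamma> b - \<Gamma> a"
   unfolding set_lebesgue_integral_def
   by (rule integral_FTC_atLeastAtMost[OF that]) (use \<Gamma> has_vector_derivative_at_within h continuous_on_subset in blast)+
  moreover have "(LBINT \<eta>:{a..b}. h \<eta>) = (LBINT \<eta>:{a<..<b}. h \<eta>)"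
   unfolding set_lebesgue_integral_def
  proof (rule integral_cong_AE)
   show "(\<lambda>x. indicat_real {a..b} x *\<^sub>R h x) \<in> borel_measurable lborel"
    by (rule borel_measurable_integrable[OF hc[unfolded set_integrable_def]])
   have "set_integrable lborel {a<..<b} h" by (rule set_integrable_subset[OF hc[of a b]]) auto
   then show "(\<lambda>x. indicat_real {a<..<b} x *\<^sub>R h x) \<in> borel_measurable lborel"
    unfolding set_integrable_def by (rule borel_measurable_integrable)
   show "AE x in lborel. indicat_real {a..b} x *\<^sub>R h x = indicat_real {a<..<b} x *\<^sub>R h x"
    using AE_lborel_singleton[of a] AE_lborel_singleton[of b]
    by eventually_elim (auto simp: indicator_def)
  qed
  ultimately show ?thesis by simp
 qed
 have hA: "(LBINT \<eta>:A \<epsilon> R. h \<eta>) = (\<Gamma> (\<alpha> + R) - \<Gamma> (\<alpha> - R)) - (\<Gamma> (\<alpha> + \<epsilon>) - \<Gamma> (\<alpha> - \<epsilon>))" if "0 < \<epsilon>" "\<epsilon> < R" for \<epsilon> R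
 proof -
  have "A \<epsilon> R = {\<alpha> - R<..<\<alpha> - \<epsilon>} \<union> {\<alpha> + \<epsilon><..<\<alpha> + R}" using that by (auto simp: A_def abs_if split: if_splits)
  then have "(LBINT \<eta>:A \<epsilon> R. h \<eta>) = (LBINT \<eta>:{\<alpha> - R<..<\<alpha> - \<epsilon>}. h \<eta>) + (LBINT \<eta>:{\<alpha> + \<epsilon><..<\<alpha> + R}. h \<eta>)"
   using that by (simp only:, intro set_integral_Un set_integrable_subset[OF hc[of "\<alpha> - R" "\<alpha> + R"]]) auto
  also have "\<dots> = (\<Gamma> (\<alpha> - \<epsilon>) - \<Gamma> (\<alpha> - R)) + (\<Gamma> (\<alpha> + R) - \<Gamma> (\<alpha> + \<epsilon>))" using that by (simp add: FTC)
  finally show ?thesis by simp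
 qed
 have f1: "filterlim fst (at_right (0::real)) (at_right 0 \<times>\<^sub>F (at_top::real filter))" and f2: "filterlim snd (at_top::real filter) (at_right (0::real) \<times>\<^sub>F at_top)"
  by (rule filterlim_fst filterlim_snd)+
 have ev: "\<forall>\<^sub>F x in at_right (0::real) \<times>\<^sub>F (at_top::real filter). 0 < fst x \<and> fst x < snd x"
 proof -
  have "\<forall>\<^sub>F x in at_right (0::real) \<times>\<^sub>F (at_top::real filter). 0 < fst x \<and> fst x < 1"
   using f1 eventually_at_right_real[of 0 1] unfolding filterlim_iff by (auto elim: eventually_mono)
  moreover have "\<forall>\<^sub>F x in at_right (0::real) \<times>\<^sub>F (at_top::real filter). 1 < snd x"
   using f2 eventually_gt_at_top[of 1] unfolding filterlim_iff by blast
  ultimately show ?thesis by eventually_elim auto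
 qed
 have c\<Gamma>: "isCont \<Gamma> x" for x using has_vector_derivative_continuous[OF \<Gamma>] by (simp add: continuous_at)
 have lim_eps: "((\<lambda>\<epsilon>. \<Gamma> (\<alpha> + \<epsilon>) - \<Gamma> (\<alpha> - \<epsilon>)) \<longlongrightarrow> 0) (at_right 0)"
 proof -
  have "((\<lambda>\<epsilon>. \<Gamma> (\<alpha> + \<epsilon>) - \<Gamma> (\<alpha> - \<epsilon>)) \<longlongrightarrow> \<Gamma> (\<alpha> + 0) - \<Gamma> (\<alpha> - 0)) (at_right 0)"
   by (intro tendsto_diff isCont_tendsto_compose[OF c\<Gamma>] tendsto_intros)
  then show ?thesis by simp
 qed
 have limh: "((\<lambda>x. LBINT \<eta>:A (fst x) (snd x). h \<eta>) \<longlongrightarrow> L) (at_right 0 \<times>\<^sub>F at_top)"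
 proof (rule tendsto_cong[THEN iffD2])
  show "\<forall>\<^sub>F x in at_right 0 \<times>\<^sub>F at_top. (LBINT \<eta>:A (fst x) (snd x). h \<eta>) = (\<Gamma> (\<alpha> + snd x) - \<Gamma> (\<alpha> - snd x)) - (\<Gamma> (\<alpha> + fst x) - \<Gamma> (\<alpha> - fst x))"
   using ev by eventually_elim (use hA in auto)
  have "((\<lambda>x. (\<Gamma> (\<alpha> + snd x) - \<Gamma> (\<alpha> - snd x)) - (\<Gamma> (\<alpha> + fst x) - \<Gamma> (\<alpha> - fst x))) \<longlongrightarrow> L - 0) (at_right 0 \<times>\<^sub>F at_top)"
   by (intro tendsto_diff filterlim_compose[OF lim f2] filterlim_compose[OF lim_eps f1])
  then show "((\<lambda>x. (\<Gamma> (\<alpha> + snd x) - \<Gamma> (\<alpha> - snd x)) - (\<Gamma> (\<alpha> + fst x) - \<Gamma> (\<alpha> - fst x))) \<longlongrightarrow> L) (at_right 0 \<times>\<^sub>F at_top)" by simp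
 qed
 define a where "a \<epsilon> = (LBINT \<eta>. indicator {\<alpha> - \<epsilon>..\<alpha> + \<epsilon>} \<eta> *\<^sub>R norm (g \<eta>))" for \<epsilon>
 define b where "b R = (LBINT \<eta>. indicator {\<eta>. R \<le> \<bar>\<eta> - \<alpha>\<bar>} \<eta> *\<^sub>R norm (g \<eta>))" for R
 have gn: "integrable lborel (\<lambda>\<eta>. norm (g \<eta>))" using g by simp
 have Cm: "{\<eta>. R \<le> \<bar>\<eta> - \<alpha>\<bar>} \<in> sets lborel" for R
 proof -
  have "closed {\<eta>. R \<le> \<bar>\<eta> - \<alpha>\<bar>}" by (intro closed_Collect_le continuous_intros)
  then show ?thesis by simp
 qed
 have ai: "integrable lborel (\<lambda>\<eta>. indicator {\<alpha> - \<epsilon>..\<alpha> + \<epsilon>} \<eta> *\<^sub>R norm (g \<eta>))" for \<epsilon>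
  by (rule integrable_mult_indicator[OF _ gn]) simp
 have bi: "integrable lborel (\<lambda>\<eta>. indicator {\<eta>. R \<le> \<bar>\<eta> - \<alpha>\<bar>} \<eta> *\<^sub>R norm (g \<eta>))" for R
  by (rule integrable_mult_indicator[OF Cm gn])
 have lima: "(a \<longlongrightarrow> 0) (at_right 0)"
 proof (rule tendsto_at_right_sequentially[of 0 1])
  fix S :: "nat \<Rightarrow> real" assume S: "\<And>n. 0 < S n" "S \<longlonglongrightarrow> 0"
  have "(\<lambda>n. a (S n)) \<longlonglongrightarrow> (LBINT \<eta>::real. 0::real)" unfolding a_def
  proof (rule integral_dominated_convergence[OF _ borel_measurable_integrable[OF ai] gn])
   show "AE \<eta> in lborel. (\<lambda>n. indicator {\<alpha> - S n..\<alpha> + S n} \<eta> *\<^sub>R norm (g \<eta>)) \<longlonglongrightarrow> 0"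
    using AE_lborel_singleton[of \<alpha>]
   proof eventually_elim
    case (elim \<eta>)
    then have "\<forall>\<^sub>F n in sequentially. S n < \<bar>\<eta> - \<alpha>\<bar>" using order_tendstoD(2)[OF S(2), of "\<bar>\<eta> - \<alpha>\<bar>"] by simp
    then have "\<forall>\<^sub>F n in sequentially. indicator {\<alpha> - S n..\<alpha> + S n} \<eta> *\<^sub>R norm (g \<eta>) = 0"
     by eventually_elim (auto simp: indicator_def)
    then show ?case by (rule tendsto_eventually)
   qed
  qed (auto simp: indicator_def intro!: AE_I2)
  then show "(\<lambda>n. a (S n)) \<longlonglongrightarrow> 0" by simp
 qed simp
 have limb: "(b \<longlongrightarrow> 0) at_top"
 proof -
  have "(b \<longlongrightarrow> (LBINT \<eta>::real. 0::real)) at_top" unfolding b_def[abs_def]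
  proof (rule integral_dominated_convergence_at_top[OF _ borel_measurable_integrable[OF bi] gn])
   show "\<forall>\<^sub>F R in at_top. AE \<eta> in lborel. norm (indicator {\<eta>. R \<le> \<bar>\<eta> - \<alpha>\<bar>} \<eta> *\<^sub>R norm (g \<eta>)) \<le> norm (g \<eta>)"
    by (intro always_eventually allI AE_I2) (auto simp: indicator_def)
   show "AE \<eta> in lborel. ((\<lambda>R. indicator {\<eta>. R \<le> \<bar>\<eta> - \<alpha>\<bar>} \<eta> *\<^sub>R norm (g \<eta>)) \<longlongrightarrow> 0) at_top"
   proof (rule AE_I2)
    fix \<eta>
    have "\<forall>\<^sub>F R in at_top. indicator {\<eta>. R \<le> \<bar>\<eta> - \<alpha>\<bar>} \<eta> *\<^sub>R norm (g \<eta>) = 0"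
     using eventually_gt_at_top[of "\<bar>\<eta> - \<alpha>\<bar>"] by eventually_elim (auto simp: indicator_def)
    then show "((\<lambda>R. indicator {\<eta>. R \<le> \<bar>\<eta> - \<alpha>\<bar>} \<eta> *\<^sub>R norm (g \<eta>)) \<longlongrightarrow> 0) at_top" by (rule tendsto_eventually)
   qed
  qed simp
  then show ?thesis by simp
 qed
 have gA: "norm ((LBINT \<eta>:A \<epsilon> R. g \<eta>) - integral\<^sup>L lborel g) \<le> a \<epsilon> + b R" for \<epsilon> R
 proof -
  have "(LBINT \<eta>:A \<epsilon> R. g \<eta>) - integral\<^sup>L lborel g = (LBINT \<eta>. indicator (A \<epsilon> R) \<eta> *\<^sub>R g \<eta> - g \<eta>)"
   unfolding set_lebesgue_integral_def using gi[unfolded set_integrable_def] g by (intro Bochner_Integration.integral_diff[symmetric])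
  also have "norm \<dots> \<le> (LBINT \<eta>. indicator {\<alpha> - \<epsilon>..\<alpha> + \<epsilon>} \<eta> *\<^sub>R norm (g \<eta>) + indicator {\<eta>. R \<le> \<bar>\<eta> - \<alpha>\<bar>} \<eta> *\<^sub>R norm (g \<eta>))"
  proof (rule Bochner_Integration.integral_norm_bound_integral)
   show "integrable lborel (\<lambda>\<eta>. indicator (A \<epsilon> R) \<eta> *\<^sub>R g \<eta> - g \<eta>)" using gi[unfolded set_integrable_def] g by (rule Bochner_Integration.integrable_diff)
   show "norm (indicator (A \<epsilon> R) \<eta> *\<^sub>R g \<eta> - g \<eta>) \<le> indicator {\<alpha> - \<epsilon>..\<alpha> + \<epsilon>} \<eta> *\<^sub>R norm (g \<eta>) + indicator {\<eta>. R \<le> \<bar>\<eta> - \<alpha>\<bar>} \<eta> *\<^sub>R norm (g \<eta>)" for \<eta>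
    by (auto simp: indicator_def A_def)
  qed (use ai bi in simp)
  also have "\<dots> = a \<epsilon> + b R" unfolding a_def b_def by (rule Bochner_Integration.integral_add[OF ai bi])
  finally show ?thesis .
 qed
 have limg: "((\<lambda>x. LBINT \<eta>:A (fst x) (snd x). g \<eta>) \<longlongrightarrow> integral\<^sup>L lborel g) (at_right 0 \<times>\<^sub>F at_top)"
 proof (rule LIM_zero_cancel, rule Lim_null_comparison[where g = "\<lambda>x. a (fst x) + b (snd x)"])
  show "\<forall>\<^sub>F x in at_right 0 \<times>\<^sub>F at_top. norm ((LBINT \<eta>:A (fst x) (snd x). g \<eta>) - integral\<^sup>L lborel g) \<le> a (fst x) + b (snd x)"
   using gA by simp
  have "((\<lambda>x. a (fst x) + b (snd x)) \<longlongrightarrow> 0 + 0) (at_right 0 \<times>\<^sub>F at_top)"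
   by (intro tendsto_add filterlim_compose[OF lima f1] filterlim_compose[OF limb f2])
  then show "((\<lambda>x. a (fst x) + b (snd x)) \<longlongrightarrow> 0) (at_right 0 \<times>\<^sub>F at_top)" by simp
 qed
 show ?thesis unfolding has_pv_integral_def A_def[symmetric]
 proof (intro conjI allI impI)
  show "set_integrable lborel (A \<epsilon> R) (\<lambda>\<eta>. g \<eta> + h \<eta>)" for \<epsilon> R using gi hi by (rule set_integral_add(1))
  have "((\<lambda>x. (LBINT \<eta>:A (fst x) (snd x). g \<eta>) + (LBINT \<eta>:A (fst x) (snd x). h \<eta>)) \<longlongrightarrow> integral\<^sup>L lborel g + L) (at_right 0 \<times>\<^sub>F at_top)"
   using limg limh by (rule tendsto_add)
  moreover have "(LBINT \<eta>:A \<epsilon> R. g \<eta> + h \<eta>) = (LBINT \<eta>:A \<epsilon> R. g \<eta>) + (LBINT \<eta>:A \<epsilon> R. h \<eta>)" for \<epsilon> R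
   using gi hi by (rule set_integral_add(2))
  ultimately show "((\<lambda>(\<epsilon>, R). LBINT \<eta>:A \<epsilon> R. g \<eta> + h \<eta>) \<longlongrightarrow> integral\<^sup>L lborel g + L) (at_right 0 \<times>\<^sub>F at_top)"
   by (simp add: case_prod_beta')
 qed
qed

section \<open>The Muskat equation for the holomorphic displacement\<close>

definition to_pair :: "complex \<Rightarrow> real \<times> real" where "to_pair z = (Re z, Im z)"

lemma bounded_linear_to_pair: "bounded_linear to_pair"
 unfolding to_pair_def[abs_def] by (intro bounded_linear_Pair bounded_linear_Re bounded_linear_Im)

lemma to_pair_simps: "to_pair (a + b) = to_pair a + to_pair b" "to_pair (a - b) = to_pair a - to_pair b" "to_pair (of_real r * a) = r *\<^sub>R to_pair a"
 by (simp_all add: to_pair_def)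

lemma to_pair_eq_iff: "to_pair a = to_pair b \<longleftrightarrow> a = b"
 by (simp add: to_pair_def complex_eq_iff)

definition curve :: "(complex \<Rightarrow> complex) \<Rightarrow> real \<Rightarrow> real \<times> real" where
 "curve v \<alpha> = to_pair (pt v (of_real \<alpha>))"

lemma curve_has_vector_derivative:
 assumes "v holomorphic_on strip s" "0 < s"
 shows "(curve v has_vector_derivative to_pair (1 + deriv v (of_real \<eta>))) (at \<eta>)"
proof -
 have "((\<lambda>x. pt v (complex_of_real x)) has_vector_derivative 1 + deriv v (of_real \<eta>)) (at \<eta>)"
  using pt_deriv[OF assms(1)] assms(2) by (intro has_vector_derivative_real_field) auto
 then show ?thesis unfolding curve_def[abs_def]
  by (rule bounded_linear.has_vector_derivative[OF bounded_linear_to_pair])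
qed

lemma vector_derivative_curve:
 assumes "v holomorphic_on strip s" "0 < s"
 shows "vector_derivative (curve v) (at \<eta>) = to_pair (1 + deriv v (of_real \<eta>))"
 using curve_has_vector_derivative[OF assms] by (rule vector_derivative_at)

lemma sinh_cnj: "sinh (cnj z) = cnj (sinh z)" and cosh_cnj: "cosh (cnj z) = cnj (cosh z)"
 by (simp_all add: sinh_field_def cosh_field_def exp_cnj flip: complex_cnj_minus)

lemma sinh_of_real': "sinh (complex_of_real x) = of_real (sinh x)" and cosh_of_real': "cosh (complex_of_real x) = of_real (cosh x)"
 by (simp_all add: sinh_field_def cosh_field_def exp_of_real flip: of_real_minus)

lemma tanh_of_real': "tanh (complex_of_real x) = of_real (tanh x)"
 by (simp add: tanh_def sinh_of_real' cosh_of_real')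

lemma norm_cosh_squared: "(norm (cosh z))\<^sup>2 = (sinh (Re z))\<^sup>2 + (cos (Im z))\<^sup>2" for z :: complex
proof -
 have "(norm (cosh z))\<^sup>2 = (cosh (Re z))\<^sup>2 * (cos (Im z))\<^sup>2 + (sinh (Re z))\<^sup>2 * (sin (Im z))\<^sup>2"
  by (simp add: cmod_power2 Re_cosh Im_cosh power_mult_distrib)
 also have "\<dots> = (sinh (Re z))\<^sup>2 * ((cos (Im z))\<^sup>2 + (sin (Im z))\<^sup>2) + (cos (Im z))\<^sup>2"
  by (simp add: cosh_square_eq algebra_simps del: sin_cos_squared_add sin_cos_squared_add2)
 finally show ?thesis by simp
qed

text \<open>The denominators of the real kernel are squared moduli of the complex \<open>sinh\<close>
 and \<open>cosh\<close>.\<close>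

lemma half_angle: "2 * ((sinh (x/2))\<^sup>2 + (sin (y/2))\<^sup>2) = cosh x - cos y" "2 * ((sinh (x/2))\<^sup>2 + (cos (y/2))\<^sup>2) = cosh x + cos y" for x y :: real
proof -
 have "cosh x = 1 + 2 * (sinh (x/2))\<^sup>2" using cosh_double[of "x/2"] by (simp add: cosh_square_eq)
 moreover have "cos y = 1 - 2 * (sin (y/2))\<^sup>2" "cos y = 2 * (cos (y/2))\<^sup>2 - 1"
  using cos_double_sin[of "y/2"] cos_double_cos[of "y/2"] by auto
 ultimately show "2 * ((sinh (x/2))\<^sup>2 + (sin (y/2))\<^sup>2) = cosh x - cos y" "2 * ((sinh (x/2))\<^sup>2 + (cos (y/2))\<^sup>2) = cosh x + cos y"
  by simp_all
qed

lemma coth_add_cnj: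
 fixes Z :: complex
 assumes "sinh (Z/2) \<noteq> 0"
 shows "cosh (Z/2) / sinh (Z/2) + cosh (cnj Z/2) / sinh (cnj Z/2) = of_real (2 * sinh (Re Z) / (cosh (Re Z) - cos (Im Z)))"
proof -
 have c: "cnj Z / 2 = cnj (Z/2)" by simp
 have nz: "sinh (cnj Z / 2) \<noteq> 0" using assms unfolding c sinh_cnj by simp
 have "cosh (Z/2) / sinh (Z/2) + cosh (cnj Z/2) / sinh (cnj Z/2) = sinh (Z/2 + cnj Z/2) / (sinh (Z/2) * sinh (cnj Z/2))"
  using assms nz by (simp only: sinh_add) (simp add: field_simps)
 also have "Z/2 + cnj Z/2 = of_real (Re Z)" by (simp add: complex_eq_iff)
 also have "sinh (Z/2) * sinh (cnj Z/2) = of_real ((norm (sinh (Z/2)))\<^sup>2)"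
  unfolding c sinh_cnj by (rule complex_norm_square[symmetric])
 also have "(norm (sinh (Z/2)))\<^sup>2 = (cosh (Re Z) - cos (Im Z)) / 2"
  using half_angle(1)[of "Re Z" "Im Z"] by (simp add: norm_sinh_squared)
 also have "sinh (complex_of_real (Re Z)) / of_real ((cosh (Re Z) - cos (Im Z)) / 2) = of_real (2 * sinh (Re Z) / (cosh (Re Z) - cos (Im Z)))"
  by (simp add: sinh_of_real' )
 finally show ?thesis .
qed

lemma tanh_add_cnj:
 fixes Z :: complex
 assumes "cosh (Z/2) \<noteq> 0"
 shows "tanh (Z/2) + tanh (cnj Z/2) = of_real (2 * sinh (Re Z) / (cosh (Re Z) + cos (Im Z)))"
proof -
 have c: "cnj Z / 2 = cnj (Z/2)" by simp
 have nz: "cosh (cnj Z / 2) \<noteq> 0" using assms unfolding c cosh_cnj by simp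
 have "tanh (Z/2) + tanh (cnj Z/2) = sinh (Z/2 + cnj Z/2) / (cosh (Z/2) * cosh (cnj Z/2))"
  using assms nz by (simp only: sinh_add) (simp add: tanh_def field_simps)
 also have "Z/2 + cnj Z/2 = of_real (Re Z)" by (simp add: complex_eq_iff)
 also have "cosh (Z/2) * cosh (cnj Z/2) = of_real ((norm (cosh (Z/2)))\<^sup>2)"
  unfolding c cosh_cnj by (rule complex_norm_square[symmetric])
 also have "(norm (cosh (Z/2)))\<^sup>2 = (cosh (Re Z) + cos (Im Z)) / 2"
  using half_angle(2)[of "Re Z" "Im Z"] by (simp add: norm_cosh_squared)
 also have "sinh (complex_of_real (Re Z)) / of_real ((cosh (Re Z) + cos (Im Z)) / 2) = of_real (2 * sinh (Re Z) / (cosh (Re Z) + cos (Im Z)))"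
  by (simp add: sinh_of_real' )
 finally show ?thesis .
qed

text \<open>Twice the integrand of the equation in complex form, defined for complex parameters.\<close>

definition full_ker :: "(complex \<Rightarrow> complex) \<Rightarrow> complex \<Rightarrow> complex \<Rightarrow> complex" where
 "full_ker v \<alpha> \<eta> =
   (deriv v \<alpha> - deriv v \<eta>) *
    (tanh ((pt v \<alpha> - pt v \<eta> + \<i> * of_real pi) / 2) + tanh ((pt (conj_refl v) \<alpha> - pt (conj_refl v) \<eta> + \<i> * of_real pi) / 2))
  + (deriv v \<alpha> - deriv (conj_refl v) \<eta>) *
    (tanh ((pt v \<alpha> - pt (conj_refl v) \<eta>) / 2) + tanh ((pt (conj_refl v) \<alpha> - pt v \<eta>) / 2))"

text \<open>On the real axis the sum of a complex \<open>coth\<close> or \<open>tanh\<close> and its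
 conjugate is the real kernel (\<open>coth_add_cnj\<close>, \<open>tanh_add_cnj\<close>).\<close>

lemma full_ker_real:
 assumes v: "v holomorphic_on strip s" "0 < s"
  and nz: "cosh_nz v (of_real \<alpha>) (of_real \<eta>)"
 shows "muskat_integrand (curve v) \<alpha> \<eta> = to_pair (full_ker v (of_real \<alpha>) (of_real \<eta>) / 2)"
proof -
 define P where "P = pt v (of_real \<alpha>)" define Q where "Q = pt v (of_real \<eta>)"
 define a where "a = deriv v (of_real \<alpha>)" define b where "b = deriv v (of_real \<eta>)"
 have r: "pt (conj_refl v) (of_real \<alpha>) = cnj P" "pt (conj_refl v) (of_real \<eta>) = cnj Q"
  "deriv (conj_refl v) (of_real \<eta>) = cnj b"
  using deriv_conj_refl[OF v(1), of "of_real \<eta>"] v(2) by (simp_all add: pt_conj_refl P_def Q_def b_def)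
 have n1: "sinh ((P - Q)/2) \<noteq> 0"
  using nz cosh_plus_half_pi[of "P - Q"] unfolding cosh_nz_def P_def Q_def by fastforce
 have n2: "cosh ((P - cnj Q)/2) \<noteq> 0" using nz unfolding cosh_nz_def r P_def[symmetric] Q_def[symmetric] by fastforce
 let ?k1 = "sinh (Re (P - Q)) / (cosh (Re (P - Q)) - cos (Im (P - Q)))"
 let ?k2 = "sinh (Re (P - Q)) / (cosh (Re (P - Q)) + cos (Im P + Im Q))"
 have "full_ker v (of_real \<alpha>) (of_real \<eta>) / 2 = of_real ?k1 * (a - b) + of_real ?k2 * (a - cnj b)"
 proof -
  have 1: "cosh ((P - Q)/2) / sinh ((P - Q)/2) + cosh ((cnj P - cnj Q)/2) / sinh ((cnj P - cnj Q)/2) = of_real (2 * ?k1)"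
   using coth_add_cnj[OF n1] by simp
  have 2: "tanh ((P - cnj Q)/2) + tanh ((cnj P - Q)/2) = of_real (2 * ?k2)"
   using tanh_add_cnj[OF n2] by simp
  have "full_ker v (of_real \<alpha>) (of_real \<eta>) = (a - b) * of_real (2 * ?k1) + (a - cnj b) * of_real (2 * ?k2)"
   unfolding full_ker_def tanh_plus_half_pi r P_def[symmetric] Q_def[symmetric] a_def[symmetric] b_def[symmetric] 1 2 ..
  moreover have "X / 2 = of_real k1 * (a - b) + of_real k2 * (a - cnj b)"
   if "X = (a - b) * of_real (2 * k1) + (a - cnj b) * of_real (2 * k2)" for X k1 k2
   using that by (simp add: field_simps)
  ultimately show ?thesis by blast
 qed
 then show ?thesis
  unfolding muskat_integrand_def vector_derivative_curve[OF v] Let_def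
  by (simp add: to_pair_simps curve_def to_pair_def P_def[symmetric] Q_def[symmetric] a_def[symmetric] b_def[symmetric])
qed

text \<open>The part of \<open>full_ker\<close> that does not decay. In \<open>\<eta>\<close> it is the
 derivative of \<open>- 8 v'(\<alpha>) ln cosh ((\<alpha> - \<eta>)/2) - 2 (v + conj_refl v)(\<eta>)
 tanh ((\<alpha> - \<eta>)/2)\<close>, which has no boundary terms after symmetric truncation.\<close>

definition ref_ker :: "(complex \<Rightarrow> complex) \<Rightarrow> real \<Rightarrow> real \<Rightarrow> complex" where
 "ref_ker v \<alpha> \<eta> = 4 * deriv v (of_real \<alpha>) * of_real (tanh ((\<alpha> - \<eta>) / 2))
   - 2 * (deriv v (of_real \<eta>) + deriv (conj_refl v) (of_real \<eta>)) * of_real (tanh ((\<alpha> - \<eta>) / 2))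
   + (v (of_real \<eta>) + conj_refl v (of_real \<eta>)) * of_real (1 - (tanh ((\<alpha> - \<eta>) / 2))\<^sup>2)"

lemma full_ker_split: "full_ker v (of_real \<alpha>) (of_real \<eta>) = reg_ker v (of_real \<alpha>) (of_real \<eta>) + ref_ker v \<alpha> \<eta>"
proof -
 have c: "(of_real \<alpha> - of_real \<eta>) / 2 = complex_of_real ((\<alpha> - \<eta>) / 2)" by simp
 have r: "1 - (tanh x)\<^sup>2 = 1 / (cosh x)\<^sup>2" for x :: real
 proof -
  have "1 - (tanh x)\<^sup>2 = ((cosh x)\<^sup>2 - (sinh x)\<^sup>2) / (cosh x)\<^sup>2"
   by (simp add: tanh_def power_divide diff_divide_distrib)
  then show ?thesis by (simp add: cosh_square_eq)
 qed
 have "1 / (cosh (complex_of_real x))\<^sup>2 = of_real (1 - (tanh x)\<^sup>2)" for x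
  unfolding r cosh_of_real' by simp
 then have s: "X / (cosh (complex_of_real x))\<^sup>2 = X * of_real (1 - (tanh x)\<^sup>2)" for X x
  by (metis (no_types, lifting) mult.right_neutral times_divide_eq_right)
 show ?thesis unfolding full_ker_def reg_ker_def ref_ker_def c tanh_of_real' s by (simp add: algebra_simps)
qed

text \<open>The splitting into an integrable and an exact part, with boundary terms that vanish because
  \<open>v\<close> decays.\<close>

lemma pv_muskat:
 assumes st: "state s \<rho> M \<theta> \<mu> v" and d: "decays s v"
 shows "has_pv_integral (muskat_integrand (curve v) \<alpha>) \<alpha> (to_pair (velocity \<rho> v (of_real \<alpha>) / 2))"
proof -
 note sd = stateD[OF st]
 have s0: "0 < s" using sd by simp
 let ?r = "conj_refl v"
 note hr = conj_refl_holomorphic[OF sd(7)]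
 define W where "W = (\<lambda>\<eta>. v (complex_of_real \<eta>) + ?r (of_real \<eta>))"
 define \<Gamma> where "\<Gamma> \<eta> = - 4 * deriv v (of_real \<alpha>) * of_real (ln (cosh ((\<alpha> - \<eta>) / 2))) - W \<eta> * of_real (tanh ((\<alpha> - \<eta>) / 2))" for \<eta>
 define h where "h \<eta> = ref_ker v \<alpha> \<eta> / 2" for \<eta>
 have reals: "complex_of_real x \<in> strip s" "complex_of_real x \<in> strip \<rho>" "complex_of_real x \<in> strip (2 * \<rho>)" for x
  using s0 sd(1) by auto
 have g: "integrable lborel (\<lambda>\<eta>. reg_ker v (of_real \<alpha>) (of_real \<eta>) / 2)"
 proof -
  have "integrable lborel (\<lambda>\<beta>. reg_ker v (of_real \<alpha>) (of_real \<alpha> - of_real \<beta>))"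
   using shifted_eq_unshifted(2)[OF st reals(2), of 0] sd(1) by simp
  from lborel_integrable_real_affine[OF this, of "-1" \<alpha>]
  show ?thesis by simp
 qed
 have gi: "(LBINT \<eta>. reg_ker v (of_real \<alpha>) (of_real \<eta>) / 2) = velocity \<rho> v (of_real \<alpha>) / 2"
 proof -
  have "(LBINT \<beta>. reg_ker v (of_real \<alpha>) (of_real \<alpha> - of_real \<beta>)) = (LBINT \<eta>. reg_ker v (of_real \<alpha>) (of_real \<eta>))"
   using lborel_integral_real_affine[of "-1" "\<lambda>\<beta>. reg_ker v (of_real \<alpha>) (of_real \<alpha> - of_real \<beta>)" \<alpha>] by simp
  then show ?thesis using velocity_eq_unshifted[OF st reals(2)] by simp
 qed
 have vd: "((\<lambda>x. u (complex_of_real x)) has_vector_derivative deriv u (of_real \<eta>)) (at \<eta>)" if "u holomorphic_on strip s" for u \<eta>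
  using holomorphic_derivI[OF that open_complex_strip reals(1)] by (intro has_vector_derivative_real_field) auto
 have Wd: "(W has_vector_derivative (deriv v (of_real \<eta>) + deriv ?r (of_real \<eta>))) (at \<eta>)" for \<eta>
  unfolding W_def by (intro has_vector_derivative_add vd sd(7) hr)
 have rd: "((\<lambda>\<eta>. complex_of_real (f \<eta>)) has_vector_derivative of_real D) (at x)" if "(f has_real_derivative D) (at x)" for f D x
  using that by (intro has_vector_derivative_of_real) (simp add: has_real_derivative_iff_has_vector_derivative)
 have lnd: "((\<lambda>\<eta>. ln (cosh ((\<alpha> - \<eta>) / 2))) has_real_derivative - tanh ((\<alpha> - \<eta>) / 2) / 2) (at \<eta>)" for \<eta>
  by (auto intro!: derivative_eq_intros simp: tanh_def)
 have td: "((\<lambda>\<eta>. tanh ((\<alpha> - \<eta>) / 2)) has_real_derivative - (1 - (tanh ((\<alpha> - \<eta>) / 2))\<^sup>2) / 2) (at \<eta>)" for \<eta>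
  by (auto intro!: derivative_eq_intros simp: field_simps)
 have \<Gamma>d: "(\<Gamma> has_vector_derivative h \<eta>) (at \<eta>)" for \<eta>
 proof -
  have "(\<Gamma> has_vector_derivative - 4 * deriv v (of_real \<alpha>) * of_real (- tanh ((\<alpha> - \<eta>) / 2) / 2)
    - (W \<eta> * of_real (- (1 - (tanh ((\<alpha> - \<eta>) / 2))\<^sup>2) / 2) + (deriv v (of_real \<eta>) + deriv ?r (of_real \<eta>)) * of_real (tanh ((\<alpha> - \<eta>) / 2)))) (at \<eta>)"
   unfolding \<Gamma>_def by (intro has_vector_derivative_diff has_vector_derivative_mult_right has_vector_derivative_mult rd lnd td Wd)
  then show ?thesis by (rule has_vector_derivative_eq_rhs) (simp add: h_def ref_ker_def W_def field_simps)
 qed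
 have cu: "continuous_on UNIV (\<lambda>x. u (complex_of_real x))" if "u holomorphic_on strip s" for u
  by (rule continuous_on_compose2[OF holomorphic_on_imp_continuous_on[OF that]]) (use reals in \<open>auto intro!: continuous_intros\<close>)
 have h: "continuous_on UNIV h" unfolding h_def ref_ker_def
  by (intro continuous_intros cu holomorphic_deriv sd(7) hr open_complex_strip) auto
 have Wlim: "filterlim X at_infinity at_top \<Longrightarrow> ((\<lambda>R. W (X R)) \<longlongrightarrow> 0) at_top" for X :: "real \<Rightarrow> real"
 proof -
  assume X: "filterlim X at_infinity at_top"
  have fl: "filterlim (\<lambda>R. complex_of_real (X R)) (inf at_infinity (principal (strip (s/2)))) at_top"
  proof -
   have "filterlim (\<lambda>R. complex_of_real (X R)) at_infinity at_top"
    using X by (simp add: filterlim_at_infinity_conv_norm_at_top)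
   then show ?thesis using s0 by (simp add: filterlim_inf filterlim_principal)
  qed
  have "(v \<longlongrightarrow> 0) (inf at_infinity (principal (strip (s/2))))" "(?r \<longlongrightarrow> 0) (inf at_infinity (principal (strip (s/2))))"
   using d decays_conj_refl[OF d] s0 unfolding decays_def by auto
  from tendsto_add[OF filterlim_compose[OF this(1) fl] filterlim_compose[OF this(2) fl]]
  show ?thesis by (simp add: W_def)
 qed
 have lim: "((\<lambda>R. \<Gamma> (\<alpha> + R) - \<Gamma> (\<alpha> - R)) \<longlongrightarrow> 0) at_top"
 proof (rule Lim_null_comparison)
  have e: "\<Gamma> (\<alpha> + R) - \<Gamma> (\<alpha> - R) = (W (\<alpha> + R) + W (\<alpha> - R)) * of_real (tanh (R / 2))" for R
   by (simp add: \<Gamma>_def algebra_simps)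
  show "\<forall>\<^sub>F R in at_top. norm (\<Gamma> (\<alpha> + R) - \<Gamma> (\<alpha> - R)) \<le> norm (W (\<alpha> + R) + W (\<alpha> - R))"
  proof (intro always_eventually allI)
   fix R :: real
   have "\<bar>tanh (R/2)\<bar> \<le> 1" using tanh_real_bounds[of "R/2"] by auto
   then show "norm (\<Gamma> (\<alpha> + R) - \<Gamma> (\<alpha> - R)) \<le> norm (W (\<alpha> + R) + W (\<alpha> - R))"
    unfolding e norm_mult norm_of_real by (intro mult_left_le) auto
  qed
  have "filterlim (\<lambda>R. \<alpha> + R) at_infinity at_top" "filterlim (\<lambda>R. \<alpha> - R) at_infinity at_top"
   by (rule filterlim_mono[OF _ at_top_le_at_infinity order_refl] filterlim_mono[OF _ at_bot_le_at_infinity order_refl], real_asymp)+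
  from tendsto_norm_zero[OF tendsto_add_zero[OF Wlim[OF this(1)] Wlim[OF this(2)]]]
  show "((\<lambda>R. norm (W (\<alpha> + R) + W (\<alpha> - R))) \<longlongrightarrow> 0) at_top" .
 qed
 have "has_pv_integral (\<lambda>\<eta>. reg_ker v (of_real \<alpha>) (of_real \<eta>) / 2 + h \<eta>) \<alpha> (velocity \<rho> v (of_real \<alpha>) / 2)"
  using has_pv_integral_split[OF g h \<Gamma>d lim] unfolding gi by simp
 from has_pv_integral_bounded_linear[OF bounded_linear_to_pair this]
 show ?thesis
 proof (rule has_pv_integral_cong[rotated])
  fix \<eta> assume "\<eta> \<noteq> \<alpha>"
  then have "cosh_nz v (of_real \<alpha>) (of_real \<eta>)" by (intro inner_cosh_nz[OF st reals(3) reals(3)]) auto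
  then show "to_pair (reg_ker v (of_real \<alpha>) (of_real \<eta>) / 2 + h \<eta>) = muskat_integrand (curve v) \<alpha> \<eta>"
   using full_ker_real[OF sd(7) s0] by (simp add: full_ker_split h_def add_divide_distrib)
 qed
qed

section \<open>Chord-arc bounds for regular curves\<close>

lemma flat_bounded:
 assumes h: "v holomorphic_on strip r" and r: "0 < r" and d: "decays r v"
 obtains M where "0 \<le> M" "\<And>w. w \<in> strip (r/2) \<Longrightarrow> norm (v w) \<le> M"
proof -
 have "\<exists>b. \<forall>w\<in>strip (r/2). b \<le> norm w \<longrightarrow> norm (v w) < 1"
  using d[unfolded decays_iff_eps, rule_format, of "r/2" 1] r by simp
 then obtain b where b: "\<And>w. w \<in> strip (r/2) \<Longrightarrow> b \<le> norm w \<Longrightarrow> norm (v w) < 1" by blast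
 define C where "C = cball 0 b \<inter> {w. Im w \<le> r/2} \<inter> {w. Im w \<ge> - r/2}"
 have "compact C" unfolding C_def
  by (intro compact_Int_closed compact_cball closed_halfspace_Im_le closed_halfspace_Im_ge)
 moreover have "C \<subseteq> strip r" using r by (auto simp: C_def)
 ultimately have "bounded (v ` C)"
  by (meson compact_continuous_image compact_imp_bounded continuous_on_subset h holomorphic_on_imp_continuous_on)
 then obtain M where M: "\<And>w. w \<in> C \<Longrightarrow> norm (v w) \<le> M" by (auto simp: bounded_iff)
 have "norm (v w) \<le> max M 1" if w: "w \<in> strip (r/2)" for w
 proof (cases "b \<le> norm w")
  case True then show ?thesis using b[OF w True] by simp
 next
  case False
  then have "w \<in> C" using w by (auto simp: C_def abs_less_iff)
  then show ?thesis using M[of w] by simp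
 qed
 then show ?thesis using that[of "max M 1"] by simp
qed

lemma pt_diff_lower:
 assumes "norm (v x - v y) \<le> c" shows "norm (x - y) - c \<le> norm (pt v x - pt v y)"
proof -
 have "pt v x - pt v y = (x - y) + (v x - v y)" by (simp add: pt_def)
 then show ?thesis using norm_diff_ineq[of "x - y" "v x - v y"] assms by simp
qed

text \<open>The qualitative properties that a solution has at each time.\<close>

locale regular_curve =
 fixes v :: "complex \<Rightarrow> complex" and r :: real
 assumes h: "v holomorphic_on strip r" and r: "0 < r" and d: "decays r v"
  and Im_lt: "\<And>x::real. \<bar>Im (v (of_real x))\<bar> < pi / 2"
  and inj_pt: "inj (\<lambda>x::real. pt v (of_real x))"
  and reg: "\<And>x::real. 1 + deriv v (of_real x) \<noteq> 0"
begin

definition M where "M = (SOME M. 0 \<le> M \<and> (\<forall>w\<in>strip (r/2). norm (v w) \<le> M))"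

lemma M: "0 \<le> M" "w \<in> strip (r/2) \<Longrightarrow> norm (v w) \<le> M"
proof -
 have "\<exists>M. 0 \<le> M \<and> (\<forall>w\<in>strip (r/2). norm (v w) \<le> M)" using flat_bounded[OF h r d] by metis
 from someI_ex[OF this, folded M_def] show "0 \<le> M" "w \<in> strip (r/2) \<Longrightarrow> norm (v w) \<le> M" by auto
qed

definition B1 where "B1 = M / (r/4)"
definition B2 where "B2 = B1 / (r/8)"

lemma hsub: "s \<le> r \<Longrightarrow> v holomorphic_on strip s"
 by (rule holomorphic_on_subset[OF h]) auto

lemma B1: "0 \<le> B1" "w \<in> strip (r/4) \<Longrightarrow> norm (deriv v w) \<le> B1"
proof -
 show "0 \<le> B1" using M r by (simp add: B1_def)
 assume "w \<in> strip (r/4)"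
 then show "norm (deriv v w) \<le> B1" unfolding B1_def
  using r by (intro norm_deriv_le_strip[of v "r/2"] hsub M) auto
qed

lemma B2: "0 \<le> B2" "w \<in> strip (r/8) \<Longrightarrow> norm (deriv (deriv v) w) \<le> B2"
proof -
 show "0 \<le> B2" using B1 r by (simp add: B2_def)
 assume "w \<in> strip (r/8)"
 then show "norm (deriv (deriv v) w) \<le> B2" unfolding B2_def
  using r by (intro norm_deriv_le_strip[of "deriv v" "r/4"] holomorphic_deriv hsub B1) auto
qed

lemma v_lip: "x \<in> strip (r/4) \<Longrightarrow> y \<in> strip (r/4) \<Longrightarrow> norm (v x - v y) \<le> B1 * norm (x - y)"
 by (rule norm_diff_le_strip[OF h, of "r/4"]) (use r B1(2) in auto)

lemma dv_lip: "x \<in> strip (r/8) \<Longrightarrow> y \<in> strip (r/8) \<Longrightarrow> norm (deriv v x - deriv v y) \<le> B2 * norm (x - y)"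
 by (rule norm_diff_le_strip[OF holomorphic_deriv[OF h open_complex_strip], of "r/8"]) (use r B2(2) in auto)

text \<open>Locally, chords are close to tangents.\<close>

lemma pt_linear:
 assumes a: "\<alpha> \<in> strip (r/8)" and e: "\<eta> \<in> strip (r/8)" and x: "x \<in> strip (r/8)"
  and dl: "norm (\<alpha> - \<eta>) \<le> \<delta>" "norm (\<eta> - x) \<le> \<delta>'"
 shows "norm (1 + deriv v x) * norm (\<alpha> - \<eta>) - B2 * (\<delta> + \<delta>') * norm (\<alpha> - \<eta>) \<le> norm (pt v \<alpha> - pt v \<eta>)"
proof -
 let ?S = "strip (r/8) \<inter> cball \<eta> \<delta>"
 let ?g = "\<lambda>w. v w - deriv v x * w"
 have d0: "0 \<le> \<delta>" using dl(1) norm_ge_zero order_trans by blast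
 have "norm (?g \<alpha> - ?g \<eta>) \<le> B2 * (\<delta> + \<delta>') * norm (\<alpha> - \<eta>)"
 proof (rule field_differentiable_bound[of ?S ?g "\<lambda>w. deriv v w - deriv v x"])
  show "convex ?S" by (intro convex_Int convex_complex_strip convex_cball)
  show "\<alpha> \<in> ?S" "\<eta> \<in> ?S" using a e dl d0 by (auto simp: dist_norm norm_minus_commute)
  fix w assume w: "w \<in> ?S"
  have "(v has_field_derivative deriv v w) (at w within ?S)"
   by (rule has_field_derivative_at_within, rule holomorphic_derivI[OF h open_complex_strip]) (use w r in auto)
  then show "(?g has_field_derivative deriv v w - deriv v x) (at w within ?S)"
   by (auto intro!: derivative_eq_intros)
  have "norm (w - x) \<le> \<delta> + \<delta>'"
   using w dl norm_triangle_ineq[of "w - \<eta>" "\<eta> - x"] by (simp add: dist_norm norm_minus_commute)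
  then have "B2 * norm (w - x) \<le> B2 * (\<delta> + \<delta>')" by (rule mult_left_mono[OF _ B2(1)])
  then show "norm (deriv v w - deriv v x) \<le> B2 * (\<delta> + \<delta>')" using dv_lip[of w x] w x by simp
 qed
 moreover have "pt v \<alpha> - pt v \<eta> = (1 + deriv v x) * (\<alpha> - \<eta>) + (?g \<alpha> - ?g \<eta>)" by (simp add: pt_def algebra_simps)
 ultimately show ?thesis
  using norm_diff_ineq[of "(1 + deriv v x) * (\<alpha> - \<eta>)" "?g \<alpha> - ?g \<eta>"] by (simp add: norm_mult)
qed

lemma cont_real:
 assumes "u holomorphic_on strip r" shows "continuous_on S (\<lambda>x::real. u (of_real x))"
proof (rule continuous_on_compose2[OF holomorphic_on_imp_continuous_on[OF assms]])
 show "continuous_on S complex_of_real" by (intro continuous_intros)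
 show "complex_of_real ` S \<subseteq> strip r" using r by auto
qed

lemmas cont_v_real = cont_real[OF h]
lemmas cont_dv_real = cont_real[OF holomorphic_deriv[OF h open_complex_strip]]

text \<open>Close to the diagonal this follows from \<open>pt_linear\<close> and regularity, for large
 parameters from decay, and on the remaining compact set from injectivity.\<close>

lemma real_chord_arc: "\<exists>m>0. \<forall>x y::real. m * \<bar>x - y\<bar> \<le> norm (pt v (of_real x) - pt v (of_real y))"
proof -
 have dd: "decays r (deriv v)" by (rule decays_deriv[OF h d])
 have "\<exists>b. \<forall>w\<in>strip (r/2). b \<le> norm w \<longrightarrow> norm (deriv v w) < 1/2"
  using dd[unfolded decays_iff_eps, rule_format, of "r/2" "1/2"] r by simp
 then obtain b0 where b0: "\<And>w. w \<in> strip (r/2) \<Longrightarrow> b0 \<le> norm w \<Longrightarrow> norm (deriv v w) < 1/2" by blast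
 define b where "b = max b0 0"
 have b: "norm (deriv v (of_real x)) \<le> 1/2" if "b \<le> \<bar>x\<bar>" for x :: real
  using b0[of "of_real x"] that r by (simp add: b_def)
 define B where "B = b + 4 * M + 1"
 have B0: "0 < B" using M by (simp add: B_def b_def)
 have half: "norm (v (of_real x) - v (of_real y)) \<le> 1/2 * \<bar>x - y\<bar>" if "\<And>z. z \<in> closed_segment x y \<Longrightarrow> b \<le> \<bar>z\<bar>" for x y :: real
 proof -
  have "norm (v (of_real x) - v (of_real y)) \<le> 1/2 * norm (complex_of_real x - of_real y)"
  proof (rule field_differentiable_bound[of "closed_segment (complex_of_real x) (of_real y)" v "deriv v"])
   fix z assume "z \<in> closed_segment (complex_of_real x) (of_real y)"
   then obtain t where t: "t \<in> closed_segment x y" "z = of_real t" by (auto simp: closed_segment_of_real)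
   then show "norm (deriv v z) \<le> 1/2" using b that by blast
   show "(v has_field_derivative deriv v z) (at z within closed_segment (complex_of_real x) (of_real y))"
    by (rule has_field_derivative_at_within, rule holomorphic_derivI[OF h open_complex_strip]) (use t r in auto)
  qed auto
  then show ?thesis by (simp flip: of_real_diff)
 qed
 have far: "1/2 * \<bar>x - y\<bar> \<le> norm (pt v (of_real x) - pt v (of_real y))" if "B \<le> \<bar>x\<bar>" for x y :: real
 proof (cases "4 * M + 1 \<le> \<bar>x - y\<bar>")
  case True
  have "norm (v (of_real x) - v (of_real y)) \<le> 2 * M"
   using M(2)[of "of_real x"] M(2)[of "of_real y"] r norm_triangle_ineq4[of "v (of_real x)" "v (of_real y)"] by simp
  from pt_diff_lower[of v "of_real x" "of_real y", OF this] show ?thesis using True by (simp flip: of_real_diff)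
 next
  case False
  have "b \<le> \<bar>z\<bar>" if "z \<in> closed_segment x y" for z
  proof -
   have "\<bar>x - z\<bar> \<le> \<bar>x - y\<bar>" using that by (auto simp: closed_segment_eq_real_ivl split: if_splits)
   then show ?thesis using False \<open>B \<le> \<bar>x\<bar>\<close> by (simp add: B_def)
  qed
  from pt_diff_lower[of v "of_real x" "of_real y", OF half[OF this]] show ?thesis by (simp flip: of_real_diff)
 qed
 have far': "1/2 * \<bar>x - y\<bar> \<le> norm (pt v (of_real x) - pt v (of_real y))" if "B \<le> \<bar>x\<bar> \<or> B \<le> \<bar>y\<bar>" for x y :: real
  using that far[of x y] far[of y x] by (auto simp: norm_minus_commute abs_minus_commute)
 have "\<exists>x\<in>{-B..B}. \<forall>y\<in>{-B..B}. norm (1 + deriv v (of_real x)) \<le> norm (1 + deriv v (of_real y))"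
 proof (rule continuous_attains_inf)
  show "continuous_on {-B..B} (\<lambda>x. norm (1 + deriv v (complex_of_real x)))"
   by (intro continuous_on_norm continuous_on_add continuous_on_const cont_dv_real)
 qed (use B0 in auto)
 then obtain x0 where x0: "\<And>y. y \<in> {-B..B} \<Longrightarrow> norm (1 + deriv v (complex_of_real x0)) \<le> norm (1 + deriv v (complex_of_real y))" by blast
 define m1 where "m1 = norm (1 + deriv v (complex_of_real x0))"
 have m1: "0 < m1" using reg by (simp add: m1_def)
 define \<delta> where "\<delta> = m1 / (2 * (B2 + 1))"
 have \<delta>: "0 < \<delta>" using m1 B2(1) by (simp add: \<delta>_def)
 have near: "m1 / 2 * \<bar>x - y\<bar> \<le> norm (pt v (of_real x) - pt v (of_real y))" if "x \<in> {-B..B}" "y \<in> {-B..B}" "\<bar>x - y\<bar> \<le> \<delta>" for x y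
 proof -
  have "norm (1 + deriv v (of_real y)) * norm (complex_of_real x - of_real y) - B2 * (\<delta> + 0) * norm (complex_of_real x - of_real y) \<le> norm (pt v (of_real x) - pt v (of_real y))"
   using that r by (intro pt_linear) (auto simp flip: of_real_diff)
  moreover have "B2 * \<delta> \<le> m1 / 2"
  proof -
   have "B2 * \<delta> \<le> (B2 + 1) * \<delta>" using \<delta> by (intro mult_right_mono) auto
   also have "\<dots> = m1 / 2" using B2(1) by (simp add: \<delta>_def field_simps)
   finally show ?thesis .
  qed
  then have "m1 / 2 * \<bar>x - y\<bar> \<le> (norm (1 + deriv v (of_real y)) - B2 * \<delta>) * \<bar>x - y\<bar>"
   using x0[OF that(2)] by (intro mult_right_mono) (auto simp: m1_def)
  ultimately show ?thesis by (simp add: algebra_simps flip: of_real_diff)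
 qed
 define C where "C = ({-B..B} \<times> {-B..B}) \<inter> {z::real\<times>real. \<delta> \<le> \<bar>fst z - snd z\<bar>}"
 have cC: "compact C" unfolding C_def
  by (intro compact_Int_closed compact_Times compact_Icc closed_Collect_le continuous_intros)
 have "\<exists>m2>0. \<forall>z\<in>C. m2 \<le> norm (pt v (of_real (fst z)) - pt v (of_real (snd z)))"
 proof (cases "C = {}")
  case True then show ?thesis by (intro exI[of _ 1]) auto
 next
  case False
  have "continuous_on C (\<lambda>z. norm (pt v (of_real (fst z)) - pt v (of_real (snd z))))"
   unfolding pt_def
   by (intro continuous_intros continuous_on_compose2[OF cont_v_real[of UNIV]]) auto
  then obtain z0 where z0: "z0 \<in> C" "\<And>z. z \<in> C \<Longrightarrow> norm (pt v (of_real (fst z0)) - pt v (of_real (snd z0))) \<le> norm (pt v (of_real (fst z)) - pt v (of_real (snd z)))"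
   using continuous_attains_inf[OF cC False] by blast
  have "fst z0 \<noteq> snd z0" using z0(1) \<delta> by (auto simp: C_def)
  then have "pt v (of_real (fst z0)) \<noteq> pt v (of_real (snd z0))" using inj_pt by (auto simp: inj_def)
  then show ?thesis using z0(2) by (intro exI[of _ "norm (pt v (of_real (fst z0)) - pt v (of_real (snd z0)))"]) auto
 qed
 then obtain m2 where m2: "0 < m2" "\<And>z. z \<in> C \<Longrightarrow> m2 \<le> norm (pt v (of_real (fst z)) - pt v (of_real (snd z)))" by blast
 define m where "m = min (1/2) (min (m1/2) (m2 / (2 * B)))"
 have m: "0 < m" using m1 m2 B0 by (simp add: m_def)
 have "m * \<bar>x - y\<bar> \<le> norm (pt v (of_real x) - pt v (of_real y))" for x y
 proof -
  have mm: "m * \<bar>x - y\<bar> \<le> k * \<bar>x - y\<bar>" if "m \<le> k" for k using that by (intro mult_right_mono) auto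
  consider "B \<le> \<bar>x\<bar> \<or> B \<le> \<bar>y\<bar>" | "x \<in> {-B..B}" "y \<in> {-B..B}" "\<bar>x - y\<bar> \<le> \<delta>" | "x \<in> {-B..B}" "y \<in> {-B..B}" "\<delta> \<le> \<bar>x - y\<bar>"
   by fastforce
  then show ?thesis
  proof cases
   case 1
   have "m \<le> 1/2" by (simp add: m_def)
   from order_trans[OF mm[OF this] far'[OF 1]] show ?thesis .
  next
   case 2
   have "m \<le> m1/2" by (simp add: m_def)
   from order_trans[OF mm[OF this] near[OF 2]] show ?thesis .
  next
   case 3
   have "m * \<bar>x - y\<bar> \<le> m2 / (2 * B) * \<bar>x - y\<bar>" by (rule mm) (simp add: m_def)
   also have "\<dots> \<le> m2 / (2 * B) * (2 * B)" using 3 m2 B0 by (intro mult_left_mono) auto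
   also have "\<dots> = m2" using B0 by simp
   also have "m2 \<le> norm (pt v (of_real x) - pt v (of_real y))" using m2(2)[of "(x, y)"] 3 by (simp add: C_def)
   finally show ?thesis .
  qed
 qed
 then show ?thesis using m by blast
qed

text \<open>Only a compact part of the curve matters, since the second component tends to zero at
 infinity.\<close>

lemma real_Im_bound: "\<exists>\<theta>>0. \<forall>x::real. \<bar>Im (v (of_real x))\<bar> \<le> pi/2 - \<theta>"
proof -
 have "\<exists>b. \<forall>w\<in>strip (r/2). b \<le> norm w \<longrightarrow> norm (v w) < 1/2"
  using d[unfolded decays_iff_eps, rule_format, of "r/2" "1/2"] r by simp
 then obtain b0 where b0: "\<And>w. w \<in> strip (r/2) \<Longrightarrow> b0 \<le> norm w \<Longrightarrow> norm (v w) < 1/2" by blast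
 define b where "b = max b0 0"
 have far: "\<bar>Im (v (of_real x))\<bar> \<le> 1/2" if "b \<le> \<bar>x\<bar>" for x :: real
  using b0[of "of_real x"] that r abs_Im_le_cmod[of "v (of_real x)"] by (simp add: b_def)
 have "\<exists>x\<in>{-b..b}. \<forall>y\<in>{-b..b}. \<bar>Im (v (of_real y))\<bar> \<le> \<bar>Im (v (of_real x))\<bar>"
 proof (rule continuous_attains_sup)
  show "continuous_on {-b..b} (\<lambda>x. \<bar>Im (v (complex_of_real x))\<bar>)"
   by (intro continuous_on_rabs continuous_on_Im cont_v_real)
 qed (auto simp: b_def)
 then obtain x where x: "\<And>y. y \<in> {-b..b} \<Longrightarrow> \<bar>Im (v (complex_of_real y))\<bar> \<le> \<bar>Im (v (complex_of_real x))\<bar>" by blast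
 define \<theta> where "\<theta> = min (pi/2 - \<bar>Im (v (complex_of_real x))\<bar>) 1"
 have "\<bar>Im (v (complex_of_real y))\<bar> \<le> pi/2 - \<theta>" for y
 proof (cases "b \<le> \<bar>y\<bar>")
  case True then show ?thesis using far[OF True] pi_gt3 by (simp add: \<theta>_def)
 next
  case False
  then have "y \<in> {-b..b}" by auto
  then show ?thesis using x[of y] by (simp add: \<theta>_def)
 qed
 moreover have "0 < \<theta>" using Im_lt[of x] by (simp add: \<theta>_def)
 ultimately show ?thesis by blast
qed

text \<open>The bounds on the real axis persist in a thin strip: near the diagonal by
  \<open>pt_linear\<close>, and elsewhere because the curve moves by at most \<open>(1 + B1) s\<close>
 when a parameter is projected to the real axis.\<close>

lemma center_exists:
 assumes r0: "0 < r0"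
 obtains s M' \<theta> \<mu> where "center s M' \<theta> \<mu> v" "2 * s \<le> r0" "2 * s \<le> r / 4"
proof -
 obtain m where m: "0 < m" "\<And>x y::real. m * \<bar>x - y\<bar> \<le> norm (pt v (of_real x) - pt v (of_real y))" using real_chord_arc by blast
 obtain \<theta>0 where t0: "0 < \<theta>0" "\<And>x::real. \<bar>Im (v (of_real x))\<bar> \<le> pi/2 - \<theta>0" using real_Im_bound by blast
 have dm: "m \<le> norm (1 + deriv v (of_real x))" for x :: real
 proof -
  have "((\<lambda>y. (pt v y - pt v (of_real x)) / (y - of_real x)) \<longlongrightarrow> 1 + deriv v (of_real x)) (at (of_real x))"
   using pt_deriv[OF h, of "of_real x"] r by (simp add: has_field_derivative_iff)
  moreover have "(\<lambda>n. complex_of_real (x + 1 / Suc n)) \<longlonglongrightarrow> of_real x"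
   using tendsto_of_real[OF tendsto_add[OF tendsto_const[of x] lim_inverse_n'[THEN LIMSEQ_Suc]], where 'a=complex] by simp
  moreover have "\<forall>n. complex_of_real (x + 1 / Suc n) \<in> UNIV - {of_real x}" by (simp del: of_nat_Suc of_real_add)
  ultimately have "(\<lambda>n. (pt v (of_real (x + 1 / Suc n)) - pt v (of_real x)) / (of_real (x + 1 / Suc n) - of_real x)) \<longlonglongrightarrow> 1 + deriv v (of_real x)"
   unfolding tendsto_at_iff_sequentially comp_def
   by - (drule spec[where x = "\<lambda>n. complex_of_real (x + 1 / Suc n)"], simp only: simp_thms)
  from tendsto_norm[OF this] show ?thesis
  proof (rule tendsto_lowerbound)
   have "m \<le> norm ((pt v (of_real (x + 1 / Suc n)) - pt v (of_real x)) / (of_real (x + 1 / Suc n) - of_real x))" for n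
   proof -
    have e: "norm (complex_of_real (x + 1 / Suc n) - of_real x) = 1 / Suc n" unfolding of_real_diff[symmetric] norm_of_real by simp
    show ?thesis unfolding norm_divide e using m(2)[of "x + 1 / Suc n" x] by (simp add: field_simps)
   qed
   then show "\<forall>\<^sub>F n in sequentially. m \<le> norm ((pt v (of_real (x + 1 / Suc n)) - pt v (of_real x)) / (of_real (x + 1 / Suc n) - of_real x))" by simp
  qed simp
 qed
 define \<delta> where "\<delta> = m / (4 * (B2 + 1))"
 have \<delta>: "0 < \<delta>" using m B2(1) by (simp add: \<delta>_def)
 define s where "s = Min {1, r0 / 2, r / 16, \<theta>0 / (2 * (1 + B1)), \<delta> / 4, m * \<delta> / (4 * (m + B1 + 1)), m / (4 * (B2 + 1))}"
 have s0: "0 < s" using r0 r t0 B1(1) B2(1) \<delta> m by (simp add: s_def)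
 have s1': "s \<le> 1" "s \<le> r0 / 2" "s \<le> r / 16" "s \<le> \<theta>0 / (2 * (1 + B1))" "s \<le> \<delta> / 4" "s \<le> m * \<delta> / (4 * (m + B1 + 1))" "s \<le> m / (4 * (B2 + 1))"
  unfolding s_def by (rule Min_le; simp)+
 then have s1: "s \<le> 1" "s \<le> r0 / 2" "s \<le> r / 16" "s \<le> \<theta>0 / (2 * (1 + B1))" "4 * s \<le> \<delta>" "s \<le> m * \<delta> / (4 * (m + B1 + 1))" "s \<le> m / (4 * (B2 + 1))"
  by linarith+
 have B2s: "B2 * (\<delta> + s) \<le> m / 2"
 proof -
  have "(B2 + 1) * s \<le> m / 4" "(B2 + 1) * \<delta> = m / 4" using s1(7) B2(1) by (auto simp: \<delta>_def field_simps)
  then have "(B2 + 1) * (\<delta> + s) \<le> m / 2" by (simp add: distrib_left)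
  moreover have "B2 * (\<delta> + s) \<le> (B2 + 1) * (\<delta> + s)" using \<delta> s0 by (intro mult_right_mono) auto
  ultimately show ?thesis by simp
 qed
 have mds: "2 * s * (m + B1) \<le> m / 2 * \<delta>"
 proof -
  have "s * (m + B1 + 1) \<le> m * \<delta> / 4" using s1(6) m B1(1) by (simp add: field_simps)
  moreover have "s * (m + B1) \<le> s * (m + B1 + 1)" using s0 by (intro mult_left_mono) auto
  ultimately show ?thesis by simp
 qed
 have chord: "m / 2 * norm (\<alpha> - \<eta>) \<le> norm (pt v \<alpha> - pt v \<eta>)" if a: "\<alpha> \<in> strip s" and e: "\<eta> \<in> strip s" for \<alpha> \<eta>
 proof (cases "norm (\<alpha> - \<eta>) \<le> \<delta>")
  case True
  have ex: "norm (\<eta> - of_real (Re \<eta>)) \<le> s" using e by (simp add: cmod_def)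
  have "norm (1 + deriv v (of_real (Re \<eta>))) * norm (\<alpha> - \<eta>) - B2 * (\<delta> + s) * norm (\<alpha> - \<eta>) \<le> norm (pt v \<alpha> - pt v \<eta>)"
   by (rule pt_linear[OF _ _ _ True ex]) (use a e s1 r in auto)
  moreover have "m / 2 * norm (\<alpha> - \<eta>) \<le> (norm (1 + deriv v (of_real (Re \<eta>))) - B2 * (\<delta> + s)) * norm (\<alpha> - \<eta>)"
   using dm[of "Re \<eta>"] B2s by (intro mult_right_mono) auto
  ultimately show ?thesis by (simp add: left_diff_distrib)
 next
  case False
  let ?x = "Re \<alpha>" and ?y = "Re \<eta>"
  have xa: "norm (\<alpha> - of_real ?x) \<le> s" "norm (\<eta> - of_real ?y) \<le> s" using a e by (simp_all add: cmod_def)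
  have pl: "norm (pt v w - pt v (of_real (Re w))) \<le> (1 + B1) * s" if w: "w \<in> strip s" for w
  proof -
   have ww: "norm (w - of_real (Re w)) \<le> s" using w by (simp add: cmod_def)
   have "norm (v w - v (of_real (Re w))) \<le> B1 * norm (w - of_real (Re w))" using w s1 r by (intro v_lip) auto
   also have "\<dots> \<le> B1 * s" using ww B1 by (intro mult_left_mono) auto
   finally have "norm ((w - of_real (Re w)) + (v w - v (of_real (Re w)))) \<le> s + B1 * s"
    using ww norm_triangle_ineq[of "w - of_real (Re w)" "v w - v (of_real (Re w))"] by linarith
   then show ?thesis by (simp add: pt_def algebra_simps)
  qed
  have "norm (\<alpha> - \<eta>) \<le> \<bar>?x - ?y\<bar> + 2 * s"
  proof -
   have "\<alpha> - \<eta> = of_real (?x - ?y) + ((\<alpha> - of_real ?x) - (\<eta> - of_real ?y))" by simp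
   then have "norm (\<alpha> - \<eta>) \<le> norm (complex_of_real (?x - ?y)) + norm ((\<alpha> - of_real ?x) - (\<eta> - of_real ?y))"
    using norm_triangle_ineq by metis
   then show ?thesis using xa norm_triangle_ineq4[of "\<alpha> - of_real ?x" "\<eta> - of_real ?y"] unfolding norm_of_real by linarith
  qed
  then have "m * (norm (\<alpha> - \<eta>) - 2 * s) \<le> m * \<bar>?x - ?y\<bar>" using m by (intro mult_left_mono) auto
  also have "\<dots> \<le> norm (pt v (of_real ?x) - pt v (of_real ?y))" by (rule m(2))
  also have "\<dots> \<le> norm (pt v \<alpha> - pt v \<eta>) + 2 * ((1 + B1) * s)"
  proof -
   have "pt v (of_real ?x) - pt v (of_real ?y) = (pt v \<alpha> - pt v \<eta>) - (pt v \<alpha> - pt v (of_real ?x)) + (pt v \<eta> - pt v (of_real ?y))" by simp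
   then show ?thesis using pl[OF a] pl[OF e] norm_triangle_ineq4[of "pt v \<alpha> - pt v \<eta>" "pt v \<alpha> - pt v (of_real ?x)"]
     norm_triangle_ineq[of "(pt v \<alpha> - pt v \<eta>) - (pt v \<alpha> - pt v (of_real ?x))" "pt v \<eta> - pt v (of_real ?y)"] by (smt (verit))
  qed
  finally have 1: "m * norm (\<alpha> - \<eta>) - 2 * s * (m + B1 + 1) \<le> norm (pt v \<alpha> - pt v \<eta>)" by (simp add: algebra_simps)
  have "s * (m + B1 + 1) \<le> m * \<delta> / 4" using s1(6) m B1(1) by (simp add: field_simps)
  then have "2 * s * (m + B1 + 1) \<le> m / 2 * \<delta>" by simp
  also have "\<dots> \<le> m / 2 * norm (\<alpha> - \<eta>)" using False m by (intro mult_left_mono) auto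
  finally show ?thesis using 1 by linarith
 qed
 have ims: "\<bar>Im (pt v w)\<bar> \<le> pi/2 - 2 * (\<theta>0 / 4)" if w: "w \<in> strip s" for w
 proof -
  have "norm (v w - v (of_real (Re w))) \<le> B1 * norm (w - of_real (Re w))" using w s1 r by (intro v_lip) auto
  also have "\<dots> \<le> B1 * s" using w B1 by (intro mult_left_mono) (auto simp: cmod_def)
  finally have "\<bar>Im (v w - v (of_real (Re w)))\<bar> \<le> B1 * s" using abs_Im_le_cmod order_trans by blast
  moreover have "(1 + B1) * s \<le> \<theta>0 / 2" using s1(4) B1(1) by (simp add: field_simps)
  then have "s + B1 * s \<le> \<theta>0 / 2" by (simp add: algebra_simps)
  moreover have "\<bar>Im w\<bar> < s" using w by simp
  ultimately show ?thesis using t0(2)[of "Re w"] unfolding pt_def plus_complex.sel minus_complex.sel by linarith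
 qed
 have "center s M (\<theta>0 / 4) (m / 4) v" unfolding center_def
  using s0 s1 M t0 m r chord ims by (auto intro!: hsub)
 then show ?thesis by (rule that) (use s1 r in linarith)+
qed

end

section \<open>Uniqueness of analytic solutions\<close>

text \<open>The identity theorem.\<close>

lemma eq_on_strip:
 assumes "f holomorphic_on strip s" "g holomorphic_on strip s"
  and eq: "\<And>x::real. f (of_real x) = g (of_real x)" and w: "w \<in> strip s"
 shows "f w = g w"
proof -
 have s: "0 < s" using w by simp
 have "f w - g w = 0"
 proof (rule analytic_continuation[of "\<lambda>w. f w - g w" "strip s" "range of_real" 0])
  show "(\<lambda>w. f w - g w) holomorphic_on strip s" using assms by (intro holomorphic_on_diff)
  show "range of_real \<subseteq> strip s" "0 \<in> strip s" using s by auto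
  have "(\<lambda>n. complex_of_real (1 / Suc n)) \<longlonglongrightarrow> 0"
   using tendsto_of_real[OF lim_inverse_n'[THEN LIMSEQ_Suc], where 'a=complex] by simp
  then show "(0::complex) islimpt range of_real"
   unfolding islimpt_sequential
  proof (intro exI[of _ "\<lambda>n. complex_of_real (1 / Suc n)"] conjI allI)
   show "complex_of_real (1 / Suc n) \<in> range of_real - {0}" for n
    by (intro DiffI rangeI) (simp del: of_nat_Suc)
  qed
  show "f z - g z = 0" if "z \<in> range complex_of_real" for z using that eq by auto
 qed (use w in simp_all)
 then show ?thesis by simp
qed

lemma complex_strip_mono: "r' \<le> r \<Longrightarrow> strip r' \<subseteq> strip r"
 by auto

lemma regular_curve_mono:
 assumes "regular_curve v r" "0 < r'" "r' \<le> r" shows "regular_curve v r'"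
proof -
 interpret regular_curve v r by (rule assms(1))
 show ?thesis
 proof
  show "v holomorphic_on strip r'" by (rule hsub[OF assms(3)])
  show "decays r' v" using d assms(3) unfolding decays_def by auto
 qed (use assms Im_lt inj_pt reg in auto)
qed

text \<open>A solution of the equation in terms of its complex displacement.\<close>

definition vsol :: "real \<Rightarrow> real \<Rightarrow> real \<Rightarrow> (real \<Rightarrow> complex \<Rightarrow> complex) \<Rightarrow> bool" where
 "vsol c r T v \<longleftrightarrow> (\<forall>t\<in>{0..T}. regular_curve (v t) r \<and> uniform_limit (strip r) v (v t) (at t within {0..T}) \<and>
   (\<forall>\<alpha>. \<exists>I. has_pv_integral (muskat_integrand (curve (v t)) \<alpha>) \<alpha> I \<and>
    ((\<lambda>s. curve (v s) \<alpha>) has_vector_derivative c *\<^sub>R I) (at t within {0..T})))"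

lemma vsol_mono: "vsol c r T v \<Longrightarrow> 0 < r' \<Longrightarrow> r' \<le> r \<Longrightarrow> vsol c r' T v"
 unfolding vsol_def using regular_curve_mono uniform_limit_on_subset by (metis complex_strip_mono)

text \<open>Combine the two real extensions \<open>G\<close> and \<open>H\<close> into one complex
 displacement.\<close>

lemma muskat_solution_vsol:
 assumes sol: "muskat_solution \<rho>1 \<rho>2 T z"
 obtains r v where "0 < r" "vsol ((\<rho>2 - \<rho>1) / (4 * pi)) r T v" "\<And>t. t \<in> {0..T} \<Longrightarrow> z t = curve (v t)"
proof -
 obtain r G H where r: "0 < r" and GH: "\<And>t. t \<in> {0..T} \<Longrightarrow> flat_extension r (\<lambda>\<alpha>. fst (z t \<alpha>) - \<alpha>) (G t) \<and>
    flat_extension r (\<lambda>\<alpha>. snd (z t \<alpha>)) (H t) \<and>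
    uniform_limit (strip r) G (G t) (at t within {0..T}) \<and>
    uniform_limit (strip r) H (H t) (at t within {0..T})"
  using sol unfolding muskat_solution_def by blast
 define v where "v t w = G t w + \<i> * H t w" for t w
 have zc: "z t = curve (v t)" if "t \<in> {0..T}" for t
 proof
  fix \<alpha>
  show "z t \<alpha> = curve (v t) \<alpha>"
   using GH[OF that] by (simp add: flat_extension_def curve_def to_pair_def pt_def v_def prod_eq_iff)
 qed
 have "vsol ((\<rho>2 - \<rho>1) / (4 * pi)) r T v" unfolding vsol_def
 proof (intro ballI conjI allI)
  fix t assume t: "t \<in> {0..T}"
  note gh = GH[OF t, unfolded flat_extension_def]
  have hol: "v t holomorphic_on strip r" using gh unfolding v_def[abs_def] by (intro holomorphic_intros) auto
  show "regular_curve (v t) r"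
  proof
   show "v t holomorphic_on strip r" by (rule hol)
   show "decays r (v t)" unfolding decays_def
   proof (intro allI impI)
    fix s' assume "s' < r"
    then have le: "inf at_infinity (principal (strip s')) \<le> inf at_infinity (principal (strip r))"
     by (intro inf_mono order_refl) auto
    have "(v t \<longlongrightarrow> 0 + \<i> * 0) (inf at_infinity (principal (strip r)))"
     unfolding v_def[abs_def] using gh by (intro tendsto_intros) auto
    then have "(v t \<longlongrightarrow> 0) (inf at_infinity (principal (strip r)))" by simp
    then show "(v t \<longlongrightarrow> 0) (inf at_infinity (principal (strip s')))"
     by (rule tendsto_mono[OF le])
   qed
   have zt: "in_strip (z t)" "inj (z t)" "\<And>\<alpha>. vector_derivative (z t) (at \<alpha>) \<noteq> 0"
    using sol t unfolding muskat_solution_def by blast+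
   show "\<bar>Im (v t (of_real x))\<bar> < pi / 2" for x
    using zt(1) unfolding zc[OF t] in_strip_def by (auto simp: curve_def to_pair_def pt_def dest!: spec[of _ x])
   show "inj (\<lambda>x. pt (v t) (complex_of_real x))"
    using zt(2) unfolding zc[OF t] curve_def inj_def to_pair_eq_iff .
   show "1 + deriv (v t) (complex_of_real x) \<noteq> 0" for x
    using zt(3)[of x] unfolding zc[OF t] vector_derivative_curve[OF hol r]
    by (auto simp: to_pair_def zero_prod_def complex_eq_iff)
  qed (rule r)
  show "uniform_limit (strip r) v (v t) (at t within {0..T})"
   unfolding v_def[abs_def] using GH[OF t]
   by (intro uniform_limit_add bounded_linear.uniform_limit[OF bounded_linear_mult_right]) auto
  fix \<alpha>
  obtain I where I: "has_pv_integral (muskat_integrand (z t) \<alpha>) \<alpha> I"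
    "((\<lambda>s. z s \<alpha>) has_vector_derivative ((\<rho>2 - \<rho>1) / (4 * pi)) *\<^sub>R I) (at t within {0..T})"
   using sol t unfolding muskat_solution_def by blast
  have "((\<lambda>s. curve (v s) \<alpha>) has_vector_derivative ((\<rho>2 - \<rho>1) / (4 * pi)) *\<^sub>R I) (at t within {0..T})"
   by (rule has_vector_derivative_transform[OF t _ I(2)]) (simp add: zc)
  then show "\<exists>I. has_pv_integral (muskat_integrand (curve (v t)) \<alpha>) \<alpha> I \<and>
    ((\<lambda>s. curve (v s) \<alpha>) has_vector_derivative ((\<rho>2 - \<rho>1) / (4 * pi)) *\<^sub>R I) (at t within {0..T})"
   using I(1) unfolding zc[OF t] by blast
 qed
 then show ?thesis using that r zc by blast
qed

lemma curve_derivative_complex: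
 assumes "((\<lambda>s. curve (v s) \<alpha>) has_vector_derivative to_pair D) (at t within S)"
 shows "((\<lambda>s. v s (of_real \<alpha>)) has_vector_derivative D) (at t within S)"
proof -
 let ?L = "\<lambda>p::real\<times>real. complex_of_real (fst p) + \<i> * of_real (snd p)"
 have L: "bounded_linear ?L"
  by (intro bounded_linear_add bounded_linear_compose[OF bounded_linear_of_real bounded_linear_fst]
    bounded_linear_compose[OF bounded_linear_mult_right bounded_linear_compose[OF bounded_linear_of_real bounded_linear_snd]])
 have Lp: "?L (to_pair z) = z" for z by (simp add: to_pair_def complex_eq_iff)
 have "((\<lambda>s. ?L (curve (v s) \<alpha>)) has_vector_derivative ?L (to_pair D)) (at t within S)"
  by (rule bounded_linear.has_vector_derivative[OF L assms])
 then have "((\<lambda>s. of_real \<alpha> + v s (of_real \<alpha>)) has_vector_derivative D) (at t within S)"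
  unfolding curve_def Lp pt_def .
 from has_vector_derivative_diff[OF this has_vector_derivative_const[of "complex_of_real \<alpha>"]] show ?thesis by simp
qed

text \<open>A solution that stays close to a center solves the integral equation on the cone. It holds
 on the real axis by integrating the equation in time, and both sides are holomorphic. Closeness within
  \<open>R s\<close> on a strip of double width makes the derivatives close within \<open>R\<close>.\<close>

lemma vsol_integral_equation:
 fixes v :: "real \<Rightarrow> complex \<Rightarrow> complex"
 assumes vs: "vsol c r T v" and r: "0 < r" and c: "center s M \<theta> \<mu> (v t0)" and sr: "2 * s \<le> r"
  and Rb: "0 < R" "R \<le> \<theta>" "R \<le> \<mu> * (s / 16) / 2"
  and ck: "ck_operator (\<lambda>v \<alpha>. of_real (c/2) * velocity (s / 16) v \<alpha>) (v t0) s R C"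
  and t0: "0 \<le> t0" "t0 + \<tau> \<le> T" "0 \<le> \<tau>" and K: "0 < K" "K * \<tau> \<le> s / 4"
  and close: "\<And>t w. t \<in> {0..\<tau>} \<Longrightarrow> w \<in> strip r \<Longrightarrow> norm (v (t0 + t) w - v t0 w) \<le> R * s"
 shows "ck_operator.in_cone (v t0) s R K \<tau> (\<lambda>t. v (t0 + t))"
  and "\<And>t w. t \<in> {0..\<tau>} \<Longrightarrow> w \<in> strip (s - K * t) \<Longrightarrow>
   v (t0 + t) w = v t0 w + time_int (\<lambda>\<sigma> \<alpha>. of_real (c/2) * velocity (s / 16) (v (t0 + \<sigma>)) \<alpha>) t w"
proof -
 interpret ck_operator "\<lambda>v \<alpha>. of_real (c/2) * velocity (s / 16) v \<alpha>" "v t0" s R C by (rule ck)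
 let ?u = "\<lambda>t. v (t0 + t)"
 have T: "t0 + t \<in> {0..T}" if "t \<in> {0..\<tau>}" for t using that t0 by auto
 have t00: "t0 \<in> {0..T}" using t0 by auto
 have rc: "regular_curve (?u t) r" if "t \<in> {0..\<tau>}" for t using vs T[OF that] unfolding vsol_def by blast
 have rc0: "regular_curve (v t0) r" using vs t00 unfolding vsol_def by blast
 have hol: "?u t holomorphic_on strip r" if "t \<in> {0..\<tau>}" for t using rc[OF that] by (rule regular_curve.h)
 have hol0: "v t0 holomorphic_on strip r" using rc0 by (rule regular_curve.h)
 have Rs: "R * s \<le> R" using s R by (simp add: mult_left_le)
 have s2r: "s \<le> r" using s sr by simp
 have nr: "near (v t0) R s' (?u t)" if "t \<in> {0..\<tau>}" "s' \<le> s" for t s'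
  unfolding near_def
 proof (intro conjI ballI)
  show "?u t holomorphic_on strip s'" by (rule holomorphic_on_subset[OF hol[OF that(1)]]) (use s2r that in auto)
  fix w assume "w \<in> strip s'"
  then have "w \<in> strip r" using s2r that by auto
  from order_trans[OF close[OF that(1) this] Rs] show "norm (?u t w - v t0 w) \<le> R" .
 qed
 have Kt: "s / 2 \<le> s - K * t \<and> s - K * t \<le> s" if "t \<in> {0..\<tau>}" for t
  using width[OF K(1) t0(3) K(2) that] s by linarith
 show cone: "in_cone K \<tau> ?u" unfolding in_cone_def
 proof (intro ballI conjI allI impI)
  fix t assume t: "t \<in> {0..\<tau>}"
  show "near (v t0) R (s - K * t) (?u t)" using nr[OF t] Kt[OF t] by blast
  fix \<alpha> assume a: "\<alpha> \<in> strip (s - K * t)"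
  then have as: "\<alpha> \<in> strip s" using Kt[OF t] by auto
  have "norm (deriv (\<lambda>w. ?u t w - v t0 w) \<alpha>) \<le> R * s / s"
   by (rule norm_deriv_le_strip[of _ r]) (use hol[OF t] hol0 close[OF t] as sr s in \<open>auto intro: holomorphic_on_diff\<close>)
  then have "norm (deriv (?u t) \<alpha> - deriv (v t0) \<alpha>) \<le> R"
   using s deriv_diff_strip[OF hol[OF t] hol0, of \<alpha>] as s2r by simp
  also have "\<dots> \<le> R / sqrt (cdist s K t \<alpha>)" using R by (intro le_div_sqrt[OF K(1) t0(3) K(2) t a]) simp
  finally show "norm (deriv (?u t) \<alpha> - deriv (v t0) \<alpha>) \<le> R / sqrt (cdist s K t \<alpha>)" .
 next
  fix t s' assume t: "t \<in> {0..\<tau>}" and s': "s' < s - K * t"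
  have ul: "uniform_limit (strip r) v (v (t0 + t)) (at (t0 + t) within {0..T})"
   using vs T[OF t] unfolding vsol_def by blast
  have fl: "filterlim (\<lambda>x. t0 + x) (at (t0 + t) within {0..T}) (at t within {0..\<tau>})"
   unfolding filterlim_at
  proof
   show "((\<lambda>x. t0 + x) \<longlongrightarrow> t0 + t) (at t within {0..\<tau>})" by (intro tendsto_intros)
   show "\<forall>\<^sub>F x in at t within {0..\<tau>}. t0 + x \<in> {0..T} \<and> t0 + x \<noteq> t0 + t"
    unfolding eventually_at_filter using T by (intro always_eventually allI impI) simp
  qed
  have "uniform_limit (strip r) ?u (?u t) (at t within {0..\<tau>})"
   using filterlim_compose[OF ul fl] by (simp add: o_def)
  then show "uniform_limit (strip s') ?u (?u t) (at t within {0..\<tau>})"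
   by (rule uniform_limit_on_subset) (use s' Kt[OF t] s2r in auto)
 qed
 interpret ci: cone_integrand s K \<tau> A "\<lambda>\<sigma> \<alpha>. of_real (c/2) * velocity (s / 16) (?u \<sigma>) \<alpha>"
  by (rule F_cone[OF K(1) t0(3) K(2) cone])
 fix t w assume t: "t \<in> {0..\<tau>}" and w: "w \<in> strip (s - K * t)"
 let ?I = "time_int (\<lambda>\<sigma> \<alpha>. of_real (c/2) * velocity (s / 16) (?u \<sigma>) \<alpha>)"
 show "?u t w = v t0 w + ?I t w"
 proof (rule eq_on_strip[of "?u t" "s - K * t" "\<lambda>w. v t0 w + ?I t w"])
  show "?u t holomorphic_on strip (s - K * t)"
   by (rule holomorphic_on_subset[OF hol[OF t]]) (use Kt[OF t] s2r in auto)
  show "(\<lambda>w. v t0 w + ?I t w) holomorphic_on strip (s - K * t)"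
   by (intro holomorphic_on_add ci.time_int_holomorphic[OF t] holomorphic_on_subset[OF hol0]) (use Kt[OF t] s2r in auto)
  fix x :: real
  have der: "((\<lambda>\<sigma>. ?u \<sigma> (of_real x)) has_vector_derivative of_real (c/2) * velocity (s / 16) (?u \<sigma>) (of_real x)) (at \<sigma> within {0..t})"
   if \<sigma>: "\<sigma> \<in> {0..t}" for \<sigma>
  proof -
   have \<sigma>\<tau>: "\<sigma> \<in> {0..\<tau>}" using \<sigma> t by auto
   obtain I where I: "has_pv_integral (muskat_integrand (curve (?u \<sigma>)) x) x I"
    "((\<lambda>s. curve (v s) x) has_vector_derivative c *\<^sub>R I) (at (t0 + \<sigma>) within {0..T})"
    using vs T[OF \<sigma>\<tau>] unfolding vsol_def by blast
   have st: "state s (s / 16) (M + R) \<theta> (\<mu> * (s / 16)) (?u \<sigma>)"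
    by (rule near_state[OF c _ Rb(2,3) _ order_refl nr[OF \<sigma>\<tau> order_refl]]) (use R s in auto)
   have dec: "decays s (?u \<sigma>)" using regular_curve.d[OF rc[OF \<sigma>\<tau>]] s2r unfolding decays_def by auto
   have "I = to_pair (velocity (s / 16) (?u \<sigma>) (of_real x) / 2)"
    by (rule has_pv_integral_unique[OF I(1) pv_muskat[OF st dec]])
   then have "c *\<^sub>R I = to_pair (of_real (c/2) * velocity (s / 16) (?u \<sigma>) (of_real x))" by (simp add: to_pair_def)
   then have "((\<lambda>s. v s (of_real x)) has_vector_derivative of_real (c/2) * velocity (s / 16) (?u \<sigma>) (of_real x)) (at (t0 + \<sigma>) within {0..T})"
    using I(2) by (intro curve_derivative_complex) simp
   then have d1: "((\<lambda>s. v s (of_real x)) has_vector_derivative of_real (c/2) * velocity (s / 16) (?u \<sigma>) (of_real x)) (at (t0 + \<sigma>) within ((+) t0) ` {0..t})"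
    by (rule has_vector_derivative_within_subset) (use t t0 in auto)
   have d2: "((+) t0 has_vector_derivative 1) (at \<sigma> within {0..t})" by (auto intro!: derivative_eq_intros)
   from vector_diff_chain_within[OF d2 d1] show ?thesis by (simp add: o_def)
  qed
  have "((\<lambda>\<sigma>. of_real (c/2) * velocity (s / 16) (?u \<sigma>) (of_real x)) has_integral (?u t (of_real x) - ?u 0 (of_real x))) {0..t}"
   by (rule fundamental_theorem_of_calculus) (use t der in auto)
  then have "?I t (of_real x) = ?u t (of_real x) - ?u 0 (of_real x)" unfolding time_int_def by (rule integral_unique)
  then show "?u t (of_real x) = v t0 (of_real x) + ?I t (of_real x)" by simp
 qed (rule w)
qed

text \<open>Both solutions satisfy the same integral equation on a common cone around the center at time
  \<open>t0\<close>.\<close>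

lemma vsol_unique_local:
 assumes v1: "vsol c r T v1" and v2: "vsol c r T v2" and r: "0 < r" and t0: "0 \<le> t0" "t0 < T"
  and eq0: "\<And>x::real. v1 t0 (of_real x) = v2 t0 (of_real x)"
 obtains \<tau> where "0 < \<tau>" "\<And>t x. t \<in> {t0..t0 + \<tau>} \<Longrightarrow> v1 t (complex_of_real x) = v2 t (of_real x)" "t0 + \<tau> \<le> T"
proof -
 have t00: "t0 \<in> {0..T}" using t0 by auto
 interpret rc: regular_curve "v1 t0" r using v1 t00 unfolding vsol_def by blast
 interpret rc2: regular_curve "v2 t0" r using v2 t00 unfolding vsol_def by blast
 obtain s M \<theta> \<mu> where c: "center s M \<theta> \<mu> (v1 t0)" and sr: "2 * s \<le> r"
  by (rule rc.center_exists[OF r], rule that)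
 note c' = c[unfolded center_def]
 have s: "0 < s" "s \<le> 1" using c' by auto
 define r' where "r' = 2 * s"
 have r': "0 < r'" "r' \<le> r" using s sr by (auto simp: r'_def)
 define R where "R = min \<theta> (\<mu> * (s / 16) / 2)"
 have Rc: "0 < R" "R \<le> \<theta>" "R \<le> \<mu> * (s / 16) / 2" using c' by (auto simp: R_def)
 obtain C where ck: "ck_operator (\<lambda>v \<alpha>. of_real (c/2) * velocity (s / 16) v \<alpha>) (v1 t0) s R C" using center_ck_operator[OF c Rc] by blast
 interpret ck_operator "\<lambda>v \<alpha>. of_real (c/2) * velocity (s / 16) v \<alpha>" "v1 t0" s R C by (rule ck)
 have eq: "v1 t0 w = v2 t0 w" if "w \<in> strip r" for w
  by (rule eq_on_strip[OF rc.h rc2.h eq0 that])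
 have Rs: "0 < R * s" using R s by simp
 have ev: "\<exists>\<delta>>0. \<forall>t\<in>{0..T}. \<bar>t - t0\<bar> < \<delta> \<longrightarrow> (\<forall>w\<in>strip r. norm (v t w - v t0 w) \<le> R * s)" if "vsol c r T v" for v
 proof -
  have "uniform_limit (strip r) v (v t0) (at t0 within {0..T})" using that t00 unfolding vsol_def by blast
  from uniform_limitD[OF this Rs] obtain \<delta> where \<delta>: "0 < \<delta>" "\<And>t. t \<in> {0..T} \<Longrightarrow> t \<noteq> t0 \<Longrightarrow> dist t t0 < \<delta> \<Longrightarrow> \<forall>w\<in>strip r. dist (v t w) (v t0 w) < R * s"
   unfolding eventually_at by blast
  have "norm (v t w - v t0 w) \<le> R * s" if "t \<in> {0..T}" "\<bar>t - t0\<bar> < \<delta>" "w \<in> strip r" for t w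
  proof (cases "t = t0")
   case True then show ?thesis using Rs by simp
  next
   case False
   then have "dist (v t w) (v t0 w) < R * s" using \<delta>(2)[OF that(1) False] that by (simp add: dist_real_def)
   then show ?thesis by (simp add: dist_norm)
  qed
  then show ?thesis using \<delta>(1) by blast
 qed
 obtain \<delta>1 where d1: "0 < \<delta>1" "\<And>t w. t \<in> {0..T} \<Longrightarrow> \<bar>t - t0\<bar> < \<delta>1 \<Longrightarrow> w \<in> strip r \<Longrightarrow> norm (v1 t w - v1 t0 w) \<le> R * s" using ev[OF v1] by blast
 obtain \<delta>2 where d2: "0 < \<delta>2" "\<And>t w. t \<in> {0..T} \<Longrightarrow> \<bar>t - t0\<bar> < \<delta>2 \<Longrightarrow> w \<in> strip r \<Longrightarrow> norm (v2 t w - v2 t0 w) \<le> R * s" using ev[OF v2] by blast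
 define K where "K = 12 * A"
 have K: "0 < K" "12 * A \<le> K" using A_pos by (auto simp: K_def)
 define \<tau> where "\<tau> = Min {\<delta>1 / 2, \<delta>2 / 2, T - t0, s / (4 * K)}"
 have \<tau>0: "0 < \<tau>" using d1 d2 t0 s K by (simp add: \<tau>_def)
 have \<tau>1: "\<tau> \<le> \<delta>1 / 2" "\<tau> \<le> \<delta>2 / 2" "\<tau> \<le> T - t0" "\<tau> \<le> s / (4 * K)" unfolding \<tau>_def by (rule Min_le; simp)+
 have K\<tau>: "K * \<tau> \<le> s / 4" using \<tau>1(4) K by (simp add: field_simps)
 have tt: "0 \<le> t0" "t0 + \<tau> \<le> T" "0 \<le> \<tau>" using t0 \<tau>1 \<tau>0 by auto
 have cl1: "norm (v1 (t0 + t) w - v1 t0 w) \<le> R * s" if "t \<in> {0..\<tau>}" "w \<in> strip r" for t w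
  using that tt \<tau>1 \<tau>0 d1(1) by (intro d1(2)) auto
 have cl2: "norm (v2 (t0 + t) w - v2 t0 w) \<le> R * s" if "t \<in> {0..\<tau>}" "w \<in> strip r" for t w
  using that tt \<tau>1 \<tau>0 d2(1) by (intro d2(2)) auto
 note e1 = vsol_integral_equation[OF v1 r c sr Rc ck tt K(1) K\<tau> cl1]
 \<comment> \<open>On the real axis the two solutions agree at \<open>t0\<close>; the complex displacements then agree on a strip, and here they are made literally equal.\<close>
 define v2' where "v2' t = (if t = t0 then v1 t0 else v2 t)" for t
 have c2: "curve (v2' t) = curve (v2 t)" for t using eq0 by (auto simp: v2'_def curve_def fun_eq_iff pt_def)
 have vsol2: "vsol c r T v2'" unfolding vsol_def
 proof (intro ballI conjI)
  fix t assume t: "t \<in> {0..T}"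
  note vt = v2[unfolded vsol_def, rule_format, OF t]
  show "regular_curve (v2' t) r" using vt v1 t00 unfolding vsol_def by (auto simp: v2'_def)
  have e: "dist (v2' x w) (v2' t w) = dist (v2 x w) (v2 t w)" if "w \<in> strip r" for x w using eq[OF that] by (auto simp: v2'_def)
  show "uniform_limit (strip r) v2' (v2' t) (at t within {0..T})" using vt unfolding uniform_limit_iff by (simp add: e)
  show "\<forall>\<alpha>. \<exists>I. has_pv_integral (muskat_integrand (curve (v2' t)) \<alpha>) \<alpha> I \<and>
    ((\<lambda>s. curve (v2' s) \<alpha>) has_vector_derivative c *\<^sub>R I) (at t within {0..T})" using vt unfolding c2 by blast
 qed
 have v20: "v2' t0 = v1 t0" by (simp add: v2'_def)
 have cl2': "norm (v2' (t0 + t) w - v2' t0 w) \<le> R * s" if "t \<in> {0..\<tau>}" "w \<in> strip r" for t w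
  using cl2[OF that] eq[OF that(2)] Rs by (auto simp: v2'_def)
 note e2 = vsol_integral_equation[OF vsol2 r _ sr Rc _ tt K(1) K\<tau> cl2', unfolded v20, OF c ck]
 have "v1 t (complex_of_real x) = v2 t (of_real x)" if t: "t \<in> {t0..t0 + \<tau>}" for t x
 proof -
  have t': "t - t0 \<in> {0..\<tau>}" using t by auto
  have x: "complex_of_real x \<in> strip (s - K * (t - t0))"
   using width[OF K(1) tt(3) K\<tau> t'] s by simp
  have "v1 (t0 + (t - t0)) (of_real x) = v2' (t0 + (t - t0)) (of_real x)"
   using solution_unique[OF K(1) tt(3) K\<tau> e1(1) e2(1) K(2) e1(2) e2(2) vs_hol t' x] .
  then show ?thesis using eq0 by (auto simp: v2'_def split: if_splits)
 qed
 then show ?thesis using that[OF \<tau>0] tt by blast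
qed

text \<open>At the infimum of the times of disagreement the solutions still agree, by continuity; local
 uniqueness contradicts the choice of the infimum.\<close>

lemma vsol_unique:
 assumes v1: "vsol c r T v1" and v2: "vsol c r T v2" and r: "0 < r"
  and eq0: "\<And>x::real. v1 0 (of_real x) = v2 0 (of_real x)" and t: "t \<in> {0..T}"
 shows "v1 t (complex_of_real x) = v2 t (of_real x)"
proof (rule ccontr)
 assume neq: "\<not> ?thesis"
 define B where "B = {t\<in>{0..T}. \<exists>x::real. v1 t (of_real x) \<noteq> v2 t (of_real x)}"
 have tB: "t \<in> B" using neq t by (auto simp: B_def)
 define t0 where "t0 = Inf B"
 have bb: "bdd_below B" by (rule bdd_belowI[of _ 0]) (auto simp: B_def)
 have t0l: "t0 \<le> b" if "b \<in> B" for b unfolding t0_def using that bb by (rule cInf_lower)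
 have t00: "0 \<le> t0" unfolding t0_def using tB by (intro cInf_greatest) (auto simp: B_def)
 have t0T: "t0 \<in> {0..T}" using t00 t0l[OF tB] t by auto
 have good: "v1 t' (of_real x) = v2 t' (of_real x)" if "0 \<le> t'" "t' < t0" for t' and x :: real
  using t0l[of t'] that t0T by (auto simp: B_def)
 have cont: "((\<lambda>t. v t (of_real x)) \<longlongrightarrow> v t0 (of_real x)) (at t0 within {0..T})" if "vsol c r T v" for v and x :: real
 proof -
  have "uniform_limit (strip r) v (v t0) (at t0 within {0..T})" using that t0T unfolding vsol_def by blast
  then show ?thesis by (rule tendsto_uniform_limitI) (use r in simp)
 qed
 have e0: "v1 t0 (of_real x) = v2 t0 (of_real x)" for x :: real
 proof (cases "t0 = 0")
  case True then show ?thesis using eq0 by simp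
 next
  case False
  then have p: "0 < t0" using t00 by simp
  let ?F = "at t0 within {0..<t0}"
  have nb: "?F \<noteq> bot"
  proof -
   have "t0 islimpt {0..<t0}" using islimpt_Ico[of 0 t0 t0] p by simp
   then show ?thesis by (simp add: trivial_limit_within)
  qed
  have le: "?F \<le> at t0 within {0..T}" using t0T by (intro at_le) auto
  have c1: "((\<lambda>t. v1 t (of_real x)) \<longlongrightarrow> v1 t0 (of_real x)) ?F" using tendsto_mono[OF le cont[OF v1]] .
  have c2: "((\<lambda>t. v2 t (of_real x)) \<longlongrightarrow> v2 t0 (of_real x)) ?F" using tendsto_mono[OF le cont[OF v2]] .
  have "\<forall>\<^sub>F t in ?F. v2 t (of_real x) = v1 t (of_real x)"
   unfolding eventually_at_filter using good by (auto intro!: always_eventually)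
  from Lim_transform_eventually[OF c2 this] show ?thesis using tendsto_unique[OF nb c1] by simp
 qed
 then have "t0 \<notin> B" by (auto simp: B_def)
 then have "t0 \<noteq> t" using tB by blast
 then have lt: "t0 < T" using t0l[OF tB] t by simp
 obtain \<tau> where \<tau>: "0 < \<tau>" "\<And>t x. t \<in> {t0..t0 + \<tau>} \<Longrightarrow> v1 t (complex_of_real x) = v2 t (of_real x)"
  by (rule vsol_unique_local[OF v1 v2 r t00 lt e0], rule that)
 have "t0 + \<tau> \<le> b" if "b \<in> B" for b
 proof (rule ccontr)
  assume "\<not> t0 + \<tau> \<le> b"
  then have "b \<in> {t0..t0 + \<tau>}" using t0l[OF that] by auto
  then show False using \<tau>(2) that by (auto simp: B_def)
 qed
 then have "t0 + \<tau> \<le> t0" unfolding t0_def[symmetric] using tB by (subst (2) t0_def, intro cInf_greatest) auto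
 then show False using \<tau>(1) by simp
qed

theorem muskat_solution_unique:
 assumes "muskat_solution \<rho>1 \<rho>2 T z" "muskat_solution \<rho>1 \<rho>2 T w" "w 0 = z 0" "t \<in> {0..T}"
 shows "w t = z t"
proof -
 obtain r1 v1 where 1: "0 < r1" "vsol ((\<rho>2 - \<rho>1) / (4 * pi)) r1 T v1" "\<And>t. t \<in> {0..T} \<Longrightarrow> z t = curve (v1 t)"
  using muskat_solution_vsol[OF assms(1)] by blast
 obtain r2 v2 where 2: "0 < r2" "vsol ((\<rho>2 - \<rho>1) / (4 * pi)) r2 T v2" "\<And>t. t \<in> {0..T} \<Longrightarrow> w t = curve (v2 t)"
  using muskat_solution_vsol[OF assms(2)] by blast
 define r where "r = min r1 r2"
 have r: "0 < r" "r \<le> r1" "r \<le> r2" using 1 2 by (auto simp: r_def)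
 have "0 \<in> {0..T}" using assms(4) by auto
 then have "curve (v1 0) = curve (v2 0)" using 1(3) 2(3) assms(3) by metis
 then have eq0: "v1 0 (of_real x) = v2 0 (of_real x)" for x :: real
  by (auto simp: curve_def to_pair_eq_iff pt_def dest!: fun_cong[of _ _ x])
 have "v1 t (complex_of_real x) = v2 t (of_real x)" for x
  by (rule vsol_unique[OF vsol_mono[OF 1(2) r(1,2)] vsol_mono[OF 2(2) r(1,3)] r(1) eq0 assms(4)])
 then show ?thesis unfolding 1(3)[OF assms(4)] 2(3)[OF assms(4)] by (auto simp: curve_def pt_def)
qed

section \<open>Existence of solutions and loss of the graph property\<close>

lemma state_regular_curve:
 assumes st: "state s \<rho> M \<theta> \<mu> v" and d: "decays s v"
 shows "regular_curve v s"
proof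
 note sd = stateD[OF st]
 show "v holomorphic_on strip s" "0 < s" "decays s v" using sd d by auto
 fix x :: real
 have x: "complex_of_real x \<in> strip s" "complex_of_real x \<in> strip (2 * \<rho>)" using sd by auto
 have "\<bar>Im (pt v (of_real x))\<bar> \<le> pi/2 - \<theta>" using st x(1) unfolding state_def by blast
 then show "\<bar>Im (v (complex_of_real x))\<bar> < pi / 2" using sd(5) by (simp add: pt_def)
 show "1 + deriv v (complex_of_real x) \<noteq> 0" using inner_deriv_nz[OF st x(2)] sd(6) by auto
next
 note sd = stateD[OF st]
 show "inj (\<lambda>x. pt v (complex_of_real x))"
 proof (rule injI, rule ccontr)
  fix x y :: real assume e: "pt v (of_real x) = pt v (of_real y)" and ne: "x \<noteq> y"
  have "\<mu> * norm (complex_of_real x - of_real y) \<le> 0"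
   using sd(11)[of "of_real x" "of_real y"] sd(1) e by simp
  moreover have "0 < \<mu> * norm (complex_of_real x - of_real y)" using ne sd(6) by simp
  ultimately show False by linarith
 qed
qed

lemma tendsto_decays: "decays s v \<Longrightarrow> s' < s \<Longrightarrow> (v \<longlongrightarrow> 0) (inf at_infinity (principal (strip s')))"
 unfolding decays_def by blast

text \<open>Conversely, a solution of the integral equation on the cone, restricted to the strip of half
 width, is a solution of the Muskat equation.\<close>

lemma muskat_solution_from_cone:
 fixes \<rho>1 \<rho>2 :: real
 defines "c \<equiv> (\<rho>2 - \<rho>1) / (4 * pi)"
 assumes c: "center s M \<theta> \<mu> vs" and Rb: "0 < R" "R \<le> \<theta>" "R \<le> \<mu> * (s / 16) / 2"
  and ck: "ck_operator (\<lambda>v \<alpha>. of_real (c/2) * velocity (s / 16) v \<alpha>) vs s R C"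
  and K: "0 < K" "K * T \<le> s / 4" "0 \<le> T"
  and cone: "ck_operator.in_cone vs s R K T v"
  and eq: "\<And>t w. t \<in> {0..T} \<Longrightarrow> w \<in> strip (s - K * t) \<Longrightarrow> v t w = vi w + time_int (\<lambda>\<tau> \<alpha>. of_real (c/2) * velocity (s / 16) (v \<tau>) \<alpha>) t w"
  and dec: "\<And>t. t \<in> {0..T} \<Longrightarrow> decays (s - K * t) (v t)"
 shows "muskat_solution \<rho>1 \<rho>2 T (\<lambda>t. curve (v t))"
proof -
 interpret ck_operator "\<lambda>v \<alpha>. of_real (c/2) * velocity (s / 16) v \<alpha>" vs s R C by (rule ck)
 note wd = width[OF K(1,3,2)]
 have w2: "s / 2 < s - K * t" if "t \<in> {0..T}" for t using wd[OF that] s by linarith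
 have st: "state (s - K * t) (s / 16) (M + R) \<theta> (\<mu> * (s / 16)) (v t)" if t: "t \<in> {0..T}" for t
  by (rule near_state[OF assms(2) _ Rb(2,3) _ _ in_coneD(1)[OF K(1,3,2) cone t]]) (use Rb w2[OF t] wd[OF t] in auto)
 have rc: "regular_curve (v t) (s - K * t)" if t: "t \<in> {0..T}" for t
  by (rule state_regular_curve[OF st[OF t] dec[OF t]])
 have hol: "v t holomorphic_on strip (s / 2)" if t: "t \<in> {0..T}" for t
  by (rule holomorphic_on_subset[OF regular_curve.h[OF rc[OF t]] complex_strip_mono]) (use w2[OF t] in simp)
 have d2: "(v t \<longlongrightarrow> 0) (inf at_infinity (principal (strip (s / 2))))" "(conj_refl (v t) \<longlongrightarrow> 0) (inf at_infinity (principal (strip (s / 2))))"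
  if t: "t \<in> {0..T}" for t
  using tendsto_decays[OF dec[OF t] w2[OF t]] tendsto_decays[OF decays_conj_refl[OF dec[OF t]] w2[OF t]] by auto
 have ul: "uniform_limit (strip (s / 2)) v (v t) (at t within {0..T})" if t: "t \<in> {0..T}" for t
  by (rule in_coneD(5)[OF K(1,3,2) cone t w2[OF t]])
 have ulr: "uniform_limit (strip (s / 2)) (\<lambda>t. conj_refl (v t)) (conj_refl (v t)) (at t within {0..T})" if t: "t \<in> {0..T}" for t
 proof (rule uniform_limitI)
  fix e :: real assume "0 < e"
  from uniform_limitD[OF ul[OF t] this]
  show "\<forall>\<^sub>F \<tau> in at t within {0..T}. \<forall>w\<in>strip (s/2). dist (conj_refl (v \<tau>) w) (conj_refl (v t) w) < e"
  proof eventually_elim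
   case (elim \<tau>)
   show ?case
   proof
    fix w assume "w \<in> strip (s / 2)"
    then have "dist (v \<tau> (cnj w)) (v t (cnj w)) < e" using elim by simp
    moreover have "dist (conj_refl (v \<tau>) w) (conj_refl (v t) w) = dist (v \<tau> (cnj w)) (v t (cnj w))"
     unfolding dist_norm conj_refl_def complex_cnj_diff[symmetric] complex_mod_cnj ..
    ultimately show "dist (conj_refl (v \<tau>) w) (conj_refl (v t) w) < e" by simp
   qed
  qed
 qed
 define G where "G t w = (v t w + conj_refl (v t) w) / 2" for t w
 define H where "H t w = (v t w - conj_refl (v t) w) / (2 * \<i>)" for t w
 have GH: "flat_extension (s / 2) (\<lambda>\<alpha>. fst (curve (v t) \<alpha>) - \<alpha>) (G t) \<and>
    flat_extension (s / 2) (\<lambda>\<alpha>. snd (curve (v t) \<alpha>)) (H t) \<and>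
    uniform_limit (strip (s / 2)) G (G t) (at t within {0..T}) \<and>
    uniform_limit (strip (s / 2)) H (H t) (at t within {0..T})" if t: "t \<in> {0..T}" for t
 proof (intro conjI)
  note hr = conj_refl_holomorphic[OF hol[OF t]]
  show "flat_extension (s / 2) (\<lambda>\<alpha>. fst (curve (v t) \<alpha>) - \<alpha>) (G t)"
   unfolding flat_extension_def
  proof (intro conjI allI)
   show "G t holomorphic_on strip (s / 2)" unfolding G_def[abs_def] by (intro holomorphic_intros hol[OF t] hr) auto
   show "G t (of_real x) = of_real (fst (curve (v t) x) - x)" for x
    by (simp add: G_def conj_refl_def curve_def to_pair_def pt_def complex_eq_iff)
   have "(G t \<longlongrightarrow> (0 + 0) / 2) (inf at_infinity (principal (strip (s / 2))))"
    unfolding G_def[abs_def] by (intro tendsto_intros d2[OF t]) auto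
   then show "(G t \<longlongrightarrow> 0) (inf at_infinity (principal (strip (s / 2))))" by simp
  qed
  show "flat_extension (s / 2) (\<lambda>\<alpha>. snd (curve (v t) \<alpha>)) (H t)"
   unfolding flat_extension_def
  proof (intro conjI allI)
   show "H t holomorphic_on strip (s / 2)" unfolding H_def[abs_def] by (intro holomorphic_intros hol[OF t] hr) auto
   show "H t (of_real x) = of_real (snd (curve (v t) x))" for x
    by (simp add: H_def conj_refl_def curve_def to_pair_def pt_def complex_eq_iff)
   have "(H t \<longlongrightarrow> (0 - 0) / (2 * \<i>)) (inf at_infinity (principal (strip (s / 2))))"
    unfolding H_def[abs_def] by (intro tendsto_intros d2[OF t]) auto
   then show "(H t \<longlongrightarrow> 0) (inf at_infinity (principal (strip (s / 2))))" by simp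
  qed
  show "uniform_limit (strip (s / 2)) G (G t) (at t within {0..T})"
   unfolding G_def[abs_def]
   by (rule bounded_linear.uniform_limit[OF bounded_linear_divide]) (intro uniform_limit_add ul[OF t] ulr[OF t])
  show "uniform_limit (strip (s / 2)) H (H t) (at t within {0..T})"
   unfolding H_def[abs_def]
   by (rule bounded_linear.uniform_limit[OF bounded_linear_divide]) (intro uniform_limit_minus ul[OF t] ulr[OF t])
 qed
 interpret ci: cone_integrand s K T A "\<lambda>\<sigma> \<alpha>. of_real (c/2) * velocity (s / 16) (v \<sigma>) \<alpha>"
  by (rule F_cone[OF K(1,3,2) cone])
 have ode: "((\<lambda>s. curve (v s) \<alpha>) has_vector_derivative c *\<^sub>R to_pair (velocity (s / 16) (v t) (of_real \<alpha>) / 2)) (at t within {0..T})" if t: "t \<in> {0..T}" for t \<alpha>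
 proof -
  let ?f = "\<lambda>\<tau>. of_real (c/2) * velocity (s / 16) (v \<tau>) (complex_of_real \<alpha>)"
  have TT: "T \<in> {0..T}" using K by simp
  have al: "complex_of_real \<alpha> \<in> strip (s - K * t)" if "t \<in> {0..T}" for t using w2[OF that] s by simp
  have "((\<lambda>u. integral {0..u} ?f) has_vector_derivative ?f t) (at t within {0..T})"
   using ci.cont[OF TT al[OF TT]] t by (rule integral_has_vector_derivative)
  then have "((\<lambda>u. vi (of_real \<alpha>) + integral {0..u} ?f) has_vector_derivative 0 + ?f t) (at t within {0..T})"
   by (intro has_vector_derivative_add has_vector_derivative_const)
  then have "((\<lambda>u. v u (of_real \<alpha>)) has_vector_derivative 0 + ?f t) (at t within {0..T})"
   by (rule has_vector_derivative_transform[OF t, rotated]) (simp add: eq[OF _ al] time_int_def)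
  then have "((\<lambda>u. of_real \<alpha> + v u (of_real \<alpha>)) has_vector_derivative 0 + (0 + ?f t)) (at t within {0..T})"
   by (intro has_vector_derivative_add has_vector_derivative_const)
  from bounded_linear.has_vector_derivative[OF bounded_linear_to_pair this]
  have "((\<lambda>u. curve (v u) \<alpha>) has_vector_derivative to_pair (0 + (0 + ?f t))) (at t within {0..T})" unfolding curve_def pt_def .
  moreover have "to_pair (0 + (0 + ?f t)) = c *\<^sub>R to_pair (velocity (s / 16) (v t) (of_real \<alpha>) / 2)" by (simp add: to_pair_def)
  ultimately show ?thesis by simp
 qed
 show ?thesis unfolding muskat_solution_def
 proof (intro conjI ballI allI)
  fix t assume t: "t \<in> {0..T}"
  interpret rct: regular_curve "v t" "s - K * t" by (rule rc[OF t])
  show "in_strip (curve (v t))" using rct.Im_lt by (simp add: in_strip_def curve_def to_pair_def pt_def)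
  show "inj (curve (v t))" using rct.inj_pt unfolding curve_def inj_def to_pair_eq_iff .
  show "vector_derivative (curve (v t)) (at \<alpha>) \<noteq> 0" for \<alpha>
   using rct.reg[of \<alpha>] unfolding vector_derivative_curve[OF rct.h rct.r]
   by (auto simp: to_pair_def zero_prod_def complex_eq_iff)
  fix \<alpha>
  show "\<exists>I. has_pv_integral (muskat_integrand (curve (v t)) \<alpha>) \<alpha> I \<and>
    ((\<lambda>s. curve (v s) \<alpha>) has_vector_derivative ((\<rho>2 - \<rho>1) / (4 * pi)) *\<^sub>R I) (at t within {0..T})"
   using pv_muskat[OF st[OF t] dec[OF t]] ode[OF t] unfolding c_def by blast
 next
  show "\<exists>r>0. \<exists>G H. \<forall>t\<in>{0..T}.
    flat_extension r (\<lambda>\<alpha>. fst (curve (v t) \<alpha>) - \<alpha>) (G t) \<and>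
    flat_extension r (\<lambda>\<alpha>. snd (curve (v t) \<alpha>)) (H t) \<and>
    uniform_limit (strip r) G (G t) (at t within {0..T}) \<and>
    uniform_limit (strip r) H (H t) (at t within {0..T})"
   using GH s by (intro exI[of _ "s / 2"] conjI exI[of _ G] exI[of _ H]) auto
 qed
qed

text \<open>If the first component decreases at \<open>0\<close> although it tends to infinity on the
 right, it takes a value twice. Two points of a graph with the same first component coincide, which
 contradicts injectivity.\<close>

lemma not_graph:
 assumes h: "v holomorphic_on strip r" and r: "0 < r" and d: "decays r v" and i: "inj (curve v)"
  and neg: "1 + Re (deriv v 0) < 0"
 shows "\<not> is_graph_of (curve v) f"
proof
 assume g: "is_graph_of (curve v) f"
 define z where "z x = x + Re (v (complex_of_real x))" for x
 have cz: "fst (curve v x) = z x" for x by (simp add: curve_def to_pair_def pt_def z_def)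
 have graph: "curve v x = (z x, f (z x))" for x
 proof -
  have "curve v x \<in> range (\<lambda>x. (x, f x))" using g unfolding is_graph_of_def by auto
  then show ?thesis using cz[of x] by auto
 qed
 have injz: "x = y" if "z x = z y" for x y using i graph[of x] graph[of y] that by (auto simp: inj_def)
 have dz: "(z has_real_derivative 1 + Re (deriv v (of_real x))) (at x)" for x
 proof -
  have "((\<lambda>x. v (complex_of_real x)) has_vector_derivative deriv v (of_real x)) (at x)"
   by (rule has_vector_derivative_real_field, rule holomorphic_derivI[OF h open_complex_strip]) (use r in simp)
  from bounded_linear.has_vector_derivative[OF bounded_linear_Re this]
  have "((\<lambda>x. Re (v (complex_of_real x))) has_real_derivative Re (deriv v (of_real x))) (at x)"
   by (simp add: has_real_derivative_iff_has_vector_derivative)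
  from DERIV_add[OF DERIV_ident this] show ?thesis unfolding z_def by simp
 qed
 have "\<exists>b. \<forall>w\<in>strip (r/2). b \<le> norm w \<longrightarrow> norm (v w) < 1"
  using d[unfolded decays_iff_eps, rule_format, of "r/2" 1] r by simp
 then obtain b where b: "\<And>w. w \<in> strip (r/2) \<Longrightarrow> b \<le> norm w \<Longrightarrow> norm (v w) < 1" by blast
 obtain e where e: "0 < e" "\<And>h. 0 < h \<Longrightarrow> h < e \<Longrightarrow> z (0 + h) < z 0"
  using has_real_derivative_neg_dec_right[of z "1 + Re (deriv v (of_real 0))" 0 UNIV] dz[of 0] neg by auto
 define h' where "h' = e / 2"
 have h': "0 < h'" "z h' < z 0" using e(1) e(2)[of "e/2"] by (auto simp: h'_def)
 define B where "B = max (\<bar>b\<bar> + h') (\<bar>z 0\<bar> + 1)"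
 have "b \<le> norm (complex_of_real B)" "h' \<le> B" "\<bar>z 0\<bar> + 1 \<le> B" using h' by (auto simp: B_def)
 then have "norm (v (of_real B)) < 1" using b[of "of_real B"] r by simp
 then have "- 1 < Re (v (of_real B))" using abs_Re_le_cmod[of "v (of_real B)"] by linarith
 then have zB: "z 0 < z B" using \<open>\<bar>z 0\<bar> + 1 \<le> B\<close> unfolding z_def[of B] by linarith
 have "\<exists>x\<ge>h'. x \<le> B \<and> z x = z 0"
  by (rule IVT) (use h' zB \<open>h' \<le> B\<close> DERIV_isCont[OF dz] in auto)
 then obtain x where "h' \<le> x" "z x = z 0" by blast
 then show False using injz[of x 0] h' by simp
qed

text \<open>Everything except \<open>\<epsilon>\<close> is chosen from the center: in a small ball the
 gradient of the horizontal velocity at \<open>0\<close> is at most \<open>- D / 2\<close>, and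
 solutions exist up to a time \<open>T\<close> for every initial datum in the ball of half the radius.
 The tilt \<open>\<epsilon>\<close> is chosen last, small against \<open>D T\<close>.\<close>

lemma turning_dynamics:
 fixes \<rho>1 \<rho>2 :: real
 assumes \<rho>: "0 < \<rho>2 - \<rho>1" and c: "center s M \<theta> \<mu> vs" and dvs: "decays s vs"
  and vert: "1 + Re (deriv vs 0) = 0" and turn: "Re (deriv (velocity (s / 16) vs) 0) < 0"
  and e: "e holomorphic_on strip (2 * s)" "\<And>w. w \<in> strip (2 * s) \<Longrightarrow> norm (e w) \<le> E" "decays s e" "deriv e 0 = 1"
 obtains \<epsilon> T v where "0 < \<epsilon>" "\<epsilon> < 1" "0 < T" "muskat_solution \<rho>1 \<rho>2 T (\<lambda>t. curve (v t))"
  "curve (v 0) = curve (\<lambda>w. vs w + of_real \<epsilon> * e w)" "\<And>f. \<not> is_graph_of (curve (v T)) f"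
proof -
 define c0 where "c0 = (\<rho>2 - \<rho>1) / (4 * pi)"
 have c0: "0 < c0" using \<rho> by (simp add: c0_def)
 define F where "F v \<alpha> = complex_of_real (c0/2) * velocity (s / 16) v \<alpha>" for v \<alpha>
 note c' = c[unfolded center_def]
 have s: "0 < s" "s \<le> 1" using c' by auto
 define R0 where "R0 = min \<theta> (\<mu> * (s / 16) / 2)"
 have R0: "0 < R0" "R0 \<le> \<theta>" "R0 \<le> \<mu> * (s / 16) / 2" using c' by (auto simp: R0_def)
 obtain C0 where ck0: "ck_operator F vs s R0 C0" using center_ck_operator[OF c R0] unfolding F_def by blast
 interpret k0: ck_operator F vs s R0 C0 by (rule ck0)
 have C0: "0 < C0" using k0.C by simp
 have holF: "F v holomorphic_on strip s'" if "s / 2 \<le> s'" "s' \<le> s" "near vs R0 s' v" for s' v by (rule k0.F_hol[OF that])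
 define D where "D = - Re (deriv (F vs) 0)"
 have D: "0 < D"
 proof -
  have "near vs R0 s vs" using R0 s by (intro center_near_self[OF c]) auto
  then have "state s (s / 16) (M + R0) \<theta> (\<mu> * (s / 16)) vs" using s R0 by (intro near_state[OF c _ R0(2,3)]) auto
  then have "velocity (s / 16) vs field_differentiable at 0"
   using velocity_holomorphic s by (intro holomorphic_on_imp_differentiable_at[of _ "strip s"]) auto
  then have "deriv (F vs) 0 = of_real (c0/2) * deriv (velocity (s / 16) vs) 0"
   unfolding F_def[abs_def] by (rule deriv_cmult)
  moreover have "Re (complex_of_real x * z) = x * Re z" for x z by simp
  ultimately have "D = - (c0/2) * Re (deriv (velocity (s / 16) vs) 0)" unfolding D_def by (simp only: mult_minus_left)
  then show ?thesis using turn c0 by (simp add: mult_pos_neg)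
 qed
 \<comment> \<open>A Lipschitz constant for the velocity gradient at \<open>0\<close>: each of the two factors \<open>4 / s\<close> is one use of Cauchy's inequality.\<close>
 define L where "L = C0 * (4 / s + (1 + C0)) * (4 / s)"
 have L: "0 < L" unfolding L_def by (intro mult_pos_pos divide_pos_pos add_pos_pos) (use C0 s in simp_all)
 define R where "R = min R0 (D / (2 * L))"
 have Rp: "0 < R" "R \<le> R0" "L * R \<le> D / 2" using R0 D L by (auto simp: R_def min_def field_simps)
 have Rb: "0 < R" "R \<le> \<theta>" "R \<le> \<mu> * (s / 16) / 2" using Rp R0 by auto
 have derF: "Re (deriv (F v) 0) \<le> - D / 2" if s': "s / 2 \<le> s'" "s' \<le> s" and n: "near vs R s' v" for s' v
 proof -
  have n0: "near vs R0 s' v" "near vs R0 s' vs" using n Rp s s' R0 center_near_self[OF c, of R0 s'] unfolding near_def by auto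
  have hv: "v holomorphic_on strip s'" "vs holomorphic_on strip s'" using n0 unfolding near_def by auto
  have hF: "F v holomorphic_on strip s'" "F vs holomorphic_on strip s'" using holF[OF s'] n0 by auto
  have "norm (deriv (\<lambda>w. F v w - F vs w) 0) \<le> (C0 * (4 / s + (1 + C0)) * R) / (s / 4)"
  proof (rule norm_deriv_le_strip[of _ "s / 4"])
   show "(\<lambda>w. F v w - F vs w) holomorphic_on strip (s / 4)"
    by (rule holomorphic_on_subset[OF holomorphic_on_diff[OF hF] complex_strip_mono]) (use s s' in auto)
   fix w assume w: "w \<in> strip (s / 4)"
   have ws: "w \<in> strip s'" "w \<in> strip s" using w s s' by auto
   have "norm (deriv (\<lambda>w. v w - vs w) w) \<le> R / (s / 4)"
    by (rule norm_deriv_le_strip[of _ s']) (use hv n w s s' in \<open>auto intro: holomorphic_on_diff simp: near_def\<close>)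
   then have d1: "norm (deriv v w - deriv vs w) \<le> 4 / s * R" using deriv_diff_strip[OF hv ws(1)] by (simp add: field_simps)
   have "norm (F v w - F vs w) \<le> C0 * (norm (deriv v w - deriv vs w) + (1 + norm (deriv vs w)) * R)"
    by (rule k0.F_lip[OF s' n0 _ ws(1)]) (use n in \<open>auto simp: near_def\<close>)
   also have "\<dots> \<le> C0 * (4 / s * R + (1 + C0) * R)"
    using d1 k0.vs_deriv[OF ws(2)] C0 Rp by (intro mult_left_mono add_mono mult_right_mono) auto
   finally show "norm (F v w - F vs w) \<le> C0 * (4 / s + (1 + C0)) * R" by (simp add: algebra_simps)
  qed (use s in auto)
  also have "\<dots> = L * R" by (simp add: L_def field_simps)
  also have "\<dots> \<le> D / 2" by (rule Rp)
  finally have "norm (deriv (F v) 0 - deriv (F vs) 0) \<le> D / 2" using deriv_diff_strip[OF hF, of 0] s s' by simp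
  then have "\<bar>Re (deriv (F v) 0 - deriv (F vs) 0)\<bar> \<le> D / 2" using abs_Re_le_cmod order_trans by blast
  then show ?thesis unfolding D_def minus_complex.sel by linarith
 qed
 obtain C where ck: "ck_operator F vs s R C" using center_ck_operator[OF c Rb] unfolding F_def by blast
 interpret k: ck_operator F vs s R C by (rule ck)
 \<comment> \<open>A cone steep enough for both conditions of the existence theorem.\<close>
 define K where "K = 12 * k.A + 12 * k.A / R"
 have K: "0 < K" "12 * k.A \<le> K * R" "12 * k.A \<le> K" using k.A_pos Rp by (auto simp: K_def field_simps intro!: add_pos_pos)
 \<comment> \<open>The longest time for which the cone keeps three quarters of its width.\<close>
 define T where "T = s / (4 * K)"
 have T: "0 < T" "K * T \<le> s / 4" using s K by (auto simp: T_def)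
 have E0: "0 \<le> E" using e(2)[of 0] s by (auto intro: order_trans[OF norm_ge_zero])
 \<comment> \<open>The second bound makes the tangent turn before \<open>T\<close>; the third keeps the datum and its derivative within \<open>R / 2\<close> of the center.\<close>
 define \<epsilon> where "\<epsilon> = Min {1/2, D * T / 4, R / (2 * (E + E / s + 1))}"
 have Ep: "0 < E + E / s + 1" using E0 s by (intro add_nonneg_pos add_nonneg_nonneg) auto
 have eps: "0 < \<epsilon>" using D T Rp Ep by (simp add: \<epsilon>_def)
 have eps1: "\<epsilon> \<le> 1/2" "\<epsilon> \<le> D * T / 4" "\<epsilon> \<le> R / (2 * (E + E / s + 1))" unfolding \<epsilon>_def by (rule Min_le; simp)+
 have epsE: "\<epsilon> * (E + E / s + 1) \<le> R / 2"
 proof -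
  have "a \<le> R / (2 * b) \<Longrightarrow> 0 < b \<Longrightarrow> a * b \<le> R / 2" for a b :: real by (simp add: pos_le_divide_eq)
  then show ?thesis using eps1(3) Ep by blast
 qed
 have epsE1: "\<epsilon> * E \<le> R / 2" "\<epsilon> * (E / s) \<le> R / 2"
  by (rule order_trans[OF mult_left_mono epsE]; use eps E0 s in simp)+
 define vi where "vi w = vs w + of_real \<epsilon> * e w" for w
 have he: "e holomorphic_on strip s" by (rule holomorphic_on_subset[OF e(1) complex_strip_mono]) (use s in simp)
 have hvi: "vi holomorphic_on strip s" unfolding vi_def[abs_def] by (intro holomorphic_intros k.vs_hol he)
 have vi1: "norm (vi w - vs w) \<le> R / 2" if "w \<in> strip s" for w
 proof -
  have "norm (vi w - vs w) = \<epsilon> * norm (e w)" using eps by (simp add: vi_def norm_mult)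
  also have "\<dots> \<le> \<epsilon> * E" using e(2)[of w] that s eps by (intro mult_left_mono) auto
  finally show ?thesis using epsE1 by simp
 qed
 have dvi: "deriv vi w = deriv vs w + of_real \<epsilon> * deriv e w" if "w \<in> strip s" for w
 proof -
  have "(vi has_field_derivative deriv vs w + of_real \<epsilon> * deriv e w) (at w)"
   unfolding vi_def[abs_def]
   by (intro DERIV_add DERIV_cmult holomorphic_derivI[OF k.vs_hol open_complex_strip that] holomorphic_derivI[OF he open_complex_strip that])
  then show ?thesis by (rule DERIV_imp_deriv)
 qed
 have vi2: "norm (deriv vi w - deriv vs w) \<le> R / 2" if "w \<in> strip s" for w
 proof -
  have "norm (deriv e w) \<le> E / s" by (rule norm_deriv_le_strip[OF e(1,2)]) (use that s in auto)
  then have "\<epsilon> * norm (deriv e w) \<le> \<epsilon> * (E / s)" using eps by (intro mult_left_mono) auto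
  from order_trans[OF this epsE1(2)] show ?thesis using eps by (simp add: dvi[OF that] norm_mult)
 qed
 have dec: "decays s vi" unfolding decays_def vi_def[abs_def]
 proof (intro allI impI)
  fix s' assume "s' < s"
  then have "((\<lambda>w. vs w + of_real \<epsilon> * e w) \<longlongrightarrow> 0 + of_real \<epsilon> * 0) (inf at_infinity (principal (strip s')))"
   using dvs e(3) unfolding decays_def by (intro tendsto_intros) auto
  then show "((\<lambda>w. vs w + of_real \<epsilon> * e w) \<longlongrightarrow> 0) (inf at_infinity (principal (strip s')))" by simp
 qed
 have decF: "decays s' (F v)" if "s / 2 \<le> s'" "s' \<le> s" "near vs R s' v" "decays s' v" for s' v
 proof -
  have "decays s' (velocity (s / 16) v)"
   using near_state[OF c _ Rb(2,3) that(1,2,3)] Rb that(4) by (intro velocity_decays) auto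
  then show ?thesis unfolding F_def[abs_def] decays_def by (intro allI impI tendsto_mult_right_zero) simp
 qed
 obtain v where v: "k.in_cone K T v" "\<And>t w. t \<in> {0..T} \<Longrightarrow> w \<in> strip (s - K * t) \<Longrightarrow> v t w = vi w + time_int (\<lambda>\<tau>. F (v \<tau>)) t w"
  "\<And>t. t \<in> {0..T} \<Longrightarrow> decays (s - K * t) (v t)"
  using k.solution_exists[OF K(1) less_imp_le[OF T(1)] T(2) K(2,3) hvi vi1 vi2 dec decF] by blast
 have sol: "muskat_solution \<rho>1 \<rho>2 T (\<lambda>t. curve (v t))"
  by (rule muskat_solution_from_cone[OF c Rb ck[unfolded F_def c0_def] K(1) T(2) less_imp_le[OF T(1)] v(1) v(2)[unfolded F_def c0_def] v(3)])
 have c00: "curve (v 0) = curve vi"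
  using v(2)[of 0 "of_real _"] T s by (auto simp: curve_def pt_def fun_eq_iff time_int_def)
 interpret ci: cone_integrand s K T k.A "\<lambda>\<tau>. F (v \<tau>)" by (rule k.F_cone[OF K(1) less_imp_le[OF T(1)] T(2) v(1)])
 have TT: "T \<in> {0..T}" using T by simp
 note wd = k.width[OF K(1) less_imp_le[OF T(1)] T(2)]
 have z0: "0 \<in> strip (s - K * T)" using wd[OF TT] s by simp
 have der: "deriv (v T) 0 = deriv vi 0 + integral {0..T} (\<lambda>\<tau>. deriv (F (v \<tau>)) 0)"
 proof -
  have "deriv (v T) 0 = deriv (\<lambda>w. vi w + time_int (\<lambda>\<tau>. F (v \<tau>)) T w) 0"
   by (rule deriv_cong_strip[OF v(2)[OF TT] z0])
  also have "\<dots> = deriv vi 0 + integral {0..T} (\<lambda>\<tau>. deriv (F (v \<tau>)) 0)"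
   by (intro DERIV_imp_deriv DERIV_add holomorphic_derivI[OF hvi open_complex_strip] ci.time_int_deriv(1)[OF TT z0]) (use s in simp)
  finally show ?thesis .
 qed
 have "Re (integral {0..T} (\<lambda>\<tau>. deriv (F (v \<tau>)) 0)) = integral {0..T} (\<lambda>\<tau>. Re (deriv (F (v \<tau>)) 0))"
  using integral_linear[OF ci.time_int_deriv(2)[OF TT z0] bounded_linear_Re] by (simp add: o_def)
 also have "\<dots> \<le> integral {0..T} (\<lambda>\<tau>. - D / 2)"
 proof (rule integral_le)
  show "(\<lambda>\<tau>. Re (deriv (F (v \<tau>)) 0)) integrable_on {0..T}"
   using integrable_linear[OF ci.time_int_deriv(2)[OF TT z0] bounded_linear_Re] by (simp add: o_def)
  show "Re (deriv (F (v \<tau>)) 0) \<le> - D / 2" if "\<tau> \<in> {0..T}" for \<tau>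
   using wd[OF that] s by (intro derF[OF _ _ k.in_coneD(1)[OF K(1) less_imp_le[OF T(1)] T(2) v(1) that]]) auto
 qed auto
 also have "\<dots> = - D / 2 * T" using T by simp
 finally have "1 + Re (deriv (v T) 0) \<le> \<epsilon> - D * T / 2"
  using vert e(4) s by (simp add: der dvi)
 also have "\<dots> < 0" using eps1(2) mult_pos_pos[OF D T(1)] by simp
 finally have neg: "1 + Re (deriv (v T) 0) < 0" .
 have ng: "\<not> is_graph_of (curve (v T)) f" for f
 proof (rule not_graph[of _ "s - K * T"])
  show "v T holomorphic_on strip (s - K * T)" by (rule k.in_coneD(2)[OF K(1) less_imp_le[OF T(1)] T(2) v(1) TT])
  show "0 < s - K * T" using z0 by simp
  show "inj (curve (v T))" using sol TT unfolding muskat_solution_def by blast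
 qed (use v(3)[OF TT] neg in auto)
 have "\<epsilon> < 1" using eps1 by simp
 then show ?thesis using that[OF eps _ T(1) sol c00[unfolded vi_def[abs_def]] ng] by blast
qed

section \<open>The velocity gradient at a vertical tangent\<close>

text \<open>The kernel as a function of the evaluation point, extended across the diagonal, with a bound
 that is uniform near \<open>0\<close>.\<close>

lemma inner_bound_sym_extend:
 assumes st: "state s \<rho> M \<theta> \<mu> v"
 obtains g C where "\<And>\<eta>::real. g \<eta> holomorphic_on strip (2 * \<rho>)"
  "\<And>\<eta> \<alpha>. \<alpha> \<in> strip (2 * \<rho>) \<Longrightarrow> \<alpha> \<noteq> of_real \<eta> \<Longrightarrow> g \<eta> \<alpha> = reg_ker v \<alpha> (of_real \<eta>)"
  "\<And>\<eta> \<alpha>. \<alpha> \<in> ball 0 (\<rho>/2) \<Longrightarrow> norm (g \<eta> \<alpha>) \<le> C * exp (- \<bar>\<eta>\<bar>)"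
proof -
 note sd = stateD[OF st]
 have e: "complex_of_real \<eta> \<in> strip (2 * \<rho>)" for \<eta> using sd(1) by simp
 have "\<exists>g. g holomorphic_on strip (2 * \<rho>) \<and> (\<forall>z\<in>strip (2 * \<rho>) - {of_real \<eta>}. g z = reg_ker v z (of_real \<eta>))" for \<eta> :: real
 proof -
  have hol: "(\<lambda>\<alpha>. reg_ker v \<alpha> (of_real \<eta>)) holomorphic_on strip (2 * \<rho>) - {of_real \<eta>}"
   by (rule reg_ker_holomorphic[OF sd(7), where g = "\<lambda>_. of_real \<eta>" and f = "\<lambda>w. w"])
     (use inner_cosh_nz[OF st _ e] inner_subset[OF st] e in auto)
  show ?thesis using holomorphic_on_extend_lim[OF hol] reg_ker_lim(2)[OF st e] e by (simp add: interior_open)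
 qed
 then obtain g where g: "\<And>\<eta>::real. g \<eta> holomorphic_on strip (2 * \<rho>)"
  "\<And>\<eta> z. z \<in> strip (2 * \<rho>) - {of_real \<eta>} \<Longrightarrow> g \<eta> z = reg_ker v z (of_real \<eta>)" by metis
 define C0 where "C0 = reg_ker_const M (cosh_low M \<theta> \<mu>) * (3 * M / \<rho> + 2 * M)"
 have C0: "0 \<le> C0" unfolding C0_def reg_ker_const_def using sd(1,4) by (intro mult_nonneg_nonneg divide_nonneg_nonneg add_nonneg_nonneg) auto
 have far: "norm (g \<eta> \<alpha>) \<le> C0 * exp (- \<bar>Re \<alpha> - \<eta>\<bar>)" if "\<alpha> \<in> strip (2 * \<rho>)" "\<rho> \<le> norm (\<alpha> - of_real \<eta>)" for \<alpha> \<eta>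
 proof -
  have "\<alpha> \<noteq> of_real \<eta>" using that(2) sd(1) by auto
  then show ?thesis using g(2)[of \<alpha> \<eta>] inner_bound[OF st that(1) e that(2)] that(1) by (simp add: C0_def)
 qed
 have "norm (g \<eta> \<alpha>) \<le> C0 * exp (2 * \<rho>) * exp (- \<bar>\<eta>\<bar>)" if a: "\<alpha> \<in> ball 0 (\<rho>/2)" for \<eta> \<alpha>
 proof -
  have na: "norm \<alpha> < \<rho> / 2" using a by simp
  have ae: "norm (g \<eta> \<alpha>) \<le> C0 * exp (- x)" if "norm (g \<eta> \<alpha>) \<le> C0 * exp (- y)" "x \<le> y" for x y
   using that C0 mult_left_mono[of "exp (-y)" "exp (-x)" C0] by simp
  have "norm (g \<eta> \<alpha>) \<le> C0 * exp (- (\<bar>\<eta>\<bar> - 2 * \<rho>))"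
  proof (cases "\<rho> \<le> norm (\<alpha> - of_real \<eta>)")
   case True
   have as: "\<alpha> \<in> strip (2 * \<rho>)" using na abs_Im_le_cmod[of \<alpha>] by simp
   show ?thesis by (rule ae[OF far[OF as True]]) (use na abs_Re_le_cmod[of \<alpha>] in auto)
  next
   case False
   have sub: "cball (complex_of_real \<eta>) \<rho> \<subseteq> strip (2 * \<rho>)" using sd(1) by (intro cball_subset_complex_strip) simp
   have "norm (g \<eta> \<alpha>) \<le> C0"
   proof (rule maximum_modulus_frontier[of "g \<eta>" "cball (complex_of_real \<eta>) \<rho>"])
    show "g \<eta> holomorphic_on interior (cball (complex_of_real \<eta>) \<rho>)"
     using sub by (intro holomorphic_on_subset[OF g(1)]) (auto intro: interior_subset[THEN subsetD])
    show "continuous_on (closure (cball (complex_of_real \<eta>) \<rho>)) (g \<eta>)"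
     using holomorphic_on_imp_continuous_on[OF holomorphic_on_subset[OF g(1) sub]] by simp
    show "\<alpha> \<in> cball (complex_of_real \<eta>) \<rho>" using False by (simp add: dist_norm norm_minus_commute)
    fix z assume "z \<in> frontier (cball (complex_of_real \<eta>) \<rho>)"
    then have z: "norm (z - of_real \<eta>) = \<rho>" using sd(1) by (simp add: dist_norm norm_minus_commute)
    then have "z \<in> strip (2 * \<rho>)" using sub by (auto simp: dist_norm norm_minus_commute)
    then have "norm (g \<eta> z) \<le> C0 * exp (- \<bar>Re z - \<eta>\<bar>)" using far z by simp
    also have "\<dots> \<le> C0 * 1" using C0 by (intro mult_left_mono) auto
    finally show "norm (g \<eta> z) \<le> C0" by simp
   qed simp
   then have 0: "norm (g \<eta> \<alpha>) \<le> C0 * exp (- 0)" by simp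
   have "\<bar>\<eta>\<bar> \<le> norm (\<alpha> - of_real \<eta>) + norm \<alpha>" using norm_triangle_ineq4[of \<alpha> "\<alpha> - of_real \<eta>"] by simp
   then show ?thesis using False na by (intro ae[OF 0]) simp
  qed
  also have "exp (- (\<bar>\<eta>\<bar> - 2 * \<rho>)) = exp (2 * \<rho>) * exp (- \<bar>\<eta>\<bar>)" by (simp flip: exp_add)
  finally show ?thesis by (simp add: mult.assoc)
 qed
 then show ?thesis using that g by blast
qed

text \<open>Differentiation under the unshifted integral. Off the diagonal the derivative can be
 computed from the real kernel.\<close>

lemma deriv_velocity_eq:
 assumes st: "state s \<rho> M \<theta> \<mu> v"
 obtains d where "integrable lborel d" "deriv (velocity \<rho> v) 0 = (LBINT \<eta>. d \<eta>)"
  "\<And>\<eta>. \<eta> \<noteq> 0 \<Longrightarrow> ((\<lambda>x. Re (reg_ker v (of_real x) (of_real \<eta>))) has_real_derivative Re (d \<eta>)) (at 0)"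
proof -
 note sd = stateD[OF st]
 obtain g C where g: "\<And>\<eta>::real. g \<eta> holomorphic_on strip (2 * \<rho>)"
  "\<And>\<eta> \<alpha>. \<alpha> \<in> strip (2 * \<rho>) \<Longrightarrow> \<alpha> \<noteq> of_real \<eta> \<Longrightarrow> g \<eta> \<alpha> = reg_ker v \<alpha> (of_real \<eta>)"
  "\<And>\<eta> \<alpha>. \<alpha> \<in> ball 0 (\<rho>/2) \<Longrightarrow> norm (g \<eta> \<alpha>) \<le> C * exp (- \<bar>\<eta>\<bar>)"
  by (rule inner_bound_sym_extend[OF st], rule that)
 let ?U = "ball (0::complex) (\<rho>/2)"
 have U0: "0 \<in> ?U" using sd(1) by simp
 have Us: "?U \<subseteq> strip \<rho>" "?U \<subseteq> strip (2 * \<rho>)"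
  using sd(1) ball_subset_complex_strip[of 0 "\<rho>/2" \<rho>] ball_subset_complex_strip[of 0 "\<rho>/2" "2 * \<rho>"] by auto
 have meas: "(\<lambda>\<eta>. g \<eta> w) \<in> borel_measurable lborel" if w: "w \<in> ?U" for w
 proof -
  have ws: "w \<in> strip \<rho>" using w Us by blast
  obtain h B where h: "h holomorphic_on strip (2 * \<rho>)" "\<And>\<eta>. \<eta> \<in> strip (2 * \<rho>) \<Longrightarrow> \<eta> \<noteq> w \<Longrightarrow> h \<eta> = reg_ker v w \<eta>"
   using reg_ker_extend[OF st ws] by metis
  have "(\<lambda>\<eta>. h (of_real \<eta> + 0)) \<in> borel_measurable borel"
   by (rule borel_measurable_line[OF holomorphic_on_imp_continuous_on[OF h(1)]]) (use sd(1) in simp)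
  then have "(\<lambda>\<eta>. if \<eta> = Re w then g (Re w) w else h (of_real \<eta>)) \<in> borel_measurable lborel" by (intro measurable_If) auto
  moreover have "(\<lambda>\<eta>. if \<eta> = Re w then g (Re w) w else h (of_real \<eta>)) = (\<lambda>\<eta>. g \<eta> w)"
  proof
   fix \<eta> :: real
   have "w \<noteq> of_real \<eta>" if "\<eta> \<noteq> Re w" using that by auto
   then show "(if \<eta> = Re w then g (Re w) w else h (of_real \<eta>)) = g \<eta> w"
    using h(2)[of "of_real \<eta>"] g(2)[of w \<eta>] ws sd(1) by auto
  qed
  ultimately show ?thesis by simp
 qed
 define d where "d \<eta> = deriv (g \<eta>) 0" for \<eta>
 note D = has_field_derivative_integral[of ?U 0 lborel "\<lambda>w \<eta>. g \<eta> w" "\<lambda>\<eta>. C * exp (- \<bar>\<eta>\<bar>)", OF open_ball U0 _ meas _ g(3)]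
 have hU: "g \<eta> holomorphic_on ?U" for \<eta> by (rule holomorphic_on_subset[OF g(1) Us(2)])
 have ge: "integrable lborel (\<lambda>\<eta>. C * exp (- \<bar>\<eta>\<bar>))" using integrable_exp_neg_abs by simp
 have D1: "((\<lambda>w. LBINT \<eta>. g \<eta> w) has_field_derivative (LBINT \<eta>. d \<eta>)) (at 0)" and D2: "integrable lborel d"
  unfolding d_def using D hU ge by auto
 have eq: "(LBINT \<eta>. g \<eta> (of_real x)) = velocity \<rho> v (of_real x)" if x: "\<bar>x\<bar> < \<rho> / 2" for x
 proof -
  have xU: "complex_of_real x \<in> ?U" using x by simp
  have xs: "complex_of_real x \<in> strip \<rho>" "complex_of_real x \<in> strip (2 * \<rho>)" using sd(1) by auto
  have int: "integrable lborel (\<lambda>\<beta>. reg_ker v (of_real x) (of_real x - of_real \<beta>))"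
   using shifted_eq_unshifted(2)[OF st xs(1), of 0] sd(1) by simp
  have int2: "integrable lborel (\<lambda>\<eta>. reg_ker v (of_real x) (of_real \<eta>))"
   using lborel_integrable_real_affine[OF int, of "-1" x] by simp
  have "velocity \<rho> v (of_real x) = (LBINT \<eta>. reg_ker v (of_real x) (of_real \<eta>))"
   using lborel_integral_real_affine[of "-1" "\<lambda>\<beta>. reg_ker v (of_real x) (of_real x - of_real \<beta>)" x] velocity_eq_unshifted[OF st xs(1)] by simp
  also have "\<dots> = (LBINT \<eta>. g \<eta> (of_real x))"
  proof (rule integral_cong_AE[OF borel_measurable_integrable[OF int2] meas[OF xU]])
   show "AE \<eta> in lborel. reg_ker v (of_real x) (of_real \<eta>) = g \<eta> (of_real x)"
    using AE_lborel_singleton[of x] by eventually_elim (use g(2) xs in auto)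
  qed
  finally show ?thesis ..
 qed
 have F1: "(velocity \<rho> v has_field_derivative deriv (velocity \<rho> v) 0) (at (of_real 0))"
  using holomorphic_derivI[OF velocity_holomorphic[OF st] open_complex_strip, of 0] sd(1,2) by simp
 have "((\<lambda>x. velocity \<rho> v (of_real x)) has_vector_derivative deriv (velocity \<rho> v) 0) (at 0)"
  by (rule has_vector_derivative_real_field[OF F1])
 moreover have "((\<lambda>x. velocity \<rho> v (of_real x)) has_vector_derivative (LBINT \<eta>. d \<eta>)) (at 0)"
 proof (rule has_vector_derivative_transform_within_open)
  show "((\<lambda>x. LBINT \<eta>. g \<eta> (of_real x)) has_vector_derivative (LBINT \<eta>. d \<eta>)) (at 0)"
   using D1 by (intro has_vector_derivative_real_field) simp
  show "open {- \<rho>/2 <..< \<rho>/2}" "0 \<in> {- \<rho>/2 <..< \<rho>/2}" using sd(1) by auto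
  show "(LBINT \<eta>. g \<eta> (of_real x)) = velocity \<rho> v (of_real x)" if "x \<in> {- \<rho>/2 <..< \<rho>/2}" for x
   using that by (intro eq) auto
 qed
 ultimately have der: "deriv (velocity \<rho> v) 0 = (LBINT \<eta>. d \<eta>)" by (rule vector_derivative_unique_at)
 have "((\<lambda>x. Re (reg_ker v (of_real x) (of_real \<eta>))) has_real_derivative Re (d \<eta>)) (at 0)" if ne: "\<eta> \<noteq> 0" for \<eta>
 proof -
  have "(g \<eta> has_field_derivative d \<eta>) (at (of_real 0))"
   unfolding d_def using holomorphic_derivI[OF g(1) open_complex_strip, of 0] sd(1) by simp
  from bounded_linear.has_vector_derivative[OF bounded_linear_Re has_vector_derivative_real_field[OF this]]
  have 1: "((\<lambda>x. Re (g \<eta> (of_real x))) has_vector_derivative Re (d \<eta>)) (at 0)" .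
  have "((\<lambda>x. Re (reg_ker v (of_real x) (of_real \<eta>))) has_vector_derivative Re (d \<eta>)) (at 0)"
  proof (rule has_vector_derivative_transform_within_open[OF 1])
   show "open (- {\<eta>})" "0 \<in> - {\<eta>}" using ne by auto
   show "Re (g \<eta> (of_real x)) = Re (reg_ker v (of_real x) (of_real \<eta>))" if "x \<in> - {\<eta>}" for x
    using g(2)[of "of_real x" \<eta>] that sd(1) by simp
  qed
  then show ?thesis by (simp add: has_real_derivative_iff_has_vector_derivative)
 qed
 then show ?thesis using that D2 der by blast
qed

text \<open>The density that is left of the derivative of the kernel at a point where \<open>z\<^sub>1'
 = z\<^sub>1'' = 0\<close>.\<close>

definition turn_ker :: "real \<Rightarrow> real \<Rightarrow> real \<Rightarrow> real" where
 "turn_ker dz1 z1 z2 = dz1 * sinh z1 * sin z2 * (1 / (cosh z1 - cos z2)\<^sup>2 + 1 / (cosh z1 + cos z2)\<^sup>2)"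

lemma Re_reg_ker_real:
 assumes st: "state s \<rho> M \<theta> \<mu> v" and ne: "x \<noteq> \<eta>"
 defines "z1 \<equiv> (\<lambda>x::real. x + Re (v (of_real x)))" and "z2 \<equiv> (\<lambda>x::real. Im (v (of_real x)))"
 shows "Re (reg_ker v (of_real x) (of_real \<eta>)) =
   2 * (Re (deriv v (of_real x)) - Re (deriv v (of_real \<eta>))) *
    (sinh (z1 x - z1 \<eta>) / (cosh (z1 x - z1 \<eta>) - cos (z2 x - z2 \<eta>)) + sinh (z1 x - z1 \<eta>) / (cosh (z1 x - z1 \<eta>) + cos (z2 x + z2 \<eta>)) - 2 * tanh ((x - \<eta>) / 2))
   - 2 * Re (v (of_real \<eta>)) * (1 - (tanh ((x - \<eta>) / 2))\<^sup>2)"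
  and "cosh (z1 x - z1 \<eta>) - cos (z2 x - z2 \<eta>) \<noteq> 0" "cosh (z1 x - z1 \<eta>) + cos (z2 x + z2 \<eta>) \<noteq> 0"
proof -
 note sd = stateD[OF st]
 have s0: "0 < s" using sd by simp
 have reals: "complex_of_real x \<in> strip (2 * \<rho>)" for x using sd(1) by simp
 have nz: "cosh_nz v (of_real x) (of_real \<eta>)" using ne by (intro inner_cosh_nz[OF st reals reals]) simp
 have "Re (full_ker v (of_real x) (of_real \<eta>) / 2) = fst (muskat_integrand (curve v) x \<eta>)"
  using full_ker_real[OF sd(7) s0 nz] by (simp add: to_pair_def)
 also have "\<dots> = (Re (deriv v (of_real x)) - Re (deriv v (of_real \<eta>))) *
    (sinh (z1 x - z1 \<eta>) / (cosh (z1 x - z1 \<eta>) - cos (z2 x - z2 \<eta>)) + sinh (z1 x - z1 \<eta>) / (cosh (z1 x - z1 \<eta>) + cos (z2 x + z2 \<eta>)))"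
  unfolding muskat_integrand_def Let_def vector_derivative_curve[OF sd(7) s0]
  by (simp add: curve_def to_pair_def pt_def z1_def z2_def distrib_left mult.commute)
 finally have f0: "Re (full_ker v (of_real x) (of_real \<eta>) / 2) = \<dots>" .
 have "Re (full_ker v (of_real x) (of_real \<eta>)) = 2 * Re (full_ker v (of_real x) (of_real \<eta>) / 2)" by simp
 note f = this[unfolded f0]
 have cd: "Re (deriv (conj_refl v) (of_real \<eta>)) = Re (deriv v (of_real \<eta>))" "Re (conj_refl v (of_real \<eta>)) = Re (v (of_real \<eta>))"
  using deriv_conj_refl[OF sd(7), of "of_real \<eta>"] s0 by (auto simp: conj_refl_def)
 have r: "Re (ref_ker v x \<eta>) = 4 * (Re (deriv v (of_real x)) - Re (deriv v (of_real \<eta>))) * tanh ((x - \<eta>) / 2) + 2 * Re (v (of_real \<eta>)) * (1 - (tanh ((x - \<eta>) / 2))\<^sup>2)"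
  unfolding ref_ker_def by (simp add: cd algebra_simps del: of_real_diff of_real_power)
 have al: "2 * (a * (X + Y)) - (4 * a * T + 2 * c * S) = 2 * a * (X + Y - 2 * T) - 2 * c * S" for a X Y T c S :: real
  by (simp add: algebra_simps)
 have "Re (reg_ker v (of_real x) (of_real \<eta>)) = Re (full_ker v (of_real x) (of_real \<eta>)) - Re (ref_ker v x \<eta>)"
  unfolding full_ker_split by simp
 then show "Re (reg_ker v (of_real x) (of_real \<eta>)) =
   2 * (Re (deriv v (of_real x)) - Re (deriv v (of_real \<eta>))) *
    (sinh (z1 x - z1 \<eta>) / (cosh (z1 x - z1 \<eta>) - cos (z2 x - z2 \<eta>)) + sinh (z1 x - z1 \<eta>) / (cosh (z1 x - z1 \<eta>) + cos (z2 x + z2 \<eta>)) - 2 * tanh ((x - \<eta>) / 2))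
   - 2 * Re (v (of_real \<eta>)) * (1 - (tanh ((x - \<eta>) / 2))\<^sup>2)"
  unfolding f r by (rule trans[OF _ al])
 let ?P = "pt v (of_real x)" and ?Q = "pt v (of_real \<eta>)"
 have n1: "sinh ((?P - ?Q)/2) \<noteq> 0" using nz cosh_plus_half_pi[of "?P - ?Q"] unfolding cosh_nz_def by fastforce
 have n2: "cosh ((?P - cnj ?Q)/2) \<noteq> 0" using nz unfolding cosh_nz_def by (simp add: pt_conj_refl)
 have e: "Re ((?P - ?Q)/2) = (z1 x - z1 \<eta>)/2" "Im ((?P - ?Q)/2) = (z2 x - z2 \<eta>)/2"
  "Re ((?P - cnj ?Q)/2) = (z1 x - z1 \<eta>)/2" "Im ((?P - cnj ?Q)/2) = (z2 x + z2 \<eta>)/2"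
  by (simp_all add: pt_def z1_def z2_def)
 have "(norm (sinh ((?P - ?Q)/2)))\<^sup>2 \<noteq> 0" "(norm (cosh ((?P - cnj ?Q)/2)))\<^sup>2 \<noteq> 0" using n1 n2 by auto
 then have "2 * (norm (sinh ((?P - ?Q)/2)))\<^sup>2 \<noteq> 0" "2 * (norm (cosh ((?P - cnj ?Q)/2)))\<^sup>2 \<noteq> 0" by simp_all
 then show "cosh (z1 x - z1 \<eta>) - cos (z2 x - z2 \<eta>) \<noteq> 0" "cosh (z1 x - z1 \<eta>) + cos (z2 x + z2 \<eta>) \<noteq> 0"
  unfolding norm_sinh_squared norm_cosh_squared e half_angle .
qed

lemma integrable_sech_sq: "integrable lborel (\<lambda>\<eta>::real. 1 - (tanh (- \<eta> / 2))\<^sup>2)"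
proof (rule Bochner_Integration.integrable_bound)
 show "integrable lborel (\<lambda>x::real. 4 * exp (- \<bar>x\<bar>))" using integrable_exp_neg_abs by simp
 show "(\<lambda>\<eta>::real. 1 - (tanh (- \<eta> / 2))\<^sup>2) \<in> borel_measurable lborel"
  unfolding measurable_lborel2 by (intro borel_measurable_continuous_onI continuous_intros) auto
 show "AE \<eta> in (lborel :: real measure). norm (1 - (tanh (- \<eta> / 2))\<^sup>2) \<le> norm (4 * exp (- \<bar>\<eta>\<bar>))"
 proof (rule AE_I2)
  fix \<eta> :: real
  have "1 - (tanh (- \<eta> / 2))\<^sup>2 = ((cosh (-\<eta>/2))\<^sup>2 - (sinh (-\<eta>/2))\<^sup>2) / (cosh (-\<eta>/2))\<^sup>2"
   by (simp add: tanh_def power_divide diff_divide_distrib)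
  also have "\<dots> = 1 / (cosh (-\<eta>/2))\<^sup>2" by (simp add: cosh_square_eq)
  finally have e: "1 - (tanh (- \<eta> / 2))\<^sup>2 = 1 / (cosh (-\<eta>/2))\<^sup>2" .
  have "(exp \<bar>-\<eta>/2\<bar> / 2)\<^sup>2 \<le> (cosh (-\<eta>/2))\<^sup>2" by (rule power_mono[OF half_exp_le_cosh]) simp
  moreover have "(exp \<bar>-\<eta>/2\<bar> / 2)\<^sup>2 = exp \<bar>\<eta>\<bar> / 4" by (simp add: power_divide power2_eq_square flip: exp_add)
  ultimately have "exp \<bar>\<eta>\<bar> / 4 \<le> (cosh (-\<eta>/2))\<^sup>2" by (simp only:)
  then have "1 / (cosh (-\<eta>/2))\<^sup>2 \<le> 1 / (exp \<bar>\<eta>\<bar> / 4)" by (intro divide_left_mono) auto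
  then show "norm (1 - (tanh (- \<eta> / 2))\<^sup>2) \<le> norm (4 * exp (- \<bar>\<eta>\<bar>))" unfolding e by (simp add: exp_minus field_simps)
 qed
qed

text \<open>At a vertical tangent \<open>u = z\<^sub>1(x) - z\<^sub>1(\<eta>)\<close> and
  \<open>z\<^sub>1'(x) - z\<^sub>1'(\<eta>)\<close> are stationary in \<open>x\<close>, so only the
 cosines contribute to the derivative of the kernel. The reference terms form an exact derivative; its
 boundary values \<open>4 tanh (\<eta>/2)\<close> give the constant \<open>8\<close>.\<close>

lemma turning_formula:
 assumes st: "state s \<rho> M \<theta> \<mu> v" and dec: "decays s v"
  and v0: "v 0 = 0" and d0: "Re (deriv v 0) = -1" and dd0: "Re (deriv (deriv v) 0) = 0"
 defines "J \<equiv> (\<lambda>\<eta>. turn_ker (1 + Re (deriv v (of_real \<eta>))) (\<eta> + Re (v (of_real \<eta>))) (Im (v (of_real \<eta>))))"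
 shows "integrable lborel (\<lambda>\<eta>. 2 * Im (deriv v 0) * J \<eta>)"
  and "Re (deriv (velocity \<rho> v) 0) = 8 + (LBINT \<eta>. 2 * Im (deriv v 0) * J \<eta>)"
proof -
 note sd = stateD[OF st]
 have s0: "0 < s" using sd by simp
 have reals: "complex_of_real x \<in> strip s" for x using s0 by simp
 obtain d where d: "integrable lborel d" "deriv (velocity \<rho> v) 0 = (LBINT \<eta>. d \<eta>)"
  "\<And>\<eta>. \<eta> \<noteq> 0 \<Longrightarrow> ((\<lambda>x. Re (reg_ker v (of_real x) (of_real \<eta>))) has_real_derivative Re (d \<eta>)) (at 0)"
  by (rule deriv_velocity_eq[OF st], rule that)
 define z1 where "z1 x = x + Re (v (complex_of_real x))" for x :: real
 define z2 where "z2 x = Im (v (complex_of_real x))" for x :: real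
 define b where "b = Im (deriv v 0)"
 have vdr: "((\<lambda>x. u (complex_of_real x)) has_vector_derivative deriv u (of_real x)) (at x)" if "u holomorphic_on strip s" for u x
  by (rule has_vector_derivative_real_field, rule holomorphic_derivI[OF that open_complex_strip reals])
 have Rd: "((\<lambda>x. Re (u (complex_of_real x))) has_real_derivative Re (deriv u (of_real x))) (at x)" if "u holomorphic_on strip s" for u x
  using bounded_linear.has_vector_derivative[OF bounded_linear_Re vdr[OF that]] by (simp add: has_real_derivative_iff_has_vector_derivative)
 have Id: "((\<lambda>x. Im (u (complex_of_real x))) has_real_derivative Im (deriv u (of_real x))) (at x)" if "u holomorphic_on strip s" for u x
  using bounded_linear.has_vector_derivative[OF bounded_linear_Im vdr[OF that]] by (simp add: has_real_derivative_iff_has_vector_derivative)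
 have z10: "z1 0 = 0" "z2 0 = 0" using v0 by (simp_all add: z1_def z2_def)
 have dz1: "(z1 has_real_derivative 1 + Re (deriv v (of_real x))) (at x)" for x
  unfolding z1_def[abs_def] by (rule DERIV_add[OF DERIV_ident Rd[OF sd(7)]])
 have dz2: "(z2 has_real_derivative Im (deriv v (of_real x))) (at x)" for x
  unfolding z2_def[abs_def] by (rule Id[OF sd(7)])
 have dz10: "(z1 has_real_derivative 0) (at 0)" using dz1[of 0] d0 by simp
 have dz20: "(z2 has_real_derivative b) (at 0)" using dz2[of 0] by (simp add: b_def)
 have ddv: "((\<lambda>x. Re (deriv v (of_real x))) has_real_derivative 0) (at 0)"
  using Rd[OF holomorphic_deriv[OF sd(7) open_complex_strip], of 0] dd0 by simp
 define D2 where "D2 \<eta> = 2 * (1 - (tanh (- \<eta> / 2))\<^sup>2) * (1 + Re (deriv v (of_real \<eta>)) + Re (v (of_real \<eta>)) * tanh (- \<eta> / 2))" for \<eta> :: real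
 have Red: "Re (d \<eta>) = 2 * b * J \<eta> + D2 \<eta>" if ne: "\<eta> \<noteq> 0" for \<eta>
 proof -
  define u where "u x = z1 x - z1 \<eta>" for x define p where "p x = z2 x - z2 \<eta>" for x define q where "q x = z2 x + z2 \<eta>" for x
  define a where "a x = Re (deriv v (complex_of_real x)) - Re (deriv v (complex_of_real \<eta>))" for x :: real
  define T where "T x = tanh ((x - \<eta>) / 2)" for x
  have du: "(u has_real_derivative 0) (at 0)" and dp: "(p has_real_derivative b) (at 0)" and dq: "(q has_real_derivative b) (at 0)" and da: "(a has_real_derivative 0) (at 0)"
   unfolding u_def p_def q_def a_def using DERIV_diff[OF dz10 DERIV_const] DERIV_diff[OF dz20 DERIV_const]
    DERIV_add[OF dz20 DERIV_const] DERIV_diff[OF ddv DERIV_const] by simp_all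
  have dT: "(T has_real_derivative (1 - (T 0)\<^sup>2) / 2) (at 0)"
   unfolding T_def by (auto intro!: derivative_eq_intros simp: field_simps)
  have n1: "cosh (u 0) - cos (p 0) \<noteq> 0" and n2: "cosh (u 0) + cos (q 0) \<noteq> 0"
   using Re_reg_ker_real(2,3)[OF st, of 0 \<eta>] ne by (auto simp: u_def p_def q_def z1_def z2_def)
  have k1: "((\<lambda>x. sinh (u x) / (cosh (u x) - cos (p x))) has_real_derivative - (sinh (u 0) * (sin (p 0) * b)) / (cosh (u 0) - cos (p 0))\<^sup>2) (at 0)"
   by (rule derivative_eq_intros du dp n1 refl | simp add: power2_eq_square)+
  have k2: "((\<lambda>x. sinh (u x) / (cosh (u x) + cos (q x))) has_real_derivative (sinh (u 0) * (sin (q 0) * b)) / (cosh (u 0) + cos (q 0))\<^sup>2) (at 0)"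
   by (rule derivative_eq_intros du dq n2 refl | simp add: power2_eq_square)+
  let ?R = "\<lambda>x. 2 * a x * (sinh (u x) / (cosh (u x) - cos (p x)) + sinh (u x) / (cosh (u x) + cos (q x)) - 2 * T x) - 2 * Re (v (of_real \<eta>)) * (1 - (T x)\<^sup>2)"
  have "(?R has_real_derivative
    2 * a 0 * (- (sinh (u 0) * (sin (p 0) * b)) / (cosh (u 0) - cos (p 0))\<^sup>2 + (sinh (u 0) * (sin (q 0) * b)) / (cosh (u 0) + cos (q 0))\<^sup>2 - 2 * ((1 - (T 0)\<^sup>2) / 2))
     + 2 * Re (v (of_real \<eta>)) * (T 0 * (1 - (T 0)\<^sup>2))) (at 0)"
   by (rule derivative_eq_intros da k1 k2 dT refl | simp)+
  then have "((\<lambda>x. Re (reg_ker v (of_real x) (of_real \<eta>))) has_real_derivative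
    2 * a 0 * (- (sinh (u 0) * (sin (p 0) * b)) / (cosh (u 0) - cos (p 0))\<^sup>2 + (sinh (u 0) * (sin (q 0) * b)) / (cosh (u 0) + cos (q 0))\<^sup>2 - 2 * ((1 - (T 0)\<^sup>2) / 2))
     + 2 * Re (v (of_real \<eta>)) * (T 0 * (1 - (T 0)\<^sup>2))) (at 0)"
  proof (rule has_field_derivative_transform_within_open)
   show "open (- {\<eta>})" "0 \<in> - {\<eta>}" using ne by auto
   show "?R x = Re (reg_ker v (of_real x) (of_real \<eta>))" if "x \<in> - {\<eta>}" for x
    using Re_reg_ker_real(1)[OF st, of x \<eta>] that by (simp add: u_def p_def q_def a_def T_def z1_def z2_def)
  qed
  from DERIV_unique[OF d(3)[OF ne] this]
  have "Re (d \<eta>) = 2 * a 0 * (- (sinh (u 0) * (sin (p 0) * b)) / (cosh (u 0) - cos (p 0))\<^sup>2 + (sinh (u 0) * (sin (q 0) * b)) / (cosh (u 0) + cos (q 0))\<^sup>2 - 2 * ((1 - (T 0)\<^sup>2) / 2))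
     + 2 * Re (v (of_real \<eta>)) * (T 0 * (1 - (T 0)\<^sup>2))" .
  moreover have "u 0 = - z1 \<eta>" "p 0 = - z2 \<eta>" "q 0 = z2 \<eta>" "a 0 = - (1 + Re (deriv v (of_real \<eta>)))" "T 0 = tanh (- \<eta> / 2)"
   using z10 d0 by (simp_all add: u_def p_def q_def a_def T_def)
  moreover have "J \<eta> = turn_ker (1 + Re (deriv v (of_real \<eta>))) (z1 \<eta>) (z2 \<eta>)" by (simp add: J_def z1_def z2_def)
  ultimately show ?thesis unfolding D2_def turn_ker_def
   by (simp add: algebra_simps add_divide_distrib diff_divide_distrib)
 qed
 have cr: "continuous_on UNIV (\<lambda>x. u (complex_of_real x))" if "u holomorphic_on strip s" for u
 proof (rule continuous_on_compose2[OF holomorphic_on_imp_continuous_on[OF that]])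
  show "continuous_on UNIV complex_of_real" by (intro continuous_intros)
  show "range complex_of_real \<subseteq> strip s" using reals by auto
 qed
 have hdv: "deriv v holomorphic_on strip s" by (rule holomorphic_deriv[OF sd(7) open_complex_strip])
 have D2c: "continuous_on UNIV D2" unfolding D2_def
  by (intro continuous_intros cr sd(7) hdv) auto
 have D2i: "integrable lborel D2"
 proof (rule Bochner_Integration.integrable_bound)
  show "integrable lborel (\<lambda>\<eta>::real. 2 * (1 + M / (s/2) + M) * (1 - (tanh (- \<eta> / 2))\<^sup>2))" using integrable_sech_sq by simp
  show "D2 \<in> borel_measurable lborel" unfolding measurable_lborel2 using D2c by (rule borel_measurable_continuous_onI)
  show "AE \<eta> in lborel. norm (D2 \<eta>) \<le> norm (2 * (1 + M / (s/2) + M) * (1 - (tanh (- \<eta> / 2))\<^sup>2))"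
  proof (rule AE_I2)
   fix \<eta> :: real
   have t: "\<bar>tanh (- \<eta> / 2)\<bar> \<le> 1" using tanh_real_bounds[of "- \<eta> / 2"] by auto
   have t2: "0 \<le> 1 - (tanh (- \<eta> / 2))\<^sup>2" using t by (simp add: abs_square_le_1)
   have "norm (deriv v (of_real \<eta>)) \<le> M / (s/2)" by (rule norm_deriv_le_strip[OF sd(7,8)]) (use s0 in auto)
   then have 1: "\<bar>Re (deriv v (of_real \<eta>))\<bar> \<le> M / (s/2)" using abs_Re_le_cmod order_trans by blast
   have "\<bar>Re (v (of_real \<eta>))\<bar> \<le> M" using sd(8)[OF reals] abs_Re_le_cmod order_trans by blast
   then have "\<bar>Re (v (of_real \<eta>))\<bar> * \<bar>tanh (- \<eta> / 2)\<bar> \<le> M * 1" using t by (intro mult_mono) auto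
   then have 2: "\<bar>Re (v (of_real \<eta>)) * tanh (- \<eta> / 2)\<bar> \<le> M" by (simp add: abs_mult)
   have "\<bar>1 + Re (deriv v (of_real \<eta>)) + Re (v (of_real \<eta>)) * tanh (- \<eta> / 2)\<bar> \<le> 1 + M / (s/2) + M" using 1 2 by linarith
   then have "2 * (1 - (tanh (- \<eta> / 2))\<^sup>2) * \<bar>1 + Re (deriv v (of_real \<eta>)) + Re (v (of_real \<eta>)) * tanh (- \<eta> / 2)\<bar> \<le> 2 * (1 - (tanh (- \<eta> / 2))\<^sup>2) * (1 + M / (s/2) + M)"
    using t2 by (intro mult_left_mono) auto
   moreover have "norm (D2 \<eta>) = 2 * (1 - (tanh (- \<eta> / 2))\<^sup>2) * \<bar>1 + Re (deriv v (of_real \<eta>)) + Re (v (of_real \<eta>)) * tanh (- \<eta> / 2)\<bar>"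
    using t2 by (simp add: D2_def abs_mult)
   ultimately have "norm (D2 \<eta>) \<le> 2 * (1 - (tanh (- \<eta> / 2))\<^sup>2) * (1 + M / (s/2) + M)" by (simp only:)
   also have "\<dots> = 2 * (1 + M / (s/2) + M) * (1 - (tanh (- \<eta> / 2))\<^sup>2)" by (simp only: mult_ac)
   finally show "norm (D2 \<eta>) \<le> norm (2 * (1 + M / (s/2) + M) * (1 - (tanh (- \<eta> / 2))\<^sup>2))"
    unfolding real_norm_def by (rule order_trans[OF _ abs_ge_self])
  qed
 qed
 have D2I: "(LBINT \<eta>. D2 \<eta>) = 8"
 proof -
  \<comment> \<open>A primitive of \<open>D2\<close>; the principal value is used only to evaluate a convergent integral.\<close>
  define \<Gamma> where "\<Gamma> \<eta> = complex_of_real (4 * tanh (\<eta> / 2) + 2 * Re (v (of_real \<eta>)) * (1 - (tanh (- \<eta> / 2))\<^sup>2))" for \<eta> :: real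
  have dG: "(\<Gamma> has_vector_derivative complex_of_real (D2 \<eta>)) (at \<eta>)" for \<eta>
  proof -
   have t1: "((\<lambda>\<eta>. tanh (\<eta> / 2)) has_real_derivative (1 - (tanh (- \<eta> / 2))\<^sup>2) / 2) (at \<eta>)" by (auto intro!: derivative_eq_intros)
   have t2: "((\<lambda>\<eta>. tanh (- \<eta> / 2)) has_real_derivative - (1 - (tanh (- \<eta> / 2))\<^sup>2) / 2) (at \<eta>)" by (auto intro!: derivative_eq_intros simp: field_simps)
   define rv where "rv \<eta> = Re (v (complex_of_real \<eta>))" for \<eta> :: real
   have t3: "(rv has_real_derivative Re (deriv v (of_real \<eta>))) (at \<eta>)" unfolding rv_def by (rule Rd[OF sd(7)])
   have "((\<lambda>\<eta>. 4 * tanh (\<eta> / 2) + 2 * rv \<eta> * (1 - (tanh (- \<eta> / 2))\<^sup>2)) has_real_derivative D2 \<eta>) (at \<eta>)"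
    unfolding D2_def rv_def[symmetric] by (rule derivative_eq_intros t1 t2 t3 refl | simp add: algebra_simps power2_eq_square)+
   then have "((\<lambda>\<eta>. 4 * tanh (\<eta> / 2) + 2 * Re (v (of_real \<eta>)) * (1 - (tanh (- \<eta> / 2))\<^sup>2)) has_real_derivative D2 \<eta>) (at \<eta>)"
    unfolding rv_def .
   then show ?thesis unfolding \<Gamma>_def by (intro has_vector_derivative_of_real) (simp add: has_real_derivative_iff_has_vector_derivative)
  qed
  have vl: "((\<lambda>R. v (complex_of_real (X R))) \<longlongrightarrow> 0) at_top" if X: "filterlim X at_infinity at_top" for X :: "real \<Rightarrow> real"
  proof -
   have "filterlim (\<lambda>R. complex_of_real (X R)) at_infinity at_top" using X by (simp add: filterlim_at_infinity_conv_norm_at_top)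
   then have "filterlim (\<lambda>R. complex_of_real (X R)) (inf at_infinity (principal (strip (s/2)))) at_top"
    using s0 by (simp add: filterlim_inf filterlim_principal)
   from filterlim_compose[OF tendsto_decays[OF dec] this] show ?thesis using s0 by simp
  qed
  have i1: "filterlim (\<lambda>R::real. R) at_infinity at_top" "filterlim (\<lambda>R::real. - R) at_infinity at_top"
   by (rule filterlim_mono[OF _ at_top_le_at_infinity order_refl] filterlim_mono[OF _ at_bot_le_at_infinity order_refl], real_asymp)+
  have R0: "((\<lambda>R. Re (v (complex_of_real (X R)))) \<longlongrightarrow> 0) at_top" if X: "filterlim X at_infinity at_top" for X :: "real \<Rightarrow> real"
   using tendsto_Re[OF vl[OF X]] by simp
  have th: "((\<lambda>R::real. tanh (R / 2)) \<longlongrightarrow> 1) at_top"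
   by (rule filterlim_compose[OF tanh_real_at_top]) real_asymp
  have "((\<lambda>R. (4 * tanh (R / 2) + 2 * Re (v (of_real R)) * (1 - (tanh (R / 2))\<^sup>2)) - (4 * (- tanh (R / 2)) + 2 * Re (v (of_real (- R))) * (1 - (tanh (R / 2))\<^sup>2)))
    \<longlongrightarrow> (4 * 1 + 2 * 0 * (1 - 1\<^sup>2)) - (4 * (- 1) + 2 * 0 * (1 - 1\<^sup>2))) at_top"
   by (intro tendsto_intros th R0 i1)
  then have "((\<lambda>R. \<Gamma> (0 + R) - \<Gamma> (0 - R)) \<longlongrightarrow> of_real 8) at_top"
   unfolding \<Gamma>_def of_real_diff[symmetric] by (intro tendsto_of_real) (simp add: power2_eq_square)
  from has_pv_integral_split[OF integrable_zero _ dG this]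
  have 1: "has_pv_integral (\<lambda>\<eta>. 0 + complex_of_real (D2 \<eta>)) 0 (integral\<^sup>L lborel (\<lambda>_. 0) + of_real 8)"
   using D2c by (auto intro!: continuous_intros)
  have ci: "integrable lborel (\<lambda>\<eta>. complex_of_real (D2 \<eta>))" using D2i by simp
  have 2: "has_pv_integral (\<lambda>\<eta>. complex_of_real (D2 \<eta>) + 0) 0 (integral\<^sup>L lborel (\<lambda>\<eta>. complex_of_real (D2 \<eta>)) + 0)"
   by (rule has_pv_integral_split[OF ci, where \<Gamma> = "\<lambda>_. 0"]) (auto intro!: continuous_intros)
  have "integral\<^sup>L lborel (\<lambda>\<eta>. complex_of_real (D2 \<eta>)) = of_real 8"
   using has_pv_integral_unique[OF 1[unfolded add_0] 2[unfolded add_0_right]] by simp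
  then have "complex_of_real (LBINT \<eta>. D2 \<eta>) = of_real 8" by simp
  then show ?thesis by (simp only: of_real_eq_iff)
 qed
 have Rdi: "integrable lborel (\<lambda>\<eta>. Re (d \<eta>))" using d(1) by simp
 have mJ: "(\<lambda>\<eta>. 2 * b * J \<eta>) \<in> borel_measurable lborel"
 proof -
  have m: "(\<lambda>x. u (complex_of_real x)) \<in> borel_measurable borel" if "u holomorphic_on strip s" for u
   by (rule borel_measurable_continuous_onI[OF cr[OF that]])
  note [measurable] = m[OF sd(7)] m[OF hdv]
  have [measurable]: "(sinh :: real \<Rightarrow> real) \<in> borel_measurable borel" "(cosh :: real \<Rightarrow> real) \<in> borel_measurable borel"
   by (intro borel_measurable_continuous_onI continuous_intros)+
  show ?thesis unfolding J_def turn_ker_def by measurable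
 qed
 have AEq: "AE \<eta> in lborel. Re (d \<eta>) - D2 \<eta> = 2 * b * J \<eta>"
  using AE_lborel_singleton[of 0] by eventually_elim (simp add: Red)
 have i1: "integrable lborel (\<lambda>\<eta>. Re (d \<eta>) - D2 \<eta>)" using Rdi D2i by simp
 show "integrable lborel (\<lambda>\<eta>. 2 * Im (deriv v 0) * J \<eta>)" unfolding b_def[symmetric]
  using integrable_cong_AE[OF borel_measurable_integrable[OF i1] mJ AEq] i1 by simp
 have "(LBINT \<eta>. 2 * b * J \<eta>) = (LBINT \<eta>. Re (d \<eta>) - D2 \<eta>)"
  by (rule integral_cong_AE[OF borel_measurable_integrable[OF i1] mJ AEq, symmetric])
 also have "\<dots> = (LBINT \<eta>. Re (d \<eta>)) - 8" using Rdi D2i D2I by simp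
 also have "(LBINT \<eta>. Re (d \<eta>)) = Re (deriv (velocity \<rho> v) 0)" using d(1) by (simp add: d(2))
 finally show "Re (deriv (velocity \<rho> v) 0) = 8 + (LBINT \<eta>. 2 * Im (deriv v 0) * J \<eta>)" by (simp add: b_def)
qed

section \<open>A curve with one vertical tangent\<close>

definition lorentz :: "'a::field \<Rightarrow> 'a" where "lorentz w = w / (1 + w\<^sup>2)"

text \<open>On the real line this tends to \<open>1\<close> for \<open>\<bar>y\<bar> < 1\<close> and to
  \<open>-1\<close> for \<open>\<bar>y\<bar> > 1\<close> as \<open>n\<close> grows.\<close>

definition switch :: "nat \<Rightarrow> 'a::field \<Rightarrow> 'a" where "switch n y = (1 - y ^ (2 * n)) / (1 + y ^ (2 * n))"

text \<open>The factor \<open>100\<close> makes the vertical tangent steep in the parameter,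
  \<open>z\<^sub>2'(0) = 100\<close>, and moves the change of sign of \<open>z\<^sub>2\<close> to
  \<open>\<bar>x\<bar> = 1/100\<close>.\<close>

definition turning_datum :: "nat \<Rightarrow> complex \<Rightarrow> complex" where
 "turning_datum n w = - lorentz w + \<i> * (lorentz (100 * w) * switch n (100 * w))"

definition height :: "nat \<Rightarrow> real \<Rightarrow> real" where "height n x = lorentz (100 * x) * switch n (100 * x)"

lemma real_pos1: "0 < 1 + x\<^sup>2" "1 + x\<^sup>2 \<noteq> 0" for x :: real
 using zero_le_power2[of x] by linarith+

lemma even_pos: "0 < 1 + x ^ (2 * n)" "0 \<le> x ^ (2 * n)" for x :: real
 by (simp_all add: power_mult add_pos_nonneg)

lemma lorentz_of_real: "lorentz (of_real x) = complex_of_real (lorentz x)"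
 by (simp add: lorentz_def)

lemma turning_datum_of_real: "turning_datum n (of_real x) = Complex (- lorentz x) (height n x)"
proof -
 have 1: "100 * complex_of_real x = of_real (100 * x)" by simp
 have 2: "switch n (complex_of_real y) = of_real (switch n y)" for y by (simp add: switch_def)
 have "turning_datum n (of_real x) = of_real (- lorentz x) + \<i> * of_real (height n x)"
  unfolding turning_datum_def 1 2 lorentz_of_real height_def by simp
 then show ?thesis by (simp add: complex_eq_iff)
qed

lemma lorentz_denominator: "1 + w\<^sup>2 \<noteq> 0" if "w \<in> strip 1" for w
proof
 assume "1 + w\<^sup>2 = 0"
 then have "(w - \<i>) * (w + \<i>) = 0" by (simp add: algebra_simps power2_eq_square)
 then have "w = \<i> \<or> w = - \<i>" by (auto simp: eq_neg_iff_add_eq_0)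
 then show False using that by auto
qed

lemma lorentz_holomorphic: "lorentz holomorphic_on strip 1"
 unfolding lorentz_def by (intro holomorphic_intros lorentz_denominator)

lemma norm_lorentz_le: "norm (lorentz w) \<le> 2 / norm w" if w: "2 \<le> norm w" for w :: complex
proof -
 have "(norm w)\<^sup>2 - 1 \<le> norm (1 + w\<^sup>2)" using norm_diff_ineq[of "w\<^sup>2" 1] by (simp add: norm_power add.commute)
 moreover have "2 * 2 \<le> norm w * norm w" using w by (intro mult_mono) auto
 ultimately have d: "(norm w)\<^sup>2 / 2 \<le> norm (1 + w\<^sup>2)" by (simp add: power2_eq_square)
 have "norm (lorentz w) \<le> norm w / ((norm w)\<^sup>2 / 2)" unfolding lorentz_def norm_divide
  by (rule divide_left_mono[OF d]) (use w d in \<open>auto intro!: mult_pos_pos less_le_trans[OF _ d]\<close>)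
 also have "\<dots> = 2 / norm w" using w by (simp add: power2_eq_square)
 finally show ?thesis .
qed

lemma norm_switch_le: "norm (switch n y) \<le> 2" if y: "2 \<le> norm y" and n: "0 < n" for y :: complex
proof -
 define Y where "Y = y ^ (2 * n)"
 have "(2::real) ^ 2 \<le> 2 ^ (2 * n)" using n by (intro power_increasing) auto
 also have "\<dots> \<le> norm Y" unfolding Y_def norm_power using y by (intro power_mono) auto
 finally have Y: "4 \<le> norm Y" by simp
 have "norm Y - 1 \<le> norm (1 + Y)" using norm_diff_ineq[of Y 1] by (simp add: add.commute)
 moreover have "norm (1 - Y) \<le> 1 + norm Y" using norm_triangle_ineq4[of 1 Y] by simp
 ultimately have "norm (1 - Y) \<le> 2 * norm (1 + Y)" "0 < norm (1 + Y)" using Y by linarith+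
 then show ?thesis unfolding switch_def Y_def[symmetric] norm_divide by (simp add: pos_divide_le_eq)
qed

text \<open>A zero has modulus \<open>1\<close>. There powers are Lipschitz, so \<open>y ^ (2 *
 n)\<close> is close to the nonnegative number \<open>(Re y) ^ (2 * n)\<close> and cannot be
  \<open>-1\<close>.\<close>

lemma switch_denominator: "1 + y ^ (2 * n) \<noteq> 0" if y: "real (2 * n) * \<bar>Im y\<bar> < 1" for y :: complex
proof
 assume e: "1 + y ^ (2 * n) = 0"
 then have ym: "y ^ (2 * n) = - 1" by (simp add: eq_neg_iff_add_eq_0 add.commute)
 have n: "0 < n" by (rule ccontr) (use ym in simp)
 have "norm y ^ (2 * n) = 1" using ym by (simp flip: norm_power)
 then have y1: "norm y = 1" using power_eq_imp_eq_base[of "norm y" "2 * n" 1] n by simp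
 have "norm (y ^ (2 * n) - of_real (Re y) ^ (2 * n)) \<le> real (2 * n) * norm (y - of_real (Re y))"
  by (rule norm_power_diff) (use y1 abs_Re_le_cmod[of y] in auto)
 also have "y - of_real (Re y) = \<i> * of_real (Im y)" by (simp add: complex_eq_iff)
 finally have "norm (y ^ (2 * n) - of_real (Re y) ^ (2 * n)) < 1" using y by (simp add: norm_mult)
 then have "norm (of_real (- (1 + Re y ^ (2 * n))) :: complex) < 1" by (simp add: ym)
 then have "\<bar>- (1 + Re y ^ (2 * n))\<bar> < 1" by (simp only: norm_of_real)
 then show False using even_pos(2)[of "Re y" n] by simp
qed

lemma decays_if_inverse_bound:
 assumes "\<And>w. 2 \<le> norm w \<Longrightarrow> norm (u w) \<le> C / norm w"
 shows "decays s u"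
 unfolding decays_iff_eps
proof (intro allI impI)
 fix s' e :: real assume e: "0 < e"
 have "norm (u w) < e" if w: "max 2 (\<bar>C\<bar> / e + 1) \<le> norm w" for w
 proof -
  have w2: "2 \<le> norm w" "\<bar>C\<bar> / e < norm w" using w by auto
  have "norm (u w) \<le> C / norm w" by (rule assms[OF w2(1)])
  also have "\<dots> \<le> \<bar>C\<bar> / norm w" by (rule divide_right_mono) auto
  also have "\<dots> < e"
  proof -
   have "0 < norm w" using w2(1) by linarith
   then show ?thesis using w2(2) e by (simp add: pos_divide_less_eq mult.commute)
  qed
  finally show ?thesis .
 qed
 then show "\<exists>b. \<forall>w\<in>strip s'. b \<le> norm w \<longrightarrow> norm (u w) < e" by blast
qed

lemma lorentz_decays: "decays s lorentz"
 by (rule decays_if_inverse_bound[OF norm_lorentz_le])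

lemma DERIV_lorentz: "(lorentz has_real_derivative (1 - x\<^sup>2) / (1 + x\<^sup>2)\<^sup>2) (at x)"
 unfolding lorentz_def[abs_def] using real_pos1(2)[of x]
 by (auto intro!: derivative_eq_intros simp: power2_eq_square field_simps)

lemma lorentz_abs_le: "\<bar>lorentz x\<bar> \<le> 1 / 2" for x :: real
proof -
 have "0 \<le> (1 - \<bar>x\<bar>)\<^sup>2" by simp
 then have "2 * \<bar>x\<bar> \<le> 1 + x\<^sup>2" by (simp add: power2_diff)
 moreover have "\<bar>lorentz x\<bar> = \<bar>x\<bar> / (1 + x\<^sup>2)" using real_pos1(1)[of x] by (simp add: lorentz_def)
 ultimately show ?thesis using real_pos1(1)[of x] by (simp add: pos_divide_le_eq)
qed

lemma switch_abs_le: "\<bar>switch n y\<bar> \<le> 1" for y :: real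
proof -
 have "\<bar>1 - y ^ (2 * n)\<bar> \<le> 1 + y ^ (2 * n)" using even_pos(2)[of y n] by linarith
 then show ?thesis using even_pos(1)[of y n] by (simp add: switch_def pos_divide_le_eq)
qed

lemma height_abs_le: "\<bar>height n x\<bar> \<le> 1 / 2"
proof -
 have "\<bar>lorentz (100 * x)\<bar> * \<bar>switch n (100 * x)\<bar> \<le> 1 / 2 * 1"
  by (intro mult_mono lorentz_abs_le switch_abs_le) auto
 then show ?thesis by (simp add: height_def abs_mult)
qed

lemma DERIV_height_0: "(height n has_real_derivative 100) (at 0)" if n: "0 < n"
proof -
 have "\<exists>D. (switch n has_real_derivative D) (at (100 * 0 :: real))"
  unfolding switch_def[abs_def] using n by (intro exI) (auto intro!: derivative_eq_intros simp: power_0_left)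
 then obtain D where "(switch n has_real_derivative D) (at (100 * 0 :: real))" ..
 then have s: "((\<lambda>x. switch n (100 * x)) has_real_derivative D * 100) (at 0)"
  by (rule DERIV_chain2) (auto intro!: derivative_eq_intros)
 have l: "((\<lambda>x. lorentz (100 * x)) has_real_derivative 1 * 100) (at (0::real))"
  by (rule DERIV_chain2[of lorentz]) (use DERIV_lorentz[of 0] in \<open>auto intro!: derivative_eq_intros\<close>)
 show ?thesis unfolding height_def[abs_def] using DERIV_mult[OF l s] n by (simp add: lorentz_def switch_def power_0_left)
qed

text \<open>The first component of the curve.\<close>

definition abscissa :: "real \<Rightarrow> real" where "abscissa x = x ^ 3 / (1 + x\<^sup>2)"

definition abscissa_deriv :: "real \<Rightarrow> real" where "abscissa_deriv x = (3 * x\<^sup>2 + x ^ 4) / (1 + x\<^sup>2)\<^sup>2"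

lemma abscissa_eq: "x - lorentz x = abscissa x"
 using real_pos1(2)[of x] by (simp add: lorentz_def abscissa_def field_simps power2_eq_square power3_eq_cube)

lemma abscissa_deriv_eq: "1 - (1 - x\<^sup>2) / (1 + x\<^sup>2)\<^sup>2 = abscissa_deriv x"
proof -
 have "(1 + x\<^sup>2)\<^sup>2 - (1 - x\<^sup>2) = 3 * x\<^sup>2 + x ^ 4" by (simp add: power2_eq_square power4_eq_xxxx algebra_simps)
 moreover have "(1 + x\<^sup>2)\<^sup>2 \<noteq> 0" using real_pos1(2)[of x] by simp
 ultimately show ?thesis unfolding abscissa_deriv_def by (simp add: diff_divide_eq_iff)
qed

lemma deriv_on_reals:
 assumes h: "u holomorphic_on strip r" and r: "0 < r"
  and f: "\<And>x. Re (u (of_real x)) = f x" "\<And>x. Im (u (of_real x)) = g x"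
 shows "(f has_real_derivative D) (at x) \<Longrightarrow> Re (deriv u (of_real x)) = D"
  "(g has_real_derivative D) (at x) \<Longrightarrow> Im (deriv u (of_real x)) = D"
proof -
 have vd: "((\<lambda>x. u (complex_of_real x)) has_vector_derivative deriv u (of_real x)) (at x)"
  by (rule has_vector_derivative_real_field, rule holomorphic_derivI[OF h open_complex_strip]) (use r in simp)
 have "(f has_real_derivative Re (deriv u (of_real x))) (at x)"
  using bounded_linear.has_vector_derivative[OF bounded_linear_Re vd] by (simp add: f has_real_derivative_iff_has_vector_derivative)
 then show "(f has_real_derivative D) (at x) \<Longrightarrow> Re (deriv u (of_real x)) = D" by (rule DERIV_unique)
 have "(g has_real_derivative Im (deriv u (of_real x))) (at x)"
  using bounded_linear.has_vector_derivative[OF bounded_linear_Im vd] by (simp add: f has_real_derivative_iff_has_vector_derivative)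
 then show "(g has_real_derivative D) (at x) \<Longrightarrow> Im (deriv u (of_real x)) = D" by (rule DERIV_unique)
qed

text \<open>Injectivity is strict monotonicity of the first component; the derivative vanishes there
 only at \<open>0\<close>, where the second component has slope \<open>100\<close>.\<close>

lemma turning_datum_facts:
 assumes n: "0 < n"
 obtains r where "regular_curve (turning_datum n) r" "turning_datum n 0 = 0"
  "\<And>x::real. 1 + Re (deriv (turning_datum n) (of_real x)) = abscissa_deriv x" "Im (deriv (turning_datum n) 0) = 100"
  "Re (deriv (deriv (turning_datum n)) 0) = 0"
proof -
 let ?v = "turning_datum n"
 define r where "r = 1 / (200 * real n)"
 have r: "0 < r" "200 * real n * r = 1" using n by (auto simp: r_def)
 have r1: "100 * r < 1" using r n by (auto simp: r_def divide_simps)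
 have "(\<lambda>w. lorentz (100 * w)) holomorphic_on strip r"
  by (rule holomorphic_on_compose_gen[OF _ lorentz_holomorphic, unfolded o_def]) (use r1 in \<open>auto intro!: holomorphic_intros simp: abs_mult\<close>)
 moreover have "lorentz holomorphic_on strip r" by (rule holomorphic_on_subset[OF lorentz_holomorphic]) (use r1 in auto)
 moreover have "(\<lambda>w. switch n (100 * w)) holomorphic_on strip r" unfolding switch_def
 proof (intro holomorphic_intros switch_denominator)
  fix w assume "w \<in> strip r"
  then have "200 * real n * \<bar>Im w\<bar> < 200 * real n * r" using n by simp
  then show "real (2 * n) * \<bar>Im (100 * w)\<bar> < 1" using r by (simp add: abs_mult)
 qed
 ultimately have h: "?v holomorphic_on strip r" unfolding turning_datum_def[abs_def] by (intro holomorphic_intros)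
 have d: "decays r ?v"
 proof (rule decays_if_inverse_bound)
  fix w :: complex assume w: "2 \<le> norm w"
  then have w2: "2 \<le> norm (100 * w)" by (simp add: norm_mult)
  have "norm (lorentz (100 * w)) * norm (switch n (100 * w)) \<le> 2 / norm (100 * w) * 2"
   by (intro mult_mono norm_lorentz_le[OF w2] norm_switch_le[OF w2 n]) auto
  also have "\<dots> \<le> 1 / norm w" using w by (simp add: norm_mult divide_simps)
  finally have "norm (lorentz (100 * w)) * norm (switch n (100 * w)) \<le> 1 / norm w" .
  moreover have "norm (?v w) \<le> norm (lorentz w) + norm (lorentz (100 * w)) * norm (switch n (100 * w))"
   unfolding turning_datum_def using norm_triangle_ineq[of "- lorentz w" "\<i> * (lorentz (100 * w) * switch n (100 * w))"] by (simp add: norm_mult)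
  ultimately have "norm (?v w) \<le> 2 / norm w + 1 / norm w" using norm_lorentz_le[OF w] by linarith
  then show "norm (?v w) \<le> 3 / norm w" by (simp flip: add_divide_distrib)
 qed
 note dr = deriv_on_reals[OF h r(1), of "\<lambda>x. - lorentz x" "height n"]
 have Re': "Re (deriv ?v (of_real x)) = - ((1 - x\<^sup>2) / (1 + x\<^sup>2)\<^sup>2)" for x
  by (rule dr(1)) (auto simp: turning_datum_of_real intro: DERIV_minus DERIV_lorentz)
 have a: "1 + Re (deriv ?v (of_real x)) = abscissa_deriv x" for x unfolding Re' abscissa_deriv_eq[symmetric] by simp
 have Im0: "Im (deriv ?v (of_real 0)) = 100"
  by (rule dr(2)) (auto simp: turning_datum_of_real intro: DERIV_height_0 n)
 have "Re (deriv (deriv ?v) (of_real 0)) = 0"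
 proof (rule deriv_on_reals(1)[OF holomorphic_deriv[OF h open_complex_strip] r(1)])
  show "Re (deriv ?v (of_real x)) = - ((1 - x\<^sup>2) / (1 + x\<^sup>2)\<^sup>2)" for x by (rule Re')
  show "((\<lambda>x. - ((1 - x\<^sup>2) / (1 + x\<^sup>2)\<^sup>2)) has_real_derivative 0) (at (0::real))"
   by (auto intro!: derivative_eq_intros)
 qed (rule refl)
 then have dd: "Re (deriv (deriv ?v) 0) = 0" by simp
 have "regular_curve ?v r"
 proof
  show "\<bar>Im (?v (of_real x))\<bar> < pi / 2" for x
   using height_abs_le[of n x] pi_gt3 by (simp add: turning_datum_of_real)
  show "inj (\<lambda>x::real. pt ?v (of_real x))"
  proof (rule injI)
   fix x y assume "pt ?v (of_real x) = pt ?v (of_real y)"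
   then have "Re (pt ?v (of_real x)) = Re (pt ?v (of_real y))" by simp
   then have "x - lorentz x = y - lorentz y" by (simp add: pt_def turning_datum_of_real)
   then have "x ^ 3 * (1 + y\<^sup>2) = y ^ 3 * (1 + x\<^sup>2)" unfolding abscissa_eq abscissa_def using real_pos1(2)[of x] real_pos1(2)[of y] by (simp add: frac_eq_eq)
   then have "(x - y) * (x\<^sup>2 + x * y + y\<^sup>2 + x\<^sup>2 * y\<^sup>2) = 0" by (simp add: algebra_simps power2_eq_square power3_eq_cube)
   moreover have "x\<^sup>2 + x * y + y\<^sup>2 + x\<^sup>2 * y\<^sup>2 = 0 \<Longrightarrow> x = y"
   proof -
    assume z: "x\<^sup>2 + x * y + y\<^sup>2 + x\<^sup>2 * y\<^sup>2 = 0"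
    have "x\<^sup>2 + x * y + y\<^sup>2 + x\<^sup>2 * y\<^sup>2 = (x + y)\<^sup>2 / 2 + x\<^sup>2 / 2 + y\<^sup>2 / 2 + (x * y)\<^sup>2" by (simp add: power2_eq_square field_simps)
    then have "x\<^sup>2 \<le> 0" "y\<^sup>2 \<le> 0" using z zero_le_power2[of "x + y"] zero_le_power2[of "x * y"] zero_le_power2[of x] zero_le_power2[of y] by linarith+
    then show "x = y" by simp
   qed
   ultimately show "x = y" by auto
  qed
  show "1 + deriv ?v (of_real x) \<noteq> 0" for x
  proof (cases "x = 0")
   case True
   then show ?thesis using Im0 by (auto simp: complex_eq_iff)
  next
   case False
   then have "0 < x\<^sup>2" "0 \<le> x ^ 4" by auto
   then have "0 < abscissa_deriv x" unfolding abscissa_deriv_def using real_pos1(1)[of x] by (intro divide_pos_pos add_pos_nonneg zero_less_power) auto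
   then have "Re (1 + deriv ?v (of_real x)) \<noteq> 0" using a[of x] by simp
   then show ?thesis by (metis zero_complex.sel(1))
  qed
 qed (fact h r(1) d)+
 moreover have "?v 0 = 0" by (simp add: turning_datum_def lorentz_def)
 ultimately show ?thesis using that a Im0 dd by simp
qed

section \<open>Sign of the velocity gradient\<close>

lemma sin_ge_linear: "5 / 6 * t \<le> sin t" if "0 \<le> t" "t \<le> 1" for t :: real
proof -
 have "\<bar>sin t - (\<Sum>m<3. sin_coeff m * t ^ m)\<bar> \<le> inverse (fact 3) * \<bar>t\<bar> ^ 3" by (rule Maclaurin_sin_bound)
 then have "\<bar>sin t - t\<bar> \<le> t ^ 3 / 6" using that by (simp add: eval_nat_numeral sin_coeff_def)
 moreover have "t ^ 3 \<le> t ^ 1" using that by (intro power_decreasing) auto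
 ultimately show ?thesis unfolding power_one_right by linarith
qed

lemma sin_le_self: "sin t \<le> t" if "0 \<le> t" for t :: real
 using sin_x_le_x that by blast

lemma sinh_le_double: "sinh t \<le> 2 * t" if "0 \<le> t" "t \<le> 1" for t :: real
proof -
 have "exp t \<le> 1 + t + t\<^sup>2" using that by (intro exp_bound) auto
 moreover have "1 - t \<le> exp (- t)" using exp_ge_add_one_self[of "- t"] by simp
 moreover have "t\<^sup>2 \<le> t" using that mult_left_le[of t t] by (simp add: power2_eq_square)
 ultimately have "exp t - exp (- t) \<le> 4 * t" using that by linarith
 then show ?thesis by (simp add: sinh_field_def)
qed

text \<open>Both estimates come from the half-angle formula.\<close>

lemma cosh_minus_cos_bounds:
 fixes x y :: real
 assumes "0 \<le> x" "x \<le> 1" "0 \<le> y" "y \<le> 1"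
 shows "x\<^sup>2 / 2 + y\<^sup>2 / 3 \<le> cosh x - cos y" "cosh x - cos y \<le> 2 * x\<^sup>2 + y\<^sup>2 / 2"
proof -
 have 1: "x/2 \<le> sinh (x/2)" "sinh (x/2) \<le> x" using le_sinh[of "x/2"] sinh_le_double[of "x/2"] assms by auto
 have 2: "5 / 12 * y \<le> sin (y/2)" "sin (y/2) \<le> y/2" using sin_ge_linear[of "y/2"] sin_le_self[of "y/2"] assms by auto
 have "(x/2)\<^sup>2 \<le> (sinh (x/2))\<^sup>2" "(5 / 12 * y)\<^sup>2 \<le> (sin (y/2))\<^sup>2" using 1 2 assms by (auto intro!: power_mono)
 moreover have e: "(x/2)\<^sup>2 = x\<^sup>2 / 4" "(5 / 12 * y)\<^sup>2 = 25 / 144 * y\<^sup>2" by (simp_all add: power_divide power_mult_distrib)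
 moreover have "a \<le> S \<Longrightarrow> b \<le> Q \<Longrightarrow> a = X / 4 \<Longrightarrow> b = 25 / 144 * Y \<Longrightarrow> 0 \<le> Y \<Longrightarrow> X / 2 + Y / 3 \<le> 2 * (S + Q)" for a b S Q X Y :: real
  by (simp add: field_simps)
 ultimately show "x\<^sup>2 / 2 + y\<^sup>2 / 3 \<le> cosh x - cos y" unfolding half_angle(1)[symmetric] using zero_le_power2[of y] by blast
 have "0 \<le> sin (y/2)" using 2 assms by (auto intro: order_trans[OF _ 2(1)])
 then have "(sinh (x/2))\<^sup>2 \<le> x\<^sup>2" "(sin (y/2))\<^sup>2 \<le> (y/2)\<^sup>2" using 1 2 assms by (auto intro!: power_mono)
 then show "cosh x - cos y \<le> 2 * x\<^sup>2 + y\<^sup>2 / 2" unfolding half_angle(1)[symmetric] power_divide by simp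
qed

lemma turn_ker_le:
 assumes "0 \<le> d" "d \<le> D" "0 \<le> x" "sinh x \<le> S" "0 \<le> sin y" "sin y \<le> W" "0 < m" "m \<le> cosh x - cos y" "0 \<le> cos y"
 shows "turn_ker d x y \<le> D * S * W * (2 / m\<^sup>2)"
proof -
 have S: "0 \<le> sinh x" using assms by simp
 have 1: "1 / (cosh x - cos y)\<^sup>2 \<le> 1 / m\<^sup>2" "1 / (cosh x + cos y)\<^sup>2 \<le> 1 / m\<^sup>2"
  using assms by (auto intro!: divide_left_mono power_mono mult_pos_pos zero_less_power)
 then have "1 / (cosh x - cos y)\<^sup>2 + 1 / (cosh x + cos y)\<^sup>2 \<le> 2 / m\<^sup>2" by simp
 moreover have "0 \<le> D" "0 \<le> S" "0 \<le> W" using assms S by linarith+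
 ultimately have "0 \<le> D * S * W" and 2: "d * sinh x \<le> D * S" using mult_mono[OF assms(2,4)] S by auto
 from mult_mono[OF mult_mono[OF 2 assms(6)] \<open>_ \<le> 2 / m\<^sup>2\<close>] show ?thesis
  unfolding turn_ker_def using assms(5) \<open>0 \<le> D\<close> \<open>0 \<le> S\<close> \<open>0 \<le> D * S * W\<close> by simp
qed

lemma turn_ker_ge:
 assumes "0 \<le> D" "D \<le> d" "0 \<le> S" "S \<le> sinh x" "0 \<le> W" "W \<le> sin y" "0 < cosh x - cos y" "cosh x - cos y \<le> m"
 shows "D * S * W * (1 / m\<^sup>2) \<le> turn_ker d x y"
proof -
 have "1 / m\<^sup>2 \<le> 1 / (cosh x - cos y)\<^sup>2" using assms by (auto intro!: divide_left_mono power_mono mult_pos_pos zero_less_power)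
 moreover have "0 \<le> 1 / (cosh x + cos y)\<^sup>2" by simp
 ultimately have "1 / m\<^sup>2 \<le> 1 / (cosh x - cos y)\<^sup>2 + 1 / (cosh x + cos y)\<^sup>2" by linarith
 moreover have "0 \<le> d" "0 \<le> sinh x" "0 \<le> sin y" using assms by linarith+
 ultimately show ?thesis unfolding turn_ker_def using assms(1-6)
  by (intro mult_mono mult_nonneg_nonneg divide_nonneg_nonneg zero_le_power2; (assumption | simp))
qed

lemma turn_ker_minus: "turn_ker d (- x) (- y) = turn_ker d x y" "turn_ker d x (- y) = - turn_ker d x y"
 by (simp_all add: turn_ker_def)

text \<open>The density \<open>turn_ker\<close> along the curve.\<close>

definition datum_ker :: "nat \<Rightarrow> real \<Rightarrow> real" where
 "datum_ker n x = turn_ker (abscissa_deriv x) (abscissa x) (height n x)"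

lemma datum_ker_abs: "datum_ker n \<bar>x\<bar> = datum_ker n x"
proof -
 have "abscissa_deriv (- x) = abscissa_deriv x" "abscissa (- x) = - abscissa x" "height n (- x) = - height n x"
  by (simp_all add: abscissa_deriv_def abscissa_def height_def lorentz_def switch_def power_mult)
 then have "datum_ker n (- x) = datum_ker n x" by (simp only: datum_ker_def turn_ker_minus(1))
 then show ?thesis by (cases "0 \<le> x") auto
qed

lemma abscissa_bounds:
 assumes "0 \<le> x" "x \<le> 1"
 shows "x ^ 3 / 2 \<le> abscissa x" "abscissa x \<le> x ^ 3" "x ^ 3 \<le> 1" "0 \<le> abscissa_deriv x" "abscissa_deriv x \<le> 3 * x\<^sup>2"
proof -
 have x2: "x\<^sup>2 \<le> 1" using assms by (simp add: power_le_one)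
 show "x ^ 3 / 2 \<le> abscissa x" unfolding abscissa_def by (intro divide_left_mono) (use assms x2 in \<open>auto simp: real_pos1 add_pos_nonneg\<close>)
 have "x ^ 3 / (1 + x\<^sup>2) \<le> x ^ 3 / 1" by (intro divide_left_mono) (use assms in \<open>auto simp: real_pos1\<close>)
 then show "abscissa x \<le> x ^ 3" by (simp add: abscissa_def)
 show "x ^ 3 \<le> 1" using assms by (simp add: power_le_one)
 show "0 \<le> abscissa_deriv x" unfolding abscissa_deriv_def by simp
 have "3 * x\<^sup>2 + x ^ 4 \<le> 3 * x\<^sup>2 * (1 + x\<^sup>2)\<^sup>2"
 proof -
  have "3 * x\<^sup>2 * (1 + x\<^sup>2)\<^sup>2 - (3 * x\<^sup>2 + x ^ 4) = 5 * x ^ 4 + 3 * x ^ 6" by (simp add: algebra_simps eval_nat_numeral)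
  moreover have "0 \<le> 5 * x ^ 4 + 3 * x ^ 6" by simp
  ultimately show ?thesis by linarith
 qed
 moreover have "0 < (1 + x\<^sup>2)\<^sup>2" using real_pos1(1)[of x] by simp
 ultimately show "abscissa_deriv x \<le> 3 * x\<^sup>2" unfolding abscissa_deriv_def by (simp only: pos_divide_le_eq)
qed

lemma height_cos: "0 \<le> cos (height n x)"
 using height_abs_le[of n x] pi_gt3 by (intro cos_ge_zero) auto

text \<open>Inside the switch the second component is at least \<open>25 x\<close> while the first one
 is at most \<open>x\<^sup>3\<close>, so the density is at most \<open>3/100 x\<^sup>2\<close>. The
 switch is at least \<open>1/2\<close> there because \<open>(1 - 1/n)\<^sup>n \<le> 1/2\<close>.\<close>

lemma datum_ker_core:
 assumes x: "0 \<le> x" "100 * x \<le> 1 - 1 / real n" and n: "0 < n"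
 shows "datum_ker n x \<le> 1 / 100"
proof (cases "x = 0")
 case True
 then show ?thesis by (simp add: datum_ker_def turn_ker_def abscissa_deriv_def)
next
 case False
 define y where "y = 100 * x"
 have "0 \<le> 1 / real n" by simp
 then have x0: "0 < x" "x \<le> 1 / 100" using x False by linarith+
 have y: "0 < y" "y \<le> 1" using x0 by (auto simp: y_def)
 have "y ^ (2 * n) \<le> 1 / 4"
 proof -
  have y': "y \<le> 1 - 1 / real n" using x by (simp add: y_def)
  have n1: "0 \<le> 1 - 1 / real n" using y y' by linarith
  have "2 \<le> (1 + 1 / real n) ^ n" using Bernoulli_inequality[of "1 / real n" n] \<open>0 \<le> 1 / real n\<close> n by simp
  then have "(1 - 1 / real n) ^ n * 2 \<le> (1 - 1 / real n) ^ n * (1 + 1 / real n) ^ n" using n1 by (intro mult_left_mono) auto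
  also have "\<dots> = (1 - (1 / real n)\<^sup>2) ^ n" by (simp add: power_mult_distrib[symmetric] algebra_simps power2_eq_square)
  also have "\<dots> \<le> 1" using n by (intro power_le_one) (auto simp: power_le_one)
  finally have "(1 - 1 / real n) ^ n \<le> 1 / 2" by simp
  moreover have "y ^ n \<le> (1 - 1 / real n) ^ n" using y y' by (intro power_mono) auto
  ultimately have "(y ^ n)\<^sup>2 \<le> (1 / 2)\<^sup>2" using y by (intro power_mono) auto
  then show ?thesis by (simp add: power_mult[symmetric] mult.commute power_divide)
 qed
 then have sw: "1 / 2 \<le> switch n y" unfolding switch_def pos_le_divide_eq[OF even_pos(1)] by simp
 have "y * y\<^sup>2 \<le> y * 1" by (rule mult_left_mono) (use y in \<open>auto simp: power_le_one\<close>)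
 moreover have "0 \<le> y * y\<^sup>2" using y by simp
 moreover have "y / 2 * (1 + y\<^sup>2) = y / 2 + (y * y\<^sup>2) / 2" "y * (1 + y\<^sup>2) = y + y * y\<^sup>2" by (simp_all add: algebra_simps)
 ultimately have "y / 2 * (1 + y\<^sup>2) \<le> y" "y \<le> y * (1 + y\<^sup>2)" by linarith+
 then have lo: "y / 2 \<le> lorentz y" "lorentz y \<le> y" unfolding lorentz_def pos_le_divide_eq[OF real_pos1(1)] pos_divide_le_eq[OF real_pos1(1)] .
 have h: "25 * x \<le> height n x" "height n x \<le> 100 * x"
 proof -
  have "y / 2 * (1 / 2) \<le> lorentz y * switch n y" using lo sw y by (intro mult_mono) auto
  then show "25 * x \<le> height n x" by (simp add: height_def y_def)
  have "lorentz y * switch n y \<le> y * 1" using lo sw y switch_abs_le[of n y] by (intro mult_mono) auto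
  then show "height n x \<le> 100 * x" by (simp add: height_def y_def)
 qed
 have h1: "0 \<le> height n x" "height n x \<le> 1" using h x0 by auto
 note ab = abscissa_bounds[of x]
 have a0: "0 \<le> abscissa x" "abscissa x \<le> 1" "sinh (abscissa x) \<le> 2 * x ^ 3"
 proof -
  show 1: "0 \<le> abscissa x" using ab(1) x0 by (auto intro: order_trans[OF _ ab(1)])
  show 2: "abscissa x \<le> 1" using ab x0 by auto
  show "sinh (abscissa x) \<le> 2 * x ^ 3" using sinh_le_double[OF 1 2] ab(2) x0 by simp
 qed
 have "(25 * x)\<^sup>2 \<le> (height n x)\<^sup>2" using h x0 by (intro power_mono) auto
 moreover have "(25 * x)\<^sup>2 = 625 * x\<^sup>2" by (simp add: power_mult_distrib)
 ultimately have m: "200 * x\<^sup>2 \<le> cosh (abscissa x) - cos (height n x)"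
  using cosh_minus_cos_bounds(1)[OF a0(1,2) h1] zero_le_power2[of "abscissa x"] zero_le_power2[of x] by linarith
 have "datum_ker n x \<le> 3 * x\<^sup>2 * (2 * x ^ 3) * (100 * x) * (2 / (200 * x\<^sup>2)\<^sup>2)"
  unfolding datum_ker_def
 proof (rule turn_ker_le[OF ab(4,5) a0(1,3) _ _ _ m height_cos])
  show "0 \<le> sin (height n x)" using h1 pi_gt3 by (intro sin_ge_zero) auto
  show "sin (height n x) \<le> 100 * x" using sin_le_self[OF h1(1)] h by simp
 qed (use x0 in auto)
 also have "\<dots> = 3 / 100 * x\<^sup>2" using x0 by (simp add: eval_nat_numeral field_simps)
 also have "\<dots> \<le> 3 / 100 * (1/100)\<^sup>2" using x0 by (intro mult_left_mono power_mono) auto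
 finally show ?thesis by (simp add: power2_eq_square)
qed

text \<open>A crude bound, independent of \<open>n\<close>, obtained from \<open>z\<^sub>1 \<ge> 1 / (2
 * 200\<^sup>3)\<close> alone.\<close>

definition layer_bound :: real where "layer_bound = 2 / (1 / (8 * 200 ^ 6))\<^sup>2"

text \<open>In the layer where the second component changes sign the first one is bounded away from
 zero, which bounds the density no matter how steep the switch is.\<close>

lemma datum_ker_layer:
 assumes x: "1 / 200 \<le> x" "x \<le> 1 / 100"
 shows "datum_ker n x \<le> layer_bound"
proof -
 have x0: "0 \<le> x" "x \<le> 1" using x by auto
 note ab = abscissa_bounds[OF x0]
 have "(1 / 200) ^ 3 \<le> x ^ 3" using x by (intro power_mono) auto
 then have z: "1 / (2 * 200 ^ 3) \<le> abscissa x" using ab(1) by (simp add: power_divide)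
 have a1: "0 \<le> abscissa x" "abscissa x \<le> 1" by (rule order_trans[OF _ z], simp) (use ab in linarith)
 have "x ^ 3 \<le> (1 / 100) ^ 3" using x by (intro power_mono) auto
 then have S: "sinh (abscissa x) \<le> 1" using sinh_le_double[OF a1] ab(2) by (simp add: power_divide)
 have "x\<^sup>2 \<le> (1 / 100)\<^sup>2" using x by (intro power_mono) auto
 then have D: "abscissa_deriv x \<le> 1" using ab(5) by (simp add: power_divide)
 have h: "0 \<le> height n x"
 proof -
  have "(100 * x) ^ (2 * n) \<le> 1" using x by (intro power_le_one) auto
  then have "0 \<le> switch n (100 * x)" using even_pos[of "100 * x" n] by (simp add: switch_def)
  then show ?thesis using x0 by (simp add: height_def lorentz_def)
 qed
 have h1: "height n x \<le> 1" using height_abs_le[of n x] by simp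
 have "(1 / (2 * 200 ^ 3))\<^sup>2 \<le> (abscissa x)\<^sup>2" by (rule power_mono[OF z]) simp
 moreover have "(1 / (2 * 200 ^ 3))\<^sup>2 / 2 = (1 / (8 * 200 ^ 6) :: real)" by (simp add: power_divide)
 ultimately have m: "1 / (8 * 200 ^ 6) \<le> cosh (abscissa x) - cos (height n x)"
  using cosh_minus_cos_bounds(1)[OF a1 h h1] zero_le_power2[of "height n x"] by linarith
 have "datum_ker n x \<le> 1 * 1 * 1 * (2 / (1 / (8 * 200 ^ 6))\<^sup>2)"
  unfolding datum_ker_def
  by (rule turn_ker_le[OF ab(4) D a1(1) S _ _ _ m height_cos]) (use h h1 pi_gt3 in \<open>auto intro!: sin_ge_zero\<close>)
 then show ?thesis by (simp only: layer_bound_def mult_1)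
qed

lemma height_nonpos: "height n x \<le> 0" if "1 / 100 \<le> x" "0 < n"
proof -
 have "1 \<le> (100 * x) ^ (2 * n)" using that by (intro one_le_power) auto
 then have "switch n (100 * x) \<le> 0" using even_pos[of "100 * x" n] by (simp add: switch_def divide_nonpos_pos)
 moreover have "0 \<le> lorentz (100 * x)" using that by (simp add: lorentz_def)
 ultimately show ?thesis by (simp add: height_def mult_nonneg_nonpos)
qed

text \<open>Beyond the switch \<open>z\<^sub>1\<close> and \<open>z\<^sub>2\<close> have opposite signs.\<close>

lemma datum_ker_far:
 assumes x: "1 / 100 \<le> x" and n: "0 < n"
 shows "datum_ker n x \<le> 0"
proof -
 have "sin (- height n x) \<ge> 0" using height_nonpos[OF assms] height_abs_le[of n x] pi_gt3 by (intro sin_ge_zero) auto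
 then have "sin (height n x) \<le> 0" by simp
 moreover have "0 \<le> abscissa x" "0 \<le> abscissa_deriv x" using x by (auto simp: abscissa_def abscissa_deriv_def)
 ultimately show ?thesis unfolding datum_ker_def turn_ker_def
  by (intro mult_nonpos_nonneg mult_nonneg_nonpos) auto
qed

text \<open>On this interval both components are small and of comparable size, hence the denominators
 are small.\<close>

lemma datum_ker_gain:
 assumes x: "3/10 \<le> x" "x \<le> 4/10" and n: "0 < n"
 shows "datum_ker n x \<le> - 1"
proof -
 define y where "y = 100 * x"
 have y: "30 \<le> y" "y \<le> 40" using x by (auto simp: y_def)
 have "(30::real) ^ 2 \<le> 30 ^ (2 * n)" using n by (intro power_increasing) auto
 also have "\<dots> \<le> y ^ (2 * n)" using y by (intro power_mono) auto
 finally have Y: "900 \<le> y ^ (2 * n)" by simp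
 have sw: "9/10 \<le> - switch n y" using even_pos[of y n] Y by (simp add: switch_def pos_le_divide_eq minus_divide_left)
 have "30 * y \<le> y\<^sup>2" "y\<^sup>2 \<le> 40 * y" using y by (auto simp: power2_eq_square intro: mult_right_mono)
 moreover have "30 * y \<le> q \<Longrightarrow> q \<le> 40 * y \<Longrightarrow> 1/41 * (1 + q) \<le> y \<and> y \<le> 1/30 * (1 + q)" for q using y by (simp add: field_simps)
 ultimately have "1/41 * (1 + y\<^sup>2) \<le> y" "y \<le> 1/30 * (1 + y\<^sup>2)" by blast+
 then have lo: "1/41 \<le> lorentz y" "lorentz y \<le> 1/30" unfolding lorentz_def pos_le_divide_eq[OF real_pos1(1)] pos_divide_le_eq[OF real_pos1(1)] .
 define u where "u = - height n x"
 have ue: "u = lorentz y * (- switch n y)" by (simp add: u_def height_def y_def)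
 have "1/41 * (9/10) \<le> u" unfolding ue using lo sw by (intro mult_mono) auto
 moreover have "u \<le> 1/30 * 1" unfolding ue using lo sw switch_abs_le[of n y] by (intro mult_mono) auto
 ultimately have u: "21/1000 \<le> u" "u \<le> 1/30" by auto
 have sin: "17/1000 \<le> sin u" using sin_ge_linear[of u] u by simp
 have x3: "(3/10)^3 \<le> x^3" "x^3 \<le> (4/10)^3" and x2: "(3/10)^2 \<le> x^2" "x^2 \<le> (4/10)^2" and x4: "(3/10)^4 \<le> x^4"
  using x by (auto intro!: power_mono)
 have a: "23/1000 \<le> abscissa x" "abscissa x \<le> 59/1000"
 proof -
  have "23/1000 * (1 + x\<^sup>2) \<le> x ^ 3" "x ^ 3 \<le> 59/1000 * (1 + x\<^sup>2)" using x2 x3 by (auto simp: power_divide)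
  then show "23/1000 \<le> abscissa x" "abscissa x \<le> 59/1000" unfolding abscissa_def pos_le_divide_eq[OF real_pos1(1)] pos_divide_le_eq[OF real_pos1(1)] .
 qed
 have d: "2/10 \<le> abscissa_deriv x"
 proof -
  have "(1 + x\<^sup>2)\<^sup>2 \<le> (1 + (4/10)^2)\<^sup>2" using x2 by (intro power_mono) auto
  then have "2/10 * (1 + x\<^sup>2)\<^sup>2 \<le> 3 * x\<^sup>2 + x ^ 4" using x2 x4 by (simp add: power_divide)
  then show ?thesis unfolding abscissa_deriv_def using real_pos1(1)[of x] by (simp only: pos_le_divide_eq zero_less_power)
 qed
 have "(abscissa x)\<^sup>2 \<le> (59/1000)\<^sup>2" "u\<^sup>2 \<le> (1/30)\<^sup>2" using a u by (auto intro!: power_mono)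
 then have m: "cosh (abscissa x) - cos u \<le> 8/1000" using cosh_minus_cos_bounds(2)[of "abscissa x" u] a u by (simp add: power_divide)
 have "0 < u\<^sup>2" using u by simp
 then have m0: "0 < cosh (abscissa x) - cos u" using cosh_minus_cos_bounds(1)[of "abscissa x" u] a u zero_le_power2[of "abscissa x"] by linarith
 have "2/10 * (23/1000) * (17/1000) * (1 / (8/1000)\<^sup>2) \<le> turn_ker (abscissa_deriv x) (abscissa x) u"
  by (rule turn_ker_ge[OF _ d _ _ _ sin m0 m]) (use a le_sinh[of "abscissa x"] in auto)
 moreover have "datum_ker n x = - turn_ker (abscissa_deriv x) (abscissa x) u"
  using turn_ker_minus(2)[of "abscissa_deriv x" "abscissa x" u] by (simp add: datum_ker_def u_def)
 ultimately show ?thesis by (simp add: power2_eq_square)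
qed

text \<open>The core contributes at most \<open>1/100 * 2/100\<close>, the layer at most
  \<open>1/100\<close> once \<open>n\<close> exceeds twice the bound on the density there, and the
 interval of gain contributes \<open>- 1/10\<close>.\<close>

lemma integral_datum_ker:
 obtains n where "0 < n" "\<And>c. integrable lborel (\<lambda>x. c * datum_ker n x) \<Longrightarrow> 0 < c \<Longrightarrow> (LBINT x. c * datum_ker n x) \<le> - c / 20"
proof -
 obtain n0 :: nat where "2 * layer_bound + 2 < real n0" using reals_Archimedean2 by blast
 moreover have L0: "0 < layer_bound" by (simp add: layer_bound_def)
 moreover define n where "n = n0"
 ultimately have n: "2 \<le> real n" "2 * layer_bound \<le> real n" by linarith+
 have n0: "0 < n" using n by (intro Nat.gr0I) auto
 define a where "a = (1 - 1 / real n) / 100"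
 have inv: "0 \<le> 1 / real n" "1 / real n \<le> 1 / 2" using n by (auto simp: divide_simps)
 have a: "1 / 200 \<le> a" "a \<le> 1 / 100" "1/100 - a = 1 / (100 * real n)" using inv by (auto simp: a_def field_simps)
 \<comment> \<open>A step function above the density.\<close>
 define U where "U x = 1/100 * indicator {-1/100..1/100} x + layer_bound * indicator {-1/100..-a} x
  + layer_bound * indicator {a..1/100} x - indicator {3/10..4/10} x" for x :: real
 have U: "datum_ker n x \<le> U x" for x
 proof -
  consider "\<bar>x\<bar> \<le> a" | "a < \<bar>x\<bar>" "\<bar>x\<bar> \<le> 1/100" | "1/100 < \<bar>x\<bar>" "x \<notin> {3/10..4/10}" | "x \<in> {3/10..4/10}" by linarith
  then show ?thesis
  proof cases
   case 1
   have "datum_ker n x \<le> 1/100" using datum_ker_core[of "\<bar>x\<bar>" n] 1 n0 by (simp add: datum_ker_abs a_def)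
   moreover have "1/100 \<le> U x" using 1 a L0 by (auto simp: U_def indicator_def)
   ultimately show ?thesis by linarith
  next
   case 2
   have "datum_ker n x \<le> layer_bound" using datum_ker_layer[of "\<bar>x\<bar>" n] 2 a by (simp add: datum_ker_abs)
   moreover have "layer_bound \<le> U x" using 2 a L0 by (auto simp: U_def indicator_def)
   ultimately show ?thesis by linarith
  next
   case 3
   have "datum_ker n x \<le> 0" using datum_ker_far[of "\<bar>x\<bar>" n] 3 n0 by (simp add: datum_ker_abs)
   moreover have "0 \<le> U x" using 3 a L0 by (auto simp: U_def indicator_def)
   ultimately show ?thesis by linarith
  next
   case 4
   have "datum_ker n x \<le> -1" using datum_ker_gain[of x n] 4 n0 by simp
   moreover have "-1 \<le> U x" using 4 a L0 by (auto simp: U_def indicator_def)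
   ultimately show ?thesis by linarith
  qed
 qed
 have hb: "has_bochner_integral lborel (\<lambda>x. c * indicator {p..q} x) (c * (q - p))" if "p \<le> q" for c p q :: real
 proof -
  have "has_bochner_integral lborel (indicator {p..q} :: real \<Rightarrow> real) (measure lborel {p..q})"
   by (rule has_bochner_integral_real_indicator) (simp_all add: emeasure_lborel_Icc_eq)
  then have "has_bochner_integral lborel (indicator {p..q} :: real \<Rightarrow> real) (q - p)" using that by simp
  then show ?thesis by (intro has_bochner_integral_mult_right)
 qed
 have "has_bochner_integral lborel U (1/100 * (1/100 - -1/100) + layer_bound * (-a - -1/100) + layer_bound * (1/100 - a) - 1 * (4/10 - 3/10))"
  unfolding U_def[abs_def] using hb[of "-1/100" "1/100" "1/100"] hb[of "-1/100" "-a" layer_bound] hb[of a "1/100" layer_bound] hb[of "3/10" "4/10" 1] a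
  by (intro has_bochner_integral_add has_bochner_integral_diff) auto
 moreover have "layer_bound * (1/100 - a) \<le> 1 / 200" unfolding a(3) using n by (simp add: divide_simps)
 ultimately have U1: "integrable lborel U" "(LBINT x. U x) \<le> - 1 / 20"
  unfolding has_bochner_integral_iff by (auto simp: algebra_simps)
 have "(LBINT x. c * datum_ker n x) \<le> - c / 20" if c: "integrable lborel (\<lambda>x. c * datum_ker n x)" "0 < c" for c
 proof -
  have "(LBINT x. c * datum_ker n x) \<le> (LBINT x. c * U x)"
   using U c U1 by (intro integral_mono) (auto intro!: mult_left_mono)
  also have "\<dots> = c * (LBINT x. U x)" by simp
  also have "\<dots> \<le> c * (- 1 / 20)" using U1 c by (intro mult_left_mono) auto
  finally show ?thesis by simp
 qed
 then show ?thesis using that n0 by blast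
qed

text \<open>Here \<open>2 z\<^sub>2'(0) = 200\<close>, and \<open>8 - 200 / 20 < 0\<close>.\<close>

lemma turning_velocity_negative:
 obtains n s M \<theta> \<mu> where "0 < n" "center s M \<theta> \<mu> (turning_datum n)" "decays s (turning_datum n)" "2 * s \<le> 1 / 2"
  "1 + Re (deriv (turning_datum n) 0) = 0" "Re (deriv (velocity (s / 16) (turning_datum n)) 0) < 0"
proof -
 obtain n where n: "0 < n" "\<And>c. integrable lborel (\<lambda>x. c * datum_ker n x) \<Longrightarrow> 0 < c \<Longrightarrow> (LBINT x. c * datum_ker n x) \<le> - c / 20"
  using integral_datum_ker by metis
 define v where "v = turning_datum n"
 obtain r where r: "regular_curve v r" "v 0 = 0" "\<And>x::real. 1 + Re (deriv v (of_real x)) = abscissa_deriv x" "Im (deriv v 0) = 100"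
  "Re (deriv (deriv v) 0) = 0" by (rule turning_datum_facts[OF n(1), folded v_def], rule that)
 obtain s M \<theta> \<mu> where c: "center s M \<theta> \<mu> v" "2 * s \<le> 1 / 2" "2 * s \<le> r / 4"
  by (rule regular_curve.center_exists[OF r(1), of "1/2"], simp, rule that)
 note c' = c(1)[unfolded center_def]
 have s: "0 < s" using c' by auto
 have ds: "decays s v" using regular_curve.d[OF r(1)] regular_curve.r[OF r(1)] c(3) unfolding decays_def by auto
 define R where "R = min \<theta> (\<mu> * (s / 16) / 2)"
 have R: "0 < R" "R \<le> \<theta>" "R \<le> \<mu> * (s / 16) / 2" using c' by (auto simp: R_def)
 have "near v R s v" using R s by (intro center_near_self[OF c(1)]) auto
 then have st: "state s (s / 16) (M + R) \<theta> (\<mu> * (s / 16)) v" using s R by (intro near_state[OF c(1) _ R(2,3)]) auto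
 have v1: "Re (deriv v 0) = - 1" using r(3)[of 0] by (simp add: abscissa_deriv_def)
 have J: "turn_ker (1 + Re (deriv v (of_real \<eta>))) (\<eta> + Re (v (of_real \<eta>))) (Im (v (of_real \<eta>))) = datum_ker n \<eta>" for \<eta>
  unfolding r(3) datum_ker_def abscissa_eq[symmetric] by (simp add: v_def turning_datum_of_real)
 note tf = turning_formula[OF st ds r(2) v1 r(5), unfolded J r(4)]
 have "(LBINT \<eta>. 2 * 100 * datum_ker n \<eta>) \<le> - (2 * 100) / 20" using tf(1) by (intro n(2)) auto
 then have "Re (deriv (velocity (s / 16) v) 0) < 0" using tf(2) by simp
 then show ?thesis using that n(1) c ds v1 unfolding v_def by simp
qed

section \<open>The tilted curve is an analytic graph\<close>

text \<open>The Taylor series of a holomorphic extension, mapped by a bounded linear map, converges to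
 the function.\<close>

lemma real_analytic_if_complex_extension:
 assumes L: "bounded_linear L"
  and ext: "\<And>x::real. \<exists>r>0. \<exists>G. G holomorphic_on ball (of_real x) r \<and> (\<forall>y. \<bar>y - x\<bar> < r \<longrightarrow> f y = L (G (complex_of_real y)))"
 shows "real_analytic f"
 unfolding real_analytic_def
proof
 fix x :: real
 obtain r G where r: "0 < r" and G: "G holomorphic_on ball (of_real x) r" and f: "\<And>y. \<bar>y - x\<bar> < r \<Longrightarrow> f y = L (G (complex_of_real y))"
  using ext[of x] by blast
 define a where "a n = (deriv ^^ n) G (of_real x) / fact n" for n
 have "(\<lambda>n. (y - x) ^ n *\<^sub>R L (a n)) sums f y" if y: "\<bar>y - x\<bar> < r" for y
 proof -
  have "norm (complex_of_real x - of_real y) < r" using y by (simp add: abs_minus_commute flip: of_real_diff)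
  then have "(\<lambda>n. a n * (of_real y - of_real x) ^ n) sums G (of_real y)"
   unfolding a_def by (intro holomorphic_power_series[OF G]) (simp add: dist_norm)
  from bounded_linear.sums[OF L this] have "(\<lambda>n. L (a n * (of_real y - of_real x) ^ n)) sums f y" by (simp add: f[OF y])
  moreover have "L (a n * (of_real y - of_real x) ^ n) = (y - x) ^ n *\<^sub>R L (a n)" for n
  proof -
   have "a n * (of_real y - of_real x) ^ n = (y - x) ^ n *\<^sub>R a n" by (simp add: scaleR_conv_of_real mult.commute)
   then show ?thesis by (simp only: linear_scale[OF bounded_linear.linear[OF L]])
  qed
  ultimately show ?thesis by simp
 qed
 then show "\<exists>r>0. \<exists>a. \<forall>y. \<bar>y - x\<bar> < r \<longrightarrow> (\<lambda>n. (y - x) ^ n *\<^sub>R a n) sums f y"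
  using r by (intro exI[of _ r] conjI exI[of _ "\<lambda>n. L (a n)"] allI impI) auto
qed

lemma real_analytic_curve:
 assumes h: "v holomorphic_on strip r" and r: "0 < r"
 shows "real_analytic (curve v)"
proof (rule real_analytic_if_complex_extension[OF bounded_linear_to_pair])
 fix x :: real
 have "pt v holomorphic_on strip r" unfolding pt_def[abs_def] by (intro holomorphic_intros h)
 then have "pt v holomorphic_on ball (of_real x) r"
  by (rule holomorphic_on_subset) (rule ball_subset_complex_strip, simp)
 then show "\<exists>r>0. \<exists>G. G holomorphic_on ball (of_real x) r \<and> (\<forall>y. \<bar>y - x\<bar> < r \<longrightarrow> curve v y = to_pair (G (complex_of_real y)))"
  using r by (intro exI[of _ r] conjI exI[of _ "pt v"]) (auto simp: curve_def)
qed

text \<open>The first component has an analytic inverse: a holomorphic local inverse of its extension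
 restricts to the real inverse. The graph function is the second component composed with it.\<close>

lemma analytic_graph:
 assumes h: "v holomorphic_on strip r" and r: "0 < r"
  and P: "P holomorphic_on strip r" "\<And>x. P (of_real x) = of_real (p x)"
  and p: "\<And>x. fst (curve v x) = p x" "\<And>x. (p has_real_derivative p' x) (at x)" "\<And>x. 0 < p' x" "surj p"
 obtains f where "real_analytic f" "is_graph_of (curve v) f"
proof -
 have mono: "p x < p y" if "x < y" for x y by (rule DERIV_pos_imp_increasing[OF that]) (use p(2,3) in blast)
 have inj: "inj p" by (rule injI) (metis mono less_irrefl linorder_less_linear)
 define \<phi> where "\<phi> = inv p"
 have \<phi>: "p (\<phi> X) = X" "\<phi> (p x) = x" for X x unfolding \<phi>_def using p(4) inj by (auto simp: surj_f_inv_f)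
 define f where "f X = Im (v (of_real (\<phi> X)))" for X
 have cv: "curve v x = (p x, f (p x))" for x using p(1)[of x] by (simp add: f_def \<phi> curve_def to_pair_def pt_def)
 have "range (curve v) = range (\<lambda>X. (X, f X))"
 proof (intro subset_antisym image_subsetI)
  show "curve v x \<in> range (\<lambda>X. (X, f X))" for x unfolding cv by blast
  show "(X, f X) \<in> range (curve v)" for X using cv[of "\<phi> X"] by (auto simp: \<phi> intro!: image_eqI[of _ _ "\<phi> X"])
 qed
 then have "is_graph_of (curve v) f" by (simp add: is_graph_of_def)
 moreover have "real_analytic f"
 proof (rule real_analytic_if_complex_extension[OF bounded_linear_Im])
  fix X :: real
  define x where "x = \<phi> X"
  have xs: "complex_of_real x \<in> strip r" using r by simp
  have "((\<lambda>x. P (complex_of_real x)) has_vector_derivative deriv P (of_real x)) (at x)"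
   by (rule has_vector_derivative_real_field, rule holomorphic_derivI[OF P(1) open_complex_strip xs])
  moreover have "((\<lambda>x. P (complex_of_real x)) has_vector_derivative of_real (p' x)) (at x)"
   unfolding P(2) using p(2)[of x] by (intro has_vector_derivative_of_real) (simp add: has_real_derivative_iff_has_vector_derivative)
  ultimately have "deriv P (of_real x) = of_real (p' x)" by (rule vector_derivative_unique_at)
  then have "deriv P (of_real x) \<noteq> 0" using p(3)[of x] by simp
  from has_complex_derivative_locally_invertible[OF P(1) xs open_complex_strip this]
  obtain \<delta> where \<delta>: "0 < \<delta>" "ball (of_real x) \<delta> \<subseteq> strip r" "open (P ` ball (of_real x) \<delta>)" "inj_on P (ball (of_real x) \<delta>)"
   by metis
  have hP: "P holomorphic_on ball (of_real x) \<delta>" by (rule holomorphic_on_subset[OF P(1) \<delta>(2)])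
  obtain g where g: "g holomorphic_on P ` ball (of_real x) \<delta>" "\<And>z. z \<in> ball (of_real x) \<delta> \<Longrightarrow> g (P z) = z"
   using holomorphic_has_inverse[OF hP open_ball \<delta>(4)] by metis
  have gs: "g ` (P ` ball (of_real x) \<delta>) \<subseteq> strip r" using g(2) \<delta>(2) by auto
  have X: "complex_of_real X \<in> P ` ball (of_real x) \<delta>"
   using \<delta>(1) P(2)[of x] by (auto simp: x_def \<phi> intro!: image_eqI[of _ _ "of_real (\<phi> X)"])
  obtain \<epsilon> where \<epsilon>: "0 < \<epsilon>" "ball (of_real X) \<epsilon> \<subseteq> P ` ball (of_real x) \<delta>" using \<delta>(3) X open_contains_ball by blast
  have lt: "p (x - \<delta>) < X" "X < p (x + \<delta>)" using mono[of "x - \<delta>" x] mono[of x "x + \<delta>"] \<delta>(1) by (auto simp: x_def \<phi>)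
  \<comment> \<open>By monotonicity the real inverse maps this interval into the disc on which \<open>P\<close> is injective.\<close>
  define \<eta> where "\<eta> = Min {\<epsilon>, X - p (x - \<delta>), p (x + \<delta>) - X}"
  have \<eta>: "0 < \<eta>" "\<eta> \<le> \<epsilon>" "\<eta> \<le> X - p (x - \<delta>)" "\<eta> \<le> p (x + \<delta>) - X" using \<epsilon>(1) lt by (auto simp: \<eta>_def)
  have hG: "(\<lambda>W. v (g W)) holomorphic_on ball (of_real X) \<eta>"
  proof (rule holomorphic_on_subset)
   show "(\<lambda>W. v (g W)) holomorphic_on P ` ball (of_real x) \<delta>"
    by (rule holomorphic_on_compose_gen[OF g(1) h gs, unfolded o_def])
   show "ball (of_real X) \<eta> \<subseteq> P ` ball (complex_of_real x) \<delta>" using \<epsilon>(2) \<eta>(2) subset_ball by blast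
  qed
  have "f Y = Im (v (g (of_real Y)))" if Y: "\<bar>Y - X\<bar> < \<eta>" for Y
  proof -
   have "p (x - \<delta>) < p (\<phi> Y)" "p (\<phi> Y) < p (x + \<delta>)" using Y \<eta> by (auto simp: \<phi>)
   then have "x - \<delta> < \<phi> Y" "\<phi> Y < x + \<delta>" using mono by (metis linorder_neqE not_less_iff_gr_or_eq)+
   then have "complex_of_real (\<phi> Y) \<in> ball (of_real x) \<delta>" by (simp add: dist_norm abs_less_iff flip: of_real_diff)
   from g(2)[OF this] show ?thesis by (simp add: P(2) \<phi> f_def)
  qed
  then show "\<exists>r>0. \<exists>G. G holomorphic_on ball (of_real X) r \<and> (\<forall>Y. \<bar>Y - X\<bar> < r \<longrightarrow> f Y = Im (G (complex_of_real Y)))"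
   using hG \<eta>(1) by (intro exI[of _ \<eta>] conjI exI[of _ "\<lambda>W. v (g W)"] allI impI)
 qed
 ultimately show ?thesis using that by blast
qed

text \<open>After the tilt the derivative of the first component is at least \<open>\<epsilon>\<close>,
 and the first component stays within distance \<open>1\<close> of the parameter.\<close>

lemma tilted_datum_is_graph:
 assumes h: "turning_datum n holomorphic_on strip r" and r: "0 < r" "r \<le> 1" and \<epsilon>: "0 < \<epsilon>" "\<epsilon> < 1"
 defines "v \<equiv> (\<lambda>w. turning_datum n w + complex_of_real \<epsilon> * lorentz w)"
 shows "real_analytic (curve v)" and "\<exists>f. real_analytic f \<and> is_graph_of (curve v) f"
proof -
 have hl: "lorentz holomorphic_on strip r" by (rule holomorphic_on_subset[OF lorentz_holomorphic]) (use r in auto)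
 have hv: "v holomorphic_on strip r" unfolding v_def by (intro holomorphic_intros h hl)
 show "real_analytic (curve v)" by (rule real_analytic_curve[OF hv r(1)])
 define p where "p x = x - (1 - \<epsilon>) * lorentz x" for x :: real
 define p' where "p' x = 1 - (1 - \<epsilon>) * ((1 - x\<^sup>2) / (1 + x\<^sup>2)\<^sup>2)" for x :: real
 have dp: "(p has_real_derivative p' x) (at x)" for x
  unfolding p_def[abs_def] p'_def by (intro DERIV_diff DERIV_ident DERIV_cmult DERIV_lorentz)
 have p': "0 < p' x" for x
 proof -
  have "0 \<le> abscissa_deriv x" by (simp add: abscissa_deriv_def)
  then have "(1 - x\<^sup>2) / (1 + x\<^sup>2)\<^sup>2 \<le> 1" unfolding abscissa_deriv_eq[symmetric] by simp
  then have "(1 - \<epsilon>) * ((1 - x\<^sup>2) / (1 + x\<^sup>2)\<^sup>2) \<le> (1 - \<epsilon>) * 1" using \<epsilon> by (intro mult_left_mono) auto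
  then show ?thesis using \<epsilon> by (simp add: p'_def)
 qed
 have near: "\<bar>p x - x\<bar> \<le> 1" for x
 proof -
  have "\<bar>1 - \<epsilon>\<bar> * \<bar>lorentz x\<bar> \<le> 1 * (1 / 2)" using \<epsilon> lorentz_abs_le[of x] by (intro mult_mono) auto
  then show ?thesis by (simp add: p_def abs_mult)
 qed
 have surj: "surj p"
 proof -
  have "\<exists>x\<ge>y - 1. x \<le> y + 1 \<and> p x = y" for y
   by (rule IVT) (use near[of "y - 1"] near[of "y + 1"] DERIV_isCont[OF dp] in auto)
  then show ?thesis unfolding surj_def by metis
 qed
 have P: "(\<lambda>w. w - of_real (1 - \<epsilon>) * lorentz w) holomorphic_on strip r" by (intro holomorphic_intros hl)
 have P2: "complex_of_real x - of_real (1 - \<epsilon>) * lorentz (of_real x) = of_real (p x)" for x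
  unfolding lorentz_of_real p_def by simp
 have fc: "fst (curve v x) = p x" for x
  by (simp add: curve_def to_pair_def pt_def v_def turning_datum_of_real lorentz_of_real p_def algebra_simps)
 obtain f where "real_analytic f" "is_graph_of (curve v) f" by (rule analytic_graph[OF hv r(1) P P2 fc dp p' surj])
 then show "\<exists>f. real_analytic f \<and> is_graph_of (curve v) f" by blast
qed

theorem theorem8:
  fixes \<rho>1 \<rho>2 :: real
  assumes "\<rho>2 - \<rho>1 > 0"
  shows "\<exists>s0 :: real \<Rightarrow> real \<times> real.
           real_analytic s0 \<and> in_strip s0 \<and> (\<exists>f. real_analytic f \<and> is_graph_of s0 f) \<and>
           (\<exists>T>0. \<exists>z. muskat_solution \<rho>1 \<rho>2 T z \<and> z 0 = s0 \<and>
              (\<forall>w. muskat_solution \<rho>1 \<rho>2 T w \<and> w 0 = s0 \<longrightarrow> (\<forall>t\<in>{0..T}. w t = z t)) \<and>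
              (\<exists>t\<in>{0<..T}. \<not> (\<exists>f. is_graph_of (z t) f)))"
proof -
 obtain n s M \<theta> \<mu> where n: "0 < n" and c: "center s M \<theta> \<mu> (turning_datum n)" "decays s (turning_datum n)" "2 * s \<le> 1 / 2"
  "1 + Re (deriv (turning_datum n) 0) = 0" "Re (deriv (velocity (s / 16) (turning_datum n)) 0) < 0"
  by (rule turning_velocity_negative, rule that)
 have s: "0 < s" using c(1) unfolding center_def by blast
 have hl: "lorentz holomorphic_on strip (2 * s)" by (rule holomorphic_on_subset[OF lorentz_holomorphic]) (use c(3) in auto)
 obtain E where E: "\<And>w. w \<in> strip (1/2) \<Longrightarrow> norm (lorentz w) \<le> E"
  by (rule flat_bounded[OF lorentz_holomorphic zero_less_one lorentz_decays], rule that)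
 have bl: "norm (lorentz w) \<le> E" if "w \<in> strip (2 * s)" for w using that c(3) by (intro E) auto
 have "(lorentz has_field_derivative 1) (at (0::complex))" unfolding lorentz_def[abs_def]
  by (auto intro!: derivative_eq_intros)
 then have d1: "deriv lorentz (0::complex) = 1" by (rule DERIV_imp_deriv)
 obtain \<epsilon> T v where \<epsilon>: "0 < \<epsilon>" "\<epsilon> < 1" and T: "0 < T" and sol: "muskat_solution \<rho>1 \<rho>2 T (\<lambda>t. curve (v t))"
  and v0: "curve (v 0) = curve (\<lambda>w. turning_datum n w + of_real \<epsilon> * lorentz w)" and ng: "\<And>f. \<not> is_graph_of (curve (v T)) f"
 proof (rule turning_dynamics[OF assms c(1,2,4,5) hl bl lorentz_decays d1])
  fix \<epsilon> T v
  assume "0 < \<epsilon>" "\<epsilon> < 1" "0 < T" "muskat_solution \<rho>1 \<rho>2 T (\<lambda>t. curve (v t))"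
   "curve (v 0) = curve (\<lambda>w. turning_datum n w + of_real \<epsilon> * lorentz w)" "\<And>f. \<not> is_graph_of (curve (v T)) f"
  then show thesis by (rule that)
 qed
 obtain r where r: "regular_curve (turning_datum n) r" by (rule turning_datum_facts[OF n], rule that)
 have hr: "turning_datum n holomorphic_on strip (min r 1)" and r0: "0 < min r 1" "min r 1 \<le> 1"
  using regular_curve.h[OF r] regular_curve.r[OF r] by (auto intro: holomorphic_on_subset)
 note td = tilted_datum_is_graph[OF hr r0 \<epsilon>, folded v0]
 have "in_strip (curve (v 0))" using sol T unfolding muskat_solution_def by auto
 moreover have "\<forall>w. muskat_solution \<rho>1 \<rho>2 T w \<and> w 0 = curve (v 0) \<longrightarrow> (\<forall>t\<in>{0..T}. w t = curve (v t))"
  using muskat_solution_unique[OF sol] by blast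
 moreover have "\<exists>t\<in>{0<..T}. \<not> (\<exists>f. is_graph_of (curve (v t)) f)" using ng T by (intro bexI[of _ T]) auto
 ultimately show ?thesis using td T sol by (intro exI[of _ "curve (v 0)"] conjI exI[of _ T] exI[of _ "\<lambda>t. curve (v t)"]) auto
qed

end
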